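(* For any long virtual knot $K$, there exists a long virtual knot $K'$ such that for all $a,b\in\{0,1\}$, with $a'=1-a$ and $b'=1-b$, (i) $F_{ab}(K';t)=H_{a'b'}(K;t)$, (ii) $H_{ab}(K';t)=F_{a'b'}(K;t)$, and (iii) $sg_1(K')\le sg_1(K)$.
   Context: Long virtual knots. A long virtual knot diagram is an oriented immersed line in $\mathbb{R}^2$ that coincides with the $x$-axis outside a $2$-disk (oriented from $-\infty$ to $\infty$), each of whose double points is either a real crossing (with over/under information) or a virtual crossing. A long virtual knot is an equivalence class of such diagrams under the generalized (real, virtual and mixed) Reidemeister moves performed inside a $2$-disk. Let $\Sigma_g$ be a connected oriented closed surface of genus $g$. A surface realization $(\Sigma_g,D)$ of a diagram $D$ is an oriented closed-curve diagram with a basepoint on $\Sigma_g$, having only real crossings, such that traversing it from the basepoint one meets the same real crossings, in the same order and with the same over/under information and signs, as when traversing $D$ from $-\infty$ to $\infty$. A surface realization of $K$ is a surface realization of some diagram of $K$. The $1$-supporting genus is $sg_1(K)=\min\{g\mid(\Sigma_g,D)\text{ is a surface realization of }K\}$. Polynomials. Let $c_1,\dots,c_n$ be the real crossings of a diagram $D$ of $K$, with signs $\varepsilon_i\in\{\pm1\}$. Call $c_i$ of type $0$ if, traversing $D$ from $-\infty$, one passes $c_i$ first over and then under; otherwise of type $1$. Put $I_a(D)=\{i\mid c_i\text{ is of type }a\}$ and $\omega_a(D)=\sum_{i\in I_a(D)}\varepsilon_i$ for $a\in\{0,1\}$. On a surface realization $(\Sigma_g,D)$, orientation-respecting smoothing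 at $c_i$ yields two cycles; $\alpha_i$ is the one not containing the basepoint and $\beta_i$ the one containing it. A dot denotes the intersection number of cycles on $\Sigma_g$ (with a fixed standard sign convention). The following are invariants of $K$, for $a,b\in\{0,1\}$: $W_a(K;t)=\sum_{i\in I_a(D)}\varepsilon_i(t^{\alpha_i\cdot\beta_i}-1)$; $F_{ab}(K;t)=\sum_{i\in I_a(D),\,j\in I_b(D)}\varepsilon_i\varepsilon_j(t^{\alpha_i\cdot\alpha_j}-1)$; $H_{ab}(K;t)=\sum_{i\in I_a(D),\,j\in I_b(D)}\varepsilon_i\varepsilon_j(t^{\beta_i\cdot\beta_j}-1)-\omega_a(D)\,W_b(K;t)-\omega_b(D)\,W_a(K;t^{-1})$. *)

theory Defs
  imports "HOL-Library.Poly_Mapping" "HOL-Combinatorics.Permutations" "HOL-Combinatorics.Orbits"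
begin

section \<open>Long virtual knot diagrams\<close>

text \<open>
  A plane diagram in general position with respect to the projection to the \<open>x\<close>-axis is cut by
  vertical lines into slices, each containing exactly one of the following events: a point with
  vertical tangent where two strands are born (\<open>\<subset>\<close>) or die (\<open>\<supset>\<close>), or a real or virtual
  crossing. The strands meeting a vertical line are numbered \<open>0, 1, 2, ...\<close> from bottom to top.
  An event \<open>(x, i)\<close> involves the strands \<open>i\<close> and \<open>i + 1\<close>. A diagram is the list of its events
  from left to right. In \<open>Real b\<close>, the flag \<open>b\<close> says that the branch rising from left to right
  is the over-branch.
\<close>

datatype event = Birth | Death | Real bool | Virtual

type_synonym diagram = "(event \<times> nat) list"

definition turning :: "event \<Rightarrow> bool" where
  "turning x \<longleftrightarrow> x = Birth \<or> x = Death"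

definition n_left :: "event \<Rightarrow> nat" where
  "n_left x = (if x = Birth then 0 else 2)"

definition n_right :: "event \<Rightarrow> nat" where
  "n_right x = (if x = Death then 0 else 2)"

text \<open>Line \<open>k\<close> is the vertical line to the right of the first \<open>k\<close> events.\<close>

definition width :: "diagram \<Rightarrow> nat \<Rightarrow> nat" where
  "width D k = foldl (\<lambda>n (x, i). n - n_left x + n_right x) 1 (take k D)"

definition points :: "diagram \<Rightarrow> (nat \<times> nat) set" where
  "points D = {(k, p). k \<le> length D \<and> p < width D k}"

text \<open>
  \<open>transit r (x, i) p\<close>: a traveller enters the slice of the event \<open>(x, i)\<close> at height \<open>p\<close>, heading
  right (so entering from the left) if \<open>r\<close> and heading left otherwise. The result is the heading
  and the height at which the slice is left.
\<close>

fun transit :: "bool \<Rightarrow> event \<times> nat \<Rightarrow> nat \<Rightarrow> bool \<times> nat" where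
  "transit r (x, i) p =
     (let m = (if r then n_left x else n_right x);
          n = (if r then n_right x else n_left x)
      in if p < i then (r, p)
         else if p < i + m then (r \<noteq> turning x, 2 * i + 1 - p)
         else (r, p - m + n))"

text \<open>
  A state \<open>(k, p, r)\<close> is the point at height \<open>p\<close> on line \<open>k\<close>, passed with heading \<open>r\<close>
  (right if true). The diagram is traversed from \<open>-\<infinity>\<close> to \<open>+\<infinity>\<close>.
\<close>

type_synonym state = "nat \<times> nat \<times> bool"

fun next_event :: "state \<Rightarrow> nat" where
  "next_event (k, p, r) = (if r then k else k - 1)"

fun step :: "diagram \<Rightarrow> state \<Rightarrow> state" where
  "step D (k, p, r) =
     (let j = next_event (k, p, r); (r', p') = transit r (D ! j) p
      in (if r' then Suc j else j, p', r'))"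

definition state_at :: "diagram \<Rightarrow> nat \<Rightarrow> state" where
  "state_at D t = (step D ^^ t) (0, 0, True)"

definition travel_time :: "diagram \<Rightarrow> nat" where
  "travel_time D = (LEAST t. state_at D t = (length D, 0, True))"

text \<open>
  The last condition excludes closed components: all points of the diagram on the vertical lines
  are met when travelling from \<open>-\<infinity>\<close> to \<open>+\<infinity>\<close>.
\<close>

definition long_diagram :: "diagram \<Rightarrow> bool" where
  "long_diagram D \<longleftrightarrow>
     (\<forall>k < length D. case D ! k of (x, i) \<Rightarrow> i + n_left x \<le> width D k) \<and>
     width D (length D) = 1 \<and>
     state_at D (travel_time D) = (length D, 0, True) \<and>
     (\<lambda>(k, p, r). (k, p)) ` state_at D ` {..travel_time D} = points D"


section \<open>Generalized Reidemeister moves\<close>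

text \<open>
  Plane isotopy: events at different heights are interchanged; a strand is straightened;
  a vertical tangency is moved through a crossing.
\<close>

inductive isotopy_move :: "diagram \<Rightarrow> diagram \<Rightarrow> bool" where
  far: "i \<le> j \<Longrightarrow> isotopy_move [(x, i), (y, j + n_right x)] [(y, j + n_left x), (x, i)]"
| zigzag1: "isotopy_move [(Birth, Suc i), (Death, i)] []"
| zigzag2: "isotopy_move [(Birth, i), (Death, Suc i)] []"
| death_real: "isotopy_move [(Real b, i), (Death, Suc i)] [(Real (\<not> b), Suc i), (Death, i)]"
| death_virtual: "isotopy_move [(Virtual, i), (Death, Suc i)] [(Virtual, Suc i), (Death, i)]"
| birth_real: "isotopy_move [(Birth, i), (Real b, Suc i)] [(Birth, Suc i), (Real (\<not> b), i)]"
| birth_virtual: "isotopy_move [(Birth, i), (Virtual, Suc i)] [(Birth, Suc i), (Virtual, i)]"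

text \<open>
  In the third move on three strands, number these \<open>1, 2, 3\<close> from bottom to top on the left. The
  flags \<open>b, c, d\<close> say whether \<open>1\<close> is over \<open>2\<close>, \<open>1\<close> is over \<open>3\<close>, and \<open>2\<close> is over \<open>3\<close>; the condition
  says that these relations are not cyclic. Orientations and rotated versions of the moves need
  not be listed, since event lists do not record orientations and plane isotopy rotates the pictures.
\<close>

inductive real_move :: "diagram \<Rightarrow> diagram \<Rightarrow> bool" where
  R1_above: "real_move [(Birth, Suc i), (Real b, i), (Death, Suc i)] []"
| R1_below: "real_move [(Birth, i), (Real b, Suc i), (Death, i)] []"
| R2: "real_move [(Real b, i), (Real (\<not> b), i)] []"
| R3: "\<not> (b = d \<and> c \<noteq> b) \<Longrightarrow>
     real_move [(Real b, i), (Real c, Suc i), (Real d, i)]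
               [(Real d, Suc i), (Real c, i), (Real b, Suc i)]"

inductive virtual_move :: "diagram \<Rightarrow> diagram \<Rightarrow> bool" where
  V1_above: "virtual_move [(Birth, Suc i), (Virtual, i), (Death, Suc i)] []"
| V1_below: "virtual_move [(Birth, i), (Virtual, Suc i), (Death, i)] []"
| V2: "virtual_move [(Virtual, i), (Virtual, i)] []"
| V3: "virtual_move [(Virtual, i), (Virtual, Suc i), (Virtual, i)]
                    [(Virtual, Suc i), (Virtual, i), (Virtual, Suc i)]"

inductive mixed_move :: "diagram \<Rightarrow> diagram \<Rightarrow> bool" where
  M12: "mixed_move [(Real b, i), (Virtual, Suc i), (Virtual, i)]
                   [(Virtual, Suc i), (Virtual, i), (Real b, Suc i)]"
| M13: "mixed_move [(Virtual, i), (Real b, Suc i), (Virtual, i)]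
                   [(Virtual, Suc i), (Real b, i), (Virtual, Suc i)]"
| M23: "mixed_move [(Virtual, i), (Virtual, Suc i), (Real b, i)]
                   [(Real b, Suc i), (Virtual, i), (Virtual, Suc i)]"

definition move :: "diagram \<Rightarrow> diagram \<Rightarrow> bool" where
  "move D E \<longleftrightarrow> long_diagram D \<and> long_diagram E \<and>
     (\<exists>u v l r. D = u @ l @ v \<and> E = u @ r @ v \<and>
        (isotopy_move l r \<or> real_move l r \<or> virtual_move l r \<or> mixed_move l r))"

definition diagram_equiv :: "(diagram \<times> diagram) set" where
  "diagram_equiv = {(D, E). long_diagram D \<and> long_diagram E \<and> equivclp move D E}"

definition long_virtual_knots :: "diagram set set" where
  "long_virtual_knots = {D. long_diagram D} // diagram_equiv"


section \<open>Signed passages of a diagram\<close>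

text \<open>
  Crossing signs: over-branch and under-branch, in this order, form a positive frame iff the sign
  is \<open>+1\<close>. If both branches head to the same side, this means that the falling branch is over.
\<close>

definition crossing_sign :: "diagram \<Rightarrow> nat \<Rightarrow> bool \<Rightarrow> int" where
  "crossing_sign D j b =
     (let i = snd (D ! j); visited = state_at D ` {..travel_time D};
          rising_right = ((j, i, True) \<in> visited);
          falling_right = ((j, Suc i, True) \<in> visited)
      in if (rising_right = falling_right) \<noteq> b then 1 else - 1)"

text \<open>
  The list of passages through real crossings in the order of traversal, each given by the
  crossing, by the information whether it is an over-passage, and by the crossing sign. The branch
  used is the rising one iff \<open>r\<close> and \<open>p = i\<close> agree.
\<close>

definition passage :: "diagram \<Rightarrow> state \<Rightarrow> (nat \<times> bool \<times> int) list" where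
  "passage D s =
     (case s of (k, p, r) \<Rightarrow>
        (let j = next_event s in
         case D ! j of
           (Real b, i) \<Rightarrow>
             (if p = i \<or> p = Suc i then [(j, (r = (p = i)) = b, crossing_sign D j b)] else [])
         | _ \<Rightarrow> []))"

definition diagram_passages :: "diagram \<Rightarrow> (nat \<times> bool \<times> int) list" where
  "diagram_passages D = concat (map (\<lambda>t. passage D (state_at D t)) [0..<travel_time D])"


section \<open>Closed curve diagrams on closed oriented surfaces\<close>

text \<open>
  A closed oriented surface with a cell decomposition is given by its rotation system: the darts
  are the oriented edges of the 1-skeleton, \<open>opp\<close> reverses a dart, and \<open>rot\<close> maps a dart to the
  next dart counterclockwise around its initial vertex. A closed curve diagram with basepoint is
  drawn in the 1-skeleton of such a decomposition, which may contain further vertices and edges; in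
  particular the complement of the curve need not consist of disks.
  \<open>curve\<close> lists the darts traversed, starting from the basepoint, and \<open>over\<close> contains the
  times at which the curve passes a crossing on its over-branch, where time \<open>t\<close> stands for the
  passage through the initial vertex of the dart \<open>curve ! t\<close>.
\<close>

record surface_diagram =
  darts :: "nat set"
  opp :: "nat \<Rightarrow> nat"
  rot :: "nat \<Rightarrow> nat"
  curve :: "nat list"
  over :: "nat set"

definition closed_surface :: "surface_diagram \<Rightarrow> bool" where
  "closed_surface S \<longleftrightarrow>
     finite (darts S) \<and> darts S \<noteq> {} \<and> opp S permutes darts S \<and> rot S permutes darts S \<and>
     (\<forall>d \<in> darts S. opp S (opp S d) = d \<and> opp S d \<noteq> d) \<and>
     (\<forall>d \<in> darts S. \<forall>e \<in> darts S. (d, e) \<in> ((\<Union>c \<in> darts S. {(c, opp S c), (c, rot S c)})\<^sup>*))"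

definition vertex :: "surface_diagram \<Rightarrow> nat \<Rightarrow> nat set" where
  "vertex S d = orbit (rot S) d"

definition euler_characteristic :: "surface_diagram \<Rightarrow> int" where
  "euler_characteristic S =
     int (card (orbit (rot S) ` darts S)) - int (card (orbit (opp S) ` darts S))
     + int (card (orbit (rot S \<circ> opp S) ` darts S))"

text \<open>The dart opposite to the one by which a closed edge path \<open>c\<close> arrives at the start of \<open>c ! t\<close>.\<close>

definition arrival :: "surface_diagram \<Rightarrow> nat list \<Rightarrow> nat \<Rightarrow> nat" where
  "arrival S c t = opp S (c ! ((t + length c - 1) mod length c))"

text \<open>The darts leaving to the left of the closed edge path \<open>c\<close> at time \<open>t\<close>.\<close>

definition left_darts :: "surface_diagram \<Rightarrow> nat list \<Rightarrow> nat \<Rightarrow> nat set" where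
  "left_darts S c t =
     {(rot S ^^ n) (c ! t) |n. 0 < n \<and> n < funpow_dist (rot S) (c ! t) (arrival S c t)}"

text \<open>A crossing is given by the times \<open>s < t\<close> of its two passages.\<close>

definition crossings :: "surface_diagram \<Rightarrow> (nat \<times> nat) set" where
  "crossings S =
     {(s, t). s < t \<and> t < length (curve S) \<and> vertex S (curve S ! s) = vertex S (curve S ! t)}"

text \<open>
  The curve runs through every edge at most once and every vertex at most twice, the double points
  are transversal, and the basepoint is not a double point.
\<close>

definition curve_diagram :: "surface_diagram \<Rightarrow> bool" where
  "curve_diagram S \<longleftrightarrow>
     curve S \<noteq> [] \<and> set (curve S) \<subseteq> darts S \<and>
     distinct (curve S @ map (opp S) (curve S)) \<and>
     (\<forall>t < length (curve S). arrival S (curve S) t \<in> vertex S (curve S ! t)) \<and>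
     (\<forall>d \<in> darts S. card {t. t < length (curve S) \<and> curve S ! t \<in> vertex S d} \<le> 2) \<and>
     (\<forall>(s, t) \<in> crossings S.
        0 < s \<and>
        (curve S ! t \<in> left_darts S (curve S) s) \<noteq>
          (arrival S (curve S) t \<in> left_darts S (curve S) s) \<and>
        (s \<in> over S) \<noteq> (t \<in> over S))"

definition surface_diagram_of_genus :: "nat \<Rightarrow> surface_diagram \<Rightarrow> bool" where
  "surface_diagram_of_genus g S \<longleftrightarrow>
     closed_surface S \<and> euler_characteristic S = 2 - 2 * int g \<and> curve_diagram S"

fun sign :: "surface_diagram \<Rightarrow> nat \<times> nat \<Rightarrow> int" where
  "sign S (s, t) =
     (if (curve S ! t \<in> left_darts S (curve S) s) = (s \<in> over S) then 1 else - 1)"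

definition surface_passages :: "surface_diagram \<Rightarrow> ((nat \<times> nat) \<times> bool \<times> int) list" where
  "surface_passages S =
     concat (map (\<lambda>r.
       if \<exists>(s, t) \<in> crossings S. r = s \<or> r = t
       then let c = (THE c. c \<in> crossings S \<and> (r = fst c \<or> r = snd c))
            in [(c, r \<in> over S, sign S c)]
       else []) [0..<length (curve S)])"

definition realizes :: "surface_diagram \<Rightarrow> diagram \<Rightarrow> bool" where
  "realizes S D \<longleftrightarrow>
     (\<exists>h. inj_on h (fst ` set (diagram_passages D)) \<and>
        surface_passages S = map (\<lambda>(c, o_c, \<epsilon>). (h c, o_c, \<epsilon>)) (diagram_passages D))"

definition surface_realization :: "diagram set \<Rightarrow> nat \<Rightarrow> surface_diagram \<Rightarrow> bool" where
  "surface_realization K g S \<longleftrightarrow>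
     surface_diagram_of_genus g S \<and> (\<exists>D \<in> K. realizes S D)"

definition supporting_genus :: "diagram set \<Rightarrow> nat" ("sg\<^sub>1") where
  "sg\<^sub>1 K = (LEAST g. \<exists>S. surface_realization K g S)"


section \<open>Intersection numbers and the polynomials\<close>

fun alpha :: "surface_diagram \<Rightarrow> nat \<times> nat \<Rightarrow> nat list" where
  "alpha S (s, t) = take (t - s) (drop s (curve S))"

fun beta :: "surface_diagram \<Rightarrow> nat \<times> nat \<Rightarrow> nat list" where
  "beta S (s, t) = take s (curve S) @ drop t (curve S)"

definition outflow :: "surface_diagram \<Rightarrow> nat list \<Rightarrow> nat \<Rightarrow> int" where
  "outflow S c d = int (count_list c d) - int (count_list c (opp S d))"

text \<open>
  To make the closed edge paths \<open>a\<close> and \<open>b\<close> transversal, push \<open>a\<close> slightly to its left. It then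
  crosses exactly the darts leaving its vertices to the left. A crossing with \<open>b\<close> counts \<open>+1\<close> iff
  the directions of \<open>a\<close> and \<open>b\<close>, in this order, form a positive frame, that is, iff \<open>b\<close> crosses
  from the right of \<open>a\<close> to the left.
\<close>

definition intersection_number :: "surface_diagram \<Rightarrow> nat list \<Rightarrow> nat list \<Rightarrow> int" where
  "intersection_number S a b = (\<Sum>t<length a. \<Sum>d\<in>left_darts S a t. outflow S b d)"

text \<open>Laurent polynomials with integer coefficients form the group ring of the integers.\<close>

type_synonym laurent = "int \<Rightarrow>\<^sub>0 int"

definition t_power :: "int \<Rightarrow> laurent" where
  "t_power n = Poly_Mapping.single n 1"

definition invert_t :: "laurent \<Rightarrow> laurent" where
  "invert_t p = Poly_Mapping.map_key uminus p"

fun crossing_type :: "surface_diagram \<Rightarrow> nat \<times> nat \<Rightarrow> nat" where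
  "crossing_type S (s, t) = (if s \<in> over S then 0 else 1)"

definition I :: "surface_diagram \<Rightarrow> nat \<Rightarrow> (nat \<times> nat) set" where
  "I S a = {c \<in> crossings S. crossing_type S c = a}"

definition writhe :: "surface_diagram \<Rightarrow> nat \<Rightarrow> int" where
  "writhe S a = (\<Sum>c\<in>I S a. sign S c)"

definition W :: "surface_diagram \<Rightarrow> nat \<Rightarrow> laurent" where
  "W S a = (\<Sum>c\<in>I S a.
     of_int (sign S c) * (t_power (intersection_number S (alpha S c) (beta S c)) - 1))"

definition F :: "surface_diagram \<Rightarrow> nat \<Rightarrow> nat \<Rightarrow> laurent" where
  "F S a b = (\<Sum>c\<in>I S a. \<Sum>d\<in>I S b.
     of_int (sign S c * sign S d) *
     (t_power (intersection_number S (alpha S c) (alpha S d)) - 1))"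

definition H :: "surface_diagram \<Rightarrow> nat \<Rightarrow> nat \<Rightarrow> laurent" where
  "H S a b = (\<Sum>c\<in>I S a. \<Sum>d\<in>I S b.
       of_int (sign S c * sign S d) *
       (t_power (intersection_number S (beta S c) (beta S d)) - 1))
     - of_int (writhe S a) * W S b - of_int (writhe S b) * invert_t (W S a)"

text \<open>
  The polynomials of a long virtual knot are those of any of its surface realizations; the choice
  is immaterial because the polynomials are invariants.
\<close>

definition some_realization :: "diagram set \<Rightarrow> surface_diagram" where
  "some_realization K = (SOME S. \<exists>g. surface_realization K g S)"

definition F_polynomial :: "diagram set \<Rightarrow> nat \<Rightarrow> nat \<Rightarrow> laurent" where
  "F_polynomial K = F (some_realization K)"

definition H_polynomial :: "diagram set \<Rightarrow> nat \<Rightarrow> nat \<Rightarrow> laurent" where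
  "H_polynomial K = H (some_realization K)"

end

theory Submission
 imports Defs
begin

text \<open>
 The polynomials depend on a diagram only through its signed Gauss code, since the intersection
 numbers of the loops are counts of linked passages. Among all surfaces carrying the code, the one
 with the faces of the ribbon graph of the code as complementary disks has minimal genus. Finger
 moves (a second and a third Reidemeister move) that preserve this genus bring all first passages
 before all second passages, and kinks then make both writhes vanish. Now moving the basepoint
 between the two halves of the code exchanges the loops \<open>\<alpha>\<close> and \<open>\<beta>\<close> as well as the two types
 of crossings, and keeps the ribbon graph.
\<close>

section \<open>Signed Gauss codes\<close>

text \<open>Moving the basepoint exchanges \<alpha> and \<beta> at a crossing only if it slides past
  exactly one of the two passages; for this to happen everywhere the code has to be split into
  halves. The exponents of \<open>F\<close> then turn into those of \<open>H\<close>, but the two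
  products with writhes in \<open>H\<close> have no counterpart in \<open>F\<close>. Each of their
  terms depends on one crossing of a pair only, so it is killed in the double sum as soon as the
  writhe belonging to the other crossing is 0. This is why kinks are added. Fingers and kinks act on
  codes alone: only the invariance of polynomials and Euler characteristic under them enters, and a
  diagram is built for the rotated code only. Its class is \<open>K'\<close>. Loops are functions on
  passages with values 0, 1, 2, doubled indicators with the middle value at the corner, so that four
  times an intersection number is an antisymmetric form. A finger adds two crossings and two
  triangular faces, a kink one crossing and a monogon. Faces minus crossings is the Euler
  characteristic of the surface with complementary disks, which therefore survives.\<close>

datatype 'l point = Point (label: 'l) (is_over: bool) (psign: int)

definition mate :: "'l point \<Rightarrow> 'l point" where
 "mate p = Point (label p) (\<not> is_over p) (psign p)"

text \<open>\<open>twist p = 1\<close> iff the other strand crosses the strand of \<open>p\<close> from right to left.\<close>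

definition twist :: "'l point \<Rightarrow> int" where
 "twist p = (if is_over p then psign p else - psign p)"

lemma mate_mate [simp]: "mate (mate p) = p"
 and mate_neq [simp]: "mate p \<noteq> p" "p \<noteq> mate p"
 and label_mate [simp]: "label (mate p) = label p"
 and is_over_mate [simp]: "is_over (mate p) \<longleftrightarrow> \<not> is_over p"
 and psign_mate [simp]: "psign (mate p) = psign p"
 and twist_mate [simp]: "twist (mate p) = - twist p"
 by (auto simp: mate_def twist_def point.expand) (metis point.sel(2))+

lemma mate_eq_iff: "mate p = q \<longleftrightarrow> p = mate q" by (metis mate_mate)

lemma inj_mate [simp]: "inj_on mate A" by (metis inj_onI mate_mate)

text \<open>Since \<open>mate\<close> copies the sign, closure under \<open>mate\<close> also makes
  both passages of a crossing agree in \<open>psign\<close>.\<close>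

definition wf_code :: "'l point list \<Rightarrow> bool" where
 "wf_code L \<longleftrightarrow> distinct (map (\<lambda>p. (label p, is_over p)) L) \<and>
   (\<forall>p \<in> set L. mate p \<in> set L \<and> (psign p = 1 \<or> psign p = - 1))"

lemma wf_code_distinct: "wf_code L \<Longrightarrow> distinct L" by (simp add: wf_code_def distinct_map)

lemma wf_code_mate: "wf_code L \<Longrightarrow> mate p \<in> set L \<longleftrightarrow> p \<in> set L"
 by (metis mate_mate wf_code_def)

lemma wf_code_psign: "wf_code L \<Longrightarrow> p \<in> set L \<Longrightarrow> psign p = 1 \<or> psign p = - 1"
 by (simp add: wf_code_def)

lemma wf_code_label:
 assumes "wf_code L" "p \<in> set L" "q \<in> set L" "label p = label q"
 shows "q = p \<or> q = mate p"
proof -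
 have inj: "inj_on (\<lambda>p. (label p, is_over p)) (set L)" using assms(1) by (simp add: wf_code_def distinct_map)
 show ?thesis
 proof (cases "is_over q = is_over p")
  case True
  then show ?thesis using inj assms by (auto simp: inj_on_def)
 next
  case False
  then have "q = mate p" using inj_onD[OF inj, of q "mate p"] assms wf_code_mate[OF assms(1)] by auto
  then show ?thesis by simp
 qed
qed

section \<open>Positions in a code, loops as functions on passages, and their pairing\<close>

definition idx :: "'a list \<Rightarrow> 'a \<Rightarrow> nat" where
 "idx L p = length (takeWhile (\<lambda>x. x \<noteq> p) L)"

lemma idx_less [simp]: "p \<in> set L \<Longrightarrow> idx L p < length L" unfolding idx_def by (induction L) auto

lemma nth_idx [simp]: "p \<in> set L \<Longrightarrow> L ! idx L p = p" unfolding idx_def by (induction L) auto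

lemma idx_nth [simp]: "distinct L \<Longrightarrow> k < length L \<Longrightarrow> idx L (L ! k) = k"
 by (metis idx_less nth_eq_iff_index_eq nth_idx nth_mem)

lemma idx_eq_iff [simp]: "p \<in> set L \<Longrightarrow> q \<in> set L \<Longrightarrow> idx L p = idx L q \<longleftrightarrow> p = q"
 by (metis nth_idx)

lemma idx_map:
 assumes "inj_on f (set L)" "p \<in> set L"
 shows "idx (map f L) (f p) = idx L p"
proof -
 have "takeWhile (\<lambda>x. f x \<noteq> f p) L = takeWhile (\<lambda>x. x \<noteq> p) L"
  using assms by (intro takeWhile_cong) (auto simp: inj_on_def)
 then show ?thesis by (simp add: idx_def takeWhile_map comp_def)
qed

lemma idx_append:
 "idx (A @ B) p = (if p \<in> set A then idx A p else length A + idx B p)" by (induction A) (auto simp: idx_def)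

lemma idx_Cons: "idx (x # B) p = (if x = p then 0 else Suc (idx B p))" by (simp add: idx_def)

lemma idx_filter_less_iff:
 assumes "distinct L" "p \<in> set L" "q \<in> set L" "P p" "P q"
 shows "idx (filter P L) p < idx (filter P L) q \<longleftrightarrow> idx L p < idx L q"
 using assms by (induction L) (auto simp: idx_Cons)

text \<open>Twice the step function that jumps at \<open>p\<close>, with the middle value at the
  jump. The middle value yields the complementarity \<open>lv_swap\<close> and treats the arriving
  and the departing edge at a passage alike.\<close>

definition lv :: "'a list \<Rightarrow> 'a \<Rightarrow> 'a \<Rightarrow> int" where
 "lv L p u = 2 * of_bool (idx L p < idx L u) + of_bool (p = u)"

lemma lv_self [simp]: "lv L p p = 1" by (simp add: lv_def)

lemma lv_swap: "p \<in> set L \<Longrightarrow> u \<in> set L \<Longrightarrow> lv L u p = 2 - lv L p u"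
 using idx_eq_iff[of p L u] by (auto simp: lv_def not_less le_less)

lemma lv_cases: "p \<noteq> u \<Longrightarrow> lv L p u = 2 \<or> lv L p u = 0" by (auto simp: lv_def)

text \<open>
 For the first passage \<open>p\<close> of a crossing, \<open>cyc L p\<close> is twice the indicator function of the
 loop \<open>\<alpha>\<close> at this crossing, with the value \<open>1\<close> at its two end points.
\<close>

definition cyc :: "'l point list \<Rightarrow> 'l point \<Rightarrow> 'l point \<Rightarrow> int" where
 "cyc L p u = lv L p u - lv L (mate p) u"

lemma cyc_mate [simp]: "cyc L (mate p) u = - cyc L p u" by (simp add: cyc_def)

text \<open>For the doubled indicator functions of two loops this is four times their intersection
  number. Each crossing enters through both of its passages, with \<open>f\<close> read on one
  strand and \<open>g\<close> on the other, and \<open>twist\<close> supplies the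
  orientation.\<close>

definition pairing :: "'l point list \<Rightarrow> ('l point \<Rightarrow> int) \<Rightarrow> ('l point \<Rightarrow> int) \<Rightarrow> int" where
 "pairing L f g = (\<Sum>u\<in>set L. twist u * f u * g (mate u))"

lemma pairing_cong:
 "wf_code L \<Longrightarrow> (\<And>u. u \<in> set L \<Longrightarrow> f u = f' u) \<Longrightarrow> (\<And>u. u \<in> set L \<Longrightarrow> g u = g' u)
  \<Longrightarrow> pairing L f g = pairing L f' g'"
 unfolding pairing_def by (rule sum.cong) (auto simp: wf_code_mate)

lemma pairing_add_left: "pairing L (\<lambda>u. f u + f' u) g = pairing L f g + pairing L f' g"
 and pairing_add_right: "pairing L f (\<lambda>u. g u + g' u) = pairing L f g + pairing L f g'"
 and pairing_diff_left: "pairing L (\<lambda>u. f u - f' u) g = pairing L f g - pairing L f' g"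
 and pairing_diff_right: "pairing L f (\<lambda>u. g u - g' u) = pairing L f g - pairing L f g'"
 and pairing_minus_left: "pairing L (\<lambda>u. - f u) g = - pairing L f g"
 and pairing_minus_right: "pairing L f (\<lambda>u. - g u) = - pairing L f g"
 and pairing_mult_left: "pairing L (\<lambda>u. k * f u) g = k * pairing L f g"
 and pairing_mult_right: "pairing L f (\<lambda>u. k * g u) = k * pairing L f g"
 by (simp_all add: pairing_def algebra_simps sum.distrib sum_subtractf sum_negf sum_distrib_left)

text \<open>Reindexing by \<open>mate\<close> interchanges the roles of \<open>f\<close> and
  \<open>g\<close>, and \<open>twist\<close> changes its sign.\<close>

lemma pairing_swap:
 assumes "wf_code L"
 shows "pairing L g f = - pairing L f g"
proof -
 have "bij_betw mate (set L) (set L)" by (rule bij_betw_byWitness[of _ mate]) (auto simp: wf_code_mate[OF assms])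
 then have "pairing L g f = (\<Sum>u\<in>set L. twist (mate u) * g (mate u) * f (mate (mate u)))"
  unfolding pairing_def by (rule sum.reindex_bij_betw[symmetric])
 also have "\<dots> = - pairing L f g" by (simp add: pairing_def sum_negf mult.assoc mult.left_commute mult.commute)
 finally show ?thesis .
qed

lemma pairing_self: "wf_code L \<Longrightarrow> pairing L f f = 0" using pairing_swap[of L f f] by simp

lemma pairing_delta:
 assumes "v \<in> set L"
 shows "pairing L (\<lambda>u. k * of_bool (u = v)) g = k * twist v * g (mate v)"
proof -
 have "pairing L (\<lambda>u. k * of_bool (u = v)) g
   = (\<Sum>u\<in>set L. if u = v then k * twist v * g (mate v) else 0)"
  unfolding pairing_def by (rule sum.cong) auto
 then show ?thesis using assms by simp
qed

definition Om :: "'l point list \<Rightarrow> 'l point \<Rightarrow> 'l point \<Rightarrow> int" where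
 "Om L p q = pairing L (cyc L p) (cyc L q)"

text \<open>The constant 2 is the doubled indicator of the whole curve \<alpha> + \<beta>. As
  \<alpha> pairs to 0 with itself, \<open>ind L p\<close> is twice the intersection number of
  \<alpha> and \<beta> when \<open>p\<close> is a first passage.\<close>

definition ind :: "'l point list \<Rightarrow> 'l point \<Rightarrow> int" where
 "ind L p = pairing L (cyc L p) (\<lambda>_. 1)"

lemma Om_mate [simp]: "Om L (mate p) q = - Om L p q" "Om L p (mate q) = - Om L p q"
 and ind_mate [simp]: "ind L (mate p) = - ind L p"
proof -
 have *: "cyc L (mate p) = (\<lambda>u. - cyc L p u)" for p by auto
 show "Om L (mate p) q = - Om L p q" "Om L p (mate q) = - Om L p q" "ind L (mate p) = - ind L p"
  by (simp_all add: Om_def ind_def * pairing_minus_left pairing_minus_right)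
qed

lemma Om_swap: "wf_code L \<Longrightarrow> Om L q p = - Om L p q" by (simp add: Om_def pairing_swap[of L "cyc L p"])

text \<open>Crossings are represented by their first passages. Every nonzero \<open>a\<close> stands
  for type 1 here.\<close>

definition firsts :: "'l point list \<Rightarrow> nat \<Rightarrow> 'l point set" where
 "firsts L a = {p \<in> set L. mate p \<in> set L \<and> lv L p (mate p) = 2 \<and> is_over p = (a = 0)}"

lemma finite_firsts [simp]: "finite (firsts L a)" by (simp add: firsts_def)

definition kernel_sum :: "'l point list \<Rightarrow> ('l point \<Rightarrow> 'l point \<Rightarrow> laurent) \<Rightarrow> nat \<Rightarrow> nat \<Rightarrow> laurent" where
 "kernel_sum L k a b = (\<Sum>p\<in>firsts L a. \<Sum>q\<in>firsts L b. of_int (psign p * psign q) * k p q)"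

definition F_kernel :: "'l point list \<Rightarrow> 'l point \<Rightarrow> 'l point \<Rightarrow> laurent" where
 "F_kernel L p q = t_power (Om L p q div 4) - 1"

text \<open>The correction terms of \<open>H\<close> are absorbed into the double sum. Expanded over
  pairs, the two products of a writhe with \<open>W\<close> contribute a power with exponent
  \<alpha> . \<beta> at \<open>q\<close> and one with the negative of this number at
  \<open>p\<close>; the constants add up to 1.\<close>

definition H_kernel :: "'l point list \<Rightarrow> 'l point \<Rightarrow> 'l point \<Rightarrow> laurent" where
 "H_kernel L p q = t_power ((Om L p q + 2 * ind L q - 2 * ind L p) div 4)
   - t_power ((2 * ind L q) div 4) - t_power ((- 2 * ind L p) div 4) + 1"

definition F_code :: "'l point list \<Rightarrow> nat \<Rightarrow> nat \<Rightarrow> laurent" where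
 "F_code L = kernel_sum L (F_kernel L)"

definition H_code :: "'l point list \<Rightarrow> nat \<Rightarrow> nat \<Rightarrow> laurent" where
 "H_code L = kernel_sum L (H_kernel L)"

definition same_polynomials :: "'l point list \<Rightarrow> 'k point list \<Rightarrow> bool" where
 "same_polynomials L M \<longleftrightarrow> F_code L = F_code M \<and> H_code L = H_code M"

lemma same_polynomials_refl [simp]: "same_polynomials L L"
 and same_polynomials_sym: "same_polynomials L M \<Longrightarrow> same_polynomials M L"
 and same_polynomials_trans:
  "same_polynomials L M \<Longrightarrow> same_polynomials M N \<Longrightarrow> same_polynomials L N"
 by (auto simp: same_polynomials_def)

lemma kernel_sum_cong:
 assumes "\<And>a. bij_betw f (firsts L a) (firsts M a)"
  and "\<And>p. p \<in> set L \<Longrightarrow> psign (f p) = psign p"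
  and "\<And>p q. p \<in> set L \<Longrightarrow> q \<in> set L \<Longrightarrow> k' (f p) (f q) = k p q"
 shows "kernel_sum L k a b = kernel_sum M k' a b"
proof -
 have "kernel_sum M k' a b
   = (\<Sum>p\<in>firsts L a. \<Sum>q\<in>firsts L b. of_int (psign (f p) * psign (f q)) * k' (f p) (f q))"
  unfolding kernel_sum_def by (subst sum.reindex_bij_betw[OF assms(1)[of a], symmetric],
    subst sum.reindex_bij_betw[OF assms(1)[of b], symmetric]) simp
 also have "\<dots> = kernel_sum L k a b" unfolding kernel_sum_def
  by (intro sum.cong refl) (simp add: assms(2,3) firsts_def)
 finally show ?thesis by simp
qed

lemma same_polynomialsI:
 assumes "\<And>a. bij_betw f (firsts L a) (firsts M a)"
  and "\<And>p. p \<in> set L \<Longrightarrow> psign (f p) = psign p"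
  and "\<And>p q. p \<in> set L \<Longrightarrow> q \<in> set L \<Longrightarrow> Om M (f p) (f q) = Om L p q"
  and "\<And>p. p \<in> set L \<Longrightarrow> ind M (f p) = ind L p"
 shows "same_polynomials L M" unfolding same_polynomials_def F_code_def H_code_def
proof (intro conjI ext)
 show "kernel_sum L (F_kernel L) a b = kernel_sum M (F_kernel M) a b" for a b
  by (rule kernel_sum_cong[OF assms(1,2)]) (auto simp: F_kernel_def assms(3))
 show "kernel_sum L (H_kernel L) a b = kernel_sum M (H_kernel M) a b" for a b
  by (rule kernel_sum_cong[OF assms(1,2)]) (auto simp: H_kernel_def assms(3,4))
qed

text \<open>Crossings are named by slices in a plane diagram and by pairs of times on a surface, so
  codes are compared up to an injective renaming.\<close>

definition relabel :: "('l \<Rightarrow> 'k) \<Rightarrow> 'l point \<Rightarrow> 'k point" where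
 "relabel h p = Point (h (label p)) (is_over p) (psign p)"

lemma relabel_simps [simp]:
 "relabel h (mate p) = mate (relabel h p)" "is_over (relabel h p) = is_over p"
 "psign (relabel h p) = psign p" "twist (relabel h p) = twist p" "label (relabel h p) = h (label p)"
 by (auto simp: relabel_def mate_def twist_def)

lemma inj_on_relabel: "inj_on h (label ` A) \<Longrightarrow> inj_on (relabel h) A"
 by (auto simp: inj_on_def relabel_def point.expand)

lemma wf_code_relabel:
 assumes "wf_code L" "inj_on h (label ` set L)"
 shows "wf_code (map (relabel h) L)"
proof -
 have "distinct L" "inj_on (\<lambda>p. (label p, is_over p)) (set L)"
  using assms(1) by (auto simp: wf_code_def distinct_map)
 then have "distinct (map (\<lambda>p. (label p, is_over p)) (map (relabel h) L))"
  using assms(2) by (auto simp: distinct_map inj_on_def)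
 then show ?thesis using assms(1) unfolding wf_code_def by (auto simp flip: relabel_simps(1))
qed

lemma same_polynomials_relabel:
 assumes wf: "wf_code L" and inj: "inj_on h (label ` set L)"
 shows "same_polynomials L (map (relabel h) L)"
proof -
 let ?M = "map (relabel h) L"
 have inj': "inj_on (relabel h) (set L)" by (rule inj_on_relabel[OF inj])
 have eq: "relabel h p = relabel h q \<longleftrightarrow> p = q" if "p \<in> set L" "q \<in> set L" for p q
  using inj' that by (auto simp: inj_on_def)
 have lv: "lv ?M (relabel h p) (relabel h u) = lv L p u" if "p \<in> set L" "u \<in> set L" for p u
  using that by (simp add: lv_def idx_map[OF inj'] eq)
 have cyc: "cyc ?M (relabel h p) (relabel h u) = cyc L p u" if "p \<in> set L" "u \<in> set L" for p u
  using that lv[of p u] lv[of "mate p" u] by (simp add: cyc_def wf_code_mate[OF wf])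
 have pair: "pairing ?M f g = pairing L (\<lambda>u. f (relabel h u)) (\<lambda>u. g (relabel h u))" for f g
  unfolding pairing_def by (simp add: sum.reindex[OF inj'])
 show ?thesis
 proof (rule same_polynomialsI)
  have "firsts ?M a = relabel h ` firsts L a" for a
  proof -
   have "relabel h p \<in> firsts ?M a \<longleftrightarrow> p \<in> firsts L a" if "p \<in> set L" for p
    using that lv[of p "mate p"] imageI[of "mate p" "set L" "relabel h"] by (auto simp: firsts_def wf_code_mate[OF wf])
   moreover have "firsts ?M a \<subseteq> relabel h ` set L" "firsts L a \<subseteq> set L" by (auto simp: firsts_def)
   ultimately show ?thesis by blast
  qed
  then show "bij_betw (relabel h) (firsts L a) (firsts ?M a)" for a
   using inj_on_subset[OF inj', of "firsts L a"] by (auto simp: bij_betw_def firsts_def)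
  show "Om ?M (relabel h p) (relabel h q) = Om L p q" if "p \<in> set L" "q \<in> set L" for p q
   unfolding Om_def pair by (rule pairing_cong[OF wf]) (auto simp: cyc that)
  show "ind ?M (relabel h p) = ind L p" if "p \<in> set L" for p
   unfolding ind_def pair by (rule pairing_cong[OF wf]) (auto simp: cyc that)
 qed auto
qed

section \<open>Reidemeister moves of codes\<close>

definition swap_adj :: "'a \<Rightarrow> 'a \<Rightarrow> 'a list \<Rightarrow> 'a list \<Rightarrow> bool" where
 "swap_adj p q L M \<longleftrightarrow> (\<exists>A B. L = A @ [p, q] @ B \<and> M = A @ [q, p] @ B
   \<or> L = A @ [q, p] @ B \<and> M = A @ [p, q] @ B)"

definition adjacent :: "'a list \<Rightarrow> 'a \<Rightarrow> 'a \<Rightarrow> bool" where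
 "adjacent L p q \<longleftrightarrow> (\<exists>A B. L = A @ [p, q] @ B \<or> L = A @ [q, p] @ B)"

lemma swap_adj_adjacent: "swap_adj p q L M \<Longrightarrow> adjacent L p q" by (auto simp: swap_adj_def adjacent_def)

lemma swap_adj_set: "swap_adj p q L M \<Longrightarrow> set M = set L"
 and swap_adj_distinct: "swap_adj p q L M \<Longrightarrow> distinct L \<Longrightarrow> distinct M"
 by (auto simp: swap_adj_def)

lemma swap_adj_wf:
 assumes "swap_adj p q L M" "wf_code L"
 shows "wf_code M" using assms(2) swap_adj_set[OF assms(1)] swap_adj_distinct[OF assms(1)]
 by (simp add: wf_code_def distinct_map)

lemma adjacent_mem: "adjacent L p q \<Longrightarrow> p \<in> set L" "adjacent L p q \<Longrightarrow> q \<in> set L"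
 by (auto simp: adjacent_def)

lemma adjacent_sym: "adjacent L p q \<longleftrightarrow> adjacent L q p" by (auto simp: adjacent_def)

lemma idx_pair:
 assumes "distinct (A @ [p, q] @ B)"
 shows "idx (A @ [p, q] @ B) p = length A" "idx (A @ [p, q] @ B) q = Suc (length A)"
  and "w \<noteq> p \<Longrightarrow> w \<noteq> q \<Longrightarrow> idx (A @ [p, q] @ B) w < length A \<or> Suc (length A) < idx (A @ [p, q] @ B) w"
  and "w \<noteq> p \<Longrightarrow> w \<noteq> q \<Longrightarrow> idx (A @ [q, p] @ B) w = idx (A @ [p, q] @ B) w"
 using assms by (auto simp: idx_append idx_Cons)

text \<open>No third passage lies between two neighbours, so a step function jumping elsewhere
  cannot separate them.\<close>

lemma adjacent_lv:
 assumes "adjacent L p q" "distinct L" "w \<noteq> p" "w \<noteq> q"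
 shows "lv L w p = lv L w q" and "lv L p w = lv L q w"
proof -
 obtain A B where AB: "L = A @ [p, q] @ B \<or> L = A @ [q, p] @ B" using assms(1) by (auto simp: adjacent_def)
 then have "lv L w p = lv L w q \<and> lv L p w = lv L q w"
 proof
  assume L: "L = A @ [p, q] @ B"
  show ?thesis using idx_pair[OF assms(2)[unfolded L], folded L] assms(3,4) by (fastforce simp: lv_def)
 next
  assume L: "L = A @ [q, p] @ B"
  show ?thesis using idx_pair[OF assms(2)[unfolded L], folded L] assms(3,4) by (fastforce simp: lv_def)
 qed
 then show "lv L w p = lv L w q" "lv L p w = lv L q w" by auto
qed

text \<open>The factor \<open>lv L p q - 1\<close> is 1 if \<open>p\<close> precedes
  \<open>q\<close> and -1 otherwise; the exchange affects the mutual order of these two passages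
  only.\<close>

lemma swap_adj_lv:
 assumes "swap_adj p q L M" "distinct L"
 shows "lv M a b = lv L a b + 2 * (lv L p q - 1) * (of_bool (a = q \<and> b = p) - of_bool (a = p \<and> b = q))"
proof -
 have *: "lv M a b = lv L a b + (of_bool (a = q \<and> b = p) - of_bool (a = p \<and> b = q)) * 2"
   "lv L p q = 2" "lv L q p = 0"
  if L: "L = A @ [p, q] @ B" and M: "M = A @ [q, p] @ B" and d: "distinct L" for A B p q and L M :: "'a list"
 proof -
  have d': "distinct (A @ [q, p] @ B)" and "p \<noteq> q" using L d by auto
  note L1 = idx_pair[OF d[unfolded L], folded L] and M1 = idx_pair[OF d', folded M]
  show "lv L p q = 2" "lv L q p = 0" using L1 \<open>p \<noteq> q\<close> by (auto simp: lv_def)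
  have w: "idx M w = idx L w" if "w \<noteq> p" "w \<noteq> q" for w using L1(4)[of w] M1(4)[of w] that M L by simp
  show "lv M a b = lv L a b + (of_bool (a = q \<and> b = p) - of_bool (a = p \<and> b = q)) * 2"
   using L1(1,2) M1(1,2) L1(3)[of a] L1(3)[of b] w[of a] w[of b] \<open>p \<noteq> q\<close>
   by (cases "a = p"; cases "a = q"; cases "b = p"; cases "b = q"; auto simp: lv_def)
 qed
 obtain A B where "L = A @ [p, q] @ B \<and> M = A @ [q, p] @ B \<or> L = A @ [q, p] @ B \<and> M = A @ [p, q] @ B"
  using assms(1) by (auto simp: swap_adj_def)
 then show ?thesis
 proof
  assume "L = A @ [p, q] @ B \<and> M = A @ [q, p] @ B"
  then show ?thesis using *[of L A p q B M] assms(2) by auto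
 next
  assume "L = A @ [q, p] @ B \<and> M = A @ [p, q] @ B"
  then show ?thesis using *[of L A q p B M] assms(2) by auto
 qed
qed

text \<open>The crossings \<open>x\<close>, \<open>y\<close>, \<open>z\<close> are the corners of a
  triangle whose sides lie on three strands with the neighbouring passages \<open>x, y\<close>, then
  \<open>mate x, z\<close>, then \<open>mate y, mate z\<close>; the move exchanges the neighbours on
  every strand. The conditions \<open>c1\<close> and \<open>c2\<close> couple the orders along the
  strands with the twists, as happens for a triangle in a surface. They make the linear changes of
  the pairing cancel for loops based elsewhere; for loops based at the triangle itself the quadratic
  change is needed as well.\<close>

theorem same_polynomials_R3:
 assumes wf: "wf_code L"
  and s1: "swap_adj x y L L1" and s2: "swap_adj (mate x) z L1 L2"
  and s3: "swap_adj (mate y) (mate z) L2 M"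
  and lab: "label x \<noteq> label y" "label x \<noteq> label z" "label y \<noteq> label z"
  and c1: "(lv L x y - 1) * (lv L (mate x) z - 1) = twist y * twist z"
  and c2: "(lv L x y - 1) * (lv L (mate y) (mate z) - 1) = twist x * twist z"
 shows "same_polynomials L M"
proof -
 define s where "s = lv L x y - 1"
 define s' where "s' = lv L (mate x) z - 1"
 define s'' where "s'' = lv L (mate y) (mate z) - 1"
 have wf1: "wf_code L1" and wf2: "wf_code L2" and wfM: "wf_code M" using swap_adj_wf s1 s2 s3 wf by blast+
 note d = wf_code_distinct[OF wf] wf_code_distinct[OF wf1] wf_code_distinct[OF wf2]
 have sets: "set L1 = set L" "set L2 = set L" "set M = set L"
  using swap_adj_set[OF s1] swap_adj_set[OF s2] swap_adj_set[OF s3] by auto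
 have ne: "x \<noteq> y" "x \<noteq> z" "y \<noteq> z" "x \<noteq> mate y" "x \<noteq> mate z" "y \<noteq> mate z" "y \<noteq> mate x"
  "z \<noteq> mate x" "z \<noteq> mate y" "mate x \<noteq> mate y" "mate x \<noteq> mate z" "mate y \<noteq> mate z"
  "mate x \<noteq> y" "mate x \<noteq> z" "mate y \<noteq> z" "mate y \<noteq> x" "mate z \<noteq> x" "mate z \<noteq> y"
  using lab by (metis label_mate)+
 have xL: "x \<in> set L" "y \<in> set L" "z \<in> set L"
  using adjacent_mem[OF swap_adj_adjacent[OF s1]] adjacent_mem[OF swap_adj_adjacent[OF s2]] sets by auto
 have mL: "mate p \<in> set L" if "p \<in> set L" for p using that wf_code_mate[OF wf] by simp
 have lv1: "lv L1 a b = lv L a b + 2 * s * (of_bool (a = y \<and> b = x) - of_bool (a = x \<and> b = y))" for a b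
  using swap_adj_lv[OF s1 d(1)] by (simp add: s_def)
 have lv2: "lv L2 a b = lv L1 a b + 2 * s' * (of_bool (a = z \<and> b = mate x) - of_bool (a = mate x \<and> b = z))" for a b
  using swap_adj_lv[OF s2 d(2)] lv1[of "mate x" z] ne by (simp add: s'_def)
 have lvM: "lv M a b = lv L a b
   + 2 * s * (of_bool (a = y \<and> b = x) - of_bool (a = x \<and> b = y))
   + 2 * s' * (of_bool (a = z \<and> b = mate x) - of_bool (a = mate x \<and> b = z))
   + 2 * s'' * (of_bool (a = mate z \<and> b = mate y) - of_bool (a = mate y \<and> b = mate z))" for a b
  using swap_adj_lv[OF s3 d(3)] lv2[of "mate y" "mate z"] lv1[of "mate y" "mate z"]
   lv2[of a b] lv1[of a b] ne by (simp add: s''_def)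
 have adj1: "lv L w x = lv L w y" if "w \<noteq> x" "w \<noteq> y" for w
  using adjacent_lv(1)[OF swap_adj_adjacent[OF s1] d(1)] that by blast
 have adj2: "lv L w (mate x) = lv L w z" if "w \<noteq> mate x" "w \<noteq> z" for w
  using adjacent_lv(1)[OF swap_adj_adjacent[OF s2] d(2)] that lv1[of w "mate x"] lv1[of w z] ne by simp
 have adj3: "lv L w (mate y) = lv L w (mate z)" if "w \<noteq> mate y" "w \<noteq> mate z" for w
  using adjacent_lv(1)[OF swap_adj_adjacent[OF s3] d(3)] that lv1[of w "mate y"] lv1[of w "mate z"]
   lv2[of w "mate y"] lv2[of w "mate z"] ne by simp
 note swp = lv_swap[OF xL(1,2)] lv_swap[OF mL[OF xL(1)] xL(3)] lv_swap[OF mL[OF xL(2)] mL[OF xL(3)]]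
 text \<open>The change of \<open>cyc\<close> is supported on the passages of the third strand.\<close>
 define \<Delta> where "\<Delta> p = (\<lambda>u. cyc M p u - cyc L p u)" for p
 have \<Delta>x: "\<Delta> x = (\<lambda>u. (- 2 * s) * of_bool (u = y) + 2 * s' * of_bool (u = z))"
  and \<Delta>y: "\<Delta> y = (\<lambda>u. (2 * s) * of_bool (u = x) + 2 * s'' * of_bool (u = mate z))"
  and \<Delta>z: "\<Delta> z = (\<lambda>u. (2 * s') * of_bool (u = mate x) + (- 2 * s'') * of_bool (u = mate y))"
  unfolding \<Delta>_def cyc_def lvM using ne by auto
 have \<Delta>o: "\<Delta> p = (\<lambda>u. 0)" if "p \<notin> {x, y, z, mate x, mate y, mate z}" for p
  unfolding \<Delta>_def cyc_def lvM using that by (auto simp: mate_eq_iff)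
 have \<Delta>m: "\<Delta> (mate p) = (\<lambda>u. - \<Delta> p u)" for p by (auto simp: \<Delta>_def)
 have cM: "cyc M p = (\<lambda>u. cyc L p u + \<Delta> p u)" for p by (auto simp: \<Delta>_def)
 have px: "pairing L (\<Delta> x) g = - 2 * s * twist y * g (mate y) + 2 * s' * twist z * g (mate z)"
  and py: "pairing L (\<Delta> y) g = 2 * s * twist x * g (mate x) - 2 * s'' * twist z * g z"
  and pz: "pairing L (\<Delta> z) g = - 2 * s' * twist x * g x + 2 * s'' * twist y * g y" for g
  unfolding \<Delta>x \<Delta>y \<Delta>z pairing_add_left using xL mL
  by (simp_all add: pairing_delta del: mult_minus_left) (simp_all add: algebra_simps)
 have pr: "pairing L f (\<Delta> p) = - pairing L (\<Delta> p) f" for f p using pairing_swap[OF wf] by blast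
 have sq: "s = 1 \<or> s = - 1" "s' = 1 \<or> s' = -1" "s'' = 1 \<or> s'' = -1"
  using lv_cases ne unfolding s_def s'_def s''_def by fastforce+
 have tw: "twist p = 1 \<or> twist p = -1" if "p \<in> set L" for p
  using wf_code_psign[OF wf that] by (auto simp: twist_def)
 have e: "s * s' = twist y * twist z" "s * s'' = twist x * twist z" using c1 c2 by (auto simp: s_def s'_def s''_def)
 \<comment> \<open>These are exactly the relations under which \<open>px\<close>, \<open>py\<close>
   and \<open>pz\<close> vanish on every function that does not separate neighbours, see
   \<open>g0\<close>.\<close>
 have e1: "s * twist y = s' * twist z" "s * twist x = s'' * twist z" "s' * twist x = s'' * twist y"
  using e sq tw[OF xL(1)] tw[OF xL(2)] tw[OF xL(3)] by auto
 have Om_eq: "Om M p q = Om L p q + pairing L (\<Delta> p) (cyc L q) - pairing L (\<Delta> q) (cyc L p)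
   + pairing L (\<Delta> p) (\<Delta> q)" for p q
 proof -
  have "Om M p q = pairing L (cyc M p) (cyc M q)" by (simp add: Om_def pairing_def sets)
  then show ?thesis by (simp add: cM pairing_add_left pairing_add_right pr[of "cyc L p" q] Om_def)
 qed
 have g0: "pairing L (\<Delta> p) g = 0" if "g x = g y" "g (mate x) = g z" "g (mate y) = g (mate z)"
   "p \<in> {x, y, z}" for g p using that e1 by (auto simp: px py pz algebra_simps)
 have co: "cyc L q x = cyc L q y" "cyc L q (mate x) = cyc L q z" "cyc L q (mate y) = cyc L q (mate z)"
  if "q \<notin> {x, y, z, mate x, mate y, mate z}" for q using that adj1 adj2 adj3 by (auto simp: cyc_def mate_eq_iff)
 have base: "Om M p q = Om L p q" if "p \<in> {x, y, z}" "q \<in> set L" for p q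
 proof (cases "q \<in> {x, y, z, mate x, mate y, mate z}")
  case False
  have "pairing L (\<Delta> p) (cyc L q) = 0" using g0[OF co[OF False]] that(1) by simp
  moreover have "pairing L f (\<lambda>u. 0) = 0" "pairing L (\<lambda>u. 0) f = 0" for f by (simp_all add: pairing_def)
  ultimately show ?thesis by (simp add: Om_eq \<Delta>o[OF False])
 next
  \<comment> \<open>A loop based at the triangle does separate neighbours, by the amounts in
    \<open>w\<close>; the resulting linear terms cancel together with the quadratic term of
    \<open>Om_eq\<close>.\<close>
  case True
  have v: "lv L x y = 1 + s" "lv L y x = 1 - s" "lv L (mate x) z = 1 + s'" "lv L z (mate x) = 1 - s'"
   "lv L (mate y) (mate z) = 1 + s''" "lv L (mate z) (mate y) = 1 - s''" using swp by (auto simp: s_def s'_def s''_def)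
  have w: "cyc L y (mate z) = cyc L y (mate y) - s''" "cyc L x z = cyc L x (mate x) - s'"
   "cyc L z (mate z) = cyc L z (mate y) - s''" "cyc L x y = cyc L x x + s"
   "cyc L z (mate x) = cyc L z z - s'" "cyc L y x = cyc L y y - s"
   using v ne adj1[of "mate x"] adj1[of "mate y"] adj2[of x] adj2[of "mate z"] adj3[of y] adj3[of z]
   by (simp_all add: cyc_def)
  have D: "\<Delta> y (mate y) = 0" "\<Delta> y (mate z) = 2 * s''" "\<Delta> z (mate y) = - 2 * s''" "\<Delta> z (mate z) = 0"
   "\<Delta> z (mate x) = 2 * s'" "\<Delta> z z = 0" using ne by (simp_all add: \<Delta>y \<Delta>z)
  have b: "Om M x y = Om L x y" "Om M x z = Om L x z" "Om M y z = Om L y z"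
   unfolding Om_eq px py pz w D using e1 by algebra+
  have self: "Om M p p = Om L p p" for p by (simp add: Om_def pairing_self[OF wf] pairing_self[OF wfM])
  have b': "Om M p q = Om L p q" if "p \<in> {x, y, z}" "q \<in> {x, y, z}" for p q
   using that b self[of x] self[of y] self[of z] Om_swap[OF wf, of y x] Om_swap[OF wfM, of y x] Om_swap[OF wf, of z x]
    Om_swap[OF wfM, of z x] Om_swap[OF wf, of z y] Om_swap[OF wfM, of z y] by auto
  show ?thesis using True b'[of p x] b'[of p y] b'[of p z] that(1) by auto
 qed
 have "Om M p q = Om L p q" if "p \<in> set L" "q \<in> set L" for p q
 proof (cases "p \<in> {x, y, z, mate x, mate y, mate z}")
  case True
  then show ?thesis using base[of x q] base[of y q] base[of z q] that(2) by auto
 next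
  case p: False
  show ?thesis
  proof (cases "q \<in> {x, y, z, mate x, mate y, mate z}")
   case True
   have "Om M q p = Om L q p" using True base[of x p] base[of y p] base[of z p] that(1) by auto
   then show ?thesis using Om_swap[OF wf] Om_swap[OF wfM] by (metis neg_equal_iff_equal)
  next
   case False
   then show ?thesis by (simp add: Om_eq \<Delta>o[OF p] \<Delta>o[OF False] pairing_def)
  qed
 qed
 moreover have "ind M p = ind L p" if "p \<in> set L" for p
 proof -
  have "ind M p = ind L p + pairing L (\<Delta> p) (\<lambda>_. 1)"
   by (simp add: ind_def pairing_def sets cM algebra_simps sum.distrib)
  moreover have "pairing L (\<Delta> q) (\<lambda>_. 1) = 0" if "q \<in> {x, y, z}" for q
   using g0[of "\<lambda>_. 1"] that by simp
  then have "pairing L (\<Delta> p) (\<lambda>_. 1) = 0"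
   using \<Delta>o[of p] \<Delta>m pairing_minus_left[of L "\<Delta> _" "\<lambda>_. 1"]
   by (cases "p \<in> {x, y, z, mate x, mate y, mate z}") (auto simp: pairing_def[of L "\<lambda>_. 0"])
  ultimately show ?thesis by simp
 qed
 moreover have "firsts M a = firsts L a" for a using ne lvM by (auto simp: firsts_def sets)
 ultimately show ?thesis by (intro same_polynomialsI[of id]) auto
qed

text \<open>The double sum is shortened in one argument at a time: the part over \<open>X\<close>
  drops out of the inner sum for each fixed \<open>p\<close>, and after exchanging the sums it drops
  out of the other one.\<close>

lemma kernel_sum_cancel:
 assumes "\<And>c. firsts L c = firsts M c \<union> X c" "\<And>c. firsts M c \<inter> X c = {}" "set M \<subseteq> set L"
  and "\<And>c q. q \<in> set L \<Longrightarrow> (\<Sum>p\<in>X c. of_int (psign p) * k p q) = 0"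
  and "\<And>c p. p \<in> set L \<Longrightarrow> (\<Sum>q\<in>X c. of_int (psign q) * k p q) = 0"
  and "\<And>p q. p \<in> set M \<Longrightarrow> q \<in> set M \<Longrightarrow> k p q = k' p q"
 shows "kernel_sum L k a b = kernel_sum M k' a b"
proof -
 have fin: "finite (X c)" for c using assms(1)[of c] finite_firsts[of L c] by (metis finite_Un)
 have sub: "firsts M c \<subseteq> set M" "X c \<subseteq> set L" "firsts L c \<subseteq> set L" for c
  using assms(1)[of c] by (auto simp: firsts_def)
 have "kernel_sum L k a b
   = (\<Sum>p\<in>firsts L a. of_int (psign p) * (\<Sum>q\<in>firsts L b. of_int (psign q) * k p q))"
  by (simp add: kernel_sum_def sum_distrib_left mult.assoc)
 also have "\<dots> = (\<Sum>p\<in>firsts L a. of_int (psign p) * (\<Sum>q\<in>firsts M b. of_int (psign q) * k p q))"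
 proof (rule sum.cong[OF refl], rule arg_cong2[of _ _ _ _ "(*)"], rule refl)
  fix p assume "p \<in> firsts L a"
  then show "(\<Sum>q\<in>firsts L b. of_int (psign q) * k p q) = (\<Sum>q\<in>firsts M b. of_int (psign q) * k p q)"
   using sub(3)[of a] assms(5)[of p b] by (auto simp: assms(1) sum.union_disjoint[OF _ fin assms(2)])
 qed
 also have "\<dots> = (\<Sum>q\<in>firsts M b. of_int (psign q) * (\<Sum>p\<in>firsts L a. of_int (psign p) * k p q))"
  unfolding sum_distrib_left by (subst sum.swap) (simp add: mult.left_commute)
 also have "\<dots> = (\<Sum>q\<in>firsts M b. of_int (psign q) * (\<Sum>p\<in>firsts M a. of_int (psign p) * k p q))"
 proof (rule sum.cong[OF refl], rule arg_cong2[of _ _ _ _ "(*)"], rule refl)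
  fix q assume "q \<in> firsts M b"
  then show "(\<Sum>p\<in>firsts L a. of_int (psign p) * k p q) = (\<Sum>p\<in>firsts M a. of_int (psign p) * k p q)"
   using sub(1)[of b] assms(3) assms(4)[of q a] by (auto simp: assms(1) sum.union_disjoint[OF _ fin assms(2)])
 qed
 also have "\<dots> = kernel_sum M k a b"
  unfolding kernel_sum_def sum_distrib_left by (subst sum.swap) (simp add: mult_ac)
 also have "\<dots> = kernel_sum M k' a b"
  unfolding kernel_sum_def using sub(1) assms(6) by (intro sum.cong refl) (auto simp: subset_eq)
 finally show ?thesis .
qed

section \<open>Deletion of crossings from a code\<close>

context
 fixes L :: "'l point list" and N :: "'l set" and M
 assumes wf: "wf_code L"
 defines "M \<equiv> filter (\<lambda>p. label p \<notin> N) L"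
begin

lemma set_remove: "set M = {p \<in> set L. label p \<notin> N}" by (simp add: M_def)

lemma wf_code_remove: "wf_code M" using wf by (auto simp: wf_code_def M_def distinct_map inj_on_def)

lemma lv_remove:
 assumes "p \<in> set M" "u \<in> set M"
 shows "lv M p u = lv L p u"
 using assms idx_filter_less_iff[OF wf_code_distinct[OF wf], of p u "\<lambda>p. label p \<notin> N"]
 by (simp add: lv_def M_def)

lemma cyc_remove: "p \<in> set M \<Longrightarrow> u \<in> set M \<Longrightarrow> cyc M p u = cyc L p u"
 using wf_code_mate[OF wf_code_remove] by (simp add: cyc_def lv_remove)

lemma firsts_remove: "firsts M c = {p \<in> firsts L c. label p \<notin> N}"
 using wf_code_mate[OF wf] wf_code_mate[OF wf_code_remove] by (auto simp: firsts_def set_remove lv_remove)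

lemma pairing_remove:
 "pairing L f g = pairing M f g + (\<Sum>u\<in>{p \<in> set L. label p \<in> N}. twist u * f u * g (mate u))"
 unfolding pairing_def set_remove by (subst sum.union_disjoint[symmetric]) (auto intro: sum.cong)

text \<open>The predicate \<open>P\<close> describes functions to which the deleted passages
  contribute nothing in the pairing; the surviving loops and the constant 1 have to satisfy it. The
  deleted crossings disappear from the sums by cancellation, which comes about differently in the
  first and in the second move.\<close>

lemma same_polynomials_remove:
 assumes pair: "\<And>f g. P f \<Longrightarrow> P g \<Longrightarrow> pairing L f g = pairing M f g"
  and P: "\<And>p. p \<in> set M \<Longrightarrow> P (cyc L p)" "P (\<lambda>_. 1)"
  and cancel: "\<And>k c q. k \<in> {F_kernel L, H_kernel L} \<Longrightarrow> q \<in> set L \<Longrightarrow>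
   (\<Sum>p | p \<in> firsts L c \<and> label p \<in> N. of_int (psign p) * k p q) = 0 \<and>
   (\<Sum>p | p \<in> firsts L c \<and> label p \<in> N. of_int (psign p) * k q p) = 0"
 shows "same_polynomials L M"
proof -
 have cycM: "pairing M (cyc M p) g = pairing M (cyc L p) g" "pairing M f (cyc M p) = pairing M f (cyc L p)"
  if "p \<in> set M" for p f g using cyc_remove that by (auto intro!: pairing_cong[OF wf_code_remove])
 have Om: "Om M p q = Om L p q" if "p \<in> set M" "q \<in> set M" for p q
  using pair[OF P(1) P(1)] that by (simp add: Om_def cycM)
 have ind: "ind M p = ind L p" if "p \<in> set M" for p using pair[OF P(1,2)] that by (simp add: ind_def cycM)
 have ks: "kernel_sum L k a b = kernel_sum M k' a b"
  if "k \<in> {F_kernel L, H_kernel L}" "\<And>p q. p \<in> set M \<Longrightarrow> q \<in> set M \<Longrightarrow> k p q = k' p q" for k k' a b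
  by (rule kernel_sum_cancel[where X = "\<lambda>c. {p. p \<in> firsts L c \<and> label p \<in> N}"])
   (use that cancel in \<open>auto simp: firsts_remove set_remove\<close>)
 show ?thesis unfolding same_polynomials_def F_code_def H_code_def
  by (intro conjI ext; rule ks) (simp_all add: F_kernel_def H_kernel_def Om ind)
qed

end

text \<open>The twists at \<open>a\<close> and \<open>b\<close> are opposite, so both passages
  cancel against functions that agree on neighbours. The loops at the two crossings have equal
  pairings with everything, so their terms in the polynomials cancel by the opposite signs.\<close>

theorem same_polynomials_R2:
 assumes wf: "wf_code L" and ab: "adjacent L a b" and ab': "adjacent L (mate a) (mate b)"
  and lab: "label a \<noteq> label b" and ov: "is_over a = is_over b" and sg: "psign a = - psign b"
 shows "same_polynomials L (filter (\<lambda>p. label p \<notin> {label a, label b}) L)"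
proof -
 define N where "N = {label a, label b}"
 define M where "M = filter (\<lambda>p. label p \<notin> N) L"
 note d = wf_code_distinct[OF wf]
 note rem = set_remove[OF wf, of N, folded M_def] pairing_remove[OF wf, of _ _ N, folded M_def]
 have mem: "a \<in> set L" "b \<in> set L" "mate a \<in> set L" "mate b \<in> set L"
  using adjacent_mem[OF ab] adjacent_mem[OF ab'] by auto
 have ne: "a \<noteq> b" "mate a \<noteq> mate b" "a \<noteq> mate b" "b \<noteq> mate a" "mate a \<noteq> b" "mate b \<noteq> a"
  using lab by (metis label_mate)+
 have "p \<in> {a, b, mate a, mate b}" if "p \<in> set L" "label p \<in> N" for p
  using wf_code_label[OF wf mem(1) that(1)] wf_code_label[OF wf mem(2) that(1)] that(2) by (auto simp: N_def)
 then have N: "{p \<in> set L. label p \<in> N} = {a, b, mate a, mate b}" using mem by (auto simp: N_def)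
 have tw: "twist b = - twist a" using ov sg by (auto simp: twist_def)
 have adj: "lv L w a = lv L w b" "lv L a w = lv L b w" if "w \<noteq> a" "w \<noteq> b" for w
  using adjacent_lv[OF ab d] that by blast+
 have adj': "lv L w (mate a) = lv L w (mate b)" "lv L (mate a) w = lv L (mate b) w"
  if "w \<noteq> mate a" "w \<noteq> mate b" for w using adjacent_lv[OF ab' d] that by blast+
 note swp = lv_swap[OF mem(1,2)] lv_swap[OF mem(3,4)]
 have pair: "pairing L f g = pairing M f g"
  if "f a = f b" "f (mate a) = f (mate b)" "g a = g b" "g (mate a) = g (mate b)" for f g
  unfolding rem(2) N using ne tw that by simp
 have co: "cyc L p a = cyc L p b \<and> cyc L p (mate a) = cyc L p (mate b)" if "p \<in> set M" for p
 proof -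
  have "label p \<notin> N" using that by (simp add: rem(1))
  then have "p \<noteq> a" "p \<noteq> b" "p \<noteq> mate a" "p \<noteq> mate b" "mate p \<noteq> a" "mate p \<noteq> b"
   "mate p \<noteq> mate a" "mate p \<noteq> mate b" unfolding N_def by (metis label_mate insertCI)+
  then show ?thesis using adj adj' by (simp add: cyc_def)
 qed
 define s where "s = lv L a b - 1"
 define s' where "s' = lv L (mate a) (mate b) - 1"
 \<comment> \<open>The two loops differ at their four end points only; \<open>s\<close> and
   \<open>s'\<close> record the order of the neighbours on the two strands.\<close>
 have \<Delta>: "(\<lambda>u. cyc L a u - cyc L b u)
   = (\<lambda>u. ((s * of_bool (u = a) + s * of_bool (u = b))
     + (- s') * of_bool (u = mate a)) + (- s') * of_bool (u = mate b))" (is "?l = ?r")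
 proof
  fix u
  show "?l u = ?r u" using ne adj(2)[of u] adj'(2)[of u] adj(2)[of "mate a"] adj(2)[of "mate b"]
    adj'(2)[of a] adj'(2)[of b] swp by (cases "u = a"; cases "u = b"; cases "u = mate a"; cases "u = mate b")
    (auto simp: cyc_def s_def s'_def)
 qed
 have d\<Delta>: "pairing L (cyc L a) g - pairing L (cyc L b) g
   = twist a * (s * (g (mate a) - g (mate b)) + s' * (g a - g b))" for g
  unfolding pairing_diff_left[symmetric] \<Delta> pairing_add_left using mem
  by (simp add: pairing_delta tw algebra_simps del: mult_minus_left)
 have cab: "cyc L a a - cyc L a b = - s" "cyc L a (mate a) - cyc L a (mate b) = s'"
   "cyc L b a - cyc L b b = - s" "cyc L b (mate a) - cyc L b (mate b) = s'"
  using ne adj(1)[of "mate a"] adj(1)[of "mate b"] adj'(1)[of a] adj'(1)[of b] swp by (auto simp: cyc_def s_def s'_def)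
 have Om_ab: "Om L a q = Om L b q" if "q \<in> set L" for q
 proof -
  \<comment> \<open>For a surviving loop both differences are 0. For \<open>a\<close> and
    \<open>b\<close> themselves they are \<open>s'\<close> and \<open>- s\<close>, and the two
    products cancel.\<close>
  have "s * (cyc L q (mate a) - cyc L q (mate b)) + s' * (cyc L q a - cyc L q b) = 0"
   if "q \<in> {a, b} \<union> set M" for q
  proof (cases "q \<in> set M")
   case True
   then show ?thesis using co by simp
  next
   case False
   then have "cyc L q (mate a) - cyc L q (mate b) = s'" "cyc L q a - cyc L q b = - s" using that cab by auto
   then show ?thesis by simp
  qed
  note * = this
  have "q \<in> {a, b} \<union> set M \<or> mate q \<in> {a, b} \<union> set M"
  proof (cases "label q \<in> N")
   case True
   then have "q \<in> {a, b, mate a, mate b}" using that N by blast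
   then show ?thesis by auto
  qed (simp add: rem(1) that)
  then have "s * (cyc L q (mate a) - cyc L q (mate b)) + s' * (cyc L q a - cyc L q b) = 0"
  proof
   assume "mate q \<in> {a, b} \<union> set M"
   from *[OF this] show ?thesis by (simp add: algebra_simps)
  qed (rule *)
  then show ?thesis using d\<Delta>[of "cyc L q"] by (simp add: Om_def)
 qed
 then have Om_ba: "Om L q a = Om L q b" if "q \<in> set L" for q
  using Om_swap[OF wf, of a q] Om_swap[OF wf, of b q] that by (simp add: eq_commute)
 have ind_ab: "ind L a = ind L b" using d\<Delta>[of "\<lambda>_. 1"] by (simp add: ind_def)
 have first_iff: "lv L a (mate a) = lv L b (mate b)" "lv L (mate a) a = lv L (mate b) b"
  using adj(2)[of "mate a"] adj'(1)[of b] adj'(2)[of a] adj(1)[of "mate b"] ne by simp_all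
 \<comment> \<open>Neighbours lie on the same side of any other passage, so \<open>a\<close> and
   \<open>b\<close> are first passages simultaneously, and so are their mates.\<close>
 have X: "{p. p \<in> firsts L c \<and> label p \<in> N} \<in> {{}, {a, b}, {mate a, mate b}}" for c
 proof -
  have "{p. p \<in> firsts L c \<and> label p \<in> N} = {p \<in> {a, b, mate a, mate b}. p \<in> firsts L c}"
   unfolding N[symmetric] by (auto simp: firsts_def)
  moreover have "a \<in> firsts L c \<longleftrightarrow> b \<in> firsts L c" "mate a \<in> firsts L c \<longleftrightarrow> mate b \<in> firsts L c"
   using mem first_iff ov by (auto simp: firsts_def)
  moreover have "\<not> (a \<in> firsts L c \<and> mate a \<in> firsts L c)" by (auto simp: firsts_def)
  ultimately show ?thesis by auto
 qed
 have sg0: "of_int (psign a) + of_int (psign b) = (0 :: laurent)" using sg by simp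
 have cancel: "(\<Sum>p | p \<in> firsts L c \<and> label p \<in> N. of_int (psign p) * K p) = 0"
  if "K a = K b" "K (mate a) = K (mate b)" for c and K :: "'a point \<Rightarrow> laurent"
 proof -
  have "(\<Sum>p\<in>Y. of_int (psign p) * K p) = 0" if "Y \<in> {{}, {a, b}, {mate a, mate b}}" for Y
   using that \<open>K a = K b\<close> \<open>K (mate a) = K (mate b)\<close> sg0 ne by (auto simp flip: distrib_right)
  from this[OF X] show ?thesis .
 qed
 have "same_polynomials L M"
 proof (rule same_polynomials_remove[OF wf, of "\<lambda>f. f a = f b \<and> f (mate a) = f (mate b)" N, folded M_def])
  show "(\<Sum>p | p \<in> firsts L c \<and> label p \<in> N. of_int (psign p) * k p q) = 0 \<and>
   (\<Sum>p | p \<in> firsts L c \<and> label p \<in> N. of_int (psign p) * k q p) = 0"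
   if "k \<in> {F_kernel L, H_kernel L}" "q \<in> set L" for k c q
   using that by (intro conjI cancel) (auto simp: F_kernel_def H_kernel_def Om_ab Om_ba ind_ab)
 qed (simp_all add: pair co)
 then show ?thesis by (simp add: M_def N_def)
qed

text \<open>The loop of a kink is supported on its two end points, with equal values there. Opposite
  twists make it pair to 0 with every function that does not separate them, and both kernels vanish
  once \<open>Om\<close> and \<open>ind\<close> do.\<close>

theorem same_polynomials_R1:
 assumes wf: "wf_code L" and adj: "adjacent L a (mate a)"
 shows "same_polynomials L (filter (\<lambda>p. label p \<noteq> label a) L)"
proof -
 define N where "N = {label a}"
 define M where "M = filter (\<lambda>p. label p \<notin> N) L"
 note d = wf_code_distinct[OF wf]
 note rem = set_remove[OF wf, of N, folded M_def] pairing_remove[OF wf, of _ _ N, folded M_def]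
 have mem: "a \<in> set L" "mate a \<in> set L" using adjacent_mem[OF adj] by auto
 have "p \<in> {a, mate a}" if "p \<in> set L" "label p \<in> N" for p
  using wf_code_label[OF wf mem(1) that(1)] that(2) by (auto simp: N_def)
 then have N: "{p \<in> set L. label p \<in> N} = {a, mate a}" using mem by (auto simp: N_def)
 note lva = adjacent_lv[OF adj d]
 have pair: "pairing L f g = pairing M f g" if "f a = f (mate a)" "g a = g (mate a)" for f g
  unfolding rem(2) N using that by simp
 have co: "cyc L p a = cyc L p (mate a)" if "p \<in> set L" for p
 proof (cases "p = a \<or> p = mate a")
  case True
  then show ?thesis using lv_swap[OF mem] by (auto simp: cyc_def)
 next
  case False
  then show ?thesis using lva(1)[of p] lva(1)[of "mate p"] by (auto simp: cyc_def mate_eq_iff)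
 qed
 define s where "s = lv L a (mate a) - 1"
 have cyc_a: "cyc L a = (\<lambda>u. s * of_bool (u = a) + s * of_bool (u = mate a))" (is "?l = ?r")
 proof
  fix u
  show "?l u = ?r u" using lva(2)[of u] lv_swap[OF mem]
   by (cases "u = a"; cases "u = mate a") (auto simp: cyc_def s_def)
 qed
 have p0: "pairing L (cyc L a) g = 0" if "g a = g (mate a)" for g
  unfolding cyc_a pairing_add_left using mem that by (simp add: pairing_delta)
 have Om0: "Om L a q = 0" "Om L q a = 0" if "q \<in> set L" for q
  using p0[of "cyc L q"] co[OF that] Om_swap[OF wf, of a q] by (auto simp: Om_def)
 have ind0: "ind L a = 0" using p0[of "\<lambda>_. 1"] by (simp add: ind_def)
 have X: "{p. p \<in> firsts L c \<and> label p \<in> N} \<subseteq> {a, mate a}" for c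
  using N by (auto simp: firsts_def)
 have cancel: "(\<Sum>p | p \<in> firsts L c \<and> label p \<in> N. of_int (psign p) * K p) = 0"
  if "K a = 0" "K (mate a) = 0" for c and K :: "'a point \<Rightarrow> laurent"
  using X[of c] that by (intro sum.neutral) auto
 have t0: "t_power 0 = 1" by (simp add: t_power_def)
 have "same_polynomials L M"
 proof (rule same_polynomials_remove[OF wf, of "\<lambda>f. f a = f (mate a)" N, folded M_def])
  show "(\<Sum>p | p \<in> firsts L c \<and> label p \<in> N. of_int (psign p) * k p q) = 0 \<and>
   (\<Sum>p | p \<in> firsts L c \<and> label p \<in> N. of_int (psign p) * k q p) = 0"
   if "k \<in> {F_kernel L, H_kernel L}" "q \<in> set L" for k c q
   using that by (intro conjI cancel) (auto simp: F_kernel_def H_kernel_def Om0 ind0 t0)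
 qed (auto simp: pair co rem(1))
 then show ?thesis by (simp add: M_def N_def)
qed

section \<open>Traversals of diagrams\<close>

text \<open>
 \<open>raw_right\<close> is the direction of travel and \<open>raw_flag\<close> the argument of \<open>Real\<close>; the sign of a crossing
 depends on the directions of both passages.
\<close>

datatype raw_point = Raw (raw_label: nat) (raw_over: bool) (raw_right: bool) (raw_flag: bool)

definition raw :: "diagram \<Rightarrow> state \<Rightarrow> raw_point list" where
 "raw D s = (case s of (k, p, r) \<Rightarrow>
   (case D ! next_event s of
    (Real b, i) \<Rightarrow> if p = i \<or> p = Suc i then [Raw (next_event s) ((r = (p = i)) = b) r b] else []
   | _ \<Rightarrow> []))"

definition live :: "diagram \<Rightarrow> state \<Rightarrow> bool" where
 "live D s = (case s of (k, p, r) \<Rightarrow> if r then k < length D else 0 < k \<and> k \<le> length D)"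

lemma live_next_event: "live D s \<Longrightarrow> next_event s < length D"
 by (cases s) (auto simp: live_def split: if_splits)

lemma raw_short: "length (raw D s) \<le> 1" by (auto simp: raw_def split: prod.splits event.splits)

inductive path :: "diagram \<Rightarrow> nat \<Rightarrow> state \<Rightarrow> raw_point list \<Rightarrow> state \<Rightarrow> bool" for D where
 path_refl: "path D 0 s [] s"
| path_step: "live D s \<Longrightarrow> path D n (step D s) ps s' \<Longrightarrow>
   path D (Suc n) s (raw D s @ ps) s'"

lemma path_trans: "path D m s ps s' \<Longrightarrow> path D n s' qs s'' \<Longrightarrow> path D (m + n) s (ps @ qs) s''"
 by (induction rule: path.induct) (auto intro: path_step)

lemma path_single: "live D s \<Longrightarrow> path D 1 s (raw D s) (step D s)"
 using path_step[OF _ path_refl] by fastforce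

text \<open>Travelling is deterministic and a state that is not live cannot be left, so every other
  path from the same start is an initial part of the path that ends there.\<close>

lemma path_prefix:
 assumes "path D m s qs s'" "path D n s ps f" "\<not> live D f"
 shows "\<exists>rs. m \<le> n \<and> ps = qs @ rs \<and> path D (n - m) s' rs f" using assms
proof (induction arbitrary: n ps rule: path.induct)
 case (path_refl s)
 then show ?case by auto
next
 case (path_step s m qs s')
 from path_step.prems(1) obtain n' ps' where
  "n = Suc n'" "ps = raw D s @ ps'" "path D n' (step D s) ps' f"
  by (cases rule: path.cases) (use path_step.prems(2) path_step.hyps(1) in auto)
 then show ?case using path_step.IH[of n' ps'] path_step.prems(2) by auto
qed

lemma path_state:
 assumes "path D n s ps s'"
 shows "s' = (step D ^^ n) s" "ps = concat (map (\<lambda>t. raw D ((step D ^^ t) s)) [0..<n])"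
  "t < n \<Longrightarrow> live D ((step D ^^ t) s)"
proof -
 have "s' = (step D ^^ n) s \<and> ps = concat (map (\<lambda>t. raw D ((step D ^^ t) s)) [0..<n]) \<and>
  (\<forall>t<n. live D ((step D ^^ t) s))"
  using assms
 proof (induction rule: path.induct)
  case (path_step s n ps s')
  have *: "[0..<Suc n] = 0 # map Suc [0..<n]" by (simp add: map_Suc_upt upt_conv_Cons)
  have "concat (map (\<lambda>t. raw D ((step D ^^ t) s)) [0..<Suc n])
    = raw D s @ concat (map (\<lambda>t. raw D ((step D ^^ t) (step D s))) [0..<n])"
   unfolding * by (simp add: comp_def funpow_swap1)
  moreover have "live D ((step D ^^ t) s)" if "t < Suc n" for t
   using that path_step by (cases t) (auto simp: funpow_swap1)
  ultimately show ?case using path_step.IH by (simp add: funpow_swap1)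
 qed simp
 then show "s' = (step D ^^ n) s" "ps = concat (map (\<lambda>t. raw D ((step D ^^ t) s)) [0..<n])"
  "t < n \<Longrightarrow> live D ((step D ^^ t) s)" by auto
qed

lemma path_of_states:
 assumes "\<And>t. t < n \<Longrightarrow> live D ((step D ^^ t) s)"
 shows "path D n s (concat (map (\<lambda>t. raw D ((step D ^^ t) s)) [0..<n])) ((step D ^^ n) s)" using assms
proof (induction n)
 case (Suc n)
 from path_trans[OF Suc.IH path_single] Suc.prems show ?case by simp
qed (simp add: path_refl)

definition raw_list :: "diagram \<Rightarrow> raw_point list" where
 "raw_list D = concat (map (\<lambda>t. raw D (state_at D t)) [0..<travel_time D])"

lemma raw_list_mem: "x \<in> set (raw_list D) \<longleftrightarrow> (\<exists>t<travel_time D. x \<in> set (raw D (state_at D t)))"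
 by (auto simp: raw_list_def)

text \<open>All states of a path before its end are live, whereas the final state is not; hence the
  end of the path is the first visit to it.\<close>

lemma path_travel_time:
 assumes "path D n (0, 0, True) ps (length D, 0, True)"
 shows "travel_time D = n" and "raw_list D = ps" and "state_at D n = (length D, 0, True)"
proof -
 show st: "state_at D n = (length D, 0, True)" using path_state(1)[OF assms] by (simp add: state_at_def)
 show tt: "travel_time D = n" unfolding travel_time_def
 proof (rule Least_equality)
  show "n \<le> m" if "state_at D m = (length D, 0, True)" for m
   using path_state(3)[OF assms, of m] that by (force simp: state_at_def live_def)
 qed (rule st)
 show "raw_list D = ps" using path_state(2)[OF assms] by (simp add: raw_list_def tt state_at_def)
qed

fun reverse :: "state \<Rightarrow> state" where
 "reverse (k, p, r) = (k, p, \<not> r)"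

lemma transit_reverse: "transit r e p = (r', p') \<Longrightarrow> transit (\<not> r') e p' = (\<not> r, p)"
 by (cases e) (auto simp: Let_def n_left_def n_right_def turning_def split: if_splits)

lemma step_reverse:
 assumes "r \<or> 0 < k"
 shows "step D (reverse (step D (k, p, r))) = reverse (k, p, r)"
proof -
 obtain r' p' where t: "transit r (D ! next_event (k, p, r)) p = (r', p')" by fastforce
 have "next_event (reverse (step D (k, p, r))) = next_event (k, p, r)" using t by (auto simp: Let_def)
 then show ?thesis using t transit_reverse[OF t] assms by (auto simp: Let_def)
qed

text \<open>The heading is reversed only at a birth or death, which moves height \<open>p\<close> to
  \<open>2 * i + 1 - p\<close>, and parity forbids that this be \<open>p\<close> again.\<close>

lemma step_neq_reverse: "step D s \<noteq> reverse s"
proof (cases s)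
 case (fields k p r)
 obtain x i where e: "D ! next_event s = (x, i)" by fastforce
 have "2 * i + 1 - p \<noteq> p \<or> \<not> (i \<le> p \<and> p < i + 2)" by presburger
 moreover have "2 * i + 1 - p \<noteq> p" if "i \<le> p" "p \<le> Suc i" using that by presburger
 ultimately show ?thesis using e fields by (auto simp: Let_def n_left_def n_right_def split: if_splits)
qed

lemma reverse_reverse [simp]: "reverse (reverse s) = s" by (cases s) auto

lemma reverse_neq [simp]: "reverse s \<noteq> s" "s \<noteq> reverse s" by (cases s; auto)+

lemma raw_cases:
 assumes "x \<in> set (raw D s)"
 obtains b i p where "D ! raw_label x = (Real b, i)" "raw D s = [x]" "p = i \<or> p = Suc i"
  "raw_over x = ((p = i) = b)" "raw_flag x = b"
  "raw_right x \<Longrightarrow> s = (raw_label x, p, True)"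
  "\<not> raw_right x \<Longrightarrow> next_event s = raw_label x \<and> s = (fst s, 2 * i + 1 - p, False)"
proof -
 obtain k p r where s: "s = (k, p, r)" by (cases s)
 obtain y i where yi: "D ! next_event s = (y, i)" by fastforce
 obtain b where e: "D ! next_event s = (Real b, i)" and p: "p = i \<or> p = Suc i"
  and x: "raw D s = [Raw (next_event s) ((r = (p = i)) = b) r b]"
  using assms s yi by (cases y) (auto simp: raw_def split: if_splits)
 show ?thesis
 proof (cases r)
  case True
  show ?thesis by (rule that[of b i p]) (use assms[unfolded x] x e p s True in auto)
 next
  case False
  show ?thesis by (rule that[of b i "2 * i + 1 - p"]) (use assms[unfolded x] x e p s False in auto)
 qed
qed

context
 fixes D assumes long: "long_diagram D"
begin

lemma long_final: "state_at D (travel_time D) = (length D, 0, True)"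
 and long_width: "width D (length D) = 1"
 and long_height: "k < length D \<Longrightarrow> snd (D ! k) + n_left (fst (D ! k)) \<le> width D k"
 and long_points: "(\<lambda>(k, p, r). (k, p)) ` state_at D ` {..travel_time D} = points D"
 using long by (auto simp: long_diagram_def split: prod.splits)

lemma long_step: "state_at D (Suc t) = step D (state_at D t)" by (simp add: state_at_def)

lemma long_before: "t < travel_time D \<Longrightarrow> state_at D t \<noteq> (length D, 0, True)"
 unfolding travel_time_def by (rule not_less_Least)

text \<open>If a state were repeated, the part of the journey between the two visits could be
  skipped, and the final state would be reached before its first occurrence.\<close>

lemma long_inj: "inj_on (state_at D) {..travel_time D}"
proof -
 have "state_at D a \<noteq> state_at D b" if "a < b" "b \<le> travel_time D" for a b
 proof
  assume eq: "state_at D a = state_at D b"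
  have "state_at D (travel_time D - b + a) = state_at D (travel_time D - b + b)"
   using eq by (simp add: state_at_def funpow_add)
  moreover have "travel_time D - b + a < travel_time D" "travel_time D - b + b = travel_time D" using that by linarith+
  ultimately show False using long_final long_before[of "travel_time D - b + a"] by simp
 qed
 then show ?thesis unfolding inj_on_def by (metis atMost_iff linorder_neqE_nat)
qed

text \<open>Coming back to a point in the opposite direction means having retraced the way, so the
  same holds for the times \<open>Suc a\<close> and \<open>b - 1\<close>. The interval shrinks to
  one state or to two successive ones, and both cases are impossible.\<close>

lemma long_not_reverse_aux:
 assumes "\<And>t. t < b \<Longrightarrow> snd (snd (state_at D t)) \<or> 0 < fst (state_at D t)" "a \<le> b"
 shows "state_at D b \<noteq> reverse (state_at D a)" using assms
proof (induction "b - a" arbitrary: a b rule: less_induct)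
 case less
 consider "b = a" | "b = Suc a" | b' where "b = Suc b'" "a < b'"
  using less.prems(2) by (cases b) (auto simp: le_less less_Suc_eq)
 then show ?case
 proof cases
  case 2
  then show ?thesis using step_neq_reverse by (simp add: long_step)
 next
  case 3
  show ?thesis
  proof
   assume eq: "state_at D b = reverse (state_at D a)"
   have "step D (reverse (step D (state_at D b'))) = reverse (state_at D b')"
    using step_reverse less.prems(1)[of b'] 3 by (cases "state_at D b'") auto
   then have "state_at D (Suc a) = reverse (state_at D b')" using eq 3 by (simp add: long_step)
   then have "state_at D b' = reverse (state_at D (Suc a))" by simp
   then show False using less.hyps[of b' "Suc a"] less.prems(1) 3 by auto
  qed
 qed simp
qed

lemma long_mem_points:
 assumes "t \<le> travel_time D" "state_at D t = (k, p, r)"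
 shows "k \<le> length D" "p < width D k"
proof -
 have "(k, p) \<in> (\<lambda>(k, p, r). (k, p)) ` state_at D ` {..travel_time D}"
  using assms by (force intro: image_eqI)
 then show "k \<le> length D" "p < width D k" unfolding long_points by (auto simp: points_def)
qed

lemma long_good: "t \<le> travel_time D \<Longrightarrow> snd (snd (state_at D t)) \<or> 0 < fst (state_at D t)"
proof (induction t rule: less_induct)
 case (less t)
 show ?case
 proof (rule ccontr)
  assume *: "\<not> ?thesis"
  obtain k p r where st: "state_at D t = (k, p, r)" by (cases "state_at D t")
  then have "k = 0" "\<not> r" using * by auto
  moreover have "p = 0" using long_mem_points(2)[OF less.prems st] \<open>k = 0\<close> by (simp add: width_def)
  ultimately have "state_at D t = reverse (state_at D 0)" using st by (simp add: state_at_def)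
  then show False using long_not_reverse_aux[of t 0] less by auto
 qed
qed

lemma long_not_reverse: "a \<le> b \<Longrightarrow> b \<le> travel_time D \<Longrightarrow> state_at D b \<noteq> reverse (state_at D a)"
 by (rule long_not_reverse_aux) (use long_good in auto)

lemma long_live:
 assumes "t < travel_time D"
 shows "live D (state_at D t)"
proof -
 obtain k p r where st: "state_at D t = (k, p, r)" by (cases "state_at D t")
 note kp = long_mem_points[OF less_imp_le[OF assms] st]
 show ?thesis
 proof (cases r)
  case True
  have "k \<noteq> length D"
  proof
   assume "k = length D"
   then have "p = 0" using kp long_width by simp
   then show False using long_before[OF assms] st True \<open>k = length D\<close> by simp
  qed
  then show ?thesis using st True kp by (simp add: live_def)
 next
  case False
  then show ?thesis using st kp long_good[of t] assms by (simp add: live_def)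
 qed
qed

lemma long_path: "path D (travel_time D) (0, 0, True) (raw_list D) (length D, 0, True)"
 using path_of_states[of "travel_time D" D "(0, 0, True)"] long_live long_final by (simp add: raw_list_def state_at_def)

text \<open>A branch can be run through from its left or from its right end. Doing both would meet a
  point with both headings, and doing the same twice contradicts \<open>long_inj\<close>.\<close>

lemma raw_heading_unique:
 assumes "t1 < travel_time D" "t2 < travel_time D" "x \<in> set (raw D (state_at D t1))"
  "y \<in> set (raw D (state_at D t2))" "raw_label x = raw_label y" "raw_over x = raw_over y"
 shows "t1 = t2"
proof -
 obtain b i p where x: "D ! raw_label x = (Real b, i)" "p = i \<or> p = Suc i"
  "raw_over x = ((p = i) = b)" 
  "raw_right x \<Longrightarrow> state_at D t1 = (raw_label x, p, True)"
  "\<not> raw_right x \<Longrightarrow> next_event (state_at D t1) = raw_label x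
    \<and> state_at D t1 = (fst (state_at D t1), 2 * i + 1 - p, False)"
  using raw_cases[OF assms(3)] by metis
 obtain b' i' p' where y: "D ! raw_label y = (Real b', i')" "p' = i' \<or> p' = Suc i'"
  "raw_over y = ((p' = i') = b')" 
  "raw_right y \<Longrightarrow> state_at D t2 = (raw_label y, p', True)"
  "\<not> raw_right y \<Longrightarrow> next_event (state_at D t2) = raw_label y
    \<and> state_at D t2 = (fst (state_at D t2), 2 * i' + 1 - p', False)"
  using raw_cases[OF assms(4)] by metis
 have eq: "b' = b" "i' = i" using x(1) y(1) assms(5) by auto
 then have "p' = p" using x(2,3) y(2,3) assms(6) by auto
 have k1: "state_at D t1 = (Suc (raw_label x), 2 * i + 1 - p, False)" if "\<not> raw_right x"
  using x(5)[OF that] long_good[of t1] assms(1) by (cases "state_at D t1") auto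
 have k2: "state_at D t2 = (Suc (raw_label y), 2 * i + 1 - p, False)" if "\<not> raw_right y"
  using y(5)[OF that] long_good[of t2] assms(2) eq \<open>p' = p\<close> by (cases "state_at D t2") auto
 have st: "step D (raw_label x, p, True) = (Suc (raw_label x), 2 * i + 1 - p, True)"
  using x(1,2) by (auto simp: n_left_def turning_def)
 have nr: "\<not> (state_at D t = (raw_label x, p, True) \<and> state_at D t' = (Suc (raw_label x), 2 * i + 1 - p, False))"
  if "t < travel_time D" "t' < travel_time D" for t t'
 proof
  assume *: "state_at D t = (raw_label x, p, True) \<and> state_at D t' = (Suc (raw_label x), 2 * i + 1 - p, False)"
  then have "state_at D t' = reverse (state_at D (Suc t))" "state_at D (Suc t) = reverse (state_at D t')"
   using st by (simp_all add: long_step)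
  then show False using long_not_reverse[of "Suc t" t'] long_not_reverse[of t' "Suc t"] that by linarith
 qed
 have "state_at D t1 = state_at D t2"
  using nr[OF assms(1,2)] nr[OF assms(2,1)] x(4) y(4) k1 k2 assms(5) \<open>p' = p\<close>
  by (cases "raw_right x"; cases "raw_right y") auto
 then show ?thesis using inj_onD[OF long_inj, of t1 t2] assms(1,2) by simp
qed

text \<open>In the absence of closed components the left end of the branch is met. If it is met
  heading left, the traveller has just run through the branch, and one step back shows the
  passage.\<close>

lemma raw_exists:
 assumes j: "j < length D" "D ! j = (Real b, i)" and q: "q = i \<or> q = Suc i"
 shows "\<exists>x \<in> set (raw_list D). raw_label x = j \<and> raw_over x = ((q = i) = b) \<and> raw_flag x = b"
proof -
 have "i + 2 \<le> width D j" using long_height[OF j(1)] j(2) by (simp add: n_left_def)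
 then have "(j, q) \<in> points D" using j q by (auto simp: points_def)
 then obtain t where t0: "t \<le> travel_time D" "(j, q) = (\<lambda>(k, p, r). (k, p)) (state_at D t)"
  unfolding long_points[symmetric] by (elim imageE) simp
 then obtain r where t: "t \<le> travel_time D" "state_at D t = (j, q, r)" by (cases "state_at D t") auto
 show ?thesis
 proof (cases r)
  case True
  have "t \<noteq> travel_time D" using t long_final j(1) by auto
  moreover have "Raw j ((q = i) = b) True b \<in> set (raw D (state_at D t))" using t j q True by (auto simp: raw_def)
  ultimately have "Raw j ((q = i) = b) True b \<in> set (raw_list D)"
   unfolding raw_list_mem using t(1) by (metis le_neq_implies_less)
  then show ?thesis by force
 next
  case False
  then obtain t' where t': "t = Suc t'" using t(2) by (cases t) (auto simp: state_at_def)
  have "step D (reverse (step D (state_at D t'))) = reverse (state_at D t')"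
   using step_reverse long_good[of t'] t(1) t' by (cases "state_at D t'") auto
  moreover have "step D (reverse (step D (state_at D t'))) = (Suc j, 2 * i + 1 - q, True)"
   using t(2) t' j q False by (auto simp: long_step[symmetric] n_left_def turning_def)
  ultimately have "state_at D t' = (Suc j, 2 * i + 1 - q, False)" by (metis reverse.simps reverse_reverse)
  then have "Raw j ((q = i) = b) False b \<in> set (raw D (state_at D t'))" using j q by (auto simp: raw_def)
  then have "Raw j ((q = i) = b) False b \<in> set (raw_list D)"
   unfolding raw_list_mem using t(1) t' by (metis Suc_le_lessD)
  then show ?thesis by force
 qed
qed

end

section \<open>From traversals to Gauss codes of diagrams\<close>

definition wf_raw :: "raw_point list \<Rightarrow> bool" where
 "wf_raw R \<longleftrightarrow> distinct (map (\<lambda>x. (raw_label x, raw_over x)) R) \<and>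
   (\<forall>x \<in> set R. \<exists>y \<in> set R. raw_label y = raw_label x \<and> raw_over y \<noteq> raw_over x \<and> raw_flag y = raw_flag x)"

lemma distinct_map_concat:
 assumes "\<And>t. t < n \<Longrightarrow> length (f t) \<le> 1"
  and "\<And>s t x y. s < n \<Longrightarrow> t < n \<Longrightarrow> x \<in> set (f s) \<Longrightarrow> y \<in> set (f t) \<Longrightarrow> key x = key y \<Longrightarrow> s = t"
 shows "distinct (map key (concat (map f [0..<n])))" using assms
proof (induction n)
 case (Suc n)
 have "distinct (map key (concat (map f [0..<n])))"
  by (rule Suc.IH) (use Suc.prems in \<open>auto intro: less_SucI\<close>)
 moreover have "f n = [] \<or> (\<exists>x. f n = [x])" using Suc.prems(1)[of n] by (cases "f n") auto
 moreover have "key x \<noteq> key y" if "x \<in> set (f n)" "y \<in> set (f t)" "t < n" for x y t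
  using Suc.prems(2)[of n t x y] that by auto
 ultimately show ?case by fastforce
qed simp

lemma wf_raw_list:
 assumes "long_diagram D"
 shows "wf_raw (raw_list D)" unfolding wf_raw_def
proof (intro conjI ballI)
 show "distinct (map (\<lambda>x. (raw_label x, raw_over x)) (raw_list D))" unfolding raw_list_def
 proof (rule distinct_map_concat[OF raw_short])
  show "s = t" if "s < travel_time D" "t < travel_time D" "x \<in> set (raw D (state_at D s))"
   "y \<in> set (raw D (state_at D t))" "(raw_label x, raw_over x) = (raw_label y, raw_over y)" for s t x y
   using raw_heading_unique[OF assms that(1-4)] that(5) by simp
 qed
 fix x assume "x \<in> set (raw_list D)"
 then obtain t where t: "t < travel_time D" "x \<in> set (raw D (state_at D t))" by (auto simp: raw_list_mem)
 from t(2) show "\<exists>y \<in> set (raw_list D). raw_label y = raw_label x \<and> raw_over y \<noteq> raw_over x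
   \<and> raw_flag y = raw_flag x"
 proof (cases rule: raw_cases)
  case (1 b i p)
  have "raw_label x < length D"
   using live_next_event[OF long_live[OF assms t(1)]] 1(6,7) by (cases "raw_right x") (force+)
  then obtain y where "y \<in> set (raw_list D)" "raw_label y = raw_label x"
    "raw_over y = ((2 * i + 1 - p = i) = b)" "raw_flag y = b"
   using raw_exists[OF assms _ 1(1), of "2 * i + 1 - p"] 1(3) by auto
  then show ?thesis using 1 by (intro bexI[of _ y]) auto
 qed
qed

text \<open>The sign involves the headings of both branches. The heading of the other branch is
  looked up in \<open>R\<close>, by asking for the raw point that this branch would have if it were
  run through to the right.\<close>

definition raw_to_point :: "raw_point list \<Rightarrow> raw_point \<Rightarrow> nat point" where
 "raw_to_point R x = Point (raw_label x) (raw_over x)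
   (if (raw_right x = (Raw (raw_label x) (\<not> raw_over x) True (raw_flag x) \<in> set R)) \<noteq> raw_flag x
   then 1 else - 1)"

definition code_of_raw :: "raw_point list \<Rightarrow> nat point list" where
 "code_of_raw R = map (raw_to_point R) R"

lemma wf_raw_unique:
 "wf_raw R \<Longrightarrow> x \<in> set R \<Longrightarrow> y \<in> set R \<Longrightarrow> raw_label x = raw_label y \<Longrightarrow> raw_over x = raw_over y \<Longrightarrow> x = y"
 by (auto simp: wf_raw_def distinct_map inj_on_def)

lemma wf_code_of_raw:
 assumes "wf_raw R"
 shows "wf_code (code_of_raw R)" unfolding wf_code_def
proof (intro conjI ballI)
 show "distinct (map (\<lambda>p. (label p, is_over p)) (code_of_raw R))"
  using assms by (simp add: wf_raw_def code_of_raw_def comp_def raw_to_point_def)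
 fix p assume "p \<in> set (code_of_raw R)"
 then obtain x where x: "x \<in> set R" "p = raw_to_point R x" by (auto simp: code_of_raw_def)
 then show "psign p = 1 \<or> psign p = - 1" by (simp add: raw_to_point_def)
 obtain y where y: "y \<in> set R" "raw_label y = raw_label x" "raw_over y = (\<not> raw_over x)" "raw_flag y = raw_flag x"
  using assms x(1) unfolding wf_raw_def by blast
 have 1: "(Raw (raw_label x) (\<not> raw_over x) True (raw_flag x) \<in> set R) = raw_right y"
  using wf_raw_unique[OF assms y(1), of "Raw (raw_label x) (\<not> raw_over x) True (raw_flag x)"] y by (cases y) auto
 have 2: "(Raw (raw_label x) (raw_over x) True (raw_flag x) \<in> set R) = raw_right x"
  using wf_raw_unique[OF assms x(1), of "Raw (raw_label x) (raw_over x) True (raw_flag x)"] x(1) by (cases x) auto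
 have "mate p = raw_to_point R y" using x(2) y 1 2 by (auto simp: mate_def raw_to_point_def)
 then show "mate p \<in> set (code_of_raw R)" using y(1) by (auto simp: code_of_raw_def)
qed

definition diagram_code :: "diagram \<Rightarrow> nat point list" where
 "diagram_code D = map (\<lambda>(c, o_c, \<epsilon>). Point c o_c \<epsilon>) (diagram_passages D)"

text \<open>The visited states in \<open>crossing_sign\<close> are left ends of branches met heading
  right, and these visits correspond to the raw points with \<open>raw_right\<close>; this matches
  the two rules for signs.\<close>

lemma diagram_code_raw:
 assumes "long_diagram D"
 shows "diagram_code D = code_of_raw (raw_list D)"
proof -
 define g where "g = raw_to_point (raw_list D)"
 have "map (\<lambda>(c, o_c, \<epsilon>). Point c o_c \<epsilon>) (passage D (state_at D t)) = map g (raw D (state_at D t))"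
  if t: "t < travel_time D" for t
 proof -
  obtain k p r where st: "state_at D t = (k, p, r)" by (cases "state_at D t")
  define j where "j = next_event (k, p, r)"
  have jl: "j < length D" using live_next_event[OF long_live[OF assms t]] st by (simp add: j_def)
  obtain y i where yi: "D ! j = (y, i)" by fastforce
  have vis: "(j, q, True) \<in> state_at D ` {..travel_time D} \<longleftrightarrow> Raw j ((q = i) = b) True b \<in> set (raw_list D)"
   if "y = Real b" "q = i \<or> q = Suc i" for b q
  proof
   assume "(j, q, True) \<in> state_at D ` {..travel_time D}"
   then obtain t' where t': "t' \<le> travel_time D" "state_at D t' = (j, q, True)" by force
   moreover have "t' \<noteq> travel_time D" using t' long_final[OF assms] jl by auto
   moreover have "Raw j ((q = i) = b) True b \<in> set (raw D (state_at D t'))" using t' yi that by (auto simp: raw_def)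
   ultimately show "Raw j ((q = i) = b) True b \<in> set (raw_list D)"
    unfolding raw_list_mem by (metis le_neq_implies_less)
  next
   assume "Raw j ((q = i) = b) True b \<in> set (raw_list D)"
   then obtain t' where t': "t' < travel_time D" "Raw j ((q = i) = b) True b \<in> set (raw D (state_at D t'))"
    unfolding raw_list_mem by auto
   from t'(2) have "state_at D t' = (j, q, True)" by (rule raw_cases) (use yi that in auto)
   then show "(j, q, True) \<in> state_at D ` {..travel_time D}" using t'(1) by (metis atMost_iff imageI less_imp_le)
  qed
  show ?thesis
  proof (cases "(\<exists>b. y = Real b) \<and> (p = i \<or> p = Suc i)")
   case False
   then show ?thesis using st yi by (cases y) (auto simp: passage_def raw_def j_def)
  next
   case True
   then obtain b where b: "y = Real b" by blast
   define x where "x = Raw j ((r = (p = i)) = b) r b"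
   have raw: "raw D (state_at D t) = [x]" using True b st yi by (auto simp: raw_def j_def x_def)
   have xR: "x \<in> set (raw_list D)" unfolding raw_list_mem using t raw by force
   have pas: "passage D (state_at D t) = [(j, (r = (p = i)) = b, crossing_sign D j b)]"
    using True b st yi by (auto simp: passage_def j_def Let_def)
   have 2: "(Raw j ((r = (p = i)) = b) True b \<in> set (raw_list D)) = r"
    using wf_raw_unique[OF wf_raw_list[OF assms] xR, of "Raw j ((r = (p = i)) = b) True b"] xR by (auto simp: x_def)
   have "crossing_sign D j b = (if ((Raw j b True b \<in> set (raw_list D)) = (Raw j (\<not> b) True b \<in> set (raw_list D))) \<noteq> b then 1 else - 1)"
    unfolding crossing_sign_def Let_def using vis[OF b, of i] vis[OF b, of "Suc i"] yi by simp
   also have "\<dots> = psign (g x)" using 2 by (cases "(r = (p = i))") (auto simp: g_def raw_to_point_def x_def)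
   finally show ?thesis by (simp add: raw pas g_def raw_to_point_def x_def)
  qed
 qed
 then have "map (\<lambda>(c, o_c, \<epsilon>). Point c o_c \<epsilon>) (diagram_passages D) = map g (raw_list D)"
  unfolding diagram_passages_def raw_list_def map_concat map_map comp_def
  by (intro arg_cong[of _ _ concat] map_cong) auto
 then show ?thesis by (simp add: diagram_code_def code_of_raw_def g_def)
qed

lemma wf_diagram_code: "long_diagram D \<Longrightarrow> wf_code (diagram_code D)"
 by (simp add: diagram_code_raw wf_code_of_raw wf_raw_list)

section \<open>Replacing a block of a diagram\<close>

definition map_label :: "(nat \<Rightarrow> nat) \<Rightarrow> raw_point \<Rightarrow> raw_point" where
 "map_label f x = Raw (f (raw_label x)) (raw_over x) (raw_right x) (raw_flag x)"

lemma map_label_simps [simp]: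
 "raw_label (map_label f x) = f (raw_label x)" "raw_over (map_label f x) = raw_over x"
 "raw_right (map_label f x) = raw_right x" "raw_flag (map_label f x) = raw_flag x" by (simp_all add: map_label_def)

lemma path_embed:
 assumes "path l m s ps s'"
 shows "path (u @ l @ v) m (length u + fst s, snd s) (map (map_label ((+) (length u))) ps)
   (length u + fst s', snd s')"
 using assms
proof (induction rule: path.induct)
 case (path_refl s)
 then show ?case by (simp add: path.path_refl)
next
 case (path_step s m ps s')
 obtain q p h where s: "s = (q, p, h)" by (cases s)
 let ?D = "u @ l @ v" and ?s = "(length u + fst s, snd s)"
 have ne: "next_event ?s = length u + next_event s" and lt: "next_event s < length l"
  using path_step.hyps(1) by (auto simp: s live_def split: if_splits)
 then have nth: "?D ! next_event ?s = l ! next_event s" by (simp add: nth_append)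
 have "step ?D ?s = (length u + fst (step l s), snd (step l s))"
  using nth ne by (simp add: s Let_def split: prod.splits)
 moreover have "raw ?D ?s = map (map_label ((+) (length u))) (raw l s)"
 proof -
  obtain y i where "l ! next_event s = (y, i)" by fastforce
  then show ?thesis using nth ne by (cases y) (simp_all add: s raw_def map_label_def del: next_event.simps)
 qed
 moreover have "live ?D ?s" using path_step.hyps(1) by (auto simp: live_def s)
 ultimately show ?case using path.path_step[of ?D ?s m _ _] path_step.IH by simp
qed

context
 fixes u v :: diagram and B :: "bool \<Rightarrow> nat \<Rightarrow> bool \<times> nat"
begin

text \<open>States are kept in the coordinates of a diagram whose block between \<open>u\<close> and
  \<open>v\<close> is shrunk to one slice; this translates them to a block of \<open>n\<close>
  slices.\<close>

definition emb :: "nat \<Rightarrow> state \<Rightarrow> state" where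
 "emb n c = (if fst c \<le> length u then fst c else fst c + n - 1, snd c)"

definition shift :: "nat \<Rightarrow> nat \<Rightarrow> nat" where
 "shift n j = (if j < length u then j else j + n - 1)"

text \<open>The virtual crossing is a mere placeholder for the block: \<open>big_step\<close>
  replaces its effect by the boundary behaviour \<open>B\<close>.\<close>

definition collapsed :: diagram where
 "collapsed = u @ [(Virtual, 0)] @ v"

definition big_step :: "state \<Rightarrow> state" where
 "big_step c = (if next_event c = length u
   then case c of (k, p, h) \<Rightarrow> case B h p of (h', p') \<Rightarrow> (if h' then Suc (length u) else length u, p', h')
   else step collapsed c)"

inductive big_run :: "state \<Rightarrow> state list \<Rightarrow> bool" where
 "big_run (length collapsed, 0, True) []"
| "live collapsed c \<Longrightarrow> big_run (big_step c) cs \<Longrightarrow> big_run c (c # cs)"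

lemma emb_step:
 assumes "live collapsed c" "next_event c \<noteq> length u" and D: "D = u @ w @ v"
 shows "step D (emb (length w) c) = emb (length w) (big_step c)"
  and "live D (emb (length w) c)"
  and "raw D (emb (length w) c) = map (map_label (shift (length w))) (raw collapsed c)"
proof -
 obtain k p h where c: "c = (k, p, h)" by (cases c)
 let ?e = "emb (length w) c"
 have ne: "next_event ?e = shift (length w) (next_event c)"
  and lv: "live D ?e" and lt: "next_event c < length collapsed"
  using assms(1,2) by (auto simp: c emb_def shift_def live_def D collapsed_def split: if_splits)
 show "live D ?e" by (rule lv)
 have nth: "D ! next_event ?e = collapsed ! next_event c" using lt assms(2) unfolding ne
  by (auto simp: D collapsed_def shift_def nth_append nth_Cons' not_less)
 have e: "?e = (fst ?e, p, h)" by (simp add: c emb_def)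
 obtain h' p' where t: "transit h (collapsed ! next_event c) p = (h', p')" by fastforce
 have "step D (a, p, h) = (if h' then Suc j else j, p', h')"
  if "next_event (a, p, h) = j" "D ! j = collapsed ! next_event c" for a j using t that by (simp add: Let_def)
 from this[of "fst ?e", folded e, OF refl nth]
 have "step D ?e = (if h' then Suc (next_event ?e) else next_event ?e, p', h')" .
 moreover have "big_step c = (if h' then Suc (next_event c) else next_event c, p', h')"
  using t assms(2) by (simp add: big_step_def c Let_def)
 moreover have "(if h' then Suc (next_event ?e) else next_event ?e)
   = fst (emb (length w) (if h' then Suc (next_event c) else next_event c, p', h'))"
  using assms(2) unfolding ne by (auto simp: emb_def shift_def)
 ultimately show "step D ?e = emb (length w) (big_step c)" by (simp add: emb_def)
 have "raw D (a, p, h) = (case D ! next_event (a, p, h) of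
    (Real b, i) \<Rightarrow> if p = i \<or> p = Suc i then [Raw (next_event (a, p, h)) ((h = (p = i)) = b) h b] else []
   | _ \<Rightarrow> [])" for a
  by (simp add: raw_def)
 from this[of "fst ?e", folded e] have "raw D ?e = (case D ! next_event ?e of
    (Real b, i) \<Rightarrow> if p = i \<or> p = Suc i then [Raw (next_event ?e) ((h = (p = i)) = b) h b] else []
   | _ \<Rightarrow> [])" .
 moreover obtain y i where "collapsed ! next_event c = (y, i)" by fastforce
 ultimately show "raw D ?e = map (map_label (shift (length w))) (raw collapsed c)"
  unfolding nth unfolding ne unfolding c by (cases y) (simp_all add: raw_def map_label_def del: next_event.simps)
qed

text \<open>\<open>B\<close> tells where a strand entering the block comes out, \<open>Out\<close>
  what it meets inside. Two blocks that share \<open>B\<close> can be exchanged without affecting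
  the journey outside.\<close>

definition block :: "diagram \<Rightarrow> (bool \<Rightarrow> nat \<Rightarrow> raw_point list) \<Rightarrow> bool" where
 "block w Out \<longleftrightarrow> (\<forall>h p. \<exists>m h' p'. B h p = (h', p') \<and>
   path w m (if h then 0 else length w, p, h) (Out h p) (if h' then length w else 0, p', h'))"

definition big_out :: "nat \<Rightarrow> (bool \<Rightarrow> nat \<Rightarrow> raw_point list) \<Rightarrow> raw_point list + bool \<times> nat \<Rightarrow> raw_point list" where
 "big_out n Out = case_sum (map (map_label (shift n)))
   (\<lambda>(h, p). map (map_label ((+) (length u))) (Out h p))"

definition item :: "state \<Rightarrow> raw_point list + bool \<times> nat" where
 "item c = (if next_event c = length u then Inr (snd (snd c), fst (snd c)) else Inl (raw collapsed c))"

lemma block_step: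
 assumes "live collapsed c" "next_event c = length u" "block w Out"
 shows "\<exists>m. path (u @ w @ v) m (emb (length w) c) (big_out (length w) Out (item c)) (emb (length w) (big_step c))"
proof -
 obtain k p h where c: "c = (k, p, h)" by (cases c)
 obtain m h' p' where B: "B h p = (h', p')"
  and m: "path w m (if h then 0 else length w, p, h) (Out h p) (if h' then length w else 0, p', h')"
  using assms(3) unfolding block_def by blast
 have "emb (length w) c = (length u + fst (if h then 0 else length w, p, h), p, h)"
  using assms(1,2) by (auto simp: c emb_def live_def split: if_splits)
 moreover have "emb (length w) (big_step c) = (length u + fst (if h' then length w else 0, p', h'), p', h')"
  using B assms(2) by (auto simp: c emb_def big_step_def)
 moreover have "item c = Inr (h, p)" using assms(2) by (simp add: item_def c)
 ultimately show ?thesis using path_embed[OF m, of u v] by (auto simp: big_out_def)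
qed

lemma big_run_path:
 assumes "big_run c cs" "block w Out"
 shows "\<exists>m. path (u @ w @ v) m (emb (length w) c) (concat (map (big_out (length w) Out \<circ> item) cs))
   (length (u @ w @ v), 0, True)"
 using assms(1)
proof (induction rule: big_run.induct)
 case 1
 have *: "emb (length w) (length collapsed, 0, True) = (length (u @ w @ v), 0, True)"
  by (simp add: emb_def collapsed_def)
 show ?case unfolding * by (rule exI[of _ 0]) (simp add: path_refl)
next
 case (2 c cs)
 obtain m where m: "path (u @ w @ v) m (emb (length w) c) (big_out (length w) Out (item c)) (emb (length w) (big_step c))"
 proof (cases "next_event c = length u")
  case True
  then show ?thesis using that block_step[OF 2(1) True assms(2)] by blast
 next
  case False
  note e = emb_step[OF 2(1) False refl, of w]
  show ?thesis by (rule that[of 1]) (use path_single[OF e(2)] e False in \<open>simp add: big_out_def item_def\<close>)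
 qed
 from 2(3) obtain m' where "path (u @ w @ v) m' (emb (length w) (big_step c))
   (concat (map (big_out (length w) Out \<circ> item) cs)) (length (u @ w @ v), 0, True)" by blast
 from path_trans[OF m this] show ?case by (intro exI[of _ "m + m'"]) (simp add: comp_def)
qed

text \<open>A passage through the block takes at least one step, which makes the induction on the
  remaining length work. This fails for an empty block, where \<open>emb\<close> identifies the
  lines on both sides of the shrunk slice; hence \<open>w\<close> is nonempty.\<close>

lemma path_big_run:
 assumes "w \<noteq> []" "block w Out" "path (u @ w @ v) n (emb (length w) c) ps (length (u @ w @ v), 0, True)"
 shows "\<exists>cs. big_run c cs" using assms(3)
proof (induction n arbitrary: c ps rule: less_induct)
 case (less n)
 let ?D = "u @ w @ v" let ?f = "(length ?D, 0, True)"
 have nl: "\<not> live ?D ?f" by (simp add: live_def)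
 show ?case
 proof (cases "c = (length collapsed, 0, True)")
  case True
  then show ?thesis using big_run.intros(1) by blast
 next
  case False
  obtain k p h where c: "c = (k, p, h)" by (cases c)
  have "emb (length w) c \<noteq> ?f"
  proof
   assume "emb (length w) c = ?f"
   then have "k = length collapsed" "p = 0" "h"
    using assms(1) by (auto simp: c emb_def collapsed_def Suc_diff_Suc neq_Nil_conv split: if_splits)
   then show False using False c by simp
  qed
  then have live: "live ?D (emb (length w) c)" and "n > 0" using less.prems by (auto elim: path.cases)
  have lc: "live collapsed c" using live assms(1)
   by (auto simp: c live_def emb_def collapsed_def neq_Nil_conv split: if_splits)
  have "\<exists>m qs. 0 < m \<and> path ?D m (emb (length w) c) qs (emb (length w) (big_step c))"
  proof (cases "next_event c = length u")
   case True
   then obtain m where m: "path ?D m (emb (length w) c) (big_out (length w) Out (item c)) (emb (length w) (big_step c))"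
    using block_step[OF lc True assms(2)] by blast
   have "m \<noteq> 0"
   proof
    assume "m = 0"
    then have "emb (length w) c = emb (length w) (big_step c)" using m by (auto elim: path.cases)
    moreover obtain h' p' where "B h p = (h', p')" by fastforce
    ultimately have "k = fst (big_step c)" "h = h'" "big_step c = (if h' then Suc (length u) else length u, p', h')"
     using assms(1) True by (auto simp: c emb_def big_step_def neq_Nil_conv split: if_splits)
    then show False using True lc by (cases u) (auto simp: c live_def split: if_splits)
   qed
   then show ?thesis using m by blast
  next
   case False
   note e = emb_step[OF lc False refl, of w]
   show ?thesis using path_single[OF e(2)] e(1) by auto
  qed
  then obtain m qs where m: "0 < m" "path ?D m (emb (length w) c) qs (emb (length w) (big_step c))" by blast
  obtain rs where rs: "m \<le> n" "path ?D (n - m) (emb (length w) (big_step c)) rs ?f"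
   using path_prefix[OF m(2) less.prems nl] by blast
  obtain cs where "big_run (big_step c) cs" using less.IH[OF _ rs(2)] m(1) \<open>0 < n\<close> by auto
  then show ?thesis using big_run.intros(2)[OF lc] by blast
 qed
qed

text \<open>The run of the shrunk diagram depends on \<open>u\<close>, \<open>v\<close> and
  \<open>B\<close> only. It is extracted from the journey through the diagram with \<open>w\<close>
  and then expanded in both diagrams, so that both raw lists come from the same items
  \<open>xs\<close>.\<close>

theorem raw_list_replace:
 assumes "long_diagram (u @ w @ v)" "w \<noteq> []" "long_diagram (u @ w' @ v)"
  and "block w Out" "block w' Out'"
 obtains xs where "raw_list (u @ w @ v) = concat (map (big_out (length w) Out) xs)"
  and "raw_list (u @ w' @ v) = concat (map (big_out (length w') Out') xs)"
  and "\<And>ps x. Inl ps \<in> set xs \<Longrightarrow> x \<in> set ps \<Longrightarrow> raw_label x \<noteq> length u"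
proof -
 have e0: "emb n (0, 0, True) = (0, 0, True)" for n by (simp add: emb_def)
 obtain cs where cs: "big_run (0, 0, True) cs"
  using path_big_run[OF assms(2,4), of _ "(0, 0, True)"] long_path[OF assms(1)] unfolding e0 by blast
 let ?xs = "map item cs"
 obtain m where "path (u @ w @ v) m (0, 0, True) (concat (map (big_out (length w) Out \<circ> item) cs))
   (length (u @ w @ v), 0, True)"
  using big_run_path[OF cs assms(4)] unfolding e0 by blast
 then have 1: "raw_list (u @ w @ v) = concat (map (big_out (length w) Out) ?xs)" using path_travel_time(2) by simp
 obtain m where "path (u @ w' @ v) m (0, 0, True) (concat (map (big_out (length w') Out' \<circ> item) cs))
   (length (u @ w' @ v), 0, True)"
  using big_run_path[OF cs assms(5)] unfolding e0 by blast
 then have 2: "raw_list (u @ w' @ v) = concat (map (big_out (length w') Out') ?xs)" using path_travel_time(2) by simp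
 have 3: "raw_label x \<noteq> length u" if "Inl ps \<in> set ?xs" "x \<in> set ps" for ps x
 proof -
  from that obtain c where "next_event c \<noteq> length u" "x \<in> set (raw collapsed c)"
   by (auto simp: item_def split: if_splits)
  then show ?thesis by (auto simp: raw_def split: prod.splits event.splits if_splits)
 qed
 show ?thesis by (rule that[OF 1 2]) (rule 3)
qed

end

section \<open>Traversal of the slices of a move\<close>

fun exec :: "diagram \<Rightarrow> nat \<Rightarrow> state \<Rightarrow> raw_point list \<times> state" where
 "exec D 0 s = ([], s)"
| "exec D (Suc m) s = (if live D s then map_prod ((@) (raw D s)) id (exec D m (step D s)) else ([], s))"

lemma exec_path: "\<exists>k. path D k s (fst (exec D m s)) (snd (exec D m s))"
proof (induction m arbitrary: s)
 case (Suc m)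
 obtain k where "path D k (step D s) (fst (exec D m (step D s))) (snd (exec D m (step D s)))" using Suc by blast
 then have "path D (Suc k) s (raw D s @ fst (exec D m (step D s))) (snd (exec D m (step D s)))"
  if "live D s" using path_step[OF that] by blast
 then show ?case using path_refl[of D s] by (cases "live D s") (auto simp del: split_paired_Ex)
qed (auto intro: path_refl)

text \<open>No strand meets more than seven slices of a move.\<close>

definition traverse :: "diagram \<Rightarrow> bool \<Rightarrow> nat \<Rightarrow> raw_point list \<times> bool \<times> nat \<Rightarrow> bool" where
 "traverse w h p res \<longleftrightarrow> (case res of (ps, h', p') \<Rightarrow>
   exec w (Suc (Suc (Suc (Suc (Suc (Suc (Suc 0))))))) (if h then 0 else length w, p, h)
    = (ps, if h' then length w else 0, p', h'))"

lemmas traverse_simps = traverse_def live_def n_left_def n_right_def turning_def raw_def ex_bool_eq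

text \<open>The moves with fixed patterns act on the heights \<open>i\<close> to
  \<open>i + 2\<close> at most. The last case is written with successors so that simplification can
  execute a traversal with symbolic heights.\<close>

lemma height_cases3:
 obtains "p < i" | "p = i" | "p = Suc i" | "p = Suc (Suc i)" | d where "p = Suc (Suc (Suc (i + d)))"
proof -
 consider "p < i" | "p = i" | "p = Suc i" | "p = Suc (Suc i)" | "i + 3 \<le> p" by linarith
 then show thesis by cases (use that in \<open>auto dest!: le_Suc_ex\<close>)
qed

text \<open>Moving a vertical tangency through a crossing turns the picture of the crossing by a
  quarter: one branch changes its heading, rising and falling are exchanged, and thus the flag is
  negated. \<open>g\<close> tells which branches change their heading.\<close>

definition flip :: "(nat \<Rightarrow> nat) \<Rightarrow> (nat \<Rightarrow> bool \<Rightarrow> bool) \<Rightarrow> raw_point \<Rightarrow> raw_point" where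
 "flip f g x = Raw (f (raw_label x)) (raw_over x) (raw_right x \<noteq> g (raw_label x) (raw_over x))
   (raw_flag x \<noteq> (g (raw_label x) True \<noteq> g (raw_label x) False))"

definition similar_blocks :: "(nat \<Rightarrow> nat) \<Rightarrow> (nat \<Rightarrow> bool \<Rightarrow> bool) \<Rightarrow> diagram \<Rightarrow> diagram \<Rightarrow> bool" where
 "similar_blocks f g l r \<longleftrightarrow>
   (\<forall>h p. \<exists>ps hp. traverse l h p (ps, hp) \<and> traverse r h p (map (flip f g) ps, hp))"

lemma similar_blocksI:
 fixes f g l r
 defines "Q \<equiv> \<lambda>h p. \<exists>ps hp. traverse l h p (ps, hp) \<and> traverse r h p (map (flip f g) ps, hp)"
 assumes "\<And>p. p < i \<Longrightarrow> Q True p \<and> Q False p" "Q True i \<and> Q False i" "Q True (Suc i) \<and> Q False (Suc i)"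
  "Q True (Suc (Suc i)) \<and> Q False (Suc (Suc i))"
  "\<And>d. Q True (Suc (Suc (Suc (i + d)))) \<and> Q False (Suc (Suc (Suc (i + d))))"
 shows "similar_blocks f g l r"
proof -
 have "Q h p" for h p by (cases h; rule height_cases3[of p i]) (use assms(2-) in auto)
 then show ?thesis by (simp add: similar_blocks_def Q_def)
qed

abbreviation "unflipped \<equiv> \<lambda>_ _. False"

text \<open>In the two real tangency moves the rising branch of the left pattern, which is the one
  with \<open>raw_over\<close> equal to \<open>b\<close>, is turned round. In the mixed moves
  \<open>2 - j\<close> mirrors the three slots.\<close>

lemma similar_moves:
 "similar_blocks id unflipped [(Birth, Suc i), (Death, i)] []"
 "similar_blocks id unflipped [(Birth, i), (Death, Suc i)] []"
 "similar_blocks id (\<lambda>_ w. w = b) [(Real b, i), (Death, Suc i)] [(Real (\<not> b), Suc i), (Death, i)]"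
 "similar_blocks id unflipped [(Virtual, i), (Death, Suc i)] [(Virtual, Suc i), (Death, i)]"
 "similar_blocks id (\<lambda>_ w. w = b) [(Birth, i), (Real b, Suc i)] [(Birth, Suc i), (Real (\<not> b), i)]"
 "similar_blocks id unflipped [(Birth, i), (Virtual, Suc i)] [(Birth, Suc i), (Virtual, i)]"
 "similar_blocks id unflipped [(Birth, Suc i), (Virtual, i), (Death, Suc i)] []"
 "similar_blocks id unflipped [(Birth, i), (Virtual, Suc i), (Death, i)] []"
 "similar_blocks id unflipped [(Virtual, i), (Virtual, i)] []"
 "similar_blocks id unflipped [(Virtual, i), (Virtual, Suc i), (Virtual, i)] [(Virtual, Suc i), (Virtual, i), (Virtual, Suc i)]"
 "similar_blocks (\<lambda>j. 2 - j) unflipped [(Real b, i), (Virtual, Suc i), (Virtual, i)] [(Virtual, Suc i), (Virtual, i), (Real b, Suc i)]"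
 "similar_blocks (\<lambda>j. 2 - j) unflipped [(Virtual, i), (Real b, Suc i), (Virtual, i)] [(Virtual, Suc i), (Real b, i), (Virtual, Suc i)]"
 "similar_blocks (\<lambda>j. 2 - j) unflipped [(Virtual, i), (Virtual, Suc i), (Real b, i)] [(Real b, Suc i), (Virtual, i), (Virtual, Suc i)]"
 by (rule similar_blocksI[of i]; simp add: traverse_simps flip_def)+

lemma similar_far:
 assumes "i \<le> j"
 shows "similar_blocks (\<lambda>j. 1 - j) (\<lambda>_ _. False) [(x, i), (y, j + n_right x)] [(y, j + n_left x), (x, i)]"
 unfolding similar_blocks_def
proof (intro allI)
 fix h p
 obtain a where j: "j = i + a" using assms le_Suc_ex by blast
 have *: "\<exists>ps hp. traverse [(x, i), (y, i + a + n_right x)] h p (ps, hp) \<and>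
  traverse [(y, i + a + n_left x), (x, i)] h p (map (flip (\<lambda>j. 1 - j) (\<lambda>_ _. False)) ps, hp)"
 proof -
  define m where "m = (if h then n_left x else n_right x)"
  consider "p < i" | "p = i" "m = 2" | "p = Suc i" "m = 2" | d where "p = i + m + d" "d < a"
   | "p = i + m + a" | "p = Suc (i + m + a)" | d where "p = Suc (Suc (i + m + a + d))"
  proof -
   consider "p < i" | "p = i" "m = 2" | "p = Suc i" "m = 2" | "i + m \<le> p" "p < i + m + a"
    | "p = i + m + a" | "p = Suc (i + m + a)" | "Suc (Suc (i + m + a)) \<le> p"
    by (cases x; cases h; simp add: m_def n_left_def n_right_def; linarith)
   then show thesis by cases (use that in \<open>auto dest!: le_Suc_ex\<close>)
  qed
  then show ?thesis by cases (cases h; cases x; cases y; simp add: traverse_simps flip_def m_def)+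
 qed
 show "\<exists>ps hp. traverse [(x, i), (y, j + n_right x)] h p (ps, hp) \<and>
  traverse [(y, j + n_left x), (x, i)] h p (map (flip (\<lambda>j. 1 - j) (\<lambda>_ _. False)) ps, hp)"
  unfolding j by (rule *)
qed

lemma path_raw_label: "path D m s ps s' \<Longrightarrow> x \<in> set ps \<Longrightarrow> raw_label x < length D"
proof (induction rule: path.induct)
 case (path_step s n ps s')
 then show ?case using live_next_event[OF path_step.hyps(1)]
  by (auto simp: raw_def split: prod.splits event.splits if_splits)
qed simp

lemma traverse_path:
 assumes "traverse w h p (ps, h', p')"
 shows "\<exists>k. path w k (if h then 0 else length w, p, h) ps (if h' then length w else 0, p', h')"
 using exec_path[of w "(if h then 0 else length w, p, h)" "Suc (Suc (Suc (Suc (Suc (Suc (Suc 0))))))"] assms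
 unfolding traverse_def by auto

lemma traverse_blocks:
 assumes "\<And>h p. \<exists>hp. traverse l h p (Out h p, hp) \<and> traverse r h p (Out' h p, hp)"
 obtains B where "block B l Out" "block B r Out'"
proof -
 obtain B where B: "\<And>h p. traverse l h p (Out h p, B h p) \<and> traverse r h p (Out' h p, B h p)"
  using assms by metis
 have "block B w O'" if "\<And>h p. traverse w h p (O' h p, B h p)" for w O' unfolding block_def
 proof (intro allI)
  fix h p
  obtain h' p' where "B h p = (h', p')" by fastforce
  then show "\<exists>m h' p'. B h p = (h', p') \<and> path w m (if h then 0 else length w, p, h) (O' h p) (if h' then length w else 0, p', h')"
   using traverse_path[of w h p "O' h p" h' p'] that[of h p] by auto
 qed
 then show thesis using B by (intro that[of B]) blast+
qed

lemma raw_mate_right: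
 assumes "wf_raw R" "x \<in> set R" "y \<in> set R" "raw_label y = raw_label x" "raw_over y \<noteq> raw_over x"
 shows "(Raw (raw_label x) (\<not> raw_over x) True (raw_flag x) \<in> set R) = raw_right y"
  and "raw_flag y = raw_flag x"
proof -
 obtain z where z: "z \<in> set R" "raw_label z = raw_label x" "raw_over z \<noteq> raw_over x" "raw_flag z = raw_flag x"
  using assms(1,2) unfolding wf_raw_def by blast
 have "z = y" using wf_raw_unique[OF assms(1) z(1) assms(3)] z assms(4,5) by auto
 then show flag: "raw_flag y = raw_flag x" using z by simp
 show "(Raw (raw_label x) (\<not> raw_over x) True (raw_flag x) \<in> set R) = raw_right y"
  using wf_raw_unique[OF assms(1,3), of "Raw (raw_label x) (\<not> raw_over x) True (raw_flag x)"] assms(3-5) flag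
  by (cases y) auto
qed

lemma wf_raw_mate:
 "wf_raw R \<Longrightarrow> x \<in> set R \<Longrightarrow> \<exists>y \<in> set R. raw_label y = raw_label x \<and> raw_over y \<noteq> raw_over x"
 by (auto simp: wf_raw_def)

lemma psign_raw_to_point:
 assumes "wf_raw R" "x \<in> set R" "y \<in> set R" "raw_label y = raw_label x" "raw_over y \<noteq> raw_over x"
 shows "psign (raw_to_point R x) = (if (raw_right x = raw_right y) \<noteq> raw_flag x then 1 else - 1)"
 using raw_mate_right[OF assms] by (simp add: raw_to_point_def)

lemma raw_to_point_simps [simp]:
 "label (raw_to_point R x) = raw_label x" "is_over (raw_to_point R x) = raw_over x" by (simp_all add: raw_to_point_def)

lemma wf_raw_flip:
 assumes "wf_raw R" "inj_on f (raw_label ` set R)"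
 shows "wf_raw (map (flip f g) R)"
proof -
 have "distinct R" "inj_on (\<lambda>x. (raw_label x, raw_over x)) (set R)"
  using assms(1) by (auto simp: wf_raw_def distinct_map)
 then have "distinct (map (\<lambda>x. (raw_label x, raw_over x)) (map (flip f g) R))"
  using assms(2) by (auto simp: distinct_map inj_on_def flip_def)
 moreover have "\<exists>y \<in> set (map (flip f g) R). raw_label y = raw_label (flip f g x)
   \<and> raw_over y \<noteq> raw_over (flip f g x) \<and> raw_flag y = raw_flag (flip f g x)" if x: "x \<in> set R" for x
 proof -
  obtain y where "y \<in> set R" "raw_label y = raw_label x" "raw_over y \<noteq> raw_over x" "raw_flag y = raw_flag x"
   using assms(1) x unfolding wf_raw_def by blast
  moreover from this have "flip f g y \<in> set (map (flip f g) R)" by simp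
  ultimately show ?thesis by (intro bexI[of _ "flip f g y"]) (simp_all only: flip_def raw_point.sel, auto)
 qed
 ultimately show ?thesis by (simp add: wf_raw_def)
qed

text \<open>Reversing one branch changes both the agreement of the headings and the flag, so the
  sign of the crossing survives.\<close>

lemma code_of_raw_flip:
 assumes wf: "wf_raw R" and inj: "inj_on f (raw_label ` set R)"
 shows "code_of_raw (map (flip f g) R) = map (relabel f) (code_of_raw R)"
proof -
 let ?S = "map (flip f g) R"
 have "raw_to_point ?S (flip f g x) = relabel f (raw_to_point R x)" if x: "x \<in> set R" for x
 proof -
  obtain y where y: "y \<in> set R" "raw_label y = raw_label x" "raw_over y \<noteq> raw_over x"
   using wf_raw_mate[OF wf x] by blast
  note fl = raw_mate_right(2)[OF wf x y]
  have "psign (raw_to_point ?S (flip f g x))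
   = (if (raw_right (flip f g x) = raw_right (flip f g y)) \<noteq> raw_flag (flip f g x) then 1 else - 1)"
  proof (rule psign_raw_to_point[OF wf_raw_flip[OF wf inj]])
   show "flip f g x \<in> set ?S" "flip f g y \<in> set ?S" using x y by simp_all
  qed (simp_all add: flip_def y)
  also have "\<dots> = (if (raw_right x = raw_right y) \<noteq> raw_flag x then 1 else - 1)"
   using y by (cases "raw_over x") (auto simp: flip_def)
  also have "\<dots> = psign (raw_to_point R x)" by (rule psign_raw_to_point[OF wf x y, symmetric])
  finally show ?thesis by (intro point.expand) (simp add: flip_def)
 qed
 then show ?thesis by (simp add: code_of_raw_def)
qed

abbreviation "moved u ps \<equiv> map (map_label ((+) (length u))) ps"

text \<open>Labels in the range of the block come from passages through the block only, since
  \<open>shift\<close> avoids this range for all other slices; the entire output of such a passage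
  stands in one piece in the list.\<close>

lemma block_item:
 assumes "x \<in> set (concat (map (big_out u (length l) Out) xs))" "raw_label x \<in> {length u..<length u + length l}"
  and "l \<noteq> []" "\<And>ps x. Inl ps \<in> set xs \<Longrightarrow> x \<in> set ps \<Longrightarrow> raw_label x \<noteq> length u"
 obtains h p z A B where "Inr (h, p) \<in> set xs" "z \<in> set (Out h p)" "x = map_label ((+) (length u)) z"
  "concat (map (big_out u (length l) Out) xs) = A @ moved u (Out h p) @ B"
proof -
 obtain it where it: "it \<in> set xs" "x \<in> set (big_out u (length l) Out it)" using assms(1) by auto
 then obtain ys zs where sp: "xs = ys @ it # zs" by (meson split_list)
 show thesis
 proof (cases it)
  case (Inl ps)
  then obtain z where "z \<in> set ps" "x = map_label (shift u (length l)) z" using it(2) by (auto simp: big_out_def)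
  then have False
   using assms(2) assms(4)[of ps z] it(1) Inl assms(3) by (cases l) (auto simp: shift_def split: if_splits)
  then show thesis ..
 next
  case (Inr hp)
  obtain h p where "hp = (h, p)" by fastforce
  then show thesis using that[of h p] it sp Inr by (auto simp: big_out_def)
 qed
qed

text \<open>The local correspondence extends to the whole diagram: labels left of the block are
  kept, those in it follow \<open>f\<close>, those to its right are shifted, and headings change in
  the block only. The two codes then differ by a renaming.\<close>

theorem same_polynomials_similar:
 assumes sim: "similar_blocks f g l r" and ne: "l \<noteq> []" and inj: "inj_on f {..<length l}"
  and long: "long_diagram (u @ l @ v)" "long_diagram (u @ r @ v)"
 shows "same_polynomials (diagram_code (u @ l @ v)) (diagram_code (u @ r @ v))"
proof -
 have "\<forall>h p. \<exists>ps hp. traverse l h p (ps, hp) \<and> traverse r h p (map (flip f g) ps, hp)"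
  using sim by (simp add: similar_blocks_def)
 then obtain Out hp where tr: "\<And>h p. traverse l h p (Out h p, hp h p) \<and> traverse r h p (map (flip f g) (Out h p), hp h p)"
  by metis
 then obtain B where B: "block B l Out" "block B r (\<lambda>h p. map (flip f g) (Out h p))"
  using traverse_blocks[of l Out r "\<lambda>h p. map (flip f g) (Out h p)"] by blast
 obtain xs where xs: "raw_list (u @ l @ v) = concat (map (big_out u (length l) Out) xs)"
   "raw_list (u @ r @ v) = concat (map (big_out u (length r) (\<lambda>h p. map (flip f g) (Out h p))) xs)"
   "\<And>ps x. Inl ps \<in> set xs \<Longrightarrow> x \<in> set ps \<Longrightarrow> raw_label x \<noteq> length u"
  using raw_list_replace[OF long(1) ne long(2) B] by blast
 have lab: "raw_label x < length l \<and> f (raw_label x) < length r" if "x \<in> set (Out h p)" for x h p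
 proof -
  obtain h' p' where hp': "hp h p = (h', p')" by fastforce
  obtain k where k: "path l k (if h then 0 else length l, p, h) (Out h p) (if h' then length l else 0, p', h')"
   using traverse_path tr[of h p] hp' by metis
  obtain k' where k': "path r k' (if h then 0 else length r, p, h) (map (flip f g) (Out h p)) (if h' then length r else 0, p', h')"
   using traverse_path tr[of h p] hp' by metis
  have "flip f g x \<in> set (map (flip f g) (Out h p))" using that by simp
  from path_raw_label[OF k that] path_raw_label[OF k' this] show ?thesis by (simp add: flip_def)
 qed
 define F where "F j = (if j < length u then j else if j < length u + length l then length u + f (j - length u)
   else j - length l + length r)" for j
 define G where "G j w \<longleftrightarrow> length u \<le> j \<and> j < length u + length l \<and> g (j - length u) w" for j w
 have "big_out u (length r) (\<lambda>h p. map (flip f g) (Out h p)) it = map (flip F G) (big_out u (length l) Out it)"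
  if "it \<in> set xs" for it
 proof (cases it)
  case (Inl ps)
  have "flip F G (map_label (shift u (length l)) x) = map_label (shift u (length r)) x" if "x \<in> set ps" for x
   using xs(3)[of ps x] that \<open>it \<in> set xs\<close> Inl ne
   by (cases l) (auto simp: flip_def map_label_def F_def G_def shift_def)
  then show ?thesis by (simp add: Inl big_out_def)
 next
  case (Inr hp)
  have "flip F G (map_label ((+) (length u)) x) = map_label ((+) (length u)) (flip f g x)"
   if "x \<in> set (Out h p)" for x h p using lab[OF that] by (simp add: flip_def map_label_def F_def G_def)
  then show ?thesis by (cases hp) (simp add: Inr big_out_def)
 qed
 then have E: "raw_list (u @ r @ v) = map (flip F G) (raw_list (u @ l @ v))"
  unfolding xs(1,2) map_concat map_map by (intro arg_cong[of _ _ concat] map_cong) auto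
 have lab': "raw_label x < length u + length l \<longrightarrow> F (raw_label x) < length u + length r"
  if x: "x \<in> set (raw_list (u @ l @ v))" for x
 proof -
  show ?thesis
  proof (cases "raw_label x \<in> {length u..<length u + length l}")
   case True
   from x have "x \<in> set (concat (map (big_out u (length l) Out) xs))" unfolding xs(1) .
   then obtain h p z where "z \<in> set (Out h p)" "x = map_label ((+) (length u)) z"
    using block_item[of x u l Out xs] True ne xs(3) by metis
   then show ?thesis using lab[of z h p] by (auto simp: F_def)
  qed (auto simp: F_def)
 qed
 have injF: "inj_on F (raw_label ` set (raw_list (u @ l @ v)))"
 proof (rule inj_onI)
  fix a b assume "a \<in> raw_label ` set (raw_list (u @ l @ v))" "b \<in> raw_label ` set (raw_list (u @ l @ v))"
   and eq: "F a = F b"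
  then have "a < length u + length l \<longrightarrow> F a < length u + length r" "b < length u + length l \<longrightarrow> F b < length u + length r"
   using lab' by blast+
  note lt = this
  have r1: "c < length u \<Longrightarrow> F c = c" and r2: "length u \<le> c \<Longrightarrow> c < length u + length l \<Longrightarrow> F c = length u + f (c - length u)"
   and r3: "length u + length l \<le> c \<Longrightarrow> F c + length l = c + length r" for c by (simp_all add: F_def)
  have pos: "(F c = c \<and> c < length u) \<or> (length u \<le> F c \<and> F c < length u + length r \<and> length u \<le> c \<and> c < length u + length l)
    \<or> (F c + length l = c + length r \<and> length u + length l \<le> c)" if "c < length u + length l \<longrightarrow> F c < length u + length r" for c
  proof -
   consider "c < length u" | "length u \<le> c" "c < length u + length l" | "length u + length l \<le> c" by linarith
   then show ?thesis by cases (use r1[of c] r2[of c] r3[of c] that in simp_all)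
  qed
  show "a = b"
  proof (cases "length u \<le> a \<and> a < length u + length l \<and> length u \<le> b \<and> b < length u + length l")
   case True
   then have "f (a - length u) = f (b - length u)" using eq r2[of a] r2[of b] by simp
   then have "a - length u = b - length u"
    by (rule inj_onD[OF inj]) (use True in \<open>simp_all add: less_diff_conv2 add.commute\<close>)
   then show ?thesis using True by linarith
  next
   case False
   then show ?thesis using pos[OF lt(1)] pos[OF lt(2)] eq by (elim disjE conjE) (blast | linarith)+
  qed
 qed
 have wf: "wf_raw (raw_list (u @ l @ v))" by (rule wf_raw_list[OF long(1)])
 have "diagram_code (u @ r @ v) = map (relabel F) (diagram_code (u @ l @ v))"
  using code_of_raw_flip[OF wf injF, of G] by (simp add: diagram_code_raw long E)
 moreover have "label ` set (diagram_code (u @ l @ v)) = raw_label ` set (raw_list (u @ l @ v))"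
  by (simp add: diagram_code_raw long code_of_raw_def image_image)
 ultimately show ?thesis using same_polynomials_relabel[OF wf_diagram_code[OF long(1)], of F] injF by simp
qed

text \<open>A sign is determined by the two passages of its crossing, so discarding complete
  crossings leaves the other signs alone.\<close>

lemma code_of_raw_subset:
 assumes wf: "wf_raw R" and P: "\<And>x y. x \<in> set R \<Longrightarrow> y \<in> set R \<Longrightarrow> raw_label x = raw_label y \<Longrightarrow> P x \<Longrightarrow> P y"
 shows "wf_raw (filter P R)" "code_of_raw (filter P R) = map (raw_to_point R) (filter P R)"
proof -
 show wf': "wf_raw (filter P R)" unfolding wf_raw_def
 proof (intro conjI ballI)
  show "distinct (map (\<lambda>x. (raw_label x, raw_over x)) (filter P R))"
   using wf by (simp add: wf_raw_def distinct_map_filter)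
  fix x assume "x \<in> set (filter P R)"
  moreover from this obtain y where "y \<in> set R" "raw_label y = raw_label x" "raw_over y \<noteq> raw_over x" "raw_flag y = raw_flag x"
   using wf unfolding wf_raw_def by auto
  ultimately show "\<exists>y \<in> set (filter P R). raw_label y = raw_label x \<and> raw_over y \<noteq> raw_over x \<and> raw_flag y = raw_flag x"
   using P[of x y] by auto
 qed
 have "raw_to_point (filter P R) x = raw_to_point R x" if x: "x \<in> set R" "P x" for x
 proof -
  obtain y where y: "y \<in> set R" "raw_label y = raw_label x" "raw_over y \<noteq> raw_over x"
   using wf_raw_mate[OF wf x(1)] by blast
  have "P y" using P[OF x(1) y(1)] y(2) x(2) by simp
  then show ?thesis by (intro point.expand)
    (simp add: psign_raw_to_point[OF wf x(1) y] psign_raw_to_point[OF wf', of x y] x y)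
 qed
 then show "code_of_raw (filter P R) = map (raw_to_point R) (filter P R)" by (simp add: code_of_raw_def)
qed

lemma flip_trivial: "flip f (\<lambda>_ _. False) x = map_label f x" by (simp add: flip_def map_label_def)

text \<open>Common frame for the first and the second move, where a block is deleted. Up to
  renaming, the new code is the old one without the labels in \<open>S\<close>. The first claim
  presents the passages of a strand through the block as a contiguous piece of the code; the second
  leaves only the deletion of labels from a code, to be shown when the block is met at all.\<close>

lemma block_removal:
 assumes tr: "\<And>h p. \<exists>hp. traverse l h p (Out h p, hp) \<and> traverse [] h p ([], hp)" and ne: "l \<noteq> []"
  and long: "long_diagram (u @ l @ v)" "long_diagram (u @ [] @ v)"
 defines "R \<equiv> raw_list (u @ l @ v)" and "L \<equiv> diagram_code (u @ l @ v)" and "S \<equiv> {length u..<length u + length l}"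
 shows "\<And>w. w \<in> set R \<Longrightarrow> raw_label w \<in> S \<Longrightarrow> \<exists>h p A B. w \<in> set (moved u (Out h p)) \<and>
   set (moved u (Out h p)) \<subseteq> set R \<and> L = A @ map (raw_to_point R) (moved u (Out h p)) @ B"
  and "(\<And>w. w \<in> set R \<Longrightarrow> raw_label w \<in> S \<Longrightarrow> same_polynomials L (filter (\<lambda>p. label p \<notin> S) L)) \<Longrightarrow>
   same_polynomials L (diagram_code (u @ [] @ v))"
proof -
 obtain B where B: "block B l Out" "block B [] (\<lambda>_ _. [])"
  using traverse_blocks[of l Out "[]" "\<lambda>_ _. []"] tr by blast
 obtain xs where xs: "raw_list (u @ l @ v) = concat (map (big_out u (length l) Out) xs)"
   "raw_list (u @ [] @ v) = concat (map (big_out u (length ([] :: diagram)) (\<lambda>_ _. [])) xs)"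
   "\<And>ps x. Inl ps \<in> set xs \<Longrightarrow> x \<in> set ps \<Longrightarrow> raw_label x \<noteq> length u"
  using raw_list_replace[OF long(1) ne long(2) B] by blast
 have lab: "raw_label x < length l" if x: "x \<in> set (Out h p)" for x h p
 proof -
  obtain h' p' where "traverse l h p (Out h p, h', p')" using tr[of h p] by force
  from traverse_path[OF this] show ?thesis using path_raw_label x by blast
 qed
 define P where "P x \<longleftrightarrow> raw_label x \<notin> {length u..<length u + length l}" for x
 define F where "F j = (if j < length u then j else j - length l)" for j
 have "big_out u 0 (\<lambda>_ _. []) it = map (map_label F) (filter P (big_out u (length l) Out it))"
  if "it \<in> set xs" for it
 proof (cases it)
  case (Inl ps)
  have "P (map_label (shift u (length l)) x) \<and> map_label F (map_label (shift u (length l)) x) = map_label (shift u 0) x"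
   if "x \<in> set ps" for x using xs(3)[of ps x] that \<open>it \<in> set xs\<close> Inl ne
   by (cases l) (auto simp: map_label_def F_def P_def shift_def)
  then have "filter P (map (map_label (shift u (length l))) ps) = map (map_label (shift u (length l))) ps"
   "map (map_label F \<circ> map_label (shift u (length l))) ps = map (map_label (shift u 0)) ps"
   by (auto simp: filter_id_conv)
  then show ?thesis by (simp add: Inl big_out_def)
 next
  case (Inr hp)
  then show ?thesis using lab by (cases hp) (auto simp: big_out_def P_def filter_empty_conv)
 qed
 then have "raw_list (u @ [] @ v) = map (map_label F) (filter P (raw_list (u @ l @ v)))"
  unfolding xs(1,2) map_concat map_map filter_concat by (intro arg_cong[of _ _ concat] map_cong) auto
 then have E: "raw_list (u @ [] @ v) = map (flip F (\<lambda>_ _. False)) (filter P (raw_list (u @ l @ v)))"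
  by (simp add: flip_trivial)
 let ?R = "raw_list (u @ l @ v)"
 have wf: "wf_raw ?R" by (rule wf_raw_list[OF long(1)])
 have sub: "wf_raw (filter P ?R)" "code_of_raw (filter P ?R) = map (raw_to_point ?R) (filter P ?R)"
  by (rule code_of_raw_subset[OF wf]; simp add: P_def)+
 have inj: "inj_on F (raw_label ` set (filter P ?R))"
 proof (rule inj_onI)
  fix a b assume ab: "a \<in> raw_label ` set (filter P ?R)" "b \<in> raw_label ` set (filter P ?R)" "F a = F b"
  have pos: "F c = c \<and> c < length u \<or> F c + length l = c \<and> length u + length l \<le> c"
   if "c \<in> raw_label ` set (filter P ?R)" for c using that by (auto simp: P_def F_def)
  from pos[OF ab(1)] pos[OF ab(2)] ab(3) show "a = b" by (elim disjE conjE) linarith+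
 qed
 have 1: "diagram_code (u @ [] @ v) = map (relabel F) (code_of_raw (filter P ?R))"
  unfolding diagram_code_raw[OF long(2)] E by (rule code_of_raw_flip[OF sub(1) inj])
 have 2: "code_of_raw (filter P ?R) = filter (\<lambda>p. label p \<notin> {length u..<length u + length l}) (diagram_code (u @ l @ v))"
  unfolding sub(2) unfolding diagram_code_raw[OF long(1)] code_of_raw_def
  by (simp add: filter_map comp_def) (rule arg_cong[of _ _ "map _"], rule filter_cong; simp add: P_def)
 have "inj_on F (label ` set (code_of_raw (filter P ?R)))" using inj by (simp add: code_of_raw_def image_image)
 then have "same_polynomials (code_of_raw (filter P ?R)) (diagram_code (u @ [] @ v))"
  unfolding 1 using same_polynomials_relabel wf_code_of_raw[OF sub(1)] by blast
 then have 3: "same_polynomials (filter (\<lambda>p. label p \<notin> S) L) (diagram_code (u @ [] @ v))"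
  unfolding 2 L_def S_def .
 have L: "L = map (raw_to_point R) R" by (simp add: L_def R_def diagram_code_raw[OF long(1)] code_of_raw_def)
 show "\<exists>h p A B. w \<in> set (moved u (Out h p)) \<and>
   set (moved u (Out h p)) \<subseteq> set R \<and> L = A @ map (raw_to_point R) (moved u (Out h p)) @ B" if "w \<in> set R" "raw_label w \<in> S" for w
 proof -
  have "w \<in> set (concat (map (big_out u (length l) Out) xs))" using that xs(1) by (simp add: R_def)
  moreover have "raw_label w \<in> {length u..<length u + length l}" using that by (simp add: S_def)
  ultimately obtain h p z A B where z: "z \<in> set (Out h p)" "w = map_label ((+) (length u)) z"
    "R = A @ moved u (Out h p) @ B" unfolding R_def xs(1) using block_item[of w u l Out xs] ne xs(3) by metis
  have "L = map (raw_to_point R) A @ map (raw_to_point R) (moved u (Out h p)) @ map (raw_to_point R) B"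
   unfolding L by (subst (2) z(3)) simp
  moreover have "set (moved u (Out h p)) \<subseteq> set R" unfolding z(3) by auto
  ultimately show ?thesis using z(1,2) by fastforce
 qed
 assume core: "\<And>w. w \<in> set R \<Longrightarrow> raw_label w \<in> S \<Longrightarrow> same_polynomials L (filter (\<lambda>p. label p \<notin> S) L)"
 have "same_polynomials L (filter (\<lambda>p. label p \<notin> S) L)"
 proof (cases "\<exists>w \<in> set R. raw_label w \<in> S")
  case False
  then have "filter (\<lambda>p. label p \<notin> S) L = L" by (auto simp: L filter_id_conv)
  then show ?thesis by simp
 qed (use core in blast)
 then show "same_polynomials L (diagram_code (u @ [] @ v))" using 3 same_polynomials_trans by blast
qed

text \<open>A strand meeting the crossing meets it twice in succession; the two passages are then
  mates and adjacent.\<close>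

theorem same_polynomials_remove_R1:
 assumes tr: "\<And>h p. \<exists>hp. traverse l h p (Out h p, hp) \<and> traverse [] h p ([], hp)" and ne: "l \<noteq> []"
  and Out: "\<And>h p. Out h p = [] \<or> (\<exists>x y. Out h p = [x, y] \<and> raw_label x = c \<and> raw_label y = c)"
  and long: "long_diagram (u @ l @ v)" "long_diagram (u @ [] @ v)"
 shows "same_polynomials (diagram_code (u @ l @ v)) (diagram_code (u @ [] @ v))"
proof -
 let ?L = "diagram_code (u @ l @ v)" and ?R = "raw_list (u @ l @ v)" and ?S = "{length u..<length u + length l}"
 note rm = block_removal[where l = l and u = u and v = v, OF tr ne long]
 have wf: "wf_code ?L" by (rule wf_diagram_code[OF long(1)])
 show ?thesis
 proof (rule rm(2))
  fix w assume w: "w \<in> set ?R" "raw_label w \<in> ?S"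
  have bl: "raw_label x = length u + c" if "x \<in> set ?R" "raw_label x \<in> ?S" for x
  proof -
   from rm(1)[OF that] obtain h p where "x \<in> set (moved u (Out h p))" by blast
   then show ?thesis using Out[of h p] by auto
  qed
  obtain h q A B where "w \<in> set (moved u (Out h q))"
   and "?L = A @ map (raw_to_point ?R) (moved u (Out h q)) @ B" using rm(1)[OF w] by blast
  then obtain p q where pq: "?L = A @ [p, q] @ B" "label p = length u + c" "label q = length u + c"
   using Out[of h q] by auto
  have "q = mate p" using wf_code_label[OF wf, of p q] wf_code_distinct[OF wf] pq by auto
  then have "adjacent ?L p (mate p)" using pq(1) by (auto simp: adjacent_def)
  from same_polynomials_R1[OF wf this] have "same_polynomials ?L (filter (\<lambda>r. label r \<noteq> label p) ?L)" .
  moreover have "filter (\<lambda>r. label r \<noteq> label p) ?L = filter (\<lambda>p. label p \<notin> ?S) ?L"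
  proof (rule filter_cong[OF refl])
   fix r assume "r \<in> set ?L"
   then obtain x where "x \<in> set ?R" "label r = raw_label x"
    by (auto simp: diagram_code_raw[OF long(1)] code_of_raw_def)
   moreover have "label p \<in> ?S" using bl[OF w] w(2) by (simp only: pq(2))
   ultimately show "label r \<noteq> label p \<longleftrightarrow> label r \<notin> ?S" using bl[of x] pq(2) by metis
  qed
  ultimately show "same_polynomials ?L (filter (\<lambda>p. label p \<notin> ?S) ?L)" by simp
 qed
qed

text \<open>Each of the two strands meets both crossings in succession. On either strand the
  headings agree and the flags differ, which gives opposite signs.\<close>

theorem same_polynomials_remove_R2:
 assumes tr: "\<And>h p. \<exists>hp. traverse l h p (Out h p, hp) \<and> traverse [] h p ([], hp)" and ne: "l \<noteq> []"
  and Out: "\<And>h p. Out h p = [] \<or> (\<exists>x y. Out h p = [x, y] \<and> {raw_label x, raw_label y} = {0, 1} \<and>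
    raw_over x = raw_over y \<and> raw_right x = raw_right y \<and> raw_flag x \<noteq> raw_flag y)"
  and len: "length l = 2"
  and long: "long_diagram (u @ l @ v)" "long_diagram (u @ [] @ v)"
 shows "same_polynomials (diagram_code (u @ l @ v)) (diagram_code (u @ [] @ v))"
proof -
 let ?L = "diagram_code (u @ l @ v)" and ?R = "raw_list (u @ l @ v)" and ?S = "{length u..<length u + length l}"
 note rm = block_removal[where l = l and u = u and v = v, OF tr ne long]
 have wfR: "wf_raw ?R" by (rule wf_raw_list[OF long(1)])
 have wf: "wf_code ?L" by (rule wf_diagram_code[OF long(1)])
 have L: "?L = map (raw_to_point ?R) ?R" by (simp add: diagram_code_raw[OF long(1)] code_of_raw_def)
 have strand: "\<exists>x y. x \<in> set ?R \<and> y \<in> set ?R \<and> (x = w \<or> y = w) \<and> {raw_label x, raw_label y} = {length u, Suc (length u)}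
   \<and> raw_over x = raw_over y \<and> raw_right x = raw_right y \<and> raw_flag x \<noteq> raw_flag y
   \<and> adjacent ?L (raw_to_point ?R x) (raw_to_point ?R y)"
  if w: "w \<in> set ?R" "raw_label w \<in> ?S" for w
 proof -
  obtain h q A B where z: "w \<in> set (moved u (Out h q))"
   and R: "set (moved u (Out h q)) \<subseteq> set ?R" and L1: "?L = A @ map (raw_to_point ?R) (moved u (Out h q)) @ B"
   using rm(1)[OF w] by blast
  then obtain a b where ab: "Out h q = [a, b]" "{raw_label a, raw_label b} = {0, 1}"
    "raw_over a = raw_over b" "raw_right a = raw_right b" "raw_flag a \<noteq> raw_flag b" using Out[of h q] by auto
  let ?a = "map_label ((+) (length u)) a" and ?b = "map_label ((+) (length u)) b"
  have "adjacent ?L (raw_to_point ?R ?a) (raw_to_point ?R ?b)" using L1 ab(1) by (auto simp: adjacent_def)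
  moreover have "?a \<in> set ?R" "?b \<in> set ?R" using R ab(1) by auto
  moreover have "?a = w \<or> ?b = w" using z ab(1) by auto
  ultimately show ?thesis using ab(2-) by - (rule exI[of _ ?a], rule exI[of _ ?b], auto simp: doubleton_eq_iff)
 qed
 show ?thesis
 proof (rule rm(2))
  fix w assume w: "w \<in> set ?R" "raw_label w \<in> ?S"
  from strand[OF w] obtain x y where xy: "x \<in> set ?R" "y \<in> set ?R" "{raw_label x, raw_label y} = {length u, Suc (length u)}"
   "raw_over x = raw_over y" "raw_right x = raw_right y" "raw_flag x \<noteq> raw_flag y"
   "adjacent ?L (raw_to_point ?R x) (raw_to_point ?R y)" by blast
  \<comment> \<open>The second strand of the bigon is reached through the mate of
    \<open>x\<close>.\<close>
  obtain m where m: "m \<in> set ?R" "raw_label m = raw_label x" "raw_over m \<noteq> raw_over x"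
   using wf_raw_mate[OF wfR xy(1)] by blast
  have "raw_label m \<in> ?S" using m(2) xy(3) len by (auto simp: doubleton_eq_iff)
  from strand[OF m(1) this] obtain x' y' where xy'0: "x' \<in> set ?R" "y' \<in> set ?R" "x' = m \<or> y' = m"
   "{raw_label x', raw_label y'} = {length u, Suc (length u)}"
   "raw_over x' = raw_over y'" "raw_right x' = raw_right y'" "raw_flag x' \<noteq> raw_flag y'"
   "adjacent ?L (raw_to_point ?R x') (raw_to_point ?R y')" by blast
  obtain n where n: "n \<in> set ?R" "raw_label n = raw_label y" "raw_over n = raw_over m" "raw_right n = raw_right m"
   "adjacent ?L (raw_to_point ?R m) (raw_to_point ?R n)"
  proof (cases "x' = m")
   case True
   show thesis by (rule that[of y']) (use True xy'0 xy(3) m(2) in \<open>auto simp: doubleton_eq_iff\<close>)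
  next
   case False
   then have "y' = m" using xy'0(3) by simp
   then have "adjacent ?L (raw_to_point ?R m) (raw_to_point ?R x')" using xy'0(8) adjacent_sym by metis
   with \<open>y' = m\<close> show thesis
    by (intro that[of x']) (use xy'0(1-6) xy(3) m(2) in \<open>auto simp: doubleton_eq_iff\<close>)
  qed
  let ?x = "raw_to_point ?R x" and ?y = "raw_to_point ?R y"
  have in_L: "raw_to_point ?R z \<in> set ?L" if "z \<in> set ?R" for z using that L by auto
  have "raw_to_point ?R m = mate ?x"
   using wf_code_label[OF wf in_L[OF xy(1)] in_L[OF m(1)]] m by (auto dest: arg_cong[of _ _ is_over])
  moreover have "raw_to_point ?R n = mate ?y"
   using wf_code_label[OF wf in_L[OF xy(2)] in_L[OF n(1)]] n m xy(4) by (auto dest: arg_cong[of _ _ is_over])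
  moreover have "psign ?x = - psign ?y"
   using psign_raw_to_point[OF wfR xy(1) m] psign_raw_to_point[OF wfR xy(2) n(1,2)] n m xy by auto
  ultimately have "same_polynomials ?L (filter (\<lambda>p. label p \<notin> {label ?x, label ?y}) ?L)"
   using xy(3,4,7) n(5) by (intro same_polynomials_R2[OF wf]) auto
  moreover have "?S = {length u, Suc (length u)}" using len by auto
  then have "{label ?x, label ?y} = ?S" using xy(3) by simp
  ultimately show "same_polynomials ?L (filter (\<lambda>p. label p \<notin> ?S) ?L)" by (simp only:)
 qed
qed

text \<open>Strands 1, 2, 3 are numbered from bottom to top on the left, and the slots 0, 1, 2 hold
  the crossings of the pairs 12, 13, 23. Heading left, a strand meets its two crossings in reverse
  order.\<close>

definition strands3 :: "bool \<Rightarrow> bool \<Rightarrow> bool \<Rightarrow> nat \<Rightarrow> bool \<Rightarrow> raw_point list" where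
 "strands3 b c d k h = (if h then id else rev)
   (if k = 1 then [Raw 0 b h b, Raw 1 c h c]
   else if k = 2 then [Raw 0 (\<not> b) h b, Raw 2 d h d]
   else [Raw 1 (\<not> c) h c, Raw 2 (\<not> d) h d])"

lemma set_strands3:
 "set (strands3 b c d k h) = (if k = 1 then {Raw 0 b h b, Raw 1 c h c}
   else if k = 2 then {Raw 0 (\<not> b) h b, Raw 2 d h d} else {Raw 1 (\<not> c) h c, Raw 2 (\<not> d) h d})"
 by (auto simp: strands3_def)

text \<open>The block reverses the order of its strands, so from the right strand \<open>k\<close>
  is entered at \<open>i + 3 - k\<close>.\<close>

definition height3 :: "nat \<Rightarrow> nat \<Rightarrow> bool \<Rightarrow> nat" where
 "height3 i k h = (if h then i + k - 1 else i + 3 - k)"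

definition out3 :: "bool \<Rightarrow> bool \<Rightarrow> bool \<Rightarrow> nat \<Rightarrow> bool \<Rightarrow> nat \<Rightarrow> raw_point list" where
 "out3 b c d i h p = (if p = height3 i 1 h then strands3 b c d 1 h
   else if p = height3 i 2 h then strands3 b c d 2 h
   else if p = height3 i 3 h then strands3 b c d 3 h else [])"

text \<open>The move mirrors the slots, hence \<open>2 - j\<close>, and reverses the order in which
  a strand meets its crossings, hence \<open>rev\<close>.\<close>

lemma traverse_R3:
 "\<exists>hp. traverse [(Real b, i), (Real c, Suc i), (Real d, i)] h p (out3 b c d i h p, hp) \<and>
   traverse [(Real d, Suc i), (Real c, i), (Real b, Suc i)] h p
    (map (map_label (\<lambda>j. 2 - j)) (rev (out3 b c d i h p)), hp)"
 by (cases h; rule height_cases3[of p i];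
   simp add: traverse_simps out3_def strands3_def height3_def map_label_def)

lemma out3_nonempty:
 assumes "z \<in> set (out3 b c d i h p)"
 obtains k where "k \<in> {1, 2, 3}" "p = height3 i k h" "z \<in> set (strands3 b c d k h)"
 using assms by (auto simp: out3_def split: if_splits)

text \<open>Distinctness of the concatenation forces an item with nonempty output to occur only
  once, so changing \<open>f\<close> at \<open>e\<close> changes a single place.\<close>

lemma swap_adj_concat:
 assumes "distinct (concat (map f xs))" "e \<in> set xs" "f e = [p, q]"
 shows "swap_adj p q (concat (map f xs)) (concat (map (f(e := [q, p])) xs))"
proof -
 obtain ys zs where xs: "xs = ys @ e # zs" using assms(2) by (meson split_list)
 have "e \<notin> set ys" "e \<notin> set zs" using assms(1,3) by (auto simp: xs)
 then have "map (f(e := [q, p])) ys = map f ys" "map (f(e := [q, p])) zs = map f zs" by auto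
 then show ?thesis unfolding swap_adj_def xs by (auto simp: assms(3) simp del: map_eq_conv)
qed

lemma swap_adj_sym: "swap_adj p q L M \<Longrightarrow> swap_adj q p L M" by (auto simp: swap_adj_def)

lemma swap_adj_map:
 assumes "swap_adj p q L M"
 shows "swap_adj (f p) (f q) (map f L) (map f M)"
proof -
 obtain A B where "L = A @ [p, q] @ B \<and> M = A @ [q, p] @ B \<or> L = A @ [q, p] @ B \<and> M = A @ [p, q] @ B"
  using assms by (auto simp: swap_adj_def)
 then show ?thesis unfolding swap_adj_def by (intro exI[of _ "map f A"] exI[of _ "map f B"]) auto
qed

lemma lv_consecutive:
 assumes "distinct (A @ [p, q] @ B)"
 shows "lv (A @ [p, q] @ B) p q = 2" "lv (A @ [p, q] @ B) q p = 0"
 using assms idx_pair(1,2)[OF assms] by (auto simp: lv_def)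

text \<open>Up to renaming the slots, the new raw list reverses the output of each of the three
  strands. These are three exchanges of neighbours, as in
  \<open>same_polynomials_R3\<close>.\<close>

theorem same_polynomials_move_R3:
 fixes b c d :: bool and i :: nat
 defines "l \<equiv> [(Real b, i), (Real c, Suc i), (Real d, i)]"
  and "r \<equiv> [(Real d, Suc i), (Real c, i), (Real b, Suc i)]"
 assumes long: "long_diagram (u @ l @ v)" "long_diagram (u @ r @ v)"
 shows "same_polynomials (diagram_code (u @ l @ v)) (diagram_code (u @ r @ v))"
proof -
 let ?Out = "out3 b c d i"
 obtain B where B: "block B l ?Out" "block B r (\<lambda>h p. map (map_label (\<lambda>j. 2 - j)) (rev (?Out h p)))"
  using traverse_blocks[of l ?Out r "\<lambda>h p. map (map_label (\<lambda>j. 2 - j)) (rev (?Out h p))"] traverse_R3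
  unfolding l_def r_def by blast
 have len: "length l = 3" "length r = 3" "l \<noteq> []" by (auto simp: l_def r_def)
 obtain xs where xs: "raw_list (u @ l @ v) = concat (map (big_out u (length l) ?Out) xs)"
   "raw_list (u @ r @ v) = concat (map (big_out u (length r) (\<lambda>h p. map (map_label (\<lambda>j. 2 - j)) (rev (?Out h p)))) xs)"
   "\<And>ps x. Inl ps \<in> set xs \<Longrightarrow> x \<in> set ps \<Longrightarrow> raw_label x \<noteq> length u"
  using raw_list_replace[OF long(1) len(3) long(2) B] by blast
 let ?n = "length u"
 define R where "R = raw_list (u @ l @ v)"
 define f0 where "f0 = big_out u 3 ?Out"
 define f' where "f' = big_out u 3 (\<lambda>h p. rev (?Out h p))"
 define R' where "R' = concat (map f' xs)"
 have R: "R = concat (map f0 xs)" by (simp add: R_def xs(1) f0_def len)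
 have wfR: "wf_raw R" unfolding R_def by (rule wf_raw_list[OF long(1)])
 have dR: "distinct R" using wfR by (simp add: wf_raw_def distinct_map)
 have ms: "mset R' = mset R" unfolding R'_def R
 proof (induction xs)
  case (Cons it xs)
  have "mset (f' it) = mset (f0 it)" by (auto simp: f'_def f0_def big_out_def rev_map[symmetric] split: sum.splits)
  then show ?case using Cons by simp
 qed simp
 then have set_R': "set R' = set R" by (metis set_mset_mset)
 have wfR': "wf_raw R'" using wfR set_R' mset_eq_imp_distinct_iff[OF ms] by (simp add: wf_raw_def distinct_map)
 define F where "F j = (if ?n \<le> j \<and> j < ?n + 3 then ?n + 2 - (j - ?n) else j)" for j
 have injF: "inj F" by (rule injI) (auto simp: F_def split: if_splits)
 have "big_out u (length r) (\<lambda>h p. map (map_label (\<lambda>j. 2 - j)) (rev (?Out h p))) it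
   = map (map_label F) (f' it)" if it: "it \<in> set xs" for it
 proof (cases it)
  case (Inl ps)
  have "map_label F (map_label (shift u 3) x) = map_label (shift u 3) x" if "x \<in> set ps" for x
   using xs(3)[of ps x] that it Inl by (auto simp: map_label_def F_def shift_def)
  then show ?thesis by (simp add: Inl big_out_def f'_def len)
 next
  case (Inr hp)
  obtain h p where hp: "hp = (h, p)" by fastforce
  have "map_label F (map_label ((+) ?n) z) = map_label ((+) ?n) (map_label (\<lambda>j. 2 - j) z)"
   if "z \<in> set (?Out h p)" for z
  proof -
   have "raw_label z < 3" using that by (auto simp: out3_def strands3_def split: if_splits)
   then show ?thesis by (simp add: map_label_def F_def)
  qed
  then show ?thesis by (simp add: Inr hp big_out_def f'_def len)
 qed
 then have E: "raw_list (u @ r @ v) = map (flip F (\<lambda>_ _. False)) R'"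
  unfolding xs(2) R'_def map_concat map_map flip_trivial by (intro arg_cong[of _ _ concat] map_cong) auto
 let ?pt = "raw_to_point R"
 define L where "L = map ?pt R"
 define M where "M = map ?pt R'"
 have L: "diagram_code (u @ l @ v) = L" by (simp add: diagram_code_raw[OF long(1)] code_of_raw_def L_def R_def)
 have "raw_to_point R' = ?pt" by (rule ext) (simp add: raw_to_point_def set_R')
 then have M: "code_of_raw R' = M" by (simp add: code_of_raw_def M_def)
 have wfL: "wf_code L" using wf_diagram_code[OF long(1)] L by simp
 have "diagram_code (u @ r @ v) = map (relabel F) M" unfolding diagram_code_raw[OF long(2)] E M[symmetric]
  by (rule code_of_raw_flip[OF wfR']) (rule inj_on_subset[OF injF], simp)
 moreover have "same_polynomials M (map (relabel F) M)" by (rule same_polynomials_relabel)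
    (use wf_code_of_raw[OF wfR'] M inj_on_subset[OF injF] in auto)
 moreover have "same_polynomials L M"
 proof -
  define has where "has k h \<longleftrightarrow> Inr (h, height3 i k h) \<in> set xs" for k h
  let ?m = "map_label ((+) ?n)"
  have f0_has: "f0 (Inr (h, height3 i k h)) = map ?m (strands3 b c d k h)" if "k \<in> {1, 2, 3}" for k h
   using that by (auto simp: f0_def big_out_def out3_def height3_def)
  have mem: "?m z \<in> set R" if "has k h" "k \<in> {1, 2, 3}" "z \<in> set (strands3 b c d k h)" for k h z
  proof -
   have "?m z \<in> set (f0 (Inr (h, height3 i k h)))" using that f0_has by simp
   then show ?thesis using that(1) unfolding R has_def by (auto simp del: Inr_Inl_False)
  qed
  have item: "\<exists>k h z. has k h \<and> k \<in> {1, 2, 3} \<and> z \<in> set (strands3 b c d k h) \<and> x = ?m z"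
   if x: "x \<in> set R" "raw_label x \<in> {?n..<?n + 3}" for x
  proof -
   obtain h p z where "Inr (h, p) \<in> set xs" "z \<in> set (?Out h p)" "x = ?m z"
    using block_item[of x u l ?Out xs] x xs(1,3) len R_def by metis
   then show ?thesis using out3_nonempty unfolding has_def by metis
  qed
  have unique: "h = h'" if hk: "has k h" "has k h'" "k \<in> {1, 2, 3}" for k h h'
  proof -
   have "Raw (if k = 3 then 1 else 0) (if k = 1 then b else if k = 2 then \<not> b else \<not> c) h (if k = 3 then c else b)
     \<in> set (strands3 b c d k h)" for h
    using hk(3) by (auto simp: strands3_def)
   then obtain o1 f1 j where "Raw j o1 h f1 \<in> set (strands3 b c d k h)" "Raw j o1 h' f1 \<in> set (strands3 b c d k h')"
    by blast
   then have "?m (Raw j o1 h f1) \<in> set R" "?m (Raw j o1 h' f1) \<in> set R" using mem hk by blast+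
   then show ?thesis
    using wf_raw_unique[OF wfR, of "?m (Raw j o1 h f1)" "?m (Raw j o1 h' f1)"] by (auto simp: map_label_def)
  qed
  have mate: "\<exists>k' h' y. has k' h' \<and> k' \<in> {1, 2, 3} \<and> y \<in> set (strands3 b c d k' h')
    \<and> raw_label y = raw_label z \<and> raw_over y \<noteq> raw_over z"
   if hk: "has k h" "k \<in> {1, 2, 3}" "z \<in> set (strands3 b c d k h)" for k h z
  proof -
   obtain y where y: "y \<in> set R" "raw_label y = raw_label (?m z)" "raw_over y \<noteq> raw_over (?m z)"
    using wf_raw_mate[OF wfR mem[OF hk]] by blast
   have "raw_label z < 3" using hk by (auto simp: set_strands3 split: if_splits)
   then show ?thesis using item[OF y(1)] y by fastforce
  qed
  have nxt: "\<exists>h'. has k' h'"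
   if "has k h" "k \<in> {1, 2, 3}" "Raw j w h f \<in> set (strands3 b c d k h)"
    and "\<And>x h' y. x \<in> {1, 2, 3} \<Longrightarrow> y \<in> set (strands3 b c d x h') \<Longrightarrow> raw_label y = j \<Longrightarrow> raw_over y \<noteq> w \<Longrightarrow> x = k'"
   for k h j w f k' using mate[OF that(1-3)] that(4) by fastforce
  \<comment> \<open>Strands 1 and 2 share the crossing in slot 0, and the mate of a passage has to
    occur as well. Going on through slots 2 and 1, one strand of the triangle brings in the other
    two.\<close>
  have 12: "\<exists>h'. has 2 h'" if "has 1 h" for h
   by (rule nxt[OF that, of 0 b b]) (auto simp: set_strands3 split: if_splits)
  have 23: "\<exists>h'. has 3 h'" if "has 2 h" for h
   by (rule nxt[OF that, of 2 d d]) (auto simp: set_strands3 split: if_splits)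
  have 31: "\<exists>h'. has 1 h'" if "has 3 h" for h
   by (rule nxt[OF that, of 1 "\<not> c" c]) (auto simp: set_strands3 split: if_splits)
  have same: "f0 it = f' it" if "\<And>k h. it = Inr (h, height3 i k h) \<Longrightarrow> k \<notin> {1, 2, 3}" for it
  proof (cases it)
   case (Inr hp)
   obtain h p where hp: "hp = (h, p)" by fastforce
   have "z \<notin> set (?Out h p)" for z by (rule notI, erule out3_nonempty) (use that Inr hp in blast)
   then have "?Out h p = []" using last_in_set by blast
   then show ?thesis by (simp add: f'_def f0_def big_out_def Inr hp)
  qed (simp add: f'_def f0_def big_out_def)
  show ?thesis
  proof (cases "\<exists>k h. has k h \<and> k \<in> {1, 2, 3}")
   case False
   then have "f' it = f0 it" if "it \<in> set xs" for it using same[of it] that unfolding has_def by metis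
   then have "R' = R" unfolding R'_def R by (simp cong: map_cong)
   then show ?thesis by (simp add: L_def M_def)
  next
   case True
   then obtain h1 h2 h3 where h: "has 1 h1" "has 2 h2" "has 3 h3" using 12 23 31 by blast
   define e where "e k h = (Inr (h, height3 i k h) :: raw_point list + bool \<times> nat)" for k h
   have ne: "e 1 h1 \<noteq> e 2 h2" "e 1 h1 \<noteq> e 3 h3" "e 2 h2 \<noteq> e 3 h3" by (auto simp: e_def height3_def)
   have exs: "e 1 h1 \<in> set xs" "e 2 h2 \<in> set xs" "e 3 h3 \<in> set xs" using h by (auto simp: has_def e_def)
   have fe: "f0 (e k h) = map ?m (strands3 b c d k h)" if "k \<in> {1, 2, 3}" for k h
    using f0_has[OF that] by (simp add: e_def)
   define f1 where "f1 = f0(e 1 h1 := rev (f0 (e 1 h1)))"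
   define f2 where "f2 = f1(e 2 h2 := rev (f0 (e 2 h2)))"
   define f3 where "f3 = f2(e 3 h3 := rev (f0 (e 3 h3)))"
   have f12: "f1 (e 2 h2) = f0 (e 2 h2)" "f2 (e 3 h3) = f0 (e 3 h3)" using ne by (auto simp: f1_def f2_def)
   have f3: "f3 it = f' it" if it: "it \<in> set xs" for it
   proof (cases "it \<in> {e 1 h1, e 2 h2, e 3 h3}")
    case True
    then show ?thesis using ne by (auto simp: f3_def f2_def f1_def f'_def f0_def e_def big_out_def rev_map)
   next
    case False
    then have "f3 it = f0 it" by (auto simp: f3_def f2_def f1_def)
    also have "\<dots> = f' it"
    proof (rule same, rule notI)
     fix k h' assume k: "it = Inr (h', height3 i k h')" "k \<in> {1, 2, 3}"
     then have "has k h'" using it by (simp add: has_def)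
     then have "it = e k h'" "h' = (if k = 1 then h1 else if k = 2 then h2 else h3)"
      using k unique h by (auto simp: e_def)
     then show False using False k(2) by auto
    qed
    finally show ?thesis .
   qed
   have R'3: "R' = concat (map f3 xs)" unfolding R'_def using f3 by (simp cong: map_cong)
   let ?x1 = "?m (Raw 0 b h1 b)" and ?y1 = "?m (Raw 1 c h1 c)"
   let ?x2 = "?m (Raw 0 (\<not> b) h2 b)" and ?z2 = "?m (Raw 2 d h2 d)"
   let ?y3 = "?m (Raw 1 (\<not> c) h3 c)" and ?z3 = "?m (Raw 2 (\<not> d) h3 d)"
   have fs: "f0 (e 1 h1) = (if h1 then [?x1, ?y1] else [?y1, ?x1])"
    "f0 (e 2 h2) = (if h2 then [?x2, ?z2] else [?z2, ?x2])"
    "f0 (e 3 h3) = (if h3 then [?y3, ?z3] else [?z3, ?y3])" by (simp_all add: fe strands3_def)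
   define R1 where "R1 = concat (map f1 xs)"
   define R2 where "R2 = concat (map f2 xs)"
   have sw: "swap_adj p q (concat (map f xs)) (concat (map (f(e' := rev (f e'))) xs))"
    if "distinct (concat (map f xs))" "e' \<in> set xs" "f e' = (if h then [p, q] else [q, p])" for f e' h p q
   proof (cases h)
    case True
    then show ?thesis using swap_adj_concat[OF that(1,2), of p q] that(3) by simp
   next
    case False
    then have *: "f e' = [q, p]" "rev (f e') = [p, q]" using that(3) by simp_all
    show ?thesis using swap_adj_concat[OF that(1,2) *(1), THEN swap_adj_sym] unfolding *(2) .
   qed
   have s1: "swap_adj ?x1 ?y1 R R1"
    unfolding R R1_def f1_def using sw[of f0 "e 1 h1" h1 ?x1 ?y1] dR[unfolded R] exs(1) fs(1) by blast
   have s2: "swap_adj ?x2 ?z2 R1 R2" unfolding R1_def R2_def f2_def f12(1)[symmetric]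
    using sw[of f1 "e 2 h2" h2 ?x2 ?z2] swap_adj_distinct[OF s1 dR, unfolded R1_def] exs(2)
     fs(2)[folded f12(1)] by blast
   have s3: "swap_adj ?y3 ?z3 R2 R'" unfolding R2_def R'3 f3_def f12(2)[symmetric]
    using sw[of f2 "e 3 h3" h3 ?y3 ?z3] exs(3) fs(3)[folded f12(2)]
     swap_adj_distinct[OF s2 swap_adj_distinct[OF s1 dR], unfolded R2_def] by blast
   have in_R: "?x1 \<in> set R" "?y1 \<in> set R" "?x2 \<in> set R" "?z2 \<in> set R" "?y3 \<in> set R" "?z3 \<in> set R"
    by (rule mem[OF h(1)] mem[OF h(2)] mem[OF h(3)]; simp add: strands3_def)+
   have mt: "?pt y = mate (?pt x)" if "x \<in> set R" "y \<in> set R" "raw_label y = raw_label x" "raw_over y \<noteq> raw_over x" for x y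
    using wf_code_label[OF wfL, of "?pt x" "?pt y"] that by (auto simp: L_def dest: arg_cong[of _ _ is_over])
   have mates: "?pt ?x2 = mate (?pt ?x1)" "?pt ?y3 = mate (?pt ?y1)" "?pt ?z3 = mate (?pt ?z2)"
    by (rule mt[OF in_R(1,3)] mt[OF in_R(2,5)] mt[OF in_R(4,6)]; simp)+
   \<comment> \<open>A twist depends on the two headings only: negating the flag changes the sign of
     the crossing and also exchanges over and under.\<close>
   have tw: "twist (?pt ?x1) = (if h1 = h2 then - 1 else 1)" "twist (?pt ?y1) = (if h1 = h3 then - 1 else 1)"
    "twist (?pt ?z2) = (if h2 = h3 then - 1 else 1)"
    using psign_raw_to_point[OF wfR in_R(1,3)] psign_raw_to_point[OF wfR in_R(2,5)]
     psign_raw_to_point[OF wfR in_R(4,6)] by (auto simp: twist_def)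
   have lv: "lv L (?pt p) (?pt q) - 1 = (if h then 1 else - 1)"
    if e': "e' \<in> set xs" "f0 e' = (if h then [p, q] else [q, p])" for e' p q h
   proof -
    obtain ys zs where "xs = ys @ e' # zs" using e'(1) by (meson split_list)
    then have "L = map ?pt (concat (map f0 ys)) @ map ?pt (f0 e') @ map ?pt (concat (map f0 zs))" by (simp add: L_def R)
    then obtain A B where AB: "L = A @ map ?pt (f0 e') @ B" by blast
    have dL: "distinct L" using wf_code_distinct[OF wfL] .
    show ?thesis
    proof (cases h)
     case True
     then have L1: "L = A @ [?pt p, ?pt q] @ B" using AB e'(2) by simp
     show ?thesis using lv_consecutive(1)[OF dL[unfolded L1]] True unfolding L1 by simp
    next
     case False
     then have L1: "L = A @ [?pt q, ?pt p] @ B" using AB e'(2) by simp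
     show ?thesis using lv_consecutive(2)[OF dL[unfolded L1]] False unfolding L1 by simp
    qed
   qed
   show ?thesis
   proof (rule same_polynomials_R3[OF wfL])
    show "swap_adj (?pt ?x1) (?pt ?y1) L (map ?pt R1)" unfolding L_def by (rule swap_adj_map[OF s1])
    show "swap_adj (mate (?pt ?x1)) (?pt ?z2) (map ?pt R1) (map ?pt R2)"
     unfolding mates[symmetric] by (rule swap_adj_map[OF s2])
    show "swap_adj (mate (?pt ?y1)) (mate (?pt ?z2)) (map ?pt R2) M"
     unfolding mates[symmetric] M_def by (rule swap_adj_map[OF s3])
    show "(lv L (?pt ?x1) (?pt ?y1) - 1) * (lv L (mate (?pt ?x1)) (?pt ?z2) - 1) = twist (?pt ?y1) * twist (?pt ?z2)"
     unfolding mates[symmetric] lv[OF exs(1) fs(1)] lv[OF exs(2) fs(2)] tw by auto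
    show "(lv L (?pt ?x1) (?pt ?y1) - 1) * (lv L (mate (?pt ?y1)) (mate (?pt ?z2)) - 1) = twist (?pt ?x1) * twist (?pt ?z2)"
     unfolding mates[symmetric] lv[OF exs(1) fs(1)] lv[OF exs(3) fs(3)] tw by auto
   qed simp_all
  qed
 qed
 ultimately show ?thesis unfolding L using same_polynomials_trans by metis
qed


text \<open>The only crossing occupies the middle one of three slots, hence the label 1.\<close>

lemma traverse_R1:
 assumes "l = [(Birth, Suc i), (Real b, i), (Death, Suc i)] \<or> l = [(Birth, i), (Real b, Suc i), (Death, i)]"
 shows "\<exists>ps. (ps = [] \<or> (\<exists>x y. ps = [x, y] \<and> raw_label x = 1 \<and> raw_label y = 1)) \<and>
  (\<exists>hp. traverse l h p (ps, hp) \<and> traverse [] h p ([], hp))"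
 using assms
proof
 assume l: "l = [(Birth, Suc i), (Real b, i), (Death, Suc i)]"
 show ?thesis unfolding l by (cases h; rule height_cases3[of p i]; simp add: traverse_simps)
next
 assume l: "l = [(Birth, i), (Real b, Suc i), (Death, i)]"
 show ?thesis unfolding l by (cases h; rule height_cases3[of p i]; simp add: traverse_simps)
qed

lemma traverse_R2:
 "\<exists>ps. (ps = [] \<or> (\<exists>x y. ps = [x, y] \<and> {raw_label x, raw_label y} = {0, 1} \<and>
    raw_over x = raw_over y \<and> raw_right x = raw_right y \<and> raw_flag x \<noteq> raw_flag y)) \<and>
  (\<exists>hp. traverse [(Real b, i), (Real (\<not> b), i)] h p (ps, hp) \<and> traverse [] h p ([], hp))"
 by (cases h; rule height_cases3[of p i]; simp add: traverse_simps doubleton_eq_iff)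

section \<open>Invariance of the polynomials under all moves of diagrams\<close>

lemma same_polynomials_similar_move:
 assumes "isotopy_move l r \<or> virtual_move l r \<or> mixed_move l r" "long_diagram (u @ l @ v)" "long_diagram (u @ r @ v)"
 shows "same_polynomials (diagram_code (u @ l @ v)) (diagram_code (u @ r @ v))"
proof -
 have "\<exists>f g. similar_blocks f g l r \<and> l \<noteq> [] \<and> inj_on f {..<length l}" using assms(1)
 proof (elim disjE)
  assume "isotopy_move l r"
  then show ?thesis
   by cases (hypsubst, intro exI conjI, (rule similar_moves | (rule similar_far, assumption)), simp, fastforce simp: inj_on_def)+
 next
  assume "virtual_move l r"
  then show ?thesis
   by cases (hypsubst, intro exI conjI, (rule similar_moves | (rule similar_far, assumption)), simp, fastforce simp: inj_on_def)+
 next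
  assume "mixed_move l r"
  then show ?thesis
   by cases (hypsubst, intro exI conjI, (rule similar_moves | (rule similar_far, assumption)), simp, fastforce simp: inj_on_def)+
 qed
 then show ?thesis using same_polynomials_similar[OF _ _ _ assms(2,3)] by blast
qed

lemma same_polynomials_real_move:
 assumes "real_move l r" "long_diagram (u @ l @ v)" "long_diagram (u @ r @ v)"
 shows "same_polynomials (diagram_code (u @ l @ v)) (diagram_code (u @ r @ v))"
proof -
 have kink: "same_polynomials (diagram_code (u @ l @ v)) (diagram_code (u @ [] @ v))"
  if l: "l = [(Birth, Suc i), (Real b, i), (Death, Suc i)] \<or> l = [(Birth, i), (Real b, Suc i), (Death, i)]"
   and long: "long_diagram (u @ l @ v)" "long_diagram (u @ [] @ v)" for l i b
 proof -
  have "\<forall>h p. \<exists>ps. (ps = [] \<or> (\<exists>x y. ps = [x, y] \<and> raw_label x = 1 \<and> raw_label y = 1)) \<and>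
   (\<exists>hp. traverse l h p (ps, hp) \<and> traverse [] h p ([], hp))"
   using traverse_R1[OF l] by blast
  then obtain Out where Out: "\<And>h p. (Out h p = [] \<or> (\<exists>x y. Out h p = [x, y] \<and> raw_label x = 1 \<and> raw_label y = 1)) \<and>
   (\<exists>hp. traverse l h p (Out h p, hp) \<and> traverse [] h p ([], hp))"
   by metis
  show ?thesis by (rule same_polynomials_remove_R1[of l Out 1, OF _ _ _ long]) (use Out l in blast)+
 qed
 have bigon: "same_polynomials (diagram_code (u @ l @ v)) (diagram_code (u @ [] @ v))"
  if l: "l = [(Real b, i), (Real (\<not> b), i)]"
   and long: "long_diagram (u @ l @ v)" "long_diagram (u @ [] @ v)" for l i b
 proof -
  have "\<forall>h p. \<exists>ps. (ps = [] \<or> (\<exists>x y. ps = [x, y] \<and> {raw_label x, raw_label y} = {0, 1} \<and>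
    raw_over x = raw_over y \<and> raw_right x = raw_right y \<and> raw_flag x \<noteq> raw_flag y)) \<and>
   (\<exists>hp. traverse l h p (ps, hp) \<and> traverse [] h p ([], hp))"
   unfolding l using traverse_R2 by blast
  then obtain Out where Out: "\<And>h p. (Out h p = [] \<or> (\<exists>x y. Out h p = [x, y] \<and> {raw_label x, raw_label y} = {0, 1} \<and>
    raw_over x = raw_over y \<and> raw_right x = raw_right y \<and> raw_flag x \<noteq> raw_flag y)) \<and>
   (\<exists>hp. traverse l h p (Out h p, hp) \<and> traverse [] h p ([], hp))"
   by metis
  show ?thesis
  proof (rule same_polynomials_remove_R2[of l Out, OF _ _ _ _ long])
   show "l \<noteq> []" "length l = 2" by (simp_all add: l)
  qed (use Out in blast)+
 qed
 from assms show ?thesis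
 proof (induction rule: real_move.induct)
  case (R1_above i b)
  show ?case by (rule kink[OF _ R1_above]) blast
 next
  case (R1_below i b)
  show ?case by (rule kink[OF _ R1_below]) blast
 next
  case (R2 b i)
  show ?case by (rule bigon[OF refl R2])
 next
  case (R3 b d c i)
  show ?case by (rule same_polynomials_move_R3[OF R3(2,3)])
 qed
qed

theorem same_polynomials_move:
 assumes "move D E"
 shows "same_polynomials (diagram_code D) (diagram_code E)"
proof -
 obtain u v l r where "long_diagram D" "long_diagram E" "D = u @ l @ v" "E = u @ r @ v"
  "isotopy_move l r \<or> real_move l r \<or> virtual_move l r \<or> mixed_move l r"
  using assms unfolding move_def by blast
 then show ?thesis using same_polynomials_similar_move same_polynomials_real_move by blast
qed

theorem same_polynomials_diagram_equiv:
 assumes "(D, E) \<in> diagram_equiv"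
 shows "same_polynomials (diagram_code D) (diagram_code E)"
proof -
 have "equivclp move D E" using assms by (simp add: diagram_equiv_def)
 then show ?thesis
 proof (induction rule: equivclp_induct)
  case (step y z)
  then show ?case using same_polynomials_move same_polynomials_sym same_polynomials_trans by blast
 qed simp
qed

section \<open>Cyclic order along an orbit\<close>

text \<open>The points strictly between \<open>x\<close> and \<open>y\<close> in the cyclic order of
  the orbit. For the rotation at a vertex these are the darts to the left of a strand that leaves
  along \<open>x\<close> and has arrived along the edge of \<open>y\<close>.\<close>

definition arc :: "('a \<Rightarrow> 'a) \<Rightarrow> 'a \<Rightarrow> 'a \<Rightarrow> 'a set" where
 "arc f x y = {(f ^^ n) x |n. 0 < n \<and> n < funpow_dist f x y}"

context
 fixes f :: "'a \<Rightarrow> 'a" and b :: 'a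
 assumes self: "b \<in> orbit f b"
begin

definition period :: nat where
 "period = funpow_dist1 f b b"

lemma period_pos: "0 < period" by (simp add: period_def)

lemma funpow_period: "(f ^^ period) b = b" unfolding period_def by (rule funpow_dist1_prop[OF self])

lemma funpow_inj: "i < period \<Longrightarrow> j < period \<Longrightarrow> (f ^^ i) b = (f ^^ j) b \<Longrightarrow> i = j"
proof (induction i j rule: linorder_wlog)
 case (le i j)
 have "(f ^^ (period - j + i)) b = (f ^^ (period - j)) ((f ^^ i) b)" by (simp add: funpow_add)
 also have "\<dots> = (f ^^ (period - j)) ((f ^^ j) b)" using le by simp
 also have "\<dots> = (f ^^ (period - j + j)) b" by (simp only: funpow_add o_apply)
 also have "\<dots> = b" using le funpow_period by simp
 finally have "(f ^^ (period - j + i)) b = b" .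
 then have "\<not> (0 < period - j + i \<and> period - j + i < period)"
  using funpow_dist1_least[of "period - j + i" f b b] unfolding period_def by auto
 then show ?case using le by linarith
qed auto

lemma funpow_eq_iff: "(f ^^ i) b = (f ^^ j) b \<longleftrightarrow> i mod period = j mod period"
 using funpow_mod_eq[OF funpow_period, of i] funpow_mod_eq[OF funpow_period, of j]
  funpow_inj[of "i mod period" "j mod period"] period_pos by (metis mod_less_divisor)

lemma orbit_position:
 assumes "d \<in> orbit f b"
 obtains i where "i < period" "d = (f ^^ i) b" using assms orbit_altdef_bounded[OF funpow_period period_pos] by auto

lemma funpow_dist_position:
 assumes "i < period" "j < period"
 shows "funpow_dist f ((f ^^ i) b) ((f ^^ j) b) = (if i \<le> j then j - i else period - i + j)"
proof -
 define n where "n = (if i \<le> j then j - i else period - i + j)"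
 have n: "n < period" "(i + n) mod period = j mod period" using assms by (auto simp: n_def)
 have *: "(f ^^ k) ((f ^^ i) b) = (f ^^ j) b \<longleftrightarrow> (i + k) mod period = j mod period" for k
  using funpow_eq_iff[of "k + i" j, unfolded funpow_add o_apply] by (simp add: add.commute)
 have "funpow_dist f ((f ^^ i) b) ((f ^^ j) b) = n" unfolding funpow_dist_def
 proof (rule Least_equality)
  show "(f ^^ n) ((f ^^ i) b) = (f ^^ j) b" using * n by simp
  fix k assume "(f ^^ k) ((f ^^ i) b) = (f ^^ j) b"
  then have "(i + k) mod period = (i + n) mod period" using * n by simp
  then have "(period - i + (i + k)) mod period = (period - i + (i + n)) mod period" by (metis mod_add_right_eq)
  then have "k mod period = n mod period" using assms(1) by simp
  then show "n \<le> k" using n(1) by (metis mod_less mod_less_eq_dividend)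
 qed
 then show ?thesis by (simp add: n_def)
qed

text \<open>With positions counted from \<open>b\<close>, an arc is an interval when
  \<open>i < j\<close> and wraps around otherwise. Questions about cyclic order thereby become
  linear arithmetic.\<close>

lemma arc_position:
 assumes "i < period" "j < period" "k < period" "i \<noteq> j"
 shows "(f ^^ k) b \<in> arc f ((f ^^ i) b) ((f ^^ j) b) \<longleftrightarrow> (if i < j then i < k \<and> k < j else i < k \<or> k < j)"
proof -
 let ?n = "if i \<le> j then j - i else period - i + j"
 have "(f ^^ k) b \<in> arc f ((f ^^ i) b) ((f ^^ j) b) \<longleftrightarrow> (\<exists>n. 0 < n \<and> n < ?n \<and> (f ^^ k) b = (f ^^ (n + i)) b)"
  unfolding arc_def funpow_dist_position[OF assms(1,2)] by (auto simp: funpow_add)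
 also have "\<dots> \<longleftrightarrow> (\<exists>n. 0 < n \<and> n < ?n \<and> k = (n + i) mod period)"
  using funpow_eq_iff[of k] assms(3) by simp
 also have "\<dots> \<longleftrightarrow> (if i < j then i < k \<and> k < j else i < k \<or> k < j)"
 proof (cases "i < j")
  case True
  have "k = (n + i) mod period \<longleftrightarrow> k = n + i" if "n < j - i" for n
   using that assms by (simp add: less_diff_conv)
  then have "(\<exists>n. 0 < n \<and> n < ?n \<and> k = (n + i) mod period) \<longleftrightarrow> (\<exists>n. 0 < n \<and> n < j - i \<and> k = n + i)"
   using True by auto
  also have "\<dots> \<longleftrightarrow> i < k \<and> k < j" using assms True by (auto intro: exI[of _ "k - i"])
  finally show ?thesis using True by simp
 next
  case False
  then have "j < i" using assms(4) by simp
  have "(\<exists>n. 0 < n \<and> n < period - i + j \<and> k = (n + i) mod period) \<longleftrightarrow> i < k \<or> k < j"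
  proof
   assume "\<exists>n. 0 < n \<and> n < period - i + j \<and> k = (n + i) mod period"
   then obtain n where n: "0 < n" "n < period - i + j" "k = (n + i) mod period" by blast
   show "i < k \<or> k < j"
   proof (cases "n + i < period")
    case False
    moreover have "n + i - period < period" using n(2) assms \<open>j < i\<close> by linarith
    ultimately have "k = n + i - period" using n(3) by (simp add: le_mod_geq)
    then show ?thesis using n(2) False assms by linarith
   qed (use n in simp)
  next
   assume "i < k \<or> k < j"
   then show "\<exists>n. 0 < n \<and> n < period - i + j \<and> k = (n + i) mod period"
   proof
    assume "i < k"
    then show ?thesis using assms by (intro exI[of _ "k - i"]) auto
   next
    assume "k < j"
    then show ?thesis using assms \<open>j < i\<close> by (intro exI[of _ "period - i + k"]) auto
   qed
  qed
  then show ?thesis using \<open>j < i\<close> by simp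
 qed
 finally show ?thesis .
qed

end

lemma orbit_eq_iff_mem:
 assumes "\<And>x. x \<in> orbit f x"
 shows "orbit f x = orbit f y \<longleftrightarrow> x \<in> orbit f y"
proof
 show "x \<in> orbit f y" if "orbit f x = orbit f y" using assms that by blast
 assume x: "x \<in> orbit f y"
 show "orbit f x = orbit f y" using x orbit_swap[OF assms x] orbit_trans by (metis subsetI subset_antisym)
qed

text \<open>
 Two strands through a vertex, leaving along \<open>u\<close> and \<open>v\<close> and arriving from \<open>u'\<close> and \<open>v'\<close>.
\<close>

lemma transversal_arcs:
 assumes self: "u \<in> orbit f u" and mem: "v \<in> orbit f u" "u' \<in> orbit f u" "v' \<in> orbit f u"
  and ne: "u \<noteq> v" "u \<noteq> u'" "u \<noteq> v'" "v \<noteq> u'" "v \<noteq> v'" "u' \<noteq> v'"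
  and tr: "(v \<in> arc f u u') \<noteq> (v' \<in> arc f u u')"
 shows "u \<in> arc f v v' \<longleftrightarrow> v \<notin> arc f u u'" "u' \<in> arc f v v' \<longleftrightarrow> v \<in> arc f u u'"
  and "v \<in> arc f u v' \<longleftrightarrow> v \<in> arc f u u'" "u' \<in> arc f u v' \<longleftrightarrow> v \<in> arc f u u'"
  and "u \<in> arc f v u' \<longleftrightarrow> v \<notin> arc f u u'" "v' \<in> arc f v u' \<longleftrightarrow> v \<notin> arc f u u'"
  and "x \<in> {u, v, u', v'} \<Longrightarrow> y \<in> {u, v, u', v'} \<Longrightarrow> x \<noteq> y \<Longrightarrow> x \<notin> arc f x y \<and> y \<notin> arc f x y"
proof -
 obtain a where a: "a < period f u" "u' = (f ^^ a) u" using orbit_position[OF self mem(2)] by blast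
 obtain p where p: "p < period f u" "v = (f ^^ p) u" using orbit_position[OF self mem(1)] by blast
 obtain q where q: "q < period f u" "v' = (f ^^ q) u" using orbit_position[OF self mem(3)] by blast
 have 0: "0 < period f u" "u = (f ^^ 0) u" using period_pos[OF self] by auto
 note ap = arc_position[OF self]
 have d: "a \<noteq> 0" "p \<noteq> 0" "q \<noteq> 0" "a \<noteq> p" "a \<noteq> q" "p \<noteq> q"
  using ne a(2) p(2) q(2) by (metis funpow_0)+
 note uu' = ap[OF 0(1) a(1) p(1), folded a(2) p(2), simplified] ap[OF 0(1) a(1) q(1), folded a(2) q(2), simplified]
 have tr': "(p < a) \<noteq> (q < a)" using tr uu' d by auto
 have v: "v \<in> arc f u u' \<longleftrightarrow> p < a" using uu' d by auto
 show "u \<in> arc f v v' \<longleftrightarrow> v \<notin> arc f u u'" "u' \<in> arc f v v' \<longleftrightarrow> v \<in> arc f u u'"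
  using ap[OF p(1) q(1) 0(1), folded p(2) q(2), simplified] ap[OF p(1) q(1) a(1), folded p(2) q(2) a(2)] d tr' v
  by (auto split: if_splits)
 show "v \<in> arc f u v' \<longleftrightarrow> v \<in> arc f u u'" "u' \<in> arc f u v' \<longleftrightarrow> v \<in> arc f u u'"
  using ap[OF 0(1) q(1) p(1), folded p(2) q(2), simplified] ap[OF 0(1) q(1) a(1), folded q(2) a(2), simplified] d tr' v
  by (auto split: if_splits)
 show "u \<in> arc f v u' \<longleftrightarrow> v \<notin> arc f u u'" "v' \<in> arc f v u' \<longleftrightarrow> v \<notin> arc f u u'"
  using ap[OF p(1) a(1) 0(1), folded p(2) a(2), simplified] ap[OF p(1) a(1) q(1), folded p(2) q(2) a(2)] d tr' v
  by (auto split: if_splits)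
 show "x \<notin> arc f x y \<and> y \<notin> arc f x y" if xy: "x \<in> {u, v, u', v'}" "y \<in> {u, v, u', v'}" "x \<noteq> y"
 proof -
  have pos: "\<exists>i<period f u. x = (f ^^ i) u" if "x \<in> {u, v, u', v'}" for x
   using that a p q 0(1) by (auto intro: exI[of _ "0 :: nat"])
  obtain i where i: "i < period f u" "x = (f ^^ i) u" using pos[OF xy(1)] by blast
  obtain j where j: "j < period f u" "y = (f ^^ j) u" using pos[OF xy(2)] by blast
  have "i \<noteq> j" using i j xy(3) by auto
  then show ?thesis using ap[OF i(1) j(1) i(1)] ap[OF i(1) j(1) j(1)] i(2) j(2) by auto
 qed
qed

section \<open>Intersection numbers on surfaces\<close>

locale surface_curve =
 fixes S :: surface_diagram
 assumes surface: "closed_surface S" and diagram: "curve_diagram S"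
begin

abbreviation "m \<equiv> length (curve S)"
abbreviation "out t \<equiv> curve S ! t"
abbreviation "arr t \<equiv> arrival S (curve S) t"

definition prev :: "nat \<Rightarrow> nat" where
 "prev t = (t + m - 1) mod m"

lemma m_pos: "0 < m" using diagram by (simp add: curve_diagram_def)

lemma prev_less [simp]: "prev t < m" unfolding prev_def by (rule mod_less_divisor[OF m_pos])

lemma prev_pos:
 assumes "0 < t" "t < m"
 shows "prev t = t - 1"
proof -
 have *: "t + m - 1 = (t - 1) + m" using assms(1) by simp
 show ?thesis unfolding prev_def * mod_add_self2 by (rule mod_less) (use assms in linarith)
qed

lemma prev_0: "prev 0 = m - 1" unfolding prev_def add_0 by (rule mod_less) (use m_pos in linarith)

lemma arr_eq: "arr t = opp S (out (prev t))" by (simp add: arrival_def prev_def)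

lemma finite_darts: "finite (darts S)" and opp_perm: "opp S permutes darts S"
 and rot_perm: "rot S permutes darts S"
 and opp_opp [simp]: "d \<in> darts S \<Longrightarrow> opp S (opp S d) = d" and opp_neq: "d \<in> darts S \<Longrightarrow> opp S d \<noteq> d"
 using surface by (auto simp: closed_surface_def)

lemma out_mem [simp]: "t < m \<Longrightarrow> out t \<in> darts S" using diagram by (auto simp: curve_diagram_def)

lemma opp_mem [simp]: "d \<in> darts S \<Longrightarrow> opp S d \<in> darts S"
 using opp_perm by (simp add: permutes_in_image)

lemma arr_mem [simp]: "arr t \<in> darts S" by (simp add: arr_eq)

lemma self_orbit: "x \<in> orbit (rot S) x"
proof (rule permutation_self_in_orbit)
 show "permutation (rot S)"
  unfolding permutation_permutes using rot_perm finite_darts by (intro exI[of _ "darts S"]) simp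
qed

lemma vertex_eq_iff: "vertex S d = vertex S e \<longleftrightarrow> d \<in> vertex S e"
 unfolding vertex_def by (rule orbit_eq_iff_mem[OF self_orbit])

lemma distinct_curve: "distinct (curve S @ map (opp S) (curve S))" using diagram by (simp add: curve_diagram_def)

lemma out_eq_iff [simp]: "s < m \<Longrightarrow> t < m \<Longrightarrow> out s = out t \<longleftrightarrow> s = t"
 using distinct_curve by (simp add: nth_eq_iff_index_eq)

lemma out_neq_opp: "s < m \<Longrightarrow> t < m \<Longrightarrow> out s \<noteq> opp S (out t)"
 using distinct_curve by (auto simp: disjoint_iff) (metis image_eqI nth_mem)

lemma out_neq_arr [simp]: "s < m \<Longrightarrow> out s \<noteq> arr t" "s < m \<Longrightarrow> arr t \<noteq> out s"
 using out_neq_opp[of s "prev t"] by (auto simp: arr_eq)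

lemma prev_eq_iff [simp]: "s < m \<Longrightarrow> t < m \<Longrightarrow> prev s = prev t \<longleftrightarrow> s = t"
 using prev_pos[of s] prev_pos[of t] prev_0 by (cases "s = 0"; cases "t = 0") auto

lemma arr_eq_iff [simp]: "s < m \<Longrightarrow> t < m \<Longrightarrow> arr s = arr t \<longleftrightarrow> s = t"
 unfolding arr_eq by (metis opp_opp out_eq_iff out_mem prev_eq_iff prev_less)

lemma prev_surj: "s < m \<Longrightarrow> \<exists>t<m. prev t = s"
 using prev_pos[of "Suc s"] prev_0 m_pos by (cases "Suc s = m") (auto intro: exI[of _ "Suc s"])

lemma arr_vertex: "t < m \<Longrightarrow> arr t \<in> vertex S (out t)" using diagram by (simp add: curve_diagram_def)

definition same_vertex :: "nat \<Rightarrow> nat \<Rightarrow> bool" where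
 "same_vertex s t \<longleftrightarrow> s < m \<and> t < m \<and> vertex S (out s) = vertex S (out t)"

lemma at_most_two:
 assumes "same_vertex s t" "same_vertex s u" "s \<noteq> t" "s \<noteq> u"
 shows "t = u"
proof (rule ccontr)
 assume "t \<noteq> u"
 have "{s, t, u} \<subseteq> {r. r < m \<and> out r \<in> vertex S (out s)}"
  using assms by (auto simp: same_vertex_def vertex_eq_iff[symmetric])
 then have "card {s, t, u} \<le> card {r. r < m \<and> out r \<in> vertex S (out s)}" by (intro card_mono) auto
 also have "\<dots> \<le> 2" using diagram assms(1) by (simp add: curve_diagram_def same_vertex_def)
 finally show False using assms \<open>t \<noteq> u\<close> by simp
qed

definition crossing_time :: "nat \<Rightarrow> bool" where
 "crossing_time t \<longleftrightarrow> (\<exists>u. u \<noteq> t \<and> same_vertex t u)"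

text \<open>The default value \<open>t\<close> at times without a crossing makes this an involution,
  and later turns these times into points of degree two.\<close>

definition partner :: "nat \<Rightarrow> nat" where
 "partner t = (if crossing_time t then THE u. u \<noteq> t \<and> same_vertex t u else t)"

lemma same_vertex_sym: "same_vertex s t \<longleftrightarrow> same_vertex t s" by (auto simp: same_vertex_def)

lemma partner_eqI: "same_vertex t u \<Longrightarrow> u \<noteq> t \<Longrightarrow> partner t = u"
 unfolding partner_def crossing_time_def using at_most_two by (auto intro!: the_equality)

lemma crossing_partner:
 assumes "crossing_time t"
 shows "same_vertex t (partner t)" "partner t \<noteq> t" "crossing_time (partner t)" "partner (partner t) = t"
  "t < m" "partner t < m"
proof -
 obtain u where u: "u \<noteq> t" "same_vertex t u" using assms by (auto simp: crossing_time_def)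
 then have p: "partner t = u" "partner u = t" using partner_eqI same_vertex_sym by metis+
 then show "same_vertex t (partner t)" "partner t \<noteq> t" "partner (partner t) = t" "t < m" "partner t < m"
  using u by (auto simp: same_vertex_def)
 show "crossing_time (partner t)" unfolding crossing_time_def p using u same_vertex_sym by metis
qed

lemma crossings_iff: "(s, t) \<in> crossings S \<longleftrightarrow> crossing_time s \<and> t = partner s \<and> s < t"
proof
 assume "(s, t) \<in> crossings S"
 then have *: "same_vertex s t" "t \<noteq> s" "s < t" by (auto simp: crossings_def same_vertex_def)
 then show "crossing_time s \<and> t = partner s \<and> s < t"
  using partner_eqI[OF *(1,2)] unfolding crossing_time_def by blast
next
 assume "crossing_time s \<and> t = partner s \<and> s < t"
 then show "(s, t) \<in> crossings S" using crossing_partner(1,6)[of s] by (auto simp: crossings_def same_vertex_def)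
qed

text \<open>The value is 1 iff the other strand leaves to the left, so that it crosses from right to
  left; this is the twist of the passage, see \<open>twist_pt\<close>.\<close>

definition eta :: "nat \<Rightarrow> int" where
 "eta t = (if out (partner t) \<in> arc (rot S) (out t) (arr t) then 1 else - 1)"

lemma left_darts_arc: "left_darts S c t = arc (rot S) (c ! t) (arrival S c t)" by (simp add: left_darts_def arc_def)

lemma crossing_darts:
 assumes "crossing_time u"
 shows "out (partner u) \<in> orbit (rot S) (out u)" "arr u \<in> orbit (rot S) (out u)"
  "arr (partner u) \<in> orbit (rot S) (out u)"
  "out u \<noteq> out (partner u)" "out u \<noteq> arr u" "out u \<noteq> arr (partner u)" "out (partner u) \<noteq> arr u"
  "out (partner u) \<noteq> arr (partner u)" "arr u \<noteq> arr (partner u)"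
proof -
 note p = crossing_partner[OF assms]
 have v: "vertex S (out (partner u)) = vertex S (out u)" using p(1) by (simp add: same_vertex_def)
 then show "out (partner u) \<in> orbit (rot S) (out u)" using vertex_eq_iff by (auto simp: vertex_def)
 show "arr u \<in> orbit (rot S) (out u)" "arr (partner u) \<in> orbit (rot S) (out u)"
  using arr_vertex[OF p(5)] arr_vertex[OF p(6)] v by (auto simp: vertex_def)
qed (use crossing_partner[OF assms] in auto)

lemma crossing_less_pos:
 assumes "crossing_time u" "u < partner u"
 shows "0 < u" "(out (partner u) \<in> arc (rot S) (out u) (arr u)) \<noteq> (arr (partner u) \<in> arc (rot S) (out u) (arr u))"
  "(u \<in> over S) \<noteq> (partner u \<in> over S)"
proof -
 have "(u, partner u) \<in> crossings S" using assms crossings_iff by blast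
 then show "0 < u" "(out (partner u) \<in> arc (rot S) (out u) (arr u)) \<noteq> (arr (partner u) \<in> arc (rot S) (out u) (arr u))"
  "(u \<in> over S) \<noteq> (partner u \<in> over S)" using diagram by (auto simp: curve_diagram_def left_darts_arc)
qed

lemma crossing_pos: "crossing_time u \<Longrightarrow> 0 < u"
 using crossing_less_pos(1)[of u] crossing_less_pos(1)[of "partner u"] crossing_partner[of u]
 by (cases "u < partner u") auto

lemma eta_partner:
 assumes "crossing_time u"
 shows "eta (partner u) = - eta u"
proof -
 have *: "eta (partner u) = - eta u" if u: "crossing_time u" "u < partner u" for u
  using transversal_arcs(1)[OF self_orbit crossing_darts[OF u(1)] crossing_less_pos(2)[OF u]]
   crossing_partner(4)[OF u(1)] by (simp add: eta_def)
 note p = crossing_partner[OF assms]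
 show ?thesis using *[OF assms] *[OF p(3)] p(2,4) by (cases "u < partner u") auto
qed

text \<open>Curve diagrams state transversality at the earlier passage of a crossing only; at the
  later one it follows from \<open>transversal_arcs\<close> with the strands exchanged. The arcs
  ending at \<open>arr v\<close> occur at the corner of a loop.\<close>

lemma arcs:
 assumes "crossing_time u"
 defines "v \<equiv> partner u"
 shows "out v \<in> arc (rot S) (out u) (arr u) \<longleftrightarrow> eta u = 1" "arr v \<in> arc (rot S) (out u) (arr u) \<longleftrightarrow> eta u \<noteq> 1"
  and "out v \<in> arc (rot S) (out u) (arr v) \<longleftrightarrow> eta u = 1" "arr u \<in> arc (rot S) (out u) (arr v) \<longleftrightarrow> eta u = 1"
  and "x \<in> {out u, out v, arr u, arr v} \<Longrightarrow> y \<in> {out u, out v, arr u, arr v} \<Longrightarrow> x \<noteq> y \<Longrightarrow>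
   x \<notin> arc (rot S) x y \<and> y \<notin> arc (rot S) x y"
proof -
 note p = crossing_partner[OF assms(1), folded v_def]
 note d = crossing_darts[OF assms(1), folded v_def]
 have "(out v \<in> arc (rot S) (out u) (arr u)) \<noteq> (arr v \<in> arc (rot S) (out u) (arr u)) \<and>
  (out v \<in> arc (rot S) (out u) (arr v) \<longleftrightarrow> eta u = 1) \<and> (arr u \<in> arc (rot S) (out u) (arr v) \<longleftrightarrow> eta u = 1) \<and>
  (x \<in> {out u, out v, arr u, arr v} \<longrightarrow> y \<in> {out u, out v, arr u, arr v} \<longrightarrow> x \<noteq> y \<longrightarrow>
   x \<notin> arc (rot S) x y \<and> y \<notin> arc (rot S) x y)"
 proof (cases "u < v")
  case True
  have l: "(out v \<in> arc (rot S) (out u) (arr u)) \<noteq> (arr v \<in> arc (rot S) (out u) (arr u))"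
   using crossing_less_pos(2)[OF assms(1)] True by (simp add: v_def)
  then show ?thesis using transversal_arcs[OF self_orbit d l] by (simp add: eta_def v_def[symmetric])
 next
  case False
  then have lt: "v < partner v" using p by auto
  note d' = crossing_darts[OF p(3), unfolded p(4)]
  have l: "(out u \<in> arc (rot S) (out v) (arr v)) \<noteq> (arr u \<in> arc (rot S) (out v) (arr v))"
   using crossing_less_pos(2)[OF p(3) lt] p(4) by simp
  have e: "eta u = 1 \<longleftrightarrow> out u \<notin> arc (rot S) (out v) (arr v)"
   using eta_partner[OF p(3)] p(4) by (auto simp: eta_def)
  have "{out u, out v, arr u, arr v} = {out v, out u, arr v, arr u}" by auto
  then show ?thesis using transversal_arcs[OF self_orbit d' l] e by simp
 qed
 then show "arr v \<in> arc (rot S) (out u) (arr u) \<longleftrightarrow> eta u \<noteq> 1"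
  "out v \<in> arc (rot S) (out u) (arr v) \<longleftrightarrow> eta u = 1" "arr u \<in> arc (rot S) (out u) (arr v) \<longleftrightarrow> eta u = 1"
  "x \<in> {out u, out v, arr u, arr v} \<Longrightarrow> y \<in> {out u, out v, arr u, arr v} \<Longrightarrow> x \<noteq> y \<Longrightarrow>
   x \<notin> arc (rot S) x y \<and> y \<notin> arc (rot S) x y"
  by (auto simp: eta_def v_def[symmetric])
 show "out v \<in> arc (rot S) (out u) (arr u) \<longleftrightarrow> eta u = 1" by (simp add: eta_def v_def)
qed

end

lemma arc_endpoints:
 assumes "x \<in> orbit f x" "y \<in> orbit f x" "x \<noteq> y"
 shows "x \<notin> arc f x y" "y \<notin> arc f x y"
proof -
 obtain j where j: "j < period f x" "y = (f ^^ j) x" using orbit_position[OF assms(1,2)] by blast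
 have "0 \<noteq> j" using j(2) assms(3) by (metis funpow_0)
 then show "x \<notin> arc f x y" "y \<notin> arc f x y"
  using arc_position[OF assms(1) period_pos[OF assms(1)] j(1) period_pos[OF assms(1)]]
   arc_position[OF assms(1) period_pos[OF assms(1)] j(1) j(1)] j(2) by auto
qed

lemma count_list_distinct: "distinct xs \<Longrightarrow> count_list xs x = of_bool (x \<in> set xs)"
 by (induction xs) auto

context surface_curve
begin

text \<open>Both smoothing loops in one form: the loop leaves the crossing at time \<open>k\<close>
  and comes back at time \<open>partner k\<close>. It is \<alpha> if \<open>k\<close> is the earlier
  passage, and \<beta>, which runs through the basepoint, if \<open>k\<close> is the later
  one.\<close>

definition loop :: "nat \<Rightarrow> nat list" where
 "loop k = (if k < partner k then alpha S (k, partner k) else beta S (partner k, k))"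

definition loop_times :: "nat \<Rightarrow> nat set" where
 "loop_times k = (if k < partner k then {k..<partner k} else {..<partner k} \<union> {k..<m})"

abbreviation on_loop :: "nat \<Rightarrow> nat \<Rightarrow> int" where
 "on_loop k t \<equiv> of_bool (t \<in> loop_times k)"

lemma loop_times_less: "crossing_time k \<Longrightarrow> t \<in> loop_times k \<Longrightarrow> t < m"
 using crossing_partner(5,6)[of k] by (auto simp: loop_times_def split: if_splits)

lemma loop_times_prev:
 assumes k: "crossing_time k" and t: "t < m"
 shows "t = k \<Longrightarrow> t \<in> loop_times k \<and> prev t \<notin> loop_times k"
  "t = partner k \<Longrightarrow> t \<notin> loop_times k \<and> prev t \<in> loop_times k"
  "t \<noteq> k \<Longrightarrow> t \<noteq> partner k \<Longrightarrow> prev t \<in> loop_times k \<longleftrightarrow> t \<in> loop_times k"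
proof -
 note p = crossing_partner[OF k] crossing_pos[OF k] crossing_pos[OF crossing_partner(3)[OF k]]
 have pt: "prev t = (if t = 0 then m - 1 else t - 1)" using prev_0 prev_pos t by auto
 show "t = k \<Longrightarrow> t \<in> loop_times k \<and> prev t \<notin> loop_times k"
  "t = partner k \<Longrightarrow> t \<notin> loop_times k \<and> prev t \<in> loop_times k"
  using p unfolding pt loop_times_def by auto
 show "t \<noteq> k \<Longrightarrow> t \<noteq> partner k \<Longrightarrow> prev t \<in> loop_times k \<longleftrightarrow> t \<in> loop_times k"
  using p t unfolding pt loop_times_def by auto
qed

text \<open>A loop has the same predecessors as the curve except at its corner \<open>k\<close>,
  which it reaches along the edge arriving at \<open>partner k\<close>. The map \<open>g\<close>
  lists the times of the loop.\<close>

lemma loop_sum_aux: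
 assumes g: "bij_betw g {..<length a} T" and a: "\<And>j. j < length a \<Longrightarrow> a ! j = out (g j)"
  and prv: "\<And>j. j < length a \<Longrightarrow>
   g (if j = 0 then length a - 1 else j - 1) = (if g j = k then prev (partner k) else prev (g j))"
 shows "set a = out ` T" "intersection_number S a b =
  (\<Sum>t\<in>T. \<Sum>d\<in>arc (rot S) (out t) (if t = k then arr (partner k) else arr t). outflow S b d)"
proof -
 have "set a = (\<lambda>k. a ! k) ` {..<length a}" by (auto simp: set_conv_nth)
 also have "\<dots> = out ` g ` {..<length a}" using a by (auto simp: image_image)
 finally show "set a = out ` T" using g by (simp add: bij_betw_def)
 let ?A = "\<lambda>t. if t = k then arr (partner k) else arr t"
 have arv: "arrival S a j = ?A (g j)" if j: "j < length a" for j
 proof -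
  have pr: "(j + length a - 1) mod length a = (if j = 0 then length a - 1 else j - 1)"
  proof (cases "j = 0")
   case False
   have "j + length a - 1 = (j - 1) + length a" using False by simp
   then show ?thesis using j False by (metis less_imp_diff_less mod_add_self2 mod_less)
  qed (use j in simp)
  have "a ! (if j = 0 then length a - 1 else j - 1) = out (g (if j = 0 then length a - 1 else j - 1))"
   by (rule a) (use j in auto)
  then show ?thesis
   by (simp only: arrival_def[of _ a] pr prv[OF j] arr_eq if_distrib[of out] if_distrib[of "opp S"] split: if_splits)
 qed
 have "intersection_number S a b = (\<Sum>j<length a. \<Sum>d\<in>arc (rot S) (out (g j)) (?A (g j)). outflow S b d)"
  unfolding intersection_number_def left_darts_arc using a arv by (intro sum.cong) auto
 also have "\<dots> = (\<Sum>t\<in>T. \<Sum>d\<in>arc (rot S) (out t) (?A t). outflow S b d)"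
  by (rule sum.reindex_bij_betw[OF g])
 finally show "intersection_number S a b = (\<Sum>t\<in>T. \<Sum>d\<in>arc (rot S) (out t) (?A t). outflow S b d)" .
qed

lemma loop_sum:
 assumes k: "crossing_time k"
 shows "set (loop k) = out ` loop_times k" "distinct (loop k)"
  "intersection_number S (loop k) b = (\<Sum>t\<in>loop_times k.
    \<Sum>d\<in>arc (rot S) (out t) (if t = k then arr (partner k) else arr t). outflow S b d)"
proof -
 note p = crossing_partner[OF k] crossing_pos[OF k] crossing_pos[OF crossing_partner(3)[OF k]]
 have dc: "distinct (curve S)" using distinct_curve by simp
 have "set (loop k) = out ` loop_times k \<and> distinct (loop k) \<and>
  intersection_number S (loop k) b = (\<Sum>t\<in>loop_times k.
    \<Sum>d\<in>arc (rot S) (out t) (if t = k then arr (partner k) else arr t). outflow S b d)"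
 proof (cases "k < partner k")
  case True
  let ?a = "take (partner k - k) (drop k (curve S))"
  have a: "loop k = ?a" using True by (simp add: loop_def)
  have T: "loop_times k = {k..<partner k}" using True by (simp add: loop_times_def)
  have len: "length ?a = partner k - k" using p by simp
  have nth: "?a ! j = out (k + j)" if "j < length ?a" for j using that p by simp
  have prv: "k + (if j = 0 then length ?a - 1 else j - 1) = (if k + j = k then prev (partner k) else prev (k + j))"
   if "j < length ?a" for j using that p True len prev_pos[of "k + j"] prev_pos[of "partner k"] by auto
  have bij: "bij_betw ((+) k) {..<length ?a} {k..<partner k}"
   by (rule bij_betw_byWitness[of _ "\<lambda>t. t - k"]) (use p in \<open>auto simp: len\<close>)
  have "distinct ?a" using dc by simp
  then show ?thesis unfolding a T using loop_sum_aux[OF bij, OF nth prv] by blast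
 next
  case False
  then have lt: "partner k < k" using p by simp
  let ?a = "take (partner k) (curve S) @ drop k (curve S)"
  have a: "loop k = ?a" using False by (simp add: loop_def)
  have T: "loop_times k = {..<partner k} \<union> {k..<m}" using False by (simp add: loop_times_def)
  have len: "length ?a = partner k + (m - k)" using p by simp
  define g where "g j = (if j < partner k then j else j - partner k + k)" for j
  have nth: "?a ! j = out (g j)" if "j < length ?a" for j using that p len by (auto simp: nth_append g_def add.commute)
  have prv: "g (if j = 0 then length ?a - 1 else j - 1) = (if g j = k then prev (partner k) else prev (g j))"
   if "j < length ?a" for j
   using p lt that len prev_0 prev_pos[of "g j"] prev_pos[of "partner k"] unfolding g_def by auto
  have bij: "bij_betw g {..<length ?a} ({..<partner k} \<union> {k..<m})"
   by (rule bij_betw_byWitness[of _ "\<lambda>t. if t < partner k then t else t - k + partner k"])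
    (use p lt in \<open>auto simp: len g_def\<close>)
  have "distinct ?a" using dc lt set_take_disj_set_drop_if_distinct[OF dc, of "partner k" k] by simp
  then show ?thesis unfolding a T using loop_sum_aux[OF bij, OF nth prv] by blast
 qed
 then show "set (loop k) = out ` loop_times k" "distinct (loop k)"
  "intersection_number S (loop k) b = (\<Sum>t\<in>loop_times k.
    \<Sum>d\<in>arc (rot S) (out t) (if t = k then arr (partner k) else arr t). outflow S b d)" by auto
qed

lemma bij_prev: "bij_betw prev {..<m} {..<m}"
proof -
 have "prev ` {..<m} = {..<m}" using prev_surj by (auto simp: image_iff)
 moreover have "inj_on prev {..<m}" by (auto simp: inj_on_def)
 ultimately show ?thesis by (simp add: bij_betw_def)
qed

lemma outflow_loop:
 assumes k: "crossing_time k" and d: "d \<in> darts S"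
 shows "outflow S (loop k) d =
  (\<Sum>w<m. of_bool (d = out w) * on_loop k w - of_bool (d = arr w) * on_loop k (prev w))"
proof -
 have c: "int (count_list (loop k) e) = (\<Sum>w<m. of_bool (e = out w) * on_loop k w)" for e
 proof (cases "e \<in> set (loop k)")
  case True
  then obtain w where w: "w \<in> loop_times k" "e = out w" using loop_sum(1)[OF k] by auto
  then have "w < m" using loop_times_less[OF k] by simp
  have "(\<Sum>w'<m. of_bool (e = out w') * on_loop k w') = (\<Sum>w'<m. if w' = w then (1::int) else 0)"
   using w \<open>w < m\<close> by (intro sum.cong) auto
  then show ?thesis using True \<open>w < m\<close> loop_sum(2)[OF k] by (simp add: count_list_distinct)
 next
  case False
  then have "(\<Sum>w<m. of_bool (e = out w) * on_loop k w) = (0 :: int)"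
   using loop_sum(1)[OF k] by (intro sum.neutral) auto
  then show ?thesis using False loop_sum(2)[OF k] by (simp add: count_list_distinct)
 qed
 have "(\<Sum>w<m. of_bool (opp S d = out w) * on_loop k w)
   = (\<Sum>w<m. of_bool (opp S d = out (prev w)) * on_loop k (prev w))"
  by (rule sum.reindex_bij_betw[OF bij_prev, symmetric])
 also have "\<dots> = (\<Sum>w<m. of_bool (d = arr w) * on_loop k (prev w))"
 proof (intro sum.cong refl)
  fix w assume "w \<in> {..<m}"
  have "opp S d = out (prev w) \<longleftrightarrow> d = arr w"
   unfolding arr_eq using d by (metis opp_opp out_mem prev_less)
  then show "of_bool (opp S d = out (prev w)) * on_loop k (prev w) = of_bool (d = arr w) * on_loop k (prev w)" by simp
 qed
 finally show ?thesis unfolding outflow_def c sum_subtractf by simp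
qed

lemma arc_subset: "arc (rot S) x y \<subseteq> orbit (rot S) x" by (auto simp: arc_def orbit_altdef)

lemma finite_arc: "finite (arc (rot S) x y)" by (rule finite_subset[OF arc_subset]) (rule finite_orbit[OF self_orbit])

lemma orbit_darts: "x \<in> darts S \<Longrightarrow> orbit (rot S) x \<subseteq> darts S"
 by (rule permutes_orbit_subset[OF rot_perm])

lemma arr_orbit_iff: "w < m \<Longrightarrow> arr w \<in> orbit (rot S) x \<longleftrightarrow> out w \<in> orbit (rot S) x"
 using arr_vertex[of w] vertex_eq_iff unfolding vertex_def by metis

text \<open>Only the edges of the curve at the vertex of \<open>out t\<close> contribute, and the
  curve passes this vertex at the times \<open>t\<close> and \<open>partner t\<close> only.\<close>

lemma sum_outflow:
 assumes k: "crossing_time k" and t: "t < m" and X: "X \<subseteq> orbit (rot S) (out t)" "finite X"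
 shows "(\<Sum>d\<in>X. outflow S (loop k) d) = (\<Sum>w\<in>{t, partner t}.
  of_bool (out w \<in> X) * on_loop k w - of_bool (arr w \<in> X) * on_loop k (prev w))"
proof -
 have XD: "d \<in> darts S" if "d \<in> X" for d using that X orbit_darts[of "out t"] t by auto
 have one: "(\<Sum>d\<in>X. of_bool (d = e) * c) = of_bool (e \<in> X) * (c :: int)" for e c
  using X(2) by (simp add: sum_distrib_right[symmetric] of_bool_def sum.delta)
 have "(\<Sum>d\<in>X. outflow S (loop k) d)
   = (\<Sum>d\<in>X. \<Sum>w<m. of_bool (d = out w) * on_loop k w - of_bool (d = arr w) * on_loop k (prev w))"
  using outflow_loop[OF k XD] by (intro sum.cong) auto
 also have "\<dots> = (\<Sum>w<m. of_bool (out w \<in> X) * on_loop k w - of_bool (arr w \<in> X) * on_loop k (prev w))"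
  by (subst sum.swap) (simp only: sum_subtractf one)
 also have "\<dots> = (\<Sum>w\<in>{t, partner t}.
  of_bool (out w \<in> X) * on_loop k w - of_bool (arr w \<in> X) * on_loop k (prev w))"
 proof (rule sum.mono_neutral_right)
  show "{t, partner t} \<subseteq> {..<m}" using t crossing_partner(6)[of t] by (auto simp: partner_def)
  show "\<forall>w\<in>{..<m} - {t, partner t}. of_bool (out w \<in> X) * on_loop k w - of_bool (arr w \<in> X) * on_loop k (prev w) = 0"
  proof
   fix w assume w: "w \<in> {..<m} - {t, partner t}"
   have "out w \<notin> orbit (rot S) (out t)"
   proof
    assume "out w \<in> orbit (rot S) (out t)"
    then have "same_vertex t w" using w t vertex_eq_iff[of "out w" "out t"] by (simp add: same_vertex_def vertex_def)
    then show False using partner_eqI[of t w] w by auto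
   qed
   then have "out w \<notin> X" "arr w \<notin> X" using X(1) arr_orbit_iff[of w "out t"] w by auto
   then show "of_bool (out w \<in> X) * on_loop k w - of_bool (arr w \<in> X) * on_loop k (prev w) = 0" by simp
  qed
 qed simp
 finally show ?thesis .
qed

definition positive_times :: "nat set" where
 "positive_times = {u. crossing_time u \<and> eta u = 1}"

lemma finite_crossing_times: "finite {u. crossing_time u}"
 by (rule finite_subset[of _ "{..<m}"]) (auto dest: crossing_partner(5))

lemma eta_cases: "eta u = 1 \<or> eta u = - 1" by (simp add: eta_def)

lemma sum_crossing_times:
 "(\<Sum>u | crossing_time u. g u) = (\<Sum>u\<in>positive_times. g u + g (partner u) :: int)"
proof -
 have "{u. crossing_time u} = positive_times \<union> partner ` positive_times"
 proof (intro set_eqI iffI)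
  fix u assume "u \<in> {u. crossing_time u}"
  then have u: "crossing_time u" by simp
  show "u \<in> positive_times \<union> partner ` positive_times"
   using u eta_cases[of u] eta_partner[OF u] crossing_partner(3,4)[OF u]
   by (auto simp: positive_times_def image_iff intro!: exI[of _ "partner u"])
 qed (auto simp: positive_times_def crossing_partner)
 moreover have "positive_times \<inter> partner ` positive_times = {}"
  using eta_partner by (auto simp: positive_times_def)
 moreover have "finite positive_times"
  using finite_crossing_times by (rule finite_subset[rotated]) (auto simp: positive_times_def)
 moreover have "inj_on partner positive_times"
  by (rule inj_on_inverseI[of _ partner]) (auto simp: positive_times_def crossing_partner)
 ultimately show ?thesis by (simp add: sum.union_disjoint sum.reindex sum.distrib)
qed

text \<open>Pushing the first loop to its left localizes the intersections at the vertices, and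
  \<open>arcs\<close> determines the left sectors, including the one at the corner. Points that are
  not crossings contribute 0; each crossing is represented by its passage with \<open>eta\<close>
  equal to 1.\<close>

lemma intersection_loops:
 assumes k: "crossing_time k" and l: "crossing_time l"
 shows "intersection_number S (loop k) (loop l) = (\<Sum>u\<in>positive_times.
   on_loop k u * on_loop l (partner u) - on_loop k (prev (partner u)) * on_loop l (prev u))"
proof -
 define X where "X t = arc (rot S) (out t) (if t = k then arr (partner k) else arr t)" for t
 define G where "G t = (\<Sum>d\<in>X t. outflow S (loop l) d)" for t
 have Xo: "X t \<subseteq> orbit (rot S) (out t)" "finite (X t)" for t
  unfolding X_def using arc_subset finite_arc by blast+
 have G: "G t = (\<Sum>w\<in>{t, partner t}. of_bool (out w \<in> X t) * on_loop l w - of_bool (arr w \<in> X t) * on_loop l (prev w))"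
  if "t < m" for t unfolding G_def by (rule sum_outflow[OF l that Xo])
 have nc: "G t = 0" if "t < m" "\<not> crossing_time t" for t
 proof -
  have "t \<noteq> k" "partner t = t" using that k by (auto simp: partner_def)
  moreover have "out t \<notin> X t" "arr t \<notin> X t"
   using arc_endpoints[OF self_orbit, of "arr t" "out t"] arr_vertex[OF that(1)] that(1) \<open>t \<noteq> k\<close>
   by (auto simp: X_def vertex_def)
  ultimately show ?thesis using G[OF that(1)] by simp
 qed
 have "intersection_number S (loop k) (loop l) = (\<Sum>t\<in>loop_times k. G t)"
  unfolding loop_sum(3)[OF k] G_def X_def ..
 also have "\<dots> = (\<Sum>t<m. on_loop k t * G t)"
  using loop_times_less[OF k] by (intro sum.mono_neutral_cong_left) auto
 also have "\<dots> = (\<Sum>t | crossing_time t. on_loop k t * G t)"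
  using nc crossing_partner(5) by (intro sum.mono_neutral_right) auto
 also have "\<dots> = (\<Sum>u\<in>positive_times. on_loop k u * G u + on_loop k (partner u) * G (partner u))"
  by (rule sum_crossing_times)
 also have "\<dots> = (\<Sum>u\<in>positive_times.
   on_loop k u * on_loop l (partner u) - on_loop k (prev (partner u)) * on_loop l (prev u))"
 proof (intro sum.cong refl)
  fix u assume "u \<in> positive_times"
  then have u: "crossing_time u" "eta u = 1" by (auto simp: positive_times_def)
  define v where "v = partner u"
  note p = crossing_partner[OF u(1), folded v_def]
  note d = crossing_darts[OF u(1), folded v_def]
  have ev: "eta v = - 1" using eta_partner[OF u(1)] u(2) by (simp add: v_def)
  note au = arcs[OF u(1), folded v_def] and av = arcs[OF p(3), unfolded p(4)]
  have Gu: "G u = (of_bool (out u \<in> X u) * on_loop l u - of_bool (arr u \<in> X u) * on_loop l (prev u))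
    + (of_bool (out v \<in> X u) * on_loop l v - of_bool (arr v \<in> X u) * on_loop l (prev v))"
   using G[OF p(5)] p(2) by (simp add: v_def)
  have Gv: "G v = (of_bool (out v \<in> X v) * on_loop l v - of_bool (arr v \<in> X v) * on_loop l (prev v))
    + (of_bool (out u \<in> X v) * on_loop l u - of_bool (arr u \<in> X v) * on_loop l (prev u))"
   using G[OF p(6)] p(2,4) by simp
  have X_u: "X u = arc (rot S) (out u) (if u = k then arr v else arr u)" by (simp add: X_def v_def)
  have X_v: "X v = arc (rot S) (out v) (if v = k then arr u else arr v)" using p(4) by (auto simp: X_def)
  have Xu: "out u \<notin> X u" "out v \<in> X u" "arr v \<notin> X u" "arr u \<in> X u \<longleftrightarrow> u = k"
   using au(1,2,3,4) au(5)[of "out u" "arr u"] au(5)[of "out u" "arr v"] d u(2) by (auto simp: X_u)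
  have Xv: "out v \<notin> X v" "arr v \<notin> X v" "out u \<notin> X v" "arr u \<in> X v \<longleftrightarrow> v \<noteq> k"
   using av(1,2,3,4) av(5)[of "out v" "arr v"] av(5)[of "out v" "arr u"] d ev p(4) by (auto simp: X_v)
  have pk: "v = partner k \<longleftrightarrow> u = k" "u = partner k \<longleftrightarrow> v = k"
   using p(4) crossing_partner(4)[OF k] unfolding v_def by metis+
  have "on_loop k (prev v) = (if u = k then 1 else if v = k then 0 else on_loop k v)"
   using loop_times_prev[OF k p(6)] p(2) pk by auto
  moreover have "on_loop k u = (if u = k then 1 else if v = k then 0 else on_loop k u)"
   "on_loop k v = (if v = k then 1 else if u = k then 0 else on_loop k v)"
   using loop_times_prev[OF k p(5)] loop_times_prev[OF k p(6)] p(2) pk by auto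
  ultimately show "on_loop k u * G u + on_loop k (partner u) * G (partner u)
    = on_loop k u * on_loop l (partner u) - on_loop k (prev (partner u)) * on_loop l (prev u)"
   unfolding v_def[symmetric] Gu Gv using Xu Xv p(2) by (cases "u = k"; cases "v = k") simp_all
 qed
 finally show ?thesis .
qed

text \<open>A cycle leaves a vertex as often as it enters it.\<close>

lemma loop_conservation:
 assumes "crossing_time k" "crossing_time u"
 shows "on_loop k u + on_loop k (partner u) = on_loop k (prev u) + on_loop k (prev (partner u))"
proof -
 have "partner u = k \<longleftrightarrow> u = partner k" "partner u = partner k \<longleftrightarrow> u = k"
  using crossing_partner(4)[OF assms(2)] crossing_partner(4)[OF assms(1)] by metis+
 then show ?thesis using loop_times_prev[OF assms(1) crossing_partner(5)[OF assms(2)]]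
  loop_times_prev[OF assms(1) crossing_partner(6)[OF assms(2)]] crossing_partner(2,4)[OF assms(2)]
  crossing_partner(2,4)[OF assms(1)] by (cases "u = k"; cases "u = partner k") auto
qed

text \<open>
 The difference to the previous formula telescopes along the curve, since both loops are cycles.
\<close>

lemma intersection_loops_symmetric:
 assumes k: "crossing_time k" and l: "crossing_time l"
 shows "4 * intersection_number S (loop k) (loop l) = (\<Sum>u | crossing_time u.
   eta u * (on_loop k u + on_loop k (prev u)) * (on_loop l (partner u) + on_loop l (prev (partner u))))"
proof -
 let ?A = "on_loop k" and ?B = "on_loop l"
 define h where "h u = ?A u * ?B u - ?A (prev u) * ?B (prev u)" for u
 have "(\<Sum>u<m. ?A (prev u) * ?B (prev u)) = (\<Sum>u<m. ?A u * ?B u)" by (rule sum.reindex_bij_betw[OF bij_prev])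
 then have "(\<Sum>u<m. h u) = 0" by (simp add: h_def sum_subtractf)
 moreover have "h u = 0" if "u < m" "\<not> crossing_time u" for u
  using loop_times_prev(3)[OF k that(1)] loop_times_prev(3)[OF l that(1)] that(2) k l
   crossing_partner(3)[OF k] crossing_partner(3)[OF l] by (auto simp: h_def)
 then have "(\<Sum>u | crossing_time u. h u) = (\<Sum>u<m. h u)"
  using crossing_partner(5) by (intro sum.mono_neutral_left) auto
 ultimately have h0: "(\<Sum>u\<in>positive_times. h u + h (partner u)) = 0" using sum_crossing_times[of h] by simp
 have "4 * intersection_number S (loop k) (loop l) = (\<Sum>u\<in>positive_times.
   4 * (?A u * ?B (partner u) - ?A (prev (partner u)) * ?B (prev u)) + 2 * (h u + h (partner u)))"
  unfolding sum.distrib sum_distrib_left[symmetric] intersection_loops[OF k l] using h0 by (simp only: sum.distrib)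
 also have "\<dots> = (\<Sum>u\<in>positive_times.
   eta u * (?A u + ?A (prev u)) * (?B (partner u) + ?B (prev (partner u)))
   + eta (partner u) * (?A (partner u) + ?A (prev (partner u))) * (?B (partner (partner u)) + ?B (prev (partner (partner u)))))"
 proof (intro sum.cong refl)
  fix u assume "u \<in> positive_times"
  then have u: "crossing_time u" "eta u = 1" by (auto simp: positive_times_def)
  \<comment> \<open>Conservation for both loops makes this a polynomial identity; the factor 4
    clears the two halves in the averages of arriving and departing edge.\<close>
  have alg: "4 * (a * b' - a3 * b1) + 2 * ((a * b - a1 * b1) + (a' * b' - a3 * b3))
    = (a + a1) * (b' + b3) - (a' + a3) * (b + b1)"
   if "a + a' = a1 + a3" "b + b' = b1 + b3" for a a' a1 a3 b b' b1 b3 :: int using that by algebra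
  show "4 * (?A u * ?B (partner u) - ?A (prev (partner u)) * ?B (prev u)) + 2 * (h u + h (partner u)) =
   eta u * (?A u + ?A (prev u)) * (?B (partner u) + ?B (prev (partner u)))
   + eta (partner u) * (?A (partner u) + ?A (prev (partner u))) * (?B (partner (partner u)) + ?B (prev (partner (partner u))))"
   using alg[OF loop_conservation[OF k u(1)] loop_conservation[OF l u(1)]] u(2) eta_partner[OF u(1)]
    crossing_partner(4)[OF u(1)] by (simp add: h_def)
 qed
 also have "\<dots> = (\<Sum>u | crossing_time u.
   eta u * (?A u + ?A (prev u)) * (?B (partner u) + ?B (prev (partner u))))"
  by (rule sum_crossing_times[symmetric])
 finally show ?thesis .
qed

end

section \<open>The Gauss code of a surface diagram and its polynomials\<close>

definition surface_code :: "surface_diagram \<Rightarrow> (nat \<times> nat) point list" where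
 "surface_code S = map (\<lambda>(c, o_c, \<epsilon>). Point c o_c \<epsilon>) (surface_passages S)"

lemma t_power_0 [simp]: "t_power 0 = 1" by (simp add: t_power_def)

lemma lookup_invert_t: "Poly_Mapping.lookup (invert_t p) n = Poly_Mapping.lookup p (- n)"
 unfolding invert_t_def by (simp add: map_key.rep_eq)

lemma invert_t_add: "invert_t (p + q) = invert_t p + invert_t q"
 by (rule poly_mapping_eqI) (simp add: lookup_invert_t lookup_add)

lemma invert_t_0 [simp]: "invert_t 0 = 0" by (rule poly_mapping_eqI) (simp add: lookup_invert_t)

lemma invert_t_minus: "invert_t (- p) = - invert_t p" by (rule poly_mapping_eqI) (simp add: lookup_invert_t)

lemma invert_t_diff: "invert_t (p - q) = invert_t p - invert_t q"
 by (rule poly_mapping_eqI) (simp add: lookup_invert_t lookup_minus)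

lemma invert_t_power [simp]: "invert_t (t_power n) = t_power (- n)"
 by (rule poly_mapping_eqI) (auto simp: lookup_invert_t t_power_def lookup_single when_def)

lemma invert_t_sum: "invert_t (\<Sum>x\<in>A. f x) = (\<Sum>x\<in>A. invert_t (f x))"
 by (induction A rule: infinite_finite_induct) (simp_all add: invert_t_add)

text \<open>Multiplication by a sign is the identity or a negation, so additivity of
  \<open>invert_t\<close> suffices.\<close>

lemma invert_t_sign: "s = 1 \<or> s = - 1 \<Longrightarrow> invert_t (of_int s * p) = of_int s * invert_t p"
 by (auto simp: invert_t_minus)

lemma concat_map_if: "concat (map (\<lambda>x. if P x then [f x] else []) xs) = map f (filter P xs)"
 by (induction xs) auto

context surface_curve
begin

definition crossing_at :: "nat \<Rightarrow> nat \<times> nat" where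
 "crossing_at r = (min r (partner r), max r (partner r))"

definition pt :: "nat \<Rightarrow> (nat \<times> nat) point" where
 "pt r = Point (crossing_at r) (r \<in> over S) (sign S (crossing_at r))"

lemma is_over_pt: "is_over (pt r) \<longleftrightarrow> r \<in> over S" by (simp add: pt_def)

lemma surface_code_eq: "surface_code S = map pt (filter crossing_time [0..<m])"
proof -
 have 1: "(\<exists>(s, t) \<in> crossings S. r = s \<or> r = t) \<longleftrightarrow> crossing_time r" for r
 proof
  assume "\<exists>(s, t) \<in> crossings S. r = s \<or> r = t"
  then show "crossing_time r" using crossings_iff crossing_partner(3) by auto
 next
  assume r: "crossing_time r"
  then have "crossing_at r \<in> crossings S"
   using crossings_iff[of r "partner r"] crossings_iff[of "partner r" r] crossing_partner[OF r]
   using r by (cases "r < partner r") (auto simp: crossing_at_def)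
  moreover have "r = fst (crossing_at r) \<or> r = snd (crossing_at r)" by (auto simp: crossing_at_def min_def max_def)
  ultimately show "\<exists>(s, t) \<in> crossings S. r = s \<or> r = t"
   by (intro bexI[of _ "crossing_at r"]) (auto simp: case_prod_unfold)
 qed
 have 2: "(THE c. c \<in> crossings S \<and> (r = fst c \<or> r = snd c)) = crossing_at r" if r: "crossing_time r" for r
 proof (rule the_equality)
  show "crossing_at r \<in> crossings S \<and> (r = fst (crossing_at r) \<or> r = snd (crossing_at r))"
   using crossings_iff[of r "partner r"] crossings_iff[of "partner r" r] crossing_partner[OF r]
   using r by (cases "r < partner r") (auto simp: crossing_at_def)
  fix c assume c: "c \<in> crossings S \<and> (r = fst c \<or> r = snd c)"
  obtain s t where st: "c = (s, t)" by fastforce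
  then have "crossing_time s" "t = partner s" "s < t" using c crossings_iff by blast+
  then show "c = crossing_at r" using c st crossing_partner(4)[of s] by (auto simp: crossing_at_def)
 qed
 have "map (\<lambda>(c, o_c, \<epsilon>). Point c o_c \<epsilon>) (if \<exists>(s, t) \<in> crossings S. r = s \<or> r = t
    then let c = (THE c. c \<in> crossings S \<and> (r = fst c \<or> r = snd c)) in [(c, r \<in> over S, sign S c)] else [])
   = (if crossing_time r then [pt r] else [])" for r
  unfolding 1 using 2[of r] by (simp add: pt_def Let_def)
 then have "surface_code S = concat (map (\<lambda>r. if crossing_time r then [pt r] else []) [0..<m])"
  unfolding surface_code_def surface_passages_def map_concat map_map comp_def by simp
 also have "\<dots> = map pt (filter crossing_time [0..<m])" by (rule concat_map_if)
 finally show ?thesis .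
qed

lemma crossing_at_partner: "crossing_time r \<Longrightarrow> crossing_at (partner r) = crossing_at r"
 using crossing_partner(4) by (simp add: crossing_at_def min.commute max.commute)

lemma crossing_at_eq:
 assumes "crossing_time r" "crossing_time r'" "crossing_at r = crossing_at r'"
 shows "r' = r \<or> r' = partner r"
 using assms(3) unfolding crossing_at_def by (auto simp: min_def max_def split: if_splits)

lemma over_partner: "crossing_time r \<Longrightarrow> (partner r \<in> over S) \<noteq> (r \<in> over S)"
 using crossing_less_pos(3)[of r] crossing_less_pos(3)[of "partner r"] crossing_partner[of r]
 by (cases "r < partner r") auto

lemma mate_pt: "crossing_time r \<Longrightarrow> mate (pt r) = pt (partner r)"
 using over_partner[of r] crossing_at_partner[of r] by (simp add: mate_def pt_def)

lemma pt_inj: "crossing_time r \<Longrightarrow> crossing_time r' \<Longrightarrow> pt r = pt r' \<Longrightarrow> r = r'"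
 using crossing_at_eq[of r r'] over_partner[of r] by (auto simp: pt_def)

text \<open>At the earlier passage \<open>sign\<close> and \<open>twist\<close> both ask whether it
  is an over-passage, and what remains is the side to which the other strand leaves. Both sides of
  the equation change sign at the later passage.\<close>

lemma twist_pt:
 assumes "crossing_time r"
 shows "twist (pt r) = eta r"
proof -
 have *: "twist (pt r) = eta r" if r: "crossing_time r" "r < partner r" for r
  using r by (simp add: twist_def pt_def crossing_at_def eta_def left_darts_arc)
 note p = crossing_partner[OF assms]
 show ?thesis
 proof (cases "r < partner r")
  case False
  then have "twist (pt (partner r)) = eta (partner r)" using * p by auto
  moreover have "twist (pt r) = - twist (pt (partner r))" using mate_pt[OF assms] by (metis twist_mate minus_minus)
  ultimately show ?thesis using eta_partner[OF assms] by simp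
 qed (use * assms in simp)
qed

lemma set_surface_code: "set (surface_code S) = pt ` {r. crossing_time r}"
 by (auto simp: surface_code_eq crossing_partner(5))

lemma wf_surface_code: "wf_code (surface_code S)" unfolding wf_code_def
proof (intro conjI ballI)
 have "inj_on (\<lambda>r. (label (pt r), is_over (pt r))) {r. crossing_time r}"
  using crossing_at_eq over_partner by (fastforce simp: inj_on_def pt_def)
 then show "distinct (map (\<lambda>p. (label p, is_over p)) (surface_code S))"
  unfolding surface_code_eq map_map comp_def distinct_map by (auto simp: inj_on_def)
 fix p assume "p \<in> set (surface_code S)"
 then obtain r where r: "crossing_time r" "p = pt r" by (auto simp: set_surface_code)
 then show "mate p \<in> set (surface_code S)" using mate_pt crossing_partner(3) by (auto simp: set_surface_code)
 show "psign p = 1 \<or> psign p = - 1" by (simp add: r pt_def crossing_at_def)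
qed

lemma lv_surface_code:
 assumes "crossing_time r" "crossing_time r'"
 shows "lv (surface_code S) (pt r) (pt r') = 2 * of_bool (r < r') + of_bool (r = r')"
proof -
 have inj: "inj_on pt (set (filter crossing_time [0..<m]))" using pt_inj by (auto simp: inj_on_def)
 have up: "idx [0..<m] k = k" if "k < m" for k using that idx_nth[of "[0..<m]" k] by simp
 have mem: "r < m" "r' < m" using assms crossing_partner(5) by auto
 have "idx (surface_code S) (pt r) < idx (surface_code S) (pt r') \<longleftrightarrow> r < r'"
  unfolding surface_code_eq
  using idx_map[OF inj] idx_filter_less_iff[of "[0..<m]" r r' crossing_time] assms mem up by simp
 then show ?thesis using pt_inj assms by (auto simp: lv_def)
qed

text \<open>A passage inside the loop has both its edges on it, a corner has one, and any other
  passage none: this gives the values 2, 1 and 0, and the complementary ones for the other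
  loop.\<close>

lemma cyc_surface_code:
 assumes k: "crossing_time k" "k < partner k" and r: "crossing_time r"
 shows "cyc (surface_code S) (pt k) (pt r) = on_loop k r + on_loop k (prev r)"
  and "2 - cyc (surface_code S) (pt k) (pt r) = on_loop (partner k) r + on_loop (partner k) (prev r)"
proof -
 note p = crossing_partner[OF k(1)]
 have pr: "prev r = r - 1" "0 < r" using prev_pos crossing_pos[OF r] crossing_partner(5)[OF r] by auto
 have "cyc (surface_code S) (pt k) (pt r)
   = 2 * of_bool (k < r) + of_bool (k = r) - (2 * of_bool (partner k < r) + of_bool (partner k = r))"
  using lv_surface_code[OF k(1) r] lv_surface_code[OF p(3) r] mate_pt[OF k(1)] by (simp add: cyc_def)
 moreover have "r < m" using crossing_partner(5)[OF r] .
 ultimately show "cyc (surface_code S) (pt k) (pt r) = on_loop k r + on_loop k (prev r)"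
  "2 - cyc (surface_code S) (pt k) (pt r) = on_loop (partner k) r + on_loop (partner k) (prev r)"
  using k(2) p(4) pr by (auto simp: loop_times_def)
qed

lemma pairing_surface_code:
 "pairing (surface_code S) f g = (\<Sum>u | crossing_time u. eta u * f (pt u) * g (pt (partner u)))"
proof -
 have inj: "inj_on pt {r. crossing_time r}" using pt_inj by (auto simp: inj_on_def)
 show ?thesis unfolding pairing_def set_surface_code sum.reindex[OF inj]
  by (intro sum.cong) (auto simp: twist_pt mate_pt)
qed

lemma intersection_pairing:
 assumes "crossing_time k" "crossing_time l"
  and "\<And>u. crossing_time u \<Longrightarrow> f (pt u) = on_loop k u + on_loop k (prev u)"
  and "\<And>u. crossing_time u \<Longrightarrow> g (pt u) = on_loop l u + on_loop l (prev u)"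
 shows "intersection_number S (loop k) (loop l) = pairing (surface_code S) f g div 4"
proof -
 have "pairing (surface_code S) f g = 4 * intersection_number S (loop k) (loop l)"
  unfolding intersection_loops_symmetric[OF assms(1,2)] pairing_surface_code
  by (intro sum.cong) (auto simp: assms(3,4) crossing_partner(3))
 then show ?thesis by simp
qed

text \<open>As a cycle \<beta> is the whole curve minus \<alpha>, so its doubled indicator function
  is 2 minus \<open>cyc\<close>; the rest is bilinearity and antisymmetry.\<close>

lemma pairing_beta:
 fixes L :: "'l point list"
 assumes "wf_code L"
 shows "pairing L (cyc L p) (\<lambda>u. 2 - cyc L q u) = 2 * ind L p - Om L p q"
  and "pairing L (\<lambda>u. 2 - cyc L p u) (\<lambda>u. 2 - cyc L q u) = Om L p q + 2 * ind L q - 2 * ind L p"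
proof -
 have 2: "pairing L f (\<lambda>_. 2) = 2 * pairing L f (\<lambda>_. 1)" for f
  using pairing_mult_right[of L f 2 "\<lambda>_. 1"] by simp
 show *: "pairing L (cyc L p) (\<lambda>u. 2 - cyc L q u) = 2 * ind L p - Om L p q"
  by (simp add: pairing_diff_right 2 ind_def Om_def)
 have "pairing L (\<lambda>_. 2) (cyc L q) = - 2 * ind L q"
  using pairing_swap[OF assms, of "\<lambda>_. 2" "cyc L q"] 2[of "cyc L q"] by (simp add: ind_def)
 moreover have "pairing L (\<lambda>_. 2) (\<lambda>_. 2) = 0" by (rule pairing_self[OF assms])
 ultimately have "pairing L (\<lambda>_. 2) (\<lambda>u. 2 - cyc L q u) = 2 * ind L q" by (simp add: pairing_diff_right)
 then show "pairing L (\<lambda>u. 2 - cyc L p u) (\<lambda>u. 2 - cyc L q u) = Om L p q + 2 * ind L q - 2 * ind L p"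
  by (simp add: pairing_diff_left *)
qed

lemma intersection_numbers:
 assumes "(s, t) \<in> crossings S" "(s', t') \<in> crossings S"
 defines "L \<equiv> surface_code S"
 shows "intersection_number S (alpha S (s, t)) (alpha S (s', t')) = Om L (pt s) (pt s') div 4"
  and "intersection_number S (alpha S (s, t)) (beta S (s, t)) = (2 * ind L (pt s)) div 4"
  and "intersection_number S (beta S (s, t)) (beta S (s', t'))
   = (Om L (pt s) (pt s') + 2 * ind L (pt s') - 2 * ind L (pt s)) div 4"
proof -
 have s: "crossing_time s" "t = partner s" "s < partner s" using assms(1) crossings_iff by auto
 have s': "crossing_time s'" "t' = partner s'" "s' < partner s'" using assms(2) crossings_iff by auto
 note p = crossing_partner[OF s(1)] and p' = crossing_partner[OF s'(1)]
 have a: "alpha S (s, t) = loop s" "alpha S (s', t') = loop s'"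
  and b: "beta S (s, t) = loop (partner s)" "beta S (s', t') = loop (partner s')"
  using s s' p(4) p'(4) by (simp_all add: loop_def)
 have wf: "wf_code L" unfolding L_def by (rule wf_surface_code)
 show "intersection_number S (alpha S (s, t)) (alpha S (s', t')) = Om L (pt s) (pt s') div 4" unfolding a Om_def L_def
  by (rule intersection_pairing[OF s(1) s'(1)]) (use cyc_surface_code s s' in auto)
 have "intersection_number S (loop s) (loop (partner s)) = pairing L (cyc L (pt s)) (\<lambda>u. 2 - cyc L (pt s) u) div 4"
  unfolding L_def by (rule intersection_pairing[OF s(1) p(3)]) (use cyc_surface_code s s' in auto)
 moreover have "Om L (pt s) (pt s) = 0" unfolding Om_def by (rule pairing_self[OF wf])
 ultimately show "intersection_number S (alpha S (s, t)) (beta S (s, t)) = (2 * ind L (pt s)) div 4"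
  unfolding a b pairing_beta[OF wf] by simp
 have "intersection_number S (loop (partner s)) (loop (partner s'))
   = pairing L (\<lambda>u. 2 - cyc L (pt s) u) (\<lambda>u. 2 - cyc L (pt s') u) div 4"
  unfolding L_def by (rule intersection_pairing[OF p(3) p'(3)]) (use cyc_surface_code s s' in auto)
 then show "intersection_number S (beta S (s, t)) (beta S (s', t'))
   = (Om L (pt s) (pt s') + 2 * ind L (pt s') - 2 * ind L (pt s)) div 4"
  unfolding b pairing_beta[OF wf] .
qed

text \<open>For \<open>a\<close> beyond 1 the set \<open>I\<close> is empty whereas
  \<open>firsts\<close> still means type 1; hence the restriction on \<open>a\<close>.\<close>

lemma firsts_surface_code: "bij_betw (pt \<circ> fst) (I S a) (firsts (surface_code S) a)" if "a \<in> {0, 1}"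
proof -
 let ?P = "{s. crossing_time s \<and> s < partner s \<and> (s \<in> over S) = (a = 0)}"
 have I: "I S a = (\<lambda>s. (s, partner s)) ` ?P"
 proof (intro set_eqI iffI)
  fix c assume "c \<in> I S a"
  then show "c \<in> (\<lambda>s. (s, partner s)) ` ?P"
   using crossings_iff[of "fst c" "snd c"] by (cases c) (auto simp: I_def split: if_splits)
 next
  fix c assume "c \<in> (\<lambda>s. (s, partner s)) ` ?P"
  then obtain s where "s \<in> ?P" "c = (s, partner s)" by blast
  then show "c \<in> I S a" using crossings_iff[of s "partner s"] \<open>a \<in> {0, 1}\<close> by (auto simp: I_def)
 qed
 have f: "firsts (surface_code S) a = pt ` {s. crossing_time s \<and> s < partner s \<and> (s \<in> over S) = (a = 0)}"
 proof -
  have "pt r \<in> firsts (surface_code S) a \<longleftrightarrow> r < partner r \<and> (r \<in> over S) = (a = 0)" if r: "crossing_time r" for r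
   using r lv_surface_code[OF r crossing_partner(3)[OF r]] mate_pt[OF r] crossing_partner(3)[OF r]
   by (auto simp: firsts_def set_surface_code is_over_pt split: if_splits)
  moreover have "firsts (surface_code S) a \<subseteq> pt ` {r. crossing_time r}"
   using set_surface_code by (auto simp: firsts_def)
  ultimately show ?thesis by auto
 qed
 have "inj_on pt ?P" using pt_inj by (auto simp: inj_on_def)
 then have "bij_betw pt ?P (firsts (surface_code S) a)" unfolding f by (rule inj_on_imp_bij_betw)
 moreover have "bij_betw fst (I S a) ?P"
  unfolding I by (rule bij_betw_byWitness[of _ "\<lambda>s. (s, partner s)"]) auto
 ultimately show ?thesis by (rule bij_betw_trans[rotated])
qed

lemma sign_pt: "c \<in> crossings S \<Longrightarrow> psign (pt (fst c)) = sign S c"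
 using crossings_iff by (cases c) (auto simp: pt_def crossing_at_def simp del: sign.simps)

lemma sign_cases: "sign S c = 1 \<or> sign S c = - 1" by (cases c) auto

lemma I_crossings: "c \<in> I S a \<Longrightarrow> c \<in> crossings S" by (simp add: I_def)

lemma kernel_sum_surface:
 assumes "a \<in> {0, 1}" "b \<in> {0, 1}"
 shows "kernel_sum (surface_code S) k a b
  = (\<Sum>c\<in>I S a. \<Sum>d\<in>I S b. of_int (sign S c * sign S d) * k (pt (fst c)) (pt (fst d)))"
 unfolding kernel_sum_def by (subst sum.reindex_bij_betw[OF firsts_surface_code[OF assms(1)], symmetric],
   subst sum.reindex_bij_betw[OF firsts_surface_code[OF assms(2)], symmetric])
  (intro sum.cong; auto simp: sign_pt I_crossings)

theorem F_surface_code: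
 assumes "a \<in> {0, 1}" "b \<in> {0, 1}"
 shows "F S a b = F_code (surface_code S) a b" unfolding F_def F_code_def kernel_sum_surface[OF assms] F_kernel_def
 by (intro sum.cong refl) (auto simp del: alpha.simps simp: intersection_numbers(1) I_crossings)

theorem H_surface_code:
 assumes "a \<in> {0, 1}" "b \<in> {0, 1}"
 shows "H S a b = H_code (surface_code S) a b"
proof -
 let ?L = "surface_code S"
 define w where "w c = (2 * ind ?L (pt (fst c))) div 4" for c :: "nat \<times> nat"
 define w' where "w' c = (- 2 * ind ?L (pt (fst c))) div 4" for c :: "nat \<times> nat"
 have w: "intersection_number S (alpha S c) (beta S c) = w c" if "c \<in> crossings S" for c
  using intersection_numbers(2)[of "fst c" "snd c" "fst c" "snd c"] that by (simp add: w_def)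
 \<comment> \<open>Division rounds down, so pulling the minus sign out of \<open>div 4\<close>
   requires divisibility. It holds as \<open>2 * ind\<close> is four times an intersection
   number.\<close>
 have w': "w' c = - w c" if "c \<in> crossings S" for c
 proof -
  have c: "crossing_time (fst c)" "fst c < partner (fst c)" using that crossings_iff[of "fst c" "snd c"] by auto
  have "pairing ?L (cyc ?L (pt (fst c))) (\<lambda>u. 2 - cyc ?L (pt (fst c)) u)
   = 4 * intersection_number S (loop (fst c)) (loop (partner (fst c)))"
   unfolding intersection_loops_symmetric[OF c(1) crossing_partner(3)[OF c(1)]] pairing_surface_code
   using cyc_surface_code[OF c] crossing_partner(3) by (intro sum.cong) auto
  moreover have "Om ?L (pt (fst c)) (pt (fst c)) = 0" unfolding Om_def by (rule pairing_self[OF wf_surface_code])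
  ultimately have "2 * ind ?L (pt (fst c)) = 4 * intersection_number S (loop (fst c)) (loop (partner (fst c)))"
   unfolding pairing_beta[OF wf_surface_code] by simp
  then show ?thesis by (simp add: w_def w'_def)
 qed
 have W: "W S x = (\<Sum>c\<in>I S x. of_int (sign S c) * (t_power (w c) - 1))" for x
  unfolding W_def by (intro sum.cong refl) (simp add: w I_crossings del: alpha.simps beta.simps)
 have W': "invert_t (W S x) = (\<Sum>c\<in>I S x. of_int (sign S c) * (t_power (w' c) - 1))" for x
  unfolding W invert_t_sum by (intro sum.cong refl) (simp add: invert_t_sign[OF sign_cases] invert_t_diff w' I_crossings
   invert_t_power[of 0, simplified])
 have 1: "of_int (writhe S a) * W S b
   = (\<Sum>c\<in>I S a. \<Sum>d\<in>I S b. of_int (sign S c * sign S d) * (t_power (w d) - 1))"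
  unfolding W writhe_def of_int_sum sum_product by (simp add: mult.assoc)
 have 2: "of_int (writhe S b) * invert_t (W S a)
   = (\<Sum>c\<in>I S a. \<Sum>d\<in>I S b. of_int (sign S c * sign S d) * (t_power (w' c) - 1))"
  unfolding W' writhe_def of_int_sum sum_product by (subst sum.swap) (simp add: mult_ac)
 have 3: "(\<Sum>c\<in>I S a. \<Sum>d\<in>I S b. of_int (sign S c * sign S d) *
    (t_power (intersection_number S (beta S c) (beta S d)) - 1))
   = (\<Sum>c\<in>I S a. \<Sum>d\<in>I S b. of_int (sign S c * sign S d) *
    (t_power ((Om ?L (pt (fst c)) (pt (fst d)) + 2 * ind ?L (pt (fst d)) - 2 * ind ?L (pt (fst c))) div 4) - 1))"
  by (intro sum.cong refl) (auto simp del: beta.simps simp: intersection_numbers(3) I_crossings)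
 show ?thesis unfolding H_def H_code_def kernel_sum_surface[OF assms] 1 2 3 sum_subtractf[symmetric]
  by (intro sum.cong refl) (simp add: H_kernel_def w_def w'_def algebra_simps)
qed

end

section \<open>Counting orbits\<close>

lemma card_image_same_fibres:
 assumes "\<And>a b. a \<in> A \<Longrightarrow> b \<in> A \<Longrightarrow> \<phi> a = \<phi> b \<longleftrightarrow> G a = G b"
 shows "card (\<phi> ` A) = card (G ` A)"
proof (rule bij_betw_same_card)
 let ?h = "\<lambda>y. G (inv_into A \<phi> y)"
 have h: "?h (\<phi> a) = G a" if "a \<in> A" for a
  using assms[of "inv_into A \<phi> (\<phi> a)" a] that by (simp add: f_inv_into_f inv_into_into)
 have "?h ` \<phi> ` A = G ` A" unfolding image_image using h by (rule image_cong[OF refl])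
 moreover have "inj_on ?h (\<phi> ` A)"
 proof (rule inj_onI)
  fix y z assume "y \<in> \<phi> ` A" "z \<in> \<phi> ` A" "?h y = ?h z"
  then show "y = z" using h assms by force
 qed
 ultimately show "bij_betw ?h (\<phi> ` A) (G ` A)" by (simp add: bij_betw_def)
qed

lemma permutes_self_orbit: "finite X \<Longrightarrow> f permutes X \<Longrightarrow> x \<in> orbit f x"
 by (rule permutation_self_in_orbit) (auto simp: permutation_permutes)

lemma permutes_orbit_eq_iff:
 assumes "finite X" "f permutes X"
 shows "orbit f x = orbit f y \<longleftrightarrow> x \<in> orbit f y"
 by (rule orbit_eq_iff_mem) (rule permutes_self_orbit[OF assms])

definition returns :: "('a \<Rightarrow> 'a) \<Rightarrow> 'a set \<Rightarrow> 'a \<Rightarrow> nat \<Rightarrow> 'a \<Rightarrow> bool" where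
 "returns f A x n y \<longleftrightarrow> 0 < n \<and> (f ^^ n) x = y \<and> y \<in> A \<and> (\<forall>i. 0 < i \<and> i < n \<longrightarrow> (f ^^ i) x \<notin> A)"

lemma returns_split:
 assumes "returns f A x n y" "(f ^^ k) x \<in> A" "0 < k"
 shows "k = n \<or> n < k \<and> (f ^^ (k - n)) y = (f ^^ k) x"
proof -
 have "n \<le> k" using assms by (auto simp: returns_def not_less[symmetric])
 moreover have "(f ^^ (k - n)) y = (f ^^ k) x" if "n \<le> k"
 proof -
  have "(f ^^ k) x = (f ^^ ((k - n) + n)) x" using that by simp
  then show ?thesis using assms(1) by (simp only: funpow_add o_apply returns_def)
 qed
 ultimately show ?thesis by auto
qed

lemma returns_orbit: "returns f A x n y \<Longrightarrow> y \<in> orbit f x" by (auto simp: returns_def orbit_altdef)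

text \<open>Whether two points of \<open>A\<close> share an orbit is decided by the first return map
  to \<open>A\<close>, and the two permutations have the same first return map up to \<psi>; the
  return times may differ.\<close>

lemma return_count:
 assumes f: "finite X" "f permutes X" and g: "finite Y" "g permutes Y"
  and inj: "inj_on \<psi> A"
  and ret: "\<And>a. a \<in> A \<Longrightarrow> \<exists>n a' n'. a' \<in> A \<and> returns f A a n a' \<and> returns g (\<psi> ` A) (\<psi> a) n' (\<psi> a')"
 shows "card (orbit f ` A) = card (orbit g ` \<psi> ` A)"
proof -
 have 1: "\<psi> b \<in> orbit g (\<psi> a)" if "a \<in> A" "b \<in> A" "(f ^^ k) a = b" "0 < k" for a b k using that
 proof (induction k arbitrary: a rule: less_induct)
  case (less k)
  obtain n a' n' where r: "a' \<in> A" "returns f A a n a'" "returns g (\<psi> ` A) (\<psi> a) n' (\<psi> a')"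
   using ret[OF less.prems(1)] by blast
  have o: "\<psi> a' \<in> orbit g (\<psi> a)" using returns_orbit[OF r(3)] .
  from returns_split[OF r(2), of k] less.prems consider "k = n" | "n < k" "(f ^^ (k - n)) a' = b" by auto
  then show ?case
  proof cases
   case 1
   then show ?thesis using o r(2) less.prems(3) by (simp add: returns_def)
  next
   case 2
   have "\<psi> b \<in> orbit g (\<psi> a')"
    by (rule less.IH[of "k - n"]) (use 2 r less.prems in \<open>auto simp: returns_def\<close>)
   then show ?thesis using o orbit_trans by metis
  qed
 qed
 have 2: "b \<in> orbit f a" if "a \<in> A" "b \<in> A" "(g ^^ k) (\<psi> a) = \<psi> b" "0 < k" for a b k using that
 proof (induction k arbitrary: a rule: less_induct)
  case (less k)
  obtain n a' n' where r: "a' \<in> A" "returns f A a n a'" "returns g (\<psi> ` A) (\<psi> a) n' (\<psi> a')"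
   using ret[OF less.prems(1)] by blast
  have o: "a' \<in> orbit f a" using returns_orbit[OF r(2)] .
  from returns_split[OF r(3), of k] less.prems consider "k = n'" | "n' < k" "(g ^^ (k - n')) (\<psi> a') = \<psi> b" by auto
  then show ?case
  proof cases
   case 1
   then have "\<psi> b = \<psi> a'" using r(3) less.prems(3) by (simp add: returns_def)
   then show ?thesis using inj_onD[OF inj] less.prems(2) r(1) o by metis
  next
   case 2
   have "b \<in> orbit f a'"
    by (rule less.IH[of "k - n'"]) (use 2 r less.prems in \<open>auto simp: returns_def\<close>)
   then show ?thesis using o orbit_trans by metis
  qed
 qed
 have "orbit f a = orbit f b \<longleftrightarrow> orbit g (\<psi> a) = orbit g (\<psi> b)" if "a \<in> A" "b \<in> A" for a b
  unfolding permutes_orbit_eq_iff[OF f] permutes_orbit_eq_iff[OF g]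
  using 1[OF that(2,1)] 2[OF that(2,1)] by (auto simp: orbit_altdef)
 note eq = this
 show ?thesis unfolding image_image by (rule card_image_same_fibres) (rule eq)
qed

text \<open>Exchanging the images of two points on different cycles joins these into one cycle: from
  \<open>x\<close> the walk continues on the cycle of \<open>y\<close> and, once at
  \<open>y\<close>, comes back to that of \<open>x\<close>.\<close>

lemma orbit_transpose_merge:
 assumes f: "finite X" "f permutes X" and xy: "x \<in> X" "y \<in> X" "y \<notin> orbit f x"
 defines "g \<equiv> f \<circ> transpose x y"
 shows "g permutes X" "orbit g x = orbit f x \<union> orbit f y" "orbit g y = orbit f x \<union> orbit f y"
  "z \<notin> orbit f x \<union> orbit f y \<Longrightarrow> orbit g z = orbit f z"
  "card (orbit g ` X) + 1 = card (orbit f ` X)"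
proof -
 note so = permutes_self_orbit[OF f] and oe = permutes_orbit_eq_iff[OF f]
 show g: "g permutes X" unfolding g_def using f xy by (intro permutes_compose permutes_swap_id) auto
 have xy': "x \<notin> orbit f y" using xy(3) orbit_swap[OF so, of x y] by blast
 have "x \<noteq> y" using xy(3) so by blast
 have gx: "g x = f y" "g y = f x" and go: "\<And>z. z \<noteq> x \<Longrightarrow> z \<noteq> y \<Longrightarrow> g z = f z"
  by (auto simp: g_def transpose_def)
 have 1: "z \<in> orbit g x" if "z \<in> orbit f y" for z using that
 proof (induction rule: orbit.induct)
  case base
  then show ?case using orbit.base[of g x] gx by simp
 next
  case (step z)
  then have "z \<noteq> x" using xy' by blast
  then show ?case using step gx go orbit.base[of g x] orbit.step[OF step.IH] by (cases "z = y") auto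
 qed
 have 2: "z \<in> orbit g x" if "z \<in> orbit f x" for z using that
 proof (induction rule: orbit.induct)
  case base
  then show ?case using orbit.step[OF 1[OF so]] gx by simp
 next
  case (step z)
  then have "z \<noteq> y" using xy(3) by blast
  then show ?case using step gx go orbit.step[OF 1[OF so]] orbit.step[OF step.IH] by (cases "z = x") auto
 qed
 have 3: "z \<in> orbit f x \<union> orbit f y" if "z \<in> orbit g x" for z using that
 proof (induction rule: orbit.induct)
  case base
  then show ?case using gx orbit.base[of f y] by simp
 next
  case (step z)
  then show ?case using gx go[of z] orbit.base[of f x] orbit.base[of f y] orbit.step[of z f x] orbit.step[of z f y]
   by (cases "z = x"; cases "z = y") auto
 qed
 show ox: "orbit g x = orbit f x \<union> orbit f y" using 1 2 3 by blast
 then have "y \<in> orbit g x" using so by blast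
 then show oy: "orbit g y = orbit f x \<union> orbit f y" using permutes_orbit_eq_iff[OF f(1) g] ox by metis
 show oz: "orbit g z = orbit f z" if z: "z \<notin> orbit f x \<union> orbit f y" for z
 proof (rule orbit_cong[OF so])
  fix w assume w: "w \<in> orbit f z"
  then have "w \<noteq> x \<and> w \<noteq> y" using z orbit_swap[OF so w] by auto
  then show "g w = f w" using go by simp
 qed
 have split: "orbit f ` X = insert (orbit f x) (insert (orbit f y) (orbit f ` (X - (orbit f x \<union> orbit f y))))"
 proof -
  have "orbit f z \<in> insert (orbit f x) (insert (orbit f y) (orbit f ` (X - (orbit f x \<union> orbit f y))))"
   if "z \<in> X" for z
   using that oe[of z x] oe[of z y] by (cases "z \<in> orbit f x"; cases "z \<in> orbit f y") simp_all
  then show ?thesis using xy by auto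
 qed
 have split': "orbit g ` X = insert (orbit f x \<union> orbit f y) (orbit f ` (X - (orbit f x \<union> orbit f y)))"
 proof -
  have "orbit g z = orbit f x \<union> orbit f y" if "z \<in> orbit f x \<union> orbit f y" for z
   using that ox permutes_orbit_eq_iff[OF f(1) g, of z x] by auto
  then have "orbit g z \<in> insert (orbit f x \<union> orbit f y) (orbit f ` (X - (orbit f x \<union> orbit f y)))"
   if "z \<in> X" for z using that oz[of z] by (cases "z \<in> orbit f x \<union> orbit f y") auto
  moreover have "orbit f z \<in> orbit g ` X" if "z \<in> X - (orbit f x \<union> orbit f y)" for z
   using that oz[of z, symmetric] by blast
  moreover have "orbit f x \<union> orbit f y \<in> orbit g ` X" using ox[symmetric] xy(1) by blast
  ultimately show ?thesis by auto
 qed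
 have ne: "orbit f x \<noteq> orbit f y" using oe xy' by auto
 have fin: "finite (orbit f ` (X - (orbit f x \<union> orbit f y)))" using f(1) by simp
 have n1: "orbit f x \<notin> orbit f ` (X - (orbit f x \<union> orbit f y))" "orbit f y \<notin> orbit f ` (X - (orbit f x \<union> orbit f y))"
  using oe by auto
 have n2: "orbit f x \<union> orbit f y \<notin> orbit f ` (X - (orbit f x \<union> orbit f y))"
 proof
  assume "orbit f x \<union> orbit f y \<in> orbit f ` (X - (orbit f x \<union> orbit f y))"
  then obtain z where "z \<notin> orbit f x" "orbit f z = orbit f x \<union> orbit f y" by auto
  then have "z \<in> orbit f y" using so[of z] by blast
  then have "orbit f z = orbit f y" using oe by blast
  then show False using \<open>orbit f z = orbit f x \<union> orbit f y\<close> so[of x] xy' by blast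
 qed
 show "card (orbit g ` X) + 1 = card (orbit f ` X)" unfolding split split' using ne n1 n2 fin by simp
qed

text \<open>The transposition undoes itself, so the merging count can be applied to
  \<open>g\<close>, provided that \<open>x\<close> and \<open>y\<close> lie on different cycles of
  \<open>g\<close>. Indeed the cycle of \<open>x\<close> is now the stretch \<open>Z\<close> from
  \<open>f y\<close> to \<open>x\<close>, which avoids \<open>y\<close>.\<close>

lemma orbit_transpose_split:
 assumes f: "finite X" "f permutes X" and xy: "x \<in> X" "y \<in> X" "x \<noteq> y" "y \<in> orbit f x"
 defines "g \<equiv> f \<circ> transpose x y"
 shows "g permutes X" "card (orbit g ` X) = card (orbit f ` X) + 1"
proof -
 show g: "g permutes X" unfolding g_def using f xy by (intro permutes_compose permutes_swap_id) auto
 have gx: "g x = f y" and go: "\<And>z. z \<noteq> x \<Longrightarrow> z \<noteq> y \<Longrightarrow> g z = f z"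
  by (auto simp: g_def transpose_def)
 have x: "x \<in> orbit f y" using xy(4) orbit_swap[OF permutes_self_orbit[OF f], of y x] by blast
 define n where "n = funpow_dist1 f y x"
 have n: "(f ^^ n) y = x" unfolding n_def by (rule funpow_dist1_prop[OF x])
 have nx: "(f ^^ i) y \<noteq> x" if "0 < i" "i < n" for i using funpow_dist1_least that unfolding n_def by metis
 have ny: "(f ^^ i) y \<noteq> y" if "0 < i" "i < n" for i
 proof
  assume "(f ^^ i) y = y"
  then have "(f ^^ (n mod i)) y = x" using n funpow_mod_eq by metis
  moreover have "n mod i < i" using that by simp
  ultimately show False using nx[of "n mod i"] that xy(3) by (cases "n mod i = 0") auto
 qed
 define Z where "Z = {(f ^^ i) y |i. 0 < i \<and> i \<le> n}"
 have "0 < n" by (simp add: n_def)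
 have "z \<in> Z" if "z \<in> orbit g x" for z using that
 proof (induction rule: orbit.induct)
  case base
  show ?case using gx \<open>0 < n\<close> by (auto simp: Z_def intro!: exI[of _ 1])
 next
  case (step z)
  then obtain i where i: "z = (f ^^ i) y" "0 < i" "i \<le> n" by (auto simp: Z_def)
  show ?case
  proof (cases "i = n")
   case True
   then show ?thesis using i n gx \<open>0 < n\<close> by (auto simp: Z_def intro!: exI[of _ 1])
  next
   case False
   then have "g z = (f ^^ Suc i) y" using i nx[of i] ny[of i] go by auto
   then show ?thesis using i False unfolding Z_def by (metis (mono_tags, lifting) Suc_leI le_neq_implies_less mem_Collect_eq zero_less_Suc)
  qed
 qed
 moreover have "y \<notin> Z"
 proof
  assume "y \<in> Z"
  then obtain i where "y = (f ^^ i) y" "0 < i" "i \<le> n" by (auto simp: Z_def)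
  then show False using ny[of i] n xy(3) by (cases "i = n") auto
 qed
 ultimately have "y \<notin> orbit g x" by blast
 from orbit_transpose_merge(5)[OF f(1) g xy(1,2) this]
 show "card (orbit g ` X) = card (orbit f ` X) + 1" by (simp add: g_def comp_assoc)
qed

fun swaps :: "('a \<Rightarrow> 'a) \<Rightarrow> ('a \<times> 'a) list \<Rightarrow> 'a \<Rightarrow> 'a" where
 "swaps f [] = f"
| "swaps f ((x, y) # es) = swaps (f \<circ> transpose x y) es"

text \<open>
 The orbits of the auxiliary permutation \<open>h\<close> are the connected components of the graph that is
 built by adding the edges \<open>es\<close> one by one; an edge between two components merges two orbits.
\<close>

lemma swaps_orbits:
 assumes "finite X" "f permutes X" "h permutes X" "\<forall>x \<in> X. f x \<in> orbit h x"
  and "\<forall>(x, y) \<in> set es. x \<in> X \<and> y \<in> X \<and> x \<noteq> y"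
 shows "swaps f es permutes X \<and> even (card (orbit (swaps f es) ` X) + card (orbit f ` X) + length es) \<and>
  (\<exists>h'. h' permutes X \<and> (\<forall>x \<in> X. swaps f es x \<in> orbit h' x) \<and> (\<forall>(x, y) \<in> set es. y \<in> orbit h' x)
   \<and> (\<forall>x \<in> X. orbit h x \<subseteq> orbit h' x)
   \<and> card (orbit (swaps f es) ` X) + 2 * card (orbit h ` X) \<le> card (orbit f ` X) + length es + 2 * card (orbit h' ` X)
   \<and> (\<forall>z \<in> X. (\<forall>(x, y) \<in> set es. x \<notin> orbit h z \<and> y \<notin> orbit h z) \<longrightarrow> orbit h' z = orbit h z))"
 using assms(2-5)
proof (induction es arbitrary: f h)
 case Nil
 then show ?case by (intro conjI exI[of _ h]) auto
next
 case (Cons e es)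
 obtain x y where e: "e = (x, y)" by fastforce
 have xy: "x \<in> X" "y \<in> X" "x \<noteq> y" using Cons.prems(4) by (auto simp: e)
 have es: "\<forall>(x, y) \<in> set es. x \<in> X \<and> y \<in> X \<and> x \<noteq> y" using Cons.prems(4) by simp
 note p3 = bspec[OF Cons.prems(3)]
 note f = assms(1) Cons.prems(1) and h = assms(1) Cons.prems(2)
 let ?f = "f \<circ> transpose x y"
 have sub: "orbit f z \<subseteq> orbit h z" if "z \<in> X" for z
 proof
  fix w assume "w \<in> orbit f z"
  then have "w \<in> orbit h z \<and> w \<in> X"
  proof (induction rule: orbit.induct)
   case base
   then show ?case using p3[OF that] that f(2) by (simp add: permutes_in_image)
  next
   case (step w)
   then show ?case using p3[of w] orbit_trans f(2) by (metis permutes_in_image)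
  qed
  then show "w \<in> orbit h z" ..
 qed
 have c: "card (orbit ?f ` X) \<le> card (orbit f ` X) + 1 \<and> even (card (orbit ?f ` X) + card (orbit f ` X) + 1)"
 proof (cases "y \<in> orbit f x")
  case True
  then show ?thesis using orbit_transpose_split(2)[OF f xy] by simp
 next
  case False
  then have "card (orbit ?f ` X) + 1 = card (orbit f ` X)" by (rule orbit_transpose_merge(5)[OF f xy(1,2)])
  moreover have "a \<le> b + 1 \<and> even (a + b + 1)" if "a + 1 = b" for a b :: nat using that by auto
  ultimately show ?thesis by blast
 qed
 \<comment> \<open>An edge inside a component leaves the components alone and changes the number of
   faces by 1 in either direction. An edge between two components merges them and necessarily also
   two faces; losing one face and one component is balanced by the factor 2 in the bound.\<close>
 define k where "k = (if y \<in> orbit h x then h else h \<circ> transpose x y)"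
 have k: "k permutes X \<and> y \<in> orbit k x \<and> (\<forall>z. orbit h z \<subseteq> orbit k z)
  \<and> (\<forall>z. z \<notin> orbit h x \<union> orbit h y \<longrightarrow> orbit k z = orbit h z)
  \<and> card (orbit ?f ` X) + 2 * card (orbit h ` X) \<le> card (orbit f ` X) + 1 + 2 * card (orbit k ` X)"
 proof (cases "y \<in> orbit h x")
  case True
  then show ?thesis using h c by (simp add: k_def)
 next
  case False
  have "y \<notin> orbit f x" using False sub[OF xy(1)] by blast
  note mf = orbit_transpose_merge[OF f xy(1,2) this]
  have ke: "h \<circ> transpose x y = k" using False by (simp add: k_def)
  note mh = orbit_transpose_merge[OF h xy(1,2) False, unfolded ke]
  have "orbit h z \<subseteq> orbit k z" for z
  proof (cases "z \<in> orbit h x \<union> orbit h y")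
   case True
   then have "z \<in> orbit k x" using mh(2) by blast
   then have "orbit k z = orbit h x \<union> orbit h y" using permutes_orbit_eq_iff[OF h(1) mh(1)] mh(2) by metis
   moreover have "orbit h z = orbit h x \<or> orbit h z = orbit h y" using True permutes_orbit_eq_iff[OF h] by blast
   ultimately show ?thesis by blast
  qed (use mh(4) in simp)
  moreover have "y \<in> orbit k x" using mh(2) permutes_self_orbit[OF h, of y] by blast
  ultimately show ?thesis using mh(1,4,5) mf(5) by auto
 qed
 have yk: "y \<in> orbit k x" using k by blast
 have xk: "x \<in> orbit k y" using yk orbit_swap[OF permutes_self_orbit[OF assms(1)]] k by metis
 have f1: "?f z \<in> orbit k z" if z: "z \<in> X" for z
 proof -
  have "transpose x y z \<in> orbit k z" using yk xk permutes_self_orbit[OF assms(1)] k by (auto simp: transpose_def)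
  moreover have "f (transpose x y z) \<in> orbit h (transpose x y z)"
   by (rule p3) (use z xy in \<open>auto simp: transpose_def\<close>)
  ultimately show ?thesis using orbit_trans k by (metis comp_apply subsetD)
 qed
 have "?f permutes X" using f xy by (intro permutes_compose permutes_swap_id) auto
 from Cons.IH[OF this conjunct1[OF k] ballI[OF f1] es] obtain h' where h': "h' permutes X"
  "\<forall>x \<in> X. swaps ?f es x \<in> orbit h' x" "\<forall>(x, y) \<in> set es. y \<in> orbit h' x"
  "\<forall>x \<in> X. orbit k x \<subseteq> orbit h' x"
  "card (orbit (swaps ?f es) ` X) + 2 * card (orbit k ` X) \<le> card (orbit ?f ` X) + length es + 2 * card (orbit h' ` X)"
  "\<forall>z \<in> X. (\<forall>(x, y) \<in> set es. x \<notin> orbit k z \<and> y \<notin> orbit k z) \<longrightarrow> orbit h' z = orbit k z"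
  "swaps ?f es permutes X" "even (card (orbit (swaps ?f es) ` X) + card (orbit ?f ` X) + length es)" by blast
 show ?case
 proof (intro conjI exI[of _ h'])
  show "even (card (orbit (swaps f (e # es)) ` X) + card (orbit f ` X) + length (e # es))"
   using h'(8) c by (auto simp: e)
  show "\<forall>(x, y) \<in> set (e # es). y \<in> orbit h' x" using h'(3,4) yk xy e by auto
  show "card (orbit (swaps f (e # es)) ` X) + 2 * card (orbit h ` X)
   \<le> card (orbit f ` X) + length (e # es) + 2 * card (orbit h' ` X)"
   using h'(5) k by (simp add: e)
  show "\<forall>x \<in> X. orbit h x \<subseteq> orbit h' x" using h'(4) k by blast
  show "\<forall>z \<in> X. (\<forall>(x, y) \<in> set (e # es). x \<notin> orbit h z \<and> y \<notin> orbit h z) \<longrightarrow> orbit h' z = orbit h z"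
  proof (intro ballI impI)
   fix z assume z: "z \<in> X" "\<forall>(x, y) \<in> set (e # es). x \<notin> orbit h z \<and> y \<notin> orbit h z"
   then have "z \<notin> orbit h x \<union> orbit h y" using orbit_swap[OF permutes_self_orbit[OF h]] e by fastforce
   then have "orbit k z = orbit h z" using k by blast
   then show "orbit h' z = orbit h z" using h'(6) z by auto
  qed
 qed (use h' e in auto)
qed

section \<open>Faces of the ribbon graph of a cyclic Gauss word\<close>

definition cyc_next :: "'a list \<Rightarrow> 'a \<Rightarrow> 'a" where
 "cyc_next P u = P ! (Suc (idx P u) mod length P)"

definition cyc_prev :: "'a list \<Rightarrow> 'a \<Rightarrow> 'a" where
 "cyc_prev P u = P ! ((idx P u + length P - 1) mod length P)"

lemma cyc_next_mem: "u \<in> set P \<Longrightarrow> cyc_next P u \<in> set P"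
 unfolding cyc_next_def by (rule nth_mem) (auto intro: mod_less_divisor simp: length_pos_if_in_set)

lemma cyc_prev_mem: "u \<in> set P \<Longrightarrow> cyc_prev P u \<in> set P"
 unfolding cyc_prev_def by (rule nth_mem) (auto intro: mod_less_divisor simp: length_pos_if_in_set)

lemma cyc_prev_next: "distinct P \<Longrightarrow> u \<in> set P \<Longrightarrow> cyc_prev P (cyc_next P u) = u"
proof -
 assume d: "distinct P" and u: "u \<in> set P"
 have l: "0 < length P" and i: "idx P u < length P" using u by (auto simp: length_pos_if_in_set)
 have "idx P (cyc_next P u) = Suc (idx P u) mod length P" unfolding cyc_next_def using d l by simp
 moreover have "(Suc k mod n + n - 1) mod n = k" if "k < n" for k n :: nat
  using that by (cases "Suc k = n") (auto simp: mod_Suc)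
 ultimately show ?thesis using i u by (simp add: cyc_prev_def)
qed

lemma cyc_next_prev: "distinct P \<Longrightarrow> u \<in> set P \<Longrightarrow> cyc_next P (cyc_prev P u) = u"
proof -
 assume d: "distinct P" and u: "u \<in> set P"
 have l: "0 < length P" and i: "idx P u < length P" using u by (auto simp: length_pos_if_in_set)
 have "idx P (cyc_prev P u) = (idx P u + length P - 1) mod length P" unfolding cyc_prev_def using d l by simp
 moreover have "Suc ((k + n - 1) mod n) mod n = k" if "k < n" for k n :: nat
 proof (cases k)
  case (Suc k')
  have "(k + n - 1) = k' + n" using Suc by simp
  then show ?thesis using that Suc by simp
 qed (use that in simp)
 ultimately show ?thesis using i u by (simp add: cyc_next_def)
qed

lemma cyc_prev_eqI: "distinct P \<Longrightarrow> v \<in> set P \<Longrightarrow> cyc_next P v = u \<Longrightarrow> cyc_prev P u = v"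
 using cyc_prev_next by metis

lemma cyc_next_consecutive: "distinct (A @ [u, v] @ B) \<Longrightarrow> cyc_next (A @ [u, v] @ B) u = v"
 using idx_pair(1)[of A u v B] by (simp add: cyc_next_def nth_append)

lemma cyc_next_rotate1: "distinct P \<Longrightarrow> u \<in> set P \<Longrightarrow> cyc_next (rotate1 P) u = cyc_next P u"
proof (cases P)
 case (Cons x xs)
 assume d: "distinct P" and u: "u \<in> set P"
 show ?thesis
 proof (cases "u = x")
  case True
  then show ?thesis using d by (cases xs) (auto simp: Cons cyc_next_def idx_Cons idx_append)
 next
  case False
  then have ux: "u \<in> set xs" and i: "idx xs u < length xs" using u Cons by auto
  show ?thesis
  proof (cases "Suc (idx xs u) = length xs")
   case True
   then show ?thesis using d False ux by (simp add: Cons cyc_next_def idx_Cons idx_append nth_append)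
  next
   case nl: False
   then have "Suc (idx xs u) < length xs" using i by linarith
   then show ?thesis using d False ux by (auto simp: Cons cyc_next_def idx_Cons idx_append nth_append)
  qed
 qed
qed simp

lemma cyc_next_rotate: "distinct P \<Longrightarrow> u \<in> set P \<Longrightarrow> cyc_next (rotate n P) u = cyc_next P u"
 by (induction n) (simp_all add: cyc_next_rotate1)

lemma cyc_prev_rotate:
 assumes "distinct P" "u \<in> set P"
 shows "cyc_prev (rotate n P) u = cyc_prev P u" by (rule cyc_prev_eqI)
  (use assms cyc_next_rotate[OF assms(1) cyc_prev_mem[OF assms(2)]] cyc_next_prev[OF assms] cyc_prev_mem[OF assms(2)] in simp_all)

text \<open>A face is walked along by following the edge from \<open>u\<close> to the next point
  \<open>v\<close> and turning to the next dart counterclockwise there. That dart lies on the other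
  strand, and \<open>eta v\<close> decides whether it points forward; at a point of degree two the
  value -1 means going straight on.\<close>

definition face_map :: "('a \<Rightarrow> 'a) \<Rightarrow> ('a \<Rightarrow> int) \<Rightarrow> 'a list \<Rightarrow> 'a \<times> bool \<Rightarrow> 'a \<times> bool" where
 "face_map mu eta P = (\<lambda>(u, b). if u \<in> set P
   then let v = (if b then cyc_next P u else cyc_prev P u) in (mu v, (\<not> b) = (eta v = 1)) else (u, b))"

text \<open>
 A point \<open>u\<close> with \<open>mu u \<noteq> u\<close> is a passage through the crossing with the other passage \<open>mu u\<close>; a
 point with \<open>mu u = u\<close> is a vertex of degree two. The dart \<open>(u, True)\<close> leaves \<open>u\<close> forward, and
 \<open>(u, False)\<close> leaves it backward.
\<close>

definition wf_word :: "('a \<Rightarrow> 'a) \<Rightarrow> ('a \<Rightarrow> int) \<Rightarrow> 'a list \<Rightarrow> bool" where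
 "wf_word mu eta P \<longleftrightarrow> distinct P \<and> (\<forall>u \<in> set P. mu u \<in> set P \<and> mu (mu u) = u \<and>
   (eta u = 1 \<or> eta u = - 1) \<and> (if mu u = u then eta u = - 1 else eta (mu u) = - eta u))"

definition faces :: "('a \<Rightarrow> 'a) \<Rightarrow> ('a \<Rightarrow> int) \<Rightarrow> 'a list \<Rightarrow> nat" where
 "faces mu eta P = card (orbit (face_map mu eta P) ` (set P \<times> UNIV))"

lemma wf_word_finite: "finite (set P \<times> (UNIV :: bool set))" by simp

lemma face_map_permutes:
 assumes "wf_word mu eta P"
 shows "face_map mu eta P permutes (set P \<times> UNIV)"
proof (rule bij_imp_permutes)
 let ?f = "face_map mu eta P"
 have d: "distinct P" and mu: "\<And>u. u \<in> set P \<Longrightarrow> mu u \<in> set P \<and> mu (mu u) = u"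
  using assms by (auto simp: wf_word_def)
 have maps: "?f x \<in> set P \<times> UNIV" if "x \<in> set P \<times> UNIV" for x
  using that mu[OF cyc_next_mem] mu[OF cyc_prev_mem] by (auto simp: face_map_def Let_def)
 have inj: "inj_on ?f (set P \<times> UNIV)"
 proof (rule inj_onI)
  fix x y assume xy: "x \<in> set P \<times> UNIV" "y \<in> set P \<times> UNIV" "?f x = ?f y"
  obtain u b u' b' where x: "x = (u, b)" and y: "y = (u', b')" by fastforce
  define v where "v = (if b then cyc_next P u else cyc_prev P u)"
  define v' where "v' = (if b' then cyc_next P u' else cyc_prev P u')"
  have vP: "v \<in> set P" "v' \<in> set P" using xy cyc_next_mem cyc_prev_mem by (auto simp: x y v_def v'_def)
  have "mu v = mu v'" "((\<not> b) = (eta v = 1)) = ((\<not> b') = (eta v' = 1))"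
   using xy by (auto simp: x y face_map_def Let_def v_def v'_def)
  moreover from this(1) have v: "v = v'" using mu[OF vP(1)] mu[OF vP(2)] by metis
  ultimately have b: "b = b'" by blast
  have u: "u \<in> set P" "u' \<in> set P" using xy by (auto simp: x y)
  have "(if b then cyc_prev P v else cyc_next P v) = u"
   using cyc_prev_next[OF d u(1)] cyc_next_prev[OF d u(1)] by (simp add: v_def)
  moreover have "(if b' then cyc_prev P v' else cyc_next P v') = u'"
   using cyc_prev_next[OF d u(2)] cyc_next_prev[OF d u(2)] by (simp add: v'_def)
  ultimately have "u = u'" unfolding v b by metis
  then show "x = y" using b by (simp add: x y)
 qed
 have "?f ` (set P \<times> UNIV) = set P \<times> UNIV"
  by (rule endo_inj_surj[OF wf_word_finite _ inj]) (use maps in blast)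
 then show "bij_betw ?f (set P \<times> UNIV) (set P \<times> UNIV)" using inj by (simp add: bij_betw_def)
 show "?f x = x" if "x \<notin> set P \<times> UNIV" for x using that by (cases x) (simp add: face_map_def)
qed

definition first_return :: "('a \<Rightarrow> 'a) \<Rightarrow> 'a set \<Rightarrow> 'a \<Rightarrow> 'a \<Rightarrow> bool" where
 "first_return f A x y \<longleftrightarrow> (\<exists>n. returns f A x n y)"

lemma first_return_now: "f x \<in> A \<Longrightarrow> first_return f A x (f x)"
 unfolding first_return_def returns_def by (intro exI[of _ 1]) auto

lemma first_return_step:
 assumes "f x \<notin> A" "first_return f A (f x) y"
 shows "first_return f A x y"
proof -
 obtain n where n: "0 < n" "(f ^^ n) (f x) = y" "y \<in> A" "\<And>i. 0 < i \<Longrightarrow> i < n \<Longrightarrow> (f ^^ i) (f x) \<notin> A"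
  using assms(2) by (auto simp: first_return_def returns_def)
 have "(f ^^ i) x \<notin> A" if i: "0 < i" "i < Suc n" for i
  using i n(4)[of "i - 1"] assms(1) by (cases i; cases "i = 1") (auto simp: funpow_swap1)
 then have "returns f A x (Suc n) y" using n by (auto simp: returns_def funpow_swap1)
 then show ?thesis by (auto simp: first_return_def)
qed

lemma first_return_cases:
 "f x \<in> A \<Longrightarrow> y = f x \<Longrightarrow> first_return f A x y"
 "f x = z \<Longrightarrow> z \<notin> A \<Longrightarrow> first_return f A z y \<Longrightarrow> first_return f A x y"
 using first_return_now first_return_step by metis+

lemma first_return_count:
 assumes "finite X" "f permutes X" "finite Y" "g permutes Y" "inj_on \<psi> A"
  and "\<And>a. a \<in> A \<Longrightarrow> \<exists>a'. a' \<in> A \<and> first_return f A a a' \<and> first_return g (\<psi> ` A) (\<psi> a) (\<psi> a')"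
 shows "card (orbit f ` A) = card (orbit g ` \<psi> ` A)"
proof (rule return_count[OF assms(1-5)])
 fix a assume "a \<in> A"
 then show "\<exists>n a' n'. a' \<in> A \<and> returns f A a n a' \<and> returns g (\<psi> ` A) (\<psi> a) n' (\<psi> a')"
  using assms(6)[of a] unfolding first_return_def by blast
qed

lemma first_return_orbit: "first_return f A x y \<Longrightarrow> y \<in> A \<and> y \<in> orbit f x"
 unfolding first_return_def using returns_orbit by (metis returns_def)

text \<open>Points from which the orbit returns to \<open>A\<close> contribute no further orbits.\<close>

lemma orbits_meeting:
 assumes f: "finite X" "f permutes X" and A: "A \<subseteq> X"
  and "\<And>x. x \<in> X - A - E \<Longrightarrow> \<exists>y. first_return f A x y"
 shows "orbit f ` X = orbit f ` A \<union> orbit f ` (E \<inter> X)"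
proof -
 have "orbit f x \<in> orbit f ` A" if x: "x \<in> X - A - E" for x
 proof -
  obtain y where y: "y \<in> A" "y \<in> orbit f x" using assms(4)[OF x] first_return_orbit by metis
  then have "orbit f x = orbit f y" using permutes_orbit_eq_iff[OF f] by metis
  then show ?thesis using y(1) by blast
 qed
 then show ?thesis using A by auto
qed

lemma faces_map:
 assumes wf: "wf_word mu eta P" and wf': "wf_word mu' eta' (map h P)" and inj: "inj_on h (set P)"
  and "\<And>u. u \<in> set P \<Longrightarrow> mu' (h u) = h (mu u)" "\<And>u. u \<in> set P \<Longrightarrow> eta' (h u) = eta u"
 shows "faces mu' eta' (map h P) = faces mu eta P"
proof -
 let ?\<psi> = "\<lambda>(u, b). (h u, b)"
 have n: "cyc_next (map h P) (h u) = h (cyc_next P u)" "cyc_prev (map h P) (h u) = h (cyc_prev P u)"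
  if "u \<in> set P" for u using that length_pos_if_in_set[OF that]
  by (simp_all add: cyc_next_def cyc_prev_def idx_map[OF inj])
 have f: "face_map mu' eta' (map h P) (?\<psi> a) = ?\<psi> (face_map mu eta P a)" if "a \<in> set P \<times> UNIV" for a
  using that n assms(4)[OF cyc_next_mem] assms(4)[OF cyc_prev_mem] assms(5)[OF cyc_next_mem] assms(5)[OF cyc_prev_mem]
  by (auto simp: face_map_def Let_def)
 have img: "?\<psi> ` (set P \<times> UNIV) = set (map h P) \<times> (UNIV :: bool set)" by (auto simp: image_iff)
 have "card (orbit (face_map mu eta P) ` (set P \<times> UNIV))
   = card (orbit (face_map mu' eta' (map h P)) ` ?\<psi> ` (set P \<times> UNIV))"
 proof (rule first_return_count[OF wf_word_finite face_map_permutes[OF wf] wf_word_finite face_map_permutes[OF wf']])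
  show "inj_on ?\<psi> (set P \<times> UNIV)" using inj by (auto simp: inj_on_def)
  fix a assume a: "a \<in> set P \<times> (UNIV :: bool set)"
  have m: "face_map mu eta P a \<in> set P \<times> UNIV"
   using a permutes_in_image[OF face_map_permutes[OF wf]] by blast
  show "\<exists>a'. a' \<in> set P \<times> UNIV \<and> first_return (face_map mu eta P) (set P \<times> UNIV) a a'
   \<and> first_return (face_map mu' eta' (map h P)) (?\<psi> ` (set P \<times> UNIV)) (?\<psi> a) (?\<psi> a')"
   using first_return_now[of "face_map mu eta P" a, OF m] m f[OF a]
    first_return_now[of "face_map mu' eta' (map h P)" "?\<psi> a" "?\<psi> ` (set P \<times> UNIV)"]
   by (intro exI[of _ "face_map mu eta P a"]) auto
 qed
 then show ?thesis unfolding faces_def img by simp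
qed

lemma faces_rotate: "distinct P \<Longrightarrow> faces mu eta (rotate n P) = faces mu eta P"
proof -
 assume d: "distinct P"
 have "face_map mu eta (rotate n P) = face_map mu eta P"
  by (rule ext) (auto simp: face_map_def Let_def cyc_next_rotate[OF d] cyc_prev_rotate[OF d])
 then show ?thesis by (simp add: faces_def)
qed

lemma faces_append_swap: "distinct (A @ B) \<Longrightarrow> faces mu eta (B @ A) = faces mu eta (A @ B)"
 using faces_rotate[of "A @ B" mu eta "length A"] by (simp add: rotate_append)

lemma cyc_next_Cons:
 assumes "distinct (x # R)" "R \<noteq> []" "u \<in> set (x # R)"
 shows "cyc_next (x # R) u = (if u = x then hd R else if u = last R then x else cyc_next R u)"
proof (cases "u = x")
 case True
 then show ?thesis using assms(2) by (cases R) (auto simp: cyc_next_def idx_Cons)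
next
 case False
 then have u: "u \<in> set R" "idx R u < length R" using assms by auto
 have l: "idx R u = length R - 1 \<longleftrightarrow> u = last R"
  using u assms(1,2) last_conv_nth[OF assms(2)] nth_idx[OF u(1)] by (metis One_nat_def Suc_pred diff_Suc_less distinct.simps(2) idx_nth length_greater_0_conv)
 show ?thesis
 proof (cases "u = last R")
  case True
  then have "Suc (Suc (idx R u)) = length (x # R)" using l u assms(2) by (cases R) auto
  then show ?thesis using False True by (simp add: cyc_next_def idx_Cons)
 next
  case nl: False
  then have "Suc (idx R u) < length R" using l u by linarith
  then show ?thesis using False nl by (simp add: cyc_next_def idx_Cons)
 qed
qed

lemma cyc_next_last: "distinct R \<Longrightarrow> R \<noteq> [] \<Longrightarrow> cyc_next R (last R) = hd R"
proof -
 assume *: "distinct R" "R \<noteq> []"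
 then have "idx R (last R) = length R - 1"
  by (metis One_nat_def Suc_pred diff_Suc_less idx_nth last_conv_nth length_greater_0_conv)
 then show ?thesis using * by (simp add: cyc_next_def hd_conv_nth)
qed

lemma cyc_prev_Cons:
 assumes d: "distinct (x # R)" and "R \<noteq> []" "u \<in> set (x # R)"
 shows "cyc_prev (x # R) u = (if u = x then last R else if u = hd R then x else cyc_prev R u)"
proof -
 have dR: "distinct R" "x \<notin> set R" using d by auto
 note nx = cyc_next_Cons[OF d assms(2)]
 have "cyc_next (x # R) (if u = x then last R else if u = hd R then x else cyc_prev R u) = u"
 proof (cases "u = x \<or> u = hd R")
  case True
  then show ?thesis using nx[of "last R"] nx[of x] dR assms(2) by (auto simp: last_in_set)
 next
  case False
  then have u: "u \<in> set R" using assms(3) by auto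
  have p: "cyc_prev R u \<in> set R" using cyc_prev_mem[OF u] .
  have "cyc_prev R u \<noteq> last R" using False cyc_next_prev[OF dR(1) u] cyc_next_last[OF dR(1) assms(2)] by auto
  moreover have "cyc_prev R u \<noteq> x" using p dR by auto
  ultimately show ?thesis using nx[of "cyc_prev R u"] p False cyc_next_prev[OF dR(1) u] by auto
 qed
 moreover have "(if u = x then last R else if u = hd R then x else cyc_prev R u) \<in> set (x # R)"
  using assms cyc_prev_mem[of u R] by auto
 ultimately show ?thesis using cyc_prev_eqI[OF d] by blast
qed

lemma cyc_prev_hd: "distinct R \<Longrightarrow> R \<noteq> [] \<Longrightarrow> cyc_prev R (hd R) = last R"
 by (rule cyc_prev_eqI) (auto simp: cyc_next_last)

text \<open>Walks go straight through a point of degree two, so the first returns to the remaining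
  darts do not change. Something has to remain: a single marker has two faces, the empty word has
  none.\<close>

lemma faces_marker_Cons:
 assumes wf: "wf_word mu eta (x # R)" and x: "mu x = x" and ne: "R \<noteq> []"
 shows "wf_word mu eta R" "faces mu eta (x # R) = faces mu eta R"
proof -
 have d: "distinct (x # R)" and ex: "eta x = - 1" using wf x by (auto simp: wf_word_def)
 then have dR: "distinct R" "x \<notin> set R" by auto
 have mu: "mu u \<in> set R \<and> mu (mu u) = u" if "u \<in> set R" for u
 proof -
  have "mu u \<in> set (x # R)" "mu (mu u) = u" using wf that unfolding wf_word_def by auto
  moreover have "mu u \<noteq> x" using \<open>mu (mu u) = u\<close> x that dR by auto
  ultimately show ?thesis by simp
 qed
 show wfR: "wf_word mu eta R" using wf mu unfolding wf_word_def by auto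
 let ?f = "face_map mu eta (x # R)" and ?g = "face_map mu eta R"
 let ?A = "set R \<times> (UNIV :: bool set)"
 note nx = cyc_next_Cons[OF d ne] cyc_prev_Cons[OF d ne] cyc_next_last[OF dR(1) ne] cyc_prev_hd[OF dR(1) ne]
 have gA: "?g a \<in> ?A" if "a \<in> ?A" for a using that permutes_in_image[OF face_map_permutes[OF wfR]] by blast
 have xT: "?f (x, True) = ?g (last R, True)" and xF: "?f (x, False) = ?g (hd R, False)"
  using nx ne by (auto simp: face_map_def)
 have fg: "?f (u, b) = (if (u, b) = (last R, True) then (x, True) else if (u, b) = (hd R, False) then (x, False) else ?g (u, b))"
  if "u \<in> set R" for u b using that nx dR(2) ex x by (auto simp: face_map_def Let_def)
 have ret: "first_return ?f ?A a (?g a)" if a: "a \<in> ?A" for a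
 proof -
  obtain u b where ub: "a = (u, b)" "u \<in> set R" using a by auto
  show ?thesis
  proof (cases "a = (last R, True) \<or> a = (hd R, False)")
   case True
   then show ?thesis
   proof
    assume a': "a = (last R, True)"
    show ?thesis
    proof (rule first_return_cases(2))
     show "?f a = (x, True)" using fg ub a' by simp
     show "first_return ?f ?A (x, True) (?g a)" by (rule first_return_cases(1)) (use gA[OF a] xT a' in auto)
    qed (use dR in auto)
   next
    assume a': "a = (hd R, False)"
    show ?thesis
    proof (rule first_return_cases(2))
     show "?f a = (x, False)" using fg ub a' by simp
     show "first_return ?f ?A (x, False) (?g a)" by (rule first_return_cases(1)) (use gA[OF a] xF a' in auto)
    qed (use dR in auto)
   qed
  next
   case False
   then have "?f a = ?g a" using fg[OF ub(2), of b] ub(1) by auto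
   then show ?thesis using first_return_now[of ?f a ?A] gA[OF a] by simp
  qed
 qed
 have "card (orbit ?f ` ?A) = card (orbit ?g ` id ` ?A)"
 proof (rule first_return_count[OF wf_word_finite face_map_permutes[OF wf] wf_word_finite face_map_permutes[OF wfR]])
  show "\<exists>a'. a' \<in> ?A \<and> first_return ?f ?A a a' \<and> first_return ?g (id ` ?A) (id a) (id a')" if "a \<in> ?A" for a
   using ret[OF that] gA[OF that] first_return_now[of ?g a ?A] by (intro exI[of _ "?g a"]) simp
 qed simp
 moreover have "orbit ?f ` (set (x # R) \<times> UNIV) = orbit ?f ` ?A \<union> orbit ?f ` ({} \<inter> (set (x # R) \<times> UNIV))"
 proof (rule orbits_meeting[OF wf_word_finite face_map_permutes[OF wf]])
  fix y assume "y \<in> set (x # R) \<times> UNIV - ?A - {}"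
  then have "y = (x, True) \<or> y = (x, False)" by auto
  then have "?f y \<in> ?A" using xT xF gA ne by auto
  then show "\<exists>z. first_return ?f ?A y z" using first_return_now by metis
 qed auto
 ultimately show "faces mu eta (x # R) = faces mu eta R" by (simp add: faces_def)
qed

lemma wf_word_rotate: "wf_word mu eta (B @ A) \<longleftrightarrow> wf_word mu eta (A @ B)" by (auto simp: wf_word_def)

theorem faces_marker:
 assumes "wf_word mu eta (A @ [x] @ B)" "mu x = x" "A @ B \<noteq> []"
 shows "wf_word mu eta (A @ B)" "faces mu eta (A @ [x] @ B) = faces mu eta (A @ B)"
proof -
 have w: "wf_word mu eta (x # B @ A)" using assms(1) wf_word_rotate[of mu eta "[x] @ B" A] by simp
 note r = faces_marker_Cons[OF w assms(2)]
 show "wf_word mu eta (A @ B)" using r(1) assms(3) wf_word_rotate by auto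
 have "distinct (A @ [x] @ B)" using assms(1) by (simp add: wf_word_def)
 then show "faces mu eta (A @ [x] @ B) = faces mu eta (A @ B)"
  using r(2) assms(3) faces_append_swap[of A "[x] @ B" mu eta] faces_append_swap[of A B mu eta] by auto
qed

lemma cyc_append:
 assumes "distinct (A @ B)" "A \<noteq> []" "B \<noteq> []"
 shows "cyc_next (A @ B) (last A) = hd B" "cyc_prev (A @ B) (hd B) = last A"
  "cyc_next (A @ B) (last B) = hd A" "cyc_prev (A @ B) (hd A) = last B"
proof -
 have 1: "cyc_next (A @ B) (last A) = hd B" if "distinct (A @ B)" "A \<noteq> []" "B \<noteq> []" for A B :: "'a list"
 proof -
  have "butlast A @ [last A, hd B] @ tl B = (butlast A @ [last A]) @ (hd B # tl B)" by simp
  also have "\<dots> = A @ B" using that by (simp only: append_butlast_last_id list.collapse not_False_eq_True)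
  finally have "A @ B = butlast A @ [last A, hd B] @ tl B" ..
  then show ?thesis using cyc_next_consecutive[of "butlast A" "last A" "hd B" "tl B"] that(1) by simp
 qed
 then show 2: "cyc_next (A @ B) (last A) = hd B" using assms by blast
 show 3: "cyc_next (A @ B) (last B) = hd A"
  using 1[of B A] assms cyc_next_rotate[OF assms(1), of "last B" "length A"] by (auto simp: rotate_append)
 show "cyc_prev (A @ B) (hd B) = last A" "cyc_prev (A @ B) (hd A) = last B"
  using assms by (auto intro!: cyc_prev_eqI[OF assms(1)] 2 3)
qed

lemma cyc_inner:
 assumes "distinct (A @ R @ B)" "u \<in> set R"
 shows "u \<noteq> last R \<Longrightarrow> cyc_next (A @ R @ B) u = cyc_next R u"
  "u \<noteq> hd R \<Longrightarrow> cyc_prev (A @ R @ B) u = cyc_prev R u"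
proof -
 have *: "cyc_next (A @ R @ B) u = cyc_next R u" if "u \<noteq> last R" "u \<in> set R" for u
 proof -
  have i: "idx R u < length R" using that(2) by simp
  moreover have "idx R u \<noteq> length R - 1" using that last_conv_nth nth_idx by (metis empty_iff list.set(1))
  ultimately have "Suc (idx R u) < length R" by linarith
  then show ?thesis using assms that by (auto simp: cyc_next_def idx_append nth_append)
 qed
 show "u \<noteq> last R \<Longrightarrow> cyc_next (A @ R @ B) u = cyc_next R u" using * assms(2) by blast
 have dR: "distinct R" using assms(1) by simp
 have ne: "R \<noteq> []" using assms(2) by auto
 show "cyc_prev (A @ R @ B) u = cyc_prev R u" if "u \<noteq> hd R"
 proof (rule cyc_prev_eqI[OF assms(1)])
  have p: "cyc_prev R u \<in> set R" by (rule cyc_prev_mem[OF assms(2)])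
  then show "cyc_prev R u \<in> set (A @ R @ B)" by simp
  have "cyc_prev R u \<noteq> last R" using that cyc_next_prev[OF dR assms(2)] cyc_next_last[OF dR ne] by auto
  then show "cyc_next (A @ R @ B) (cyc_prev R u) = u" using *[OF _ p] cyc_next_prev[OF dR assms(2)] by simp
 qed
qed

section \<open>Effect of kinks and fingers on the number of faces\<close>

lemma face_map_simps:
 "u \<in> set P \<Longrightarrow> face_map mu eta P (u, True) = (mu (cyc_next P u), eta (cyc_next P u) \<noteq> 1)"
 "u \<in> set P \<Longrightarrow> face_map mu eta P (u, False) = (mu (cyc_prev P u), eta (cyc_prev P u) = 1)"
 by (simp_all add: face_map_def Let_def)

text \<open>Search for the first return with a bounded number of steps, in a form which
  simplification can evaluate on explicit words.\<close>

fun ret :: "nat \<Rightarrow> ('a \<Rightarrow> 'a) \<Rightarrow> 'a set \<Rightarrow> 'a \<Rightarrow> 'a" where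
 "ret 0 f A x = x"
| "ret (Suc k) f A x = (if f x \<in> A then f x else ret k f A (f x))"

lemma ret_first_return: "0 < k \<Longrightarrow> ret k f A x \<in> A \<Longrightarrow> first_return f A x (ret k f A x)"
proof (induction k arbitrary: x)
 case (Suc k)
 show ?case
 proof (cases "f x \<in> A")
  case False
  then have "0 < k" "ret k f A (f x) \<in> A" using Suc.prems by (cases k; auto)+
  then show ?thesis using False first_return_step[OF False Suc.IH] by simp
 qed (simp add: first_return_now)
qed simp

lemma orbit_triple:
 assumes "f a = b" "f b = c" "f c = a"
 shows "orbit f a = {a, b, c}"
proof
 show "orbit f a \<subseteq> {a, b, c}"
 proof
  fix x assume "x \<in> orbit f a"
  then show "x \<in> {a, b, c}" by induction (use assms in auto)
 qed
 have "b \<in> orbit f a" using orbit.base[of f a] assms by simp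
 moreover then have "c \<in> orbit f a" using orbit.step[of b f a] assms by simp
 moreover then have "a \<in> orbit f a" using orbit.step[of c f a] assms by simp
 ultimately show "{a, b, c} \<subseteq> orbit f a" by simp
qed

text \<open>\<open>A\<close> consists of the darts away from the modified place. Both words have the
  same first returns to \<open>A\<close>, so the faces meeting \<open>A\<close> correspond; the
  additional faces are the orbits of the darts in \<open>E\<close>, which never reach
  \<open>A\<close>. The bound 9 covers the excursions in the applications.\<close>

lemma faces_compare:
 assumes wf: "wf_word mu eta P" and wf': "wf_word mu eta Q"
  and A: "A \<subseteq> set P \<times> UNIV" "A \<subseteq> set Q \<times> UNIV"
  and "\<And>a. a \<in> A \<Longrightarrow> ret 9 (face_map mu eta P) A a \<in> A"
  and "\<And>a. a \<in> A \<Longrightarrow> ret 9 (face_map mu eta Q) A a = ret 9 (face_map mu eta P) A a"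
  and "\<And>x. x \<in> set P \<times> UNIV - A \<Longrightarrow> ret 9 (face_map mu eta P) A x \<in> A"
  and "\<And>x. x \<in> set Q \<times> UNIV - A - E \<Longrightarrow> ret 9 (face_map mu eta Q) A x \<in> A"
  and E: "E \<subseteq> set Q \<times> UNIV" "\<And>e. e \<in> E \<Longrightarrow> orbit (face_map mu eta Q) e \<inter> A = {}"
 shows "faces mu eta Q = faces mu eta P + card (orbit (face_map mu eta Q) ` E)"
proof -
 let ?f = "face_map mu eta P" and ?g = "face_map mu eta Q"
 note f = wf_word_finite face_map_permutes[OF wf] and g = wf_word_finite face_map_permutes[OF wf']
 have "card (orbit ?f ` A) = card (orbit ?g ` id ` A)"
 proof (rule first_return_count[OF f g])
  fix a assume a: "a \<in> A"
  show "\<exists>a'. a' \<in> A \<and> first_return ?f A a a' \<and> first_return ?g (id ` A) (id a) (id a')"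
   using ret_first_return[of 9 ?f A a] ret_first_return[of 9 ?g A a] assms(5,6)[OF a]
   by (intro exI[of _ "ret 9 ?f A a"]) simp
 qed simp
 moreover have "orbit ?f ` (set P \<times> UNIV) = orbit ?f ` A \<union> orbit ?f ` ({} \<inter> (set P \<times> UNIV))"
 proof (rule orbits_meeting[OF f A(1)])
  fix x assume "x \<in> set P \<times> UNIV - A - {}"
  from ret_first_return[OF _ assms(7)] this have "first_return ?f A x (ret 9 ?f A x)" by simp
  then show "\<exists>y. first_return ?f A x y" ..
 qed
 moreover have "orbit ?g ` (set Q \<times> UNIV) = orbit ?g ` A \<union> orbit ?g ` (E \<inter> (set Q \<times> UNIV))"
 proof (rule orbits_meeting[OF g A(2)])
  fix x assume "x \<in> set Q \<times> UNIV - A - E"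
  from ret_first_return[OF _ assms(8)] this have "first_return ?g A x (ret 9 ?g A x)" by simp
  then show "\<exists>y. first_return ?g A x y" ..
 qed
 moreover have "orbit ?g ` A \<inter> orbit ?g ` E = {}" using E(2) permutes_self_orbit[OF g] by blast
 moreover have "finite (orbit ?g ` A)" "finite (orbit ?g ` E)"
  by (rule finite_imageI[OF finite_subset[OF _ wf_word_finite]], rule A(2) E(1))+
 ultimately show ?thesis using E(1) by (simp add: faces_def card_Un_disjoint Int_absorb2)
qed

lemma exI2: "P x y \<Longrightarrow> \<exists>x y. P x y" by blast

text \<open>The new face is the monogon, a dart fixed by the face map: the one from \<open>x\<close>
  forward or the one from \<open>mu x\<close> backward, according to \<open>eta x\<close>.\<close>

lemma faces_kink_Cons:
 assumes wf: "wf_word mu eta (x # mu x # R)" and wfR: "wf_word mu eta R" and ne: "R \<noteq> []"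
 shows "faces mu eta (x # mu x # R) = faces mu eta R + 1"
proof -
 let ?Q = "x # mu x # R" and ?A = "set R \<times> (UNIV :: bool set)"
 let ?f = "face_map mu eta R" and ?g = "face_map mu eta ?Q"
 have d: "distinct ?Q" using wf by (simp add: wf_word_def)
 have x: "mu (mu x) = x" "eta (mu x) = - eta x" "eta x = 1 \<or> eta x = - 1" using wf d by (auto simp: wf_word_def)
 define p where "p = (eta x = 1)"
 have e: "eta x = 1 \<longleftrightarrow> p" "eta (mu x) = 1 \<longleftrightarrow> \<not> p" using x by (auto simp: p_def)
 note ca = cyc_append[of "[x]" "mu x # R"] cyc_append[of "[x, mu x]" R]
 have nx: "cyc_next ?Q x = mu x" "cyc_prev ?Q (mu x) = x" "cyc_next ?Q (mu x) = hd R" "cyc_prev ?Q (hd R) = mu x"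
  "cyc_next ?Q (last R) = x" "cyc_prev ?Q x = last R" using ca d ne by simp_all
 have nxR: "cyc_next R (last R) = hd R" "cyc_prev R (hd R) = last R"
  using d ne by (auto intro: cyc_next_last cyc_prev_hd)
 have fA: "?f a \<in> ?A" if "a \<in> ?A" for a using that permutes_in_image[OF face_map_permutes[OF wfR]] by blast
 have ff: "ret 9 ?f ?A a = ?f a" if "a \<in> ?A" for a using fA[OF that] by (simp add: numeral_eq_Suc)
 define v where "v = ?f (last R, True)"
 define w where "w = ?f (hd R, False)"
 have vw: "v \<in> ?A" "w \<in> ?A" using fA ne by (simp_all add: v_def w_def)
 have nA: "(x, b) \<notin> ?A" "(mu x, b) \<notin> ?A" for b using d by auto
 have g: "?g (x, True) = (x, p)" "?g (x, False) = w" "?g (mu x, True) = v" "?g (mu x, False) = (mu x, p)"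
  "?g (last R, True) = (mu x, \<not> p)" "?g (hd R, False) = (x, \<not> p)"
  using ne by (simp_all add: face_map_simps nx nxR x(1) e v_def w_def)
 define E where "E = (if p then {(x, True)} else {(mu x, False)})"
 have "faces mu eta ?Q = faces mu eta R + card (orbit ?g ` E)"
 proof (rule faces_compare[OF wfR wf])
  show "ret 9 ?f ?A a \<in> ?A" if "a \<in> ?A" for a using fA ff that by simp
  show "ret 9 ?g ?A a = ret 9 ?f ?A a" if a: "a \<in> ?A" for a
  proof -
   obtain u b where ub: "a = (u, b)" "u \<in> set R" using a by auto
   consider "a = (last R, True)" | "a = (hd R, False)" | "b" "u \<noteq> last R" | "\<not> b" "u \<noteq> hd R"
    using ub by auto
   then show ?thesis
   proof cases
    case 1
    then have "?f a = v" by (simp add: v_def)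
    then show ?thesis unfolding ff[OF a] using 1 g nA vw by (cases p) (simp_all add: numeral_eq_Suc)
   next
    case 2
    then have "?f a = w" by (simp add: w_def)
    then show ?thesis unfolding ff[OF a] using 2 g nA vw by (cases p) (simp_all add: numeral_eq_Suc)
   next
    case 3
    then have "?g a = ?f a" using ub cyc_inner(1)[of "[x, mu x]" R "[]" u] d by (simp add: face_map_simps)
    then show ?thesis using fA[OF a] by (simp add: numeral_eq_Suc)
   next
    case 4
    then have "?g a = ?f a" using ub cyc_inner(2)[of "[x, mu x]" R "[]" u] d by (simp add: face_map_simps)
    then show ?thesis using fA[OF a] by (simp add: numeral_eq_Suc)
   qed
  qed
  show "ret 9 ?g ?A y \<in> ?A" if "y \<in> set ?Q \<times> UNIV - ?A - E" for y
  proof -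
   obtain u b where y: "y = (u, b)" by fastforce
   have "u = x \<or> u = mu x" "y \<notin> E" using that y by auto
   then show ?thesis using y g nA vw unfolding E_def by (cases p; cases b) (auto simp: numeral_eq_Suc)
  qed
  show "orbit ?g e \<inter> ?A = {}" if "e \<in> E" for e
  proof -
   have "?g e = e" using that g by (auto simp: E_def split: if_splits)
   then have "orbit ?g e = {e}" using orbit_triple[of ?g e e e] by simp
   then show ?thesis using that nA by (auto simp: E_def split: if_splits)
  qed
 qed (auto simp: E_def)
 then show ?thesis by (simp add: E_def)
qed

lemma orbit_triple':
 assumes "f a = b" "f b = c" "f c = a" "u \<in> {a, b, c}"
 shows "orbit f u = {a, b, c}"
proof -
 note orbit_triple[of f a b c, OF assms(1-3)] orbit_triple[of f b c a, OF assms(2,3,1)]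
  orbit_triple[of f c a b, OF assms(3,1,2)]
 moreover have "{b, c, a} = {a, b, c}" "{c, a, b} = {a, b, c}" by blast+
 ultimately show ?thesis using assms(4) by auto
qed

text \<open>The junctions between consecutive blocks. All changes of neighbours take place there,
  while the interior of a block is handled by \<open>cyc_inner\<close>.\<close>

fun links :: "'a list list \<Rightarrow> ('a \<times> 'a) list" where
 "links (A # B # Ls) = (last A, hd B) # links (B # Ls)"
| "links Ls = []"

lemma cyc_links:
 assumes "distinct (concat Ls)" "[] \<notin> set Ls" "(u, v) \<in> set (links Ls)"
 shows "cyc_next (concat Ls) u = v \<and> cyc_prev (concat Ls) v = u"
proof -
 have "\<exists>L M. concat Ls = L @ M \<and> L \<noteq> [] \<and> M \<noteq> [] \<and> last L = u \<and> hd M = v"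
  using assms(2,3)
 proof (induction Ls rule: links.induct)
  case (1 A B Ls)
  show ?case
  proof (cases "(u, v) = (last A, hd B)")
   case True
   then show ?thesis using 1(2) by (intro exI2[of _ A "B @ concat Ls"]) auto
  next
   case False
   then obtain L M where "concat (B # Ls) = L @ M" "L \<noteq> []" "M \<noteq> []" "last L = u" "hd M = v" using 1 by auto
   then show ?thesis by (intro exI2[of _ "A @ L" M]) auto
  qed
 qed auto
 then show ?thesis using cyc_append(1,2) assms(1) by metis
qed

text \<open>The two new faces are the triangles found in \<open>o1\<close> and \<open>o2\<close>;
  the other faces are merely rerouted through the new crossings. Nonempty blocks ensure that the
  neighbours of every crossing can be named explicitly.\<close>

lemma faces_finger_Cons:
 assumes wf: "wf_word mu eta ([c] @ C1 @ [mu c, x] @ C2 @ [mu x] @ C3)"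
  and wf': "wf_word mu eta ([y, c, z] @ C1 @ [x, mu c] @ C2 @ [w1, mu x, w2] @ C3)"
  and e: "eta z = - eta x" "eta y = eta x"
  and w: "(w1, w2) = (if eta c * eta x = - 1 then (mu y, mu z) else (mu z, mu y))"
  and ne: "C1 \<noteq> []" "C2 \<noteq> []" "C3 \<noteq> []"
 shows "faces mu eta ([y, c, z] @ C1 @ [x, mu c] @ C2 @ [w1, mu x, w2] @ C3)
  = faces mu eta ([c] @ C1 @ [mu c, x] @ C2 @ [mu x] @ C3) + 2"
proof -
 define P where "P = [c] @ C1 @ [mu c, x] @ C2 @ [mu x] @ C3"
 define Q where "Q = [y, c, z] @ C1 @ [x, mu c] @ C2 @ [w1, mu x, w2] @ C3"
 define f where "f = face_map mu eta P"
 define g where "g = face_map mu eta Q"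
 define A where "A = (set C1 \<union> set C2 \<union> set C3) \<times> (UNIV :: bool set)"
 note wfP = wf[folded P_def] and wfQ = wf'[folded Q_def]
 have dP: "distinct P" and dQ: "distinct Q" using wfP wfQ by (auto simp: wf_word_def)
 have w12: "{w1, w2} = {mu y, mu z}" using w by (auto split: if_splits)
 have dist: "distinct ([y, c, z, x, mu c, mu x, mu y, mu z] @ C1 @ C2 @ C3)"
  using dQ w by (auto simp: Q_def split: if_splits)
 have mm: "mu (mu u) = u" if "u \<in> set Q" for u using wfQ that by (auto simp: wf_word_def)
 have em: "eta (mu u) = - eta u" "eta u = 1 \<or> eta u = - 1" if "u \<in> set Q" "mu u \<noteq> u" for u
  using wfQ that by (auto simp: wf_word_def)
 have inQ: "c \<in> set Q" "x \<in> set Q" "y \<in> set Q" "z \<in> set Q" by (auto simp: Q_def)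
 have inQ': "mu c \<in> set Q" "mu x \<in> set Q" "mu y \<in> set Q" "mu z \<in> set Q" using w12 by (auto simp: Q_def)
 have inP: "c \<in> set P" "x \<in> set P" "mu c \<in> set P" "mu x \<in> set P" by (auto simp: P_def)
 have m: "mu (mu c) = c" "mu (mu x) = x" "mu (mu y) = y" "mu (mu z) = z" by (rule mm, rule inQ)+
 have fixfree: "mu c \<noteq> c" "mu x \<noteq> x" "mu y \<noteq> y" "mu z \<noteq> z"
  by (rule not_sym, use dist in simp)+
 define p where "p = (eta c = 1)"
 define q where "q = (eta x = 1)"
 have ev: "eta (mu c) = - eta c" "eta (mu x) = - eta x" "eta (mu y) = - eta x" "eta (mu z) = eta x"
  "eta c = 1 \<or> eta c = - 1" "eta x = 1 \<or> eta x = - 1"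
  using em[OF inQ(1) fixfree(1)] em[OF inQ(2) fixfree(2)] em[OF inQ(3) fixfree(3)] em[OF inQ(4) fixfree(4)] e by simp_all
 have b: "eta c = 1 \<longleftrightarrow> p" "eta (mu c) = 1 \<longleftrightarrow> \<not> p" "eta x = 1 \<longleftrightarrow> q" "eta (mu x) = 1 \<longleftrightarrow> \<not> q"
  "eta y = 1 \<longleftrightarrow> q" "eta (mu y) = 1 \<longleftrightarrow> \<not> q" "eta z = 1 \<longleftrightarrow> \<not> q" "eta (mu z) = 1 \<longleftrightarrow> q"
  using ev e by (auto simp: p_def q_def)
 have w1: "w1 = (if p = q then mu z else mu y)" and w2: "w2 = (if p = q then mu y else mu z)"
  using w ev(5,6) by (auto simp: p_def q_def split: if_splits)
 have lP: "\<forall>(u, v) \<in> set (links [[c], C1, [mu c], [x], C2, [mu x], C3]). cyc_next P u = v \<and> cyc_prev P v = u"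
  using cyc_links[of "[[c], C1, [mu c], [x], C2, [mu x], C3]"] dP ne by (simp add: P_def)
 have lQ: "\<forall>(u, v) \<in> set (links [[y], [c], [z], C1, [x], [mu c], C2, [w1], [mu x], [w2], C3]). cyc_next Q u = v \<and> cyc_prev Q v = u"
  using cyc_links[of "[[y], [c], [z], C1, [x], [mu c], C2, [w1], [mu x], [w2], C3]"] dQ ne by (simp add: Q_def)
 have nP: "cyc_next P (last C3) = c" "cyc_prev P c = last C3"
  using cyc_append(3,4)[of "[c]" "C1 @ [mu c, x] @ C2 @ [mu x] @ C3"] dP ne by (simp_all add: P_def)
 have nQ: "cyc_next Q (last C3) = y" "cyc_prev Q y = last C3"
  using cyc_append(3,4)[of "[y]" "[c, z] @ C1 @ [x, mu c] @ C2 @ [w1, mu x, w2] @ C3"] dQ ne by (simp_all add: Q_def)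
 have CC: "last C1 \<in> set P" "last C2 \<in> set P" "last C3 \<in> set P" "hd C1 \<in> set P" "hd C2 \<in> set P" "hd C3 \<in> set P"
  "last C1 \<in> set Q" "last C2 \<in> set Q" "last C3 \<in> set Q" "hd C1 \<in> set Q" "hd C2 \<in> set Q" "hd C3 \<in> set Q"
  using ne by (auto simp: P_def Q_def)
 have muA: "(mu u, b) \<in> A" if "u \<in> set C1 \<union> set C2 \<union> set C3" for u b
 proof -
  have "mu u \<in> set P" "mu (mu u) = u" using wfP that by (auto simp: wf_word_def P_def)
  moreover have "mu u \<notin> {c, mu c, x, mu x}"
  proof
   assume "mu u \<in> {c, mu c, x, mu x}"
   then have "mu (mu u) \<in> {c, mu c, x, mu x}" using m(1,2) by (elim insertE emptyE) simp_all
   then show False using \<open>mu (mu u) = u\<close> dist that by auto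
  qed
  ultimately show ?thesis by (auto simp: A_def P_def)
 qed
 \<comment> \<open>The darts at which a face goes on after entering a block forward at its first
   point (\<open>s1\<close>, \<open>s2\<close>, \<open>s3\<close>) or backward at its last point
   (\<open>t1\<close>, \<open>t2\<close>, \<open>t3\<close>).\<close>
 define s1 t1 s2 t2 s3 t3 where st:
  "s1 = (mu (hd C1), eta (hd C1) \<noteq> 1)" "t1 = (mu (last C1), eta (last C1) = 1)"
  "s2 = (mu (hd C2), eta (hd C2) \<noteq> 1)" "t2 = (mu (last C2), eta (last C2) = 1)"
  "s3 = (mu (hd C3), eta (hd C3) \<noteq> 1)" "t3 = (mu (last C3), eta (last C3) = 1)"
 have stA: "s1 \<in> A" "t1 \<in> A" "s2 \<in> A" "t2 \<in> A" "s3 \<in> A" "t3 \<in> A"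
  unfolding st using ne by (auto intro!: muA)
 have nA: "(c, u) \<notin> A" "(mu c, u) \<notin> A" "(x, u) \<notin> A" "(mu x, u) \<notin> A"
  "(y, u) \<notin> A" "(mu y, u) \<notin> A" "(z, u) \<notin> A" "(mu z, u) \<notin> A" for u
  using dist by (auto simp: A_def)
 note fs = face_map_simps[where P = P and mu = mu and eta = eta, folded f_def]
 note gs = face_map_simps[where P = Q and mu = mu and eta = eta, folded g_def]
 have f1: "f (c, True) = s1" "f (c, False) = t3" "f (mu c, True) = (mu x, \<not> q)" "f (mu c, False) = t1"
  "f (x, True) = s2" "f (x, False) = (c, \<not> p)" "f (mu x, True) = s3" "f (mu x, False) = t2"
  "f (last C1, True) = (c, p)" "f (hd C1, False) = (mu c, p)" "f (last C2, True) = (x, q)" "f (hd C2, False) = (mu x, q)"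
  "f (last C3, True) = (mu c, \<not> p)" "f (hd C3, False) = (x, \<not> q)"
  using lP by (simp_all add: fs inP CC nP m b st)
 have g0: "g (y, True) = (mu c, \<not> p)" "g (y, False) = t3" "g (c, True) = (mu z, q)" "g (c, False) = (mu y, q)"
  "g (z, True) = s1" "g (z, False) = (mu c, p)" "g (x, True) = (c, p)" "g (x, False) = t1"
  "g (mu c, True) = s2" "g (mu c, False) = (mu x, q)"
  "g (last C1, True) = (mu x, \<not> q)" "g (hd C1, False) = (mu z, \<not> q)"
  "g (hd C2, False) = (c, \<not> p)" "g (last C3, True) = (mu y, \<not> q)"
  using lQ by (simp_all add: gs inQ inQ' CC nQ m b st)
 have g1: "p = q \<Longrightarrow> g (mu z, True) = (x, q)" "p = q \<Longrightarrow> g (mu z, False) = t2"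
   "p = q \<Longrightarrow> g (mu y, True) = s3" "p = q \<Longrightarrow> g (mu y, False) = (x, \<not> q)"
   "p = q \<Longrightarrow> g (mu x, True) = (y, q)" "p = q \<Longrightarrow> g (mu x, False) = (z, q)"
   "p = q \<Longrightarrow> g (last C2, True) = (z, \<not> q)" "p = q \<Longrightarrow> g (hd C3, False) = (y, \<not> q)"
  and g2: "p \<noteq> q \<Longrightarrow> g (mu y, True) = (x, q)" "p \<noteq> q \<Longrightarrow> g (mu y, False) = t2"
   "p \<noteq> q \<Longrightarrow> g (mu z, True) = s3" "p \<noteq> q \<Longrightarrow> g (mu z, False) = (x, \<not> q)"
   "p \<noteq> q \<Longrightarrow> g (mu x, True) = (z, \<not> q)" "p \<noteq> q \<Longrightarrow> g (mu x, False) = (y, \<not> q)"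
   "p \<noteq> q \<Longrightarrow> g (last C2, True) = (y, q)" "p \<noteq> q \<Longrightarrow> g (hd C3, False) = (z, q)"
  using lQ by (simp_all add: gs inQ inQ' CC m b st w1 w2)
 define e1 where "e1 = (if p then (y, True) else (z, False))"
 define E where "E = {(mu c, False), (mu x, q), e1, (x, True), (c, p), if p then (mu z, q) else (mu y, q)}"
 have o1: "orbit g u = {(mu c, False), (mu x, q), e1}" if "u \<in> {(mu c, False), (mu x, q), e1}" for u
 proof -
  have "g (mu c, False) = (mu x, q)" "g (mu x, q) = e1" "g e1 = (mu c, False)"
   using g0 g1(5,6) g2(5,6) by (cases p; cases q; simp add: e1_def)+
  then show ?thesis using that by (rule orbit_triple')
 qed
 have o2: "orbit g u = {(x, True), (c, p), if p then (mu z, q) else (mu y, q)}"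
  if "u \<in> {(x, True), (c, p), if p then (mu z, q) else (mu y, q)}" for u
 proof -
  have "g (x, True) = (c, p)" "g (c, p) = (if p then (mu z, q) else (mu y, q))"
   "g (if p then (mu z, q) else (mu y, q)) = (x, True)" using g0 g1(1-4) g2(1-4) by (cases p; cases q; simp)+
  then show ?thesis using that by (rule orbit_triple')
 qed
 have "faces mu eta Q = faces mu eta P + card (orbit g ` E)" unfolding g_def
 proof (rule faces_compare[OF wfP wfQ, where A = A], unfold f_def[symmetric] g_def[symmetric])
  have "ret 9 f A a \<in> A \<and> ret 9 g A a = ret 9 f A a" if a: "a \<in> A" for a
  proof -
   obtain u b where ub: "a = (u, b)" "u \<in> set C1 \<union> set C2 \<union> set C3" using a by (auto simp: A_def)
   have in1: "ret 9 f A a \<in> A \<and> ret 9 g A a = ret 9 f A a" if "f a \<in> A" "g a = f a"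
    using that by (simp add: numeral_eq_Suc)
   have in2: "f a \<in> A \<and> g a = f a" if "u \<in> set R" "P = L @ R @ M" "Q = L' @ R @ M'"
    "b \<and> u \<noteq> last R \<or> \<not> b \<and> u \<noteq> hd R" "set R \<subseteq> set C1 \<union> set C2 \<union> set C3" for L M L' M' R
   proof -
    have dR: "distinct (L @ R @ M)" "distinct (L' @ R @ M')" using dP dQ that(2,3) by auto
    have uPQ: "u \<in> set P" "u \<in> set Q" using that(1-3) by auto
    have "cyc_next R u \<in> set R" "cyc_prev R u \<in> set R" using that(1) cyc_next_mem cyc_prev_mem by metis+
    then show ?thesis using cyc_inner[OF dR(1) that(1)] cyc_inner[OF dR(2) that(1)] that(4,5) uPQ muA ub(1)
     by (cases b) (auto simp: fs gs that(2,3)[symmetric])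
   qed
   show ?thesis
   proof (cases "a \<in> {(last C1, True), (hd C1, False), (last C2, True), (hd C2, False), (last C3, True), (hd C3, False)}")
    case True
    then show ?thesis
     by (elim insertE emptyE; simp only:; cases p; cases q) (simp_all add: numeral_eq_Suc f1 g0 g1 g2 stA nA)
   next
    case False
    consider "u \<in> set C1" "b \<and> u \<noteq> last C1 \<or> \<not> b \<and> u \<noteq> hd C1" | "u \<in> set C2" "b \<and> u \<noteq> last C2 \<or> \<not> b \<and> u \<noteq> hd C2"
     | "u \<in> set C3" "b \<and> u \<noteq> last C3 \<or> \<not> b \<and> u \<noteq> hd C3" using ub False by auto
    then have "f a \<in> A \<and> g a = f a"
    proof cases
     case 1
     show ?thesis using in2[OF 1(1) P_def _ 1(2), of "[y, c, z]"] by (simp add: Q_def Un_assoc)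
    next
     case 2
     show ?thesis using in2[OF 2(1) _ _ 2(2), of "[c] @ C1 @ [mu c, x]" _ "[y, c, z] @ C1 @ [x, mu c]"]
      by (auto simp: Q_def P_def)
    next
     case 3
     show ?thesis using in2[OF 3(1) _ _ 3(2), of "[c] @ C1 @ [mu c, x] @ C2 @ [mu x]" "[]"
       "[y, c, z] @ C1 @ [x, mu c] @ C2 @ [w1, mu x, w2]" "[]"] by (auto simp: Q_def P_def)
    qed
    then show ?thesis using in1 by blast
   qed
  qed
  then show "\<And>a. a \<in> A \<Longrightarrow> ret 9 f A a \<in> A" "\<And>a. a \<in> A \<Longrightarrow> ret 9 g A a = ret 9 f A a"
   by blast+
  show "A \<subseteq> set P \<times> UNIV" "A \<subseteq> set Q \<times> UNIV" by (auto simp: A_def P_def Q_def)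
  show "ret 9 f A d \<in> A" if "d \<in> set P \<times> UNIV - A" for d
  proof -
   obtain u b where d: "d = (u, b)" by fastforce
   have "u \<in> {c, mu c, x, mu x}" using that d by (auto simp: P_def A_def)
   then show ?thesis unfolding d
    by (elim insertE emptyE; cases b; cases p; cases q) (simp_all add: numeral_eq_Suc f1 stA nA)
  qed
  show "ret 9 g A d \<in> A" if "d \<in> set Q \<times> UNIV - A - E" for d
  proof -
   obtain u b where d: "d = (u, b)" by fastforce
   have u: "u \<in> {c, mu c, x, mu x, y, z, mu y, mu z}" using that d w12 by (auto simp: Q_def A_def)
   have "(u, b) \<notin> E" using that d by auto
   with u show ?thesis unfolding d E_def e1_def
    by (elim insertE emptyE; cases b; cases p; cases q) (simp_all add: numeral_eq_Suc g0 g1 g2 stA nA)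
  qed
  show "E \<subseteq> set Q \<times> UNIV" using inQ inQ' by (auto simp: E_def e1_def)
  show "orbit g e \<inter> A = {}" if "e \<in> E" for e
  proof -
   have "e \<in> {(mu c, False), (mu x, q), e1} \<or> e \<in> {(x, True), (c, p), if p then (mu z, q) else (mu y, q)}"
    using that by (auto simp: E_def)
   moreover have "{(mu c, False), (mu x, q), e1} \<inter> A = {}" "{(x, True), (c, p), if p then (mu z, q) else (mu y, q)} \<inter> A = {}"
    using nA by (cases p; simp add: e1_def)+
   ultimately show ?thesis using o1[of e] o2[of e] by (elim disjE) simp_all
  qed
 qed
 moreover have "orbit g ` E = {orbit g (mu c, False), orbit g (x, True)}" unfolding E_def using o1 o2 by simp
 moreover have "orbit g (mu c, False) \<noteq> orbit g (x, True)"
 proof -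
  have "(x, True) \<notin> {(mu c, False), (mu x, q), e1}" using dist by (cases p) (auto simp: e1_def)
  moreover have "orbit g (mu c, False) = {(mu c, False), (mu x, q), e1}" by (rule o1) simp
  moreover have "(x, True) \<in> orbit g (x, True)" using o2[of "(x, True)"] by simp
  ultimately show ?thesis by metis
 qed
 ultimately show ?thesis by (simp add: P_def Q_def)
qed

lemma faces_kink:
 assumes "wf_word mu eta (A @ [x, mu x] @ B)" "wf_word mu eta (A @ B)" "A @ B \<noteq> []"
 shows "faces mu eta (A @ [x, mu x] @ B) = faces mu eta (A @ B) + 1"
proof -
 have "wf_word mu eta (x # mu x # B @ A)" using assms(1) wf_word_rotate[of mu eta "[x, mu x] @ B" A] by simp
 moreover have "wf_word mu eta (B @ A)" using assms(2) wf_word_rotate by blast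
 moreover have "B @ A \<noteq> []" using assms(3) by auto
 ultimately have "faces mu eta (x # mu x # B @ A) = faces mu eta (B @ A) + 1" by (rule faces_kink_Cons)
 moreover have "distinct (A @ [x, mu x] @ B)" "distinct (A @ B)" using assms(1,2) unfolding wf_word_def by blast+
 ultimately show ?thesis using faces_append_swap[of A "[x, mu x] @ B" mu eta] faces_append_swap[of A B mu eta] by simp
qed

text \<open>Adjoins two markers of degree two to the alphabet. Inserted between crossings they make
  empty blocks nonempty without affecting the number of faces.\<close>

definition lift_mu :: "('a \<Rightarrow> 'a) \<Rightarrow> 'a + bool \<Rightarrow> 'a + bool" where
 "lift_mu mu = (\<lambda>s. case s of Inl u \<Rightarrow> Inl (mu u) | Inr k \<Rightarrow> Inr k)"

definition lift_eta :: "('a \<Rightarrow> int) \<Rightarrow> 'a + bool \<Rightarrow> int" where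
 "lift_eta eta = (\<lambda>s. case s of Inl u \<Rightarrow> eta u | Inr k \<Rightarrow> - 1)"

lemma wf_word_lift:
 assumes "wf_word mu eta P" "set R = Inl ` set P \<union> Inr ` B" "distinct R"
 shows "wf_word (lift_mu mu) (lift_eta eta) R"
 using assms unfolding wf_word_def by (auto simp: lift_mu_def lift_eta_def)

lemma faces_two_markers:
 assumes wf: "wf_word mu eta (A @ B @ D)" and ne: "A @ B @ D \<noteq> []"
 defines "R \<equiv> map Inl A @ [Inr True] @ map Inl B @ [Inr False] @ map Inl D"
 shows "wf_word (lift_mu mu) (lift_eta eta) R" "faces (lift_mu mu) (lift_eta eta) R = faces mu eta (A @ B @ D)"
proof -
 have d: "distinct (A @ B @ D)" using wf unfolding wf_word_def by blast
 show w: "wf_word (lift_mu mu) (lift_eta eta) R"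
  by (rule wf_word_lift[OF wf, of _ UNIV]) (use d in \<open>auto simp: R_def distinct_map UNIV_bool\<close>)
 note m1 = faces_marker[of "lift_mu mu" "lift_eta eta" "map Inl A" "Inr True" "map Inl B @ [Inr False] @ map Inl D",
   folded R_def, OF w]
 have w1: "wf_word (lift_mu mu) (lift_eta eta) ((map Inl A @ map Inl B) @ [Inr False] @ map Inl D)"
  and f1: "faces (lift_mu mu) (lift_eta eta) R = faces (lift_mu mu) (lift_eta eta) ((map Inl A @ map Inl B) @ [Inr False] @ map Inl D)"
  using m1 by (simp_all add: lift_mu_def)
 note m2 = faces_marker[OF w1]
 have w2: "wf_word (lift_mu mu) (lift_eta eta) (map Inl (A @ B @ D))"
  and f2: "faces (lift_mu mu) (lift_eta eta) R = faces (lift_mu mu) (lift_eta eta) (map Inl (A @ B @ D))"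
  using m2 f1 ne by (simp_all add: lift_mu_def)
 have "faces (lift_mu mu) (lift_eta eta) (map Inl (A @ B @ D)) = faces mu eta (A @ B @ D)"
  by (rule faces_map[OF wf w2]) (auto simp: lift_mu_def lift_eta_def)
 with f2 show "faces (lift_mu mu) (lift_eta eta) R = faces mu eta (A @ B @ D)" by simp
qed

text \<open>After rotation the word begins at \<open>c\<close>. Markers behind \<open>A2\<close> and
  \<open>A3\<close> provide nonempty blocks for \<open>faces_finger_Cons\<close>, and
  \<open>A4 @ A1\<close> is nonempty because of \<open>A1\<close>.\<close>

lemma faces_finger:
 assumes wf: "wf_word mu eta (A1 @ [c] @ A2 @ [mu c, x] @ A3 @ [mu x] @ A4)"
  and wf': "wf_word mu eta (A1 @ [y, c, z] @ A2 @ [x, mu c] @ A3 @ [w1, mu x, w2] @ A4)"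
  and e: "eta z = - eta x" "eta y = eta x"
  and w: "(w1, w2) = (if eta c * eta x = - 1 then (mu y, mu z) else (mu z, mu y))"
  and ne: "A1 \<noteq> []"
 shows "faces mu eta (A1 @ [y, c, z] @ A2 @ [x, mu c] @ A3 @ [w1, mu x, w2] @ A4)
  = faces mu eta (A1 @ [c] @ A2 @ [mu c, x] @ A3 @ [mu x] @ A4) + 2"
proof -
 let ?mu = "lift_mu mu" and ?eta = "lift_eta eta"
 let ?P1 = "[c] @ A2" and ?P2 = "[mu c, x] @ A3" and ?P3 = "[mu x] @ A4 @ A1"
 let ?Q1 = "[y, c, z] @ A2" and ?Q2 = "[x, mu c] @ A3" and ?Q3 = "[w1, mu x, w2] @ A4 @ A1"
 have wP: "wf_word mu eta (?P1 @ ?P2 @ ?P3)"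
  using wf wf_word_rotate[of mu eta "[c] @ A2 @ [mu c, x] @ A3 @ [mu x] @ A4" A1] by simp
 have wQ: "wf_word mu eta (?Q1 @ ?Q2 @ ?Q3)"
  using wf' wf_word_rotate[of mu eta "[y, c, z] @ A2 @ [x, mu c] @ A3 @ [w1, mu x, w2] @ A4" A1] by simp
 note fP = faces_two_markers[OF wP] and fQ = faces_two_markers[OF wQ]
 let ?C1 = "map Inl A2 @ [Inr True]" and ?C2 = "map Inl A3 @ [Inr False]" and ?C3 = "map Inl (A4 @ A1)"
 have m: "?mu (Inl u) = Inl (mu u)" for u by (simp add: lift_mu_def)
 have "faces ?mu ?eta ([Inl y, Inl c, Inl z] @ ?C1 @ [Inl x, ?mu (Inl c)] @ ?C2 @ [Inl w1, ?mu (Inl x), Inl w2] @ ?C3)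
  = faces ?mu ?eta ([Inl c] @ ?C1 @ [?mu (Inl c), Inl x] @ ?C2 @ [?mu (Inl x)] @ ?C3) + 2"
 proof (rule faces_finger_Cons)
  show "wf_word ?mu ?eta ([Inl c] @ ?C1 @ [?mu (Inl c), Inl x] @ ?C2 @ [?mu (Inl x)] @ ?C3)"
   using fP(1) by (simp add: m)
  show "wf_word ?mu ?eta ([Inl y, Inl c, Inl z] @ ?C1 @ [Inl x, ?mu (Inl c)] @ ?C2 @ [Inl w1, ?mu (Inl x), Inl w2] @ ?C3)"
   using fQ(1) by (simp add: m)
  show "?eta (Inl z) = - ?eta (Inl x)" "?eta (Inl y) = ?eta (Inl x)" using e by (simp_all add: lift_eta_def)
  show "(Inl w1, Inl w2) = (if ?eta (Inl c) * ?eta (Inl x) = - 1 then (?mu (Inl y), ?mu (Inl z)) else (?mu (Inl z), ?mu (Inl y)))"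
   using w by (simp add: m lift_eta_def split: if_splits)
 qed (use ne in auto)
 then have "faces mu eta (?Q1 @ ?Q2 @ ?Q3) = faces mu eta (?P1 @ ?P2 @ ?P3) + 2" using fP(2) fQ(2) by (simp add: m)
 moreover have "distinct (A1 @ [c] @ A2 @ [mu c, x] @ A3 @ [mu x] @ A4)"
  "distinct (A1 @ [y, c, z] @ A2 @ [x, mu c] @ A3 @ [w1, mu x, w2] @ A4)" using wf wf' unfolding wf_word_def by blast+
 ultimately show ?thesis using faces_append_swap[of A1 "[c] @ A2 @ [mu c, x] @ A3 @ [mu x] @ A4" mu eta]
   faces_append_swap[of A1 "[y, c, z] @ A2 @ [x, mu c] @ A3 @ [w1, mu x, w2] @ A4" mu eta] by simp
qed

section \<open>Splitting a code\<close>

text \<open>\<open>None\<close> is the basepoint, a point of degree two; it keeps the word nonempty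
  even for the empty code.\<close>

definition code_word :: "'l point list \<Rightarrow> 'l point option list" where
 "code_word L = None # map Some L"

definition word_twist :: "'l point option \<Rightarrow> int" where
 "word_twist s = (case s of None \<Rightarrow> - 1 | Some p \<Rightarrow> twist p)"

text \<open>The Euler characteristic after gluing a disk to every face: with \<open>n\<close>
  crossings the closed curve has \<open>n + 1\<close> vertices, including the basepoint, and
  \<open>2 * n + 1\<close> edges.\<close>

definition code_euler :: "'l point list \<Rightarrow> int" where
 "code_euler L = int (faces (map_option mate) word_twist (code_word L)) - int (length L div 2)"

lemma wf_word_code: "wf_code L \<Longrightarrow> wf_word (map_option mate) word_twist (code_word L)"
 unfolding wf_word_def
proof (intro conjI ballI)
 assume wf: "wf_code L"
 show "distinct (code_word L)" using wf_code_distinct[OF wf] by (auto simp: code_word_def distinct_map)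
 fix u assume u: "u \<in> set (code_word L)"
 show "map_option mate u \<in> set (code_word L)" using u wf_code_mate[OF wf] by (auto simp: code_word_def)
 show "map_option mate (map_option mate u) = u" by (cases u) auto
 show "word_twist u = 1 \<or> word_twist u = - 1"
  using u wf_code_psign[OF wf] by (fastforce simp: code_word_def word_twist_def twist_def)
 show "if map_option mate u = u then word_twist u = - 1 else word_twist (map_option mate u) = - word_twist u"
  by (cases u) (auto simp: word_twist_def)
qed

lemma wf_code_perm:
 assumes "mset L = mset M"
 shows "wf_code L \<longleftrightarrow> wf_code M"
proof -
 have "set L = set M" using assms by (metis set_mset_mset)
 moreover have "distinct (map f L) \<longleftrightarrow> distinct (map f M)" for f :: "'a point \<Rightarrow> 'a \<times> bool"
  using assms by (metis mset_eq_imp_distinct_iff mset_map)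
 ultimately show ?thesis by (simp add: wf_code_def)
qed

lemma wf_code_add:
 assumes "wf_code L" "label k \<notin> label ` set L" "psign k = 1 \<or> psign k = - 1"
 shows "wf_code (k # mate k # L)" using assms by (fastforce simp: wf_code_def)

lemma code_euler_kink:
 assumes "wf_code (A @ [k, mate k] @ B)" "wf_code (A @ B)"
 shows "code_euler (A @ [k, mate k] @ B) = code_euler (A @ B)"
proof -
 have "faces (map_option mate) word_twist ((None # map Some A) @ [Some k, map_option mate (Some k)] @ map Some B)
  = faces (map_option mate) word_twist ((None # map Some A) @ map Some B) + 1"
  by (rule faces_kink) (use wf_word_code[OF assms(1)] wf_word_code[OF assms(2)] in \<open>simp_all add: code_word_def\<close>)
 then show ?thesis by (simp add: code_euler_def code_word_def)
qed

text \<open>A rotation of the code moves only the marker \<open>None\<close> in the cyclic word, and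
  the marker has no influence on the number of faces.\<close>

lemma code_euler_rotate:
 assumes "wf_code (A @ B)"
 shows "code_euler (B @ A) = code_euler (A @ B)"
proof (cases "A @ B = []")
 case False
 have "wf_code (B @ A)" using assms wf_code_perm[of "A @ B" "B @ A"] by simp
 note w = wf_word_code[OF assms, unfolded code_word_def] wf_word_code[OF this, unfolded code_word_def]
 note m = faces_marker[of "map_option mate" word_twist "[]" None]
 have "faces (map_option mate) word_twist (None # map Some (A @ B)) = faces (map_option mate) word_twist (map Some (A @ B))"
  using m[of "map Some (A @ B)"] w(1) False by auto
 moreover have "faces (map_option mate) word_twist (None # map Some (B @ A)) = faces (map_option mate) word_twist (map Some (B @ A))"
  using m[of "map Some (B @ A)"] w(2) False by auto
 moreover have "distinct (map Some A @ map Some B)" using w(1) by (simp add: wf_word_def)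
 ultimately show ?thesis using faces_append_swap[of "map Some A" "map Some B" "map_option mate" word_twist]
  by (simp add: code_euler_def code_word_def add.commute)
qed simp

text \<open>
 The arc leaving the crossing \<open>c\<close> at its second passage is pushed back over the crossing \<open>x\<close>: a
 second and a third Reidemeister move.
\<close>

lemma finger_step:
 fixes L0 :: "nat point list"
 assumes wf: "wf_code L0" and L0: "L0 = A1 @ [c] @ A2 @ [mate c, x] @ A3 @ [mate x] @ A4"
 obtains y z w1 w2 where "{w1, w2} = {mate y, mate z}"
  "wf_code (A1 @ [y, c, z] @ A2 @ [x, mate c] @ A3 @ [w1, mate x, w2] @ A4)"
  "same_polynomials (A1 @ [y, c, z] @ A2 @ [x, mate c] @ A3 @ [w1, mate x, w2] @ A4) L0"
  "code_euler (A1 @ [y, c, z] @ A2 @ [x, mate c] @ A3 @ [w1, mate x, w2] @ A4) = code_euler L0"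
proof -
 obtain ly where ly: "ly \<notin> label ` set L0" using ex_new_if_finite[of "label ` set L0"] by auto
 obtain lz where lz: "lz \<notin> insert ly (label ` set L0)" using ex_new_if_finite[of "insert ly (label ` set L0)"] by auto
 have tw: "twist u = 1 \<or> twist u = - 1" if "u \<in> set L0" for u
  using wf_code_psign[OF wf that] by (auto simp: twist_def)
 have cx: "c \<in> set L0" "x \<in> set L0" "mate c \<in> set L0" "mate x \<in> set L0" by (auto simp: L0)
 \<comment> \<open>Both new crossings are passed over on the arc through \<open>c\<close>, with
   opposite signs as in a second move. The order of their mates around \<open>mate x\<close> is
   governed by the twists of \<open>c\<close> and \<open>x\<close>; this is the case distinction in
   \<open>w\<close> and \<open>W\<close>.\<close>
 define y where "y = Point ly True (twist x)"
 define z where "z = Point lz True (- twist x)"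
 have yz: "twist y = twist x" "twist z = - twist x" "label y = ly" "label z = lz" "is_over y" "is_over z"
  "psign y = twist x" "psign z = - twist x" by (simp_all add: y_def z_def twist_def)
 define w where "w = (if twist c * twist x = - 1 then (mate y, mate z) else (mate z, mate y))"
 define L where "L = A1 @ [y, c, z] @ A2 @ [x, mate c] @ A3 @ [fst w, mate x, snd w] @ A4"
 define W where "W = (if twist c * twist x = - 1 then [mate y, mate z, mate x] else [mate x, mate z, mate y])"
 \<comment> \<open>The code after the second move; the third move at the triangle \<open>c\<close>,
   \<open>z\<close>, \<open>x\<close> leads from here to \<open>L\<close>.\<close>
 define L1 where "L1 = A1 @ [y, z, c] @ A2 @ [mate c, x] @ A3 @ W @ A4"
 have "wf_code (z # mate z # y # mate y # L0)" using lz ly tw[OF cx(2)] by (intro wf_code_add wf) (auto simp: yz)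
 moreover have "mset L = mset (z # mate z # y # mate y # L0)" "mset L1 = mset (z # mate z # y # mate y # L0)"
  by (auto simp: L_def L0 w_def L1_def W_def)
 ultimately have wfL: "wf_code L" and wfL1: "wf_code L1" using wf_code_perm by metis+
 have R2: "same_polynomials L1 L0"
 proof -
  have "adjacent L1 y z" unfolding adjacent_def
   by (intro exI2[of _ A1 "[c] @ A2 @ [mate c, x] @ A3 @ W @ A4"]) (simp add: L1_def)
  moreover have "adjacent L1 (mate y) (mate z)"
  proof (cases "twist c * twist x = - 1")
   case True
   then show ?thesis unfolding adjacent_def
    by (intro exI2[of _ "A1 @ [y, z, c] @ A2 @ [mate c, x] @ A3" "[mate x] @ A4"]) (simp add: L1_def W_def)
  next
   case False
   then show ?thesis unfolding adjacent_def
    by (intro exI2[of _ "A1 @ [y, z, c] @ A2 @ [mate c, x] @ A3 @ [mate x]" A4]) (simp add: L1_def W_def)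
  qed
  ultimately have "same_polynomials L1 (filter (\<lambda>p. label p \<notin> {label y, label z}) L1)"
   by (rule same_polynomials_R2[OF wfL1]) (use lz in \<open>auto simp: yz\<close>)
  moreover have "filter (\<lambda>p. label p \<notin> {label y, label z}) L1 = filter (\<lambda>p. label p \<notin> {label y, label z}) L0"
   by (simp add: L1_def L0 W_def)
  moreover have "filter (\<lambda>p. label p \<notin> {label y, label z}) L0 = L0"
   using ly lz by (intro filter_True) (auto simp: yz)
  ultimately show ?thesis by simp
 qed
 have R3: "same_polynomials L1 L"
 proof (rule same_polynomials_R3[OF wfL1])
  define M1 where "M1 = A1 @ [y, c, z] @ A2 @ [mate c, x] @ A3 @ W @ A4"
  define M2 where "M2 = A1 @ [y, c, z] @ A2 @ [x, mate c] @ A3 @ W @ A4"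
  show "swap_adj c z L1 M1" unfolding swap_adj_def
   by (intro exI2[of _ "A1 @ [y]" "A2 @ [mate c, x] @ A3 @ W @ A4"]) (simp add: L1_def M1_def)
  show "swap_adj (mate c) x M1 M2" unfolding swap_adj_def
   by (intro exI2[of _ "A1 @ [y, c, z] @ A2" "A3 @ W @ A4"]) (simp add: M2_def M1_def)
  show "swap_adj (mate z) (mate x) M2 L"
  proof (cases "twist c * twist x = - 1")
   case True
   then show ?thesis unfolding swap_adj_def by (intro exI2[of _ "A1 @ [y, c, z] @ A2 @ [x, mate c] @ A3 @ [mate y]" A4])
     (simp add: L_def M2_def W_def w_def)
  next
   case False
   then show ?thesis unfolding swap_adj_def
    by (intro exI2[of _ "A1 @ [y, c, z] @ A2 @ [x, mate c] @ A3" "[mate y] @ A4"])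
     (simp add: L_def M2_def W_def w_def)
  qed
  have d: "distinct L1" by (rule wf_code_distinct[OF wfL1])
  have before: "lv L1 u v = 2" "lv L1 v u = 0" if "L1 = A @ [u] @ B @ [v] @ D" for A u B v D
  proof -
   have "distinct (A @ [u] @ B @ [v] @ D)" using d that by simp
   then show "lv L1 u v = 2" "lv L1 v u = 0" by (auto simp: that lv_def idx_append idx_Cons)
  qed
  have l1: "lv L1 c z = 0" by (rule before(2)[of "A1 @ [y]" z "[]" c]) (simp add: L1_def)
  have l2: "lv L1 (mate c) x = 2" by (rule before(1)[of "A1 @ [y, z, c] @ A2" "mate c" "[]" x]) (simp add: L1_def)
  have l3: "lv L1 (mate z) (mate x) = 2" if "twist c * twist x = - 1"
   by (rule before(1)[of "A1 @ [y, z, c] @ A2 @ [mate c, x] @ A3 @ [mate y]" _ "[]" _ A4])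
    (use that in \<open>simp add: L1_def W_def\<close>)
  have l4: "lv L1 (mate z) (mate x) = 0" if "twist c * twist x \<noteq> - 1"
   by (rule before(2)[of "A1 @ [y, z, c] @ A2 @ [mate c, x] @ A3" _ "[]" _ "[mate y] @ A4"])
    (use that in \<open>simp add: L1_def W_def\<close>)
  show "(lv L1 c z - 1) * (lv L1 (mate c) x - 1) = twist z * twist x" using tw[OF cx(2)] by (auto simp: l1 l2 yz)
  show "(lv L1 c z - 1) * (lv L1 (mate z) (mate x) - 1) = twist c * twist x"
   using tw[OF cx(1)] tw[OF cx(2)] l1 l3 l4 by (cases "twist c * twist x = - 1") auto
  show "label c \<noteq> label z" "label z \<noteq> label x" using lz cx by (auto simp: yz)
  have "x \<noteq> c" "x \<noteq> mate c" using wf_code_distinct[OF wf] by (auto simp: L0)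
  then show "label c \<noteq> label x" using wf_code_label[OF wf cx(1,2)] by blast
 qed
 have "faces (map_option mate) word_twist ((None # map Some A1) @ [Some y, Some c, Some z] @ map Some A2
   @ [Some x, map_option mate (Some c)] @ map Some A3 @ [Some (fst w), map_option mate (Some x), Some (snd w)] @ map Some A4)
  = faces (map_option mate) word_twist ((None # map Some A1) @ [Some c] @ map Some A2
   @ [map_option mate (Some c), Some x] @ map Some A3 @ [map_option mate (Some x)] @ map Some A4) + 2"
 proof (rule faces_finger)
  show "(Some (fst w), Some (snd w)) = (if word_twist (Some c) * word_twist (Some x) = - 1
   then (map_option mate (Some y), map_option mate (Some z)) else (map_option mate (Some z), map_option mate (Some y)))"
   by (simp add: w_def word_twist_def)
 qed (use wf_word_code[OF wf] wf_word_code[OF wfL] in \<open>simp_all add: code_word_def L0 L_def yz word_twist_def\<close>)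
 then have "code_euler L = code_euler L0" by (simp add: code_euler_def code_word_def L_def L0)
 moreover have "{fst w, snd w} = {mate y, mate z}" by (auto simp: w_def)
 ultimately show thesis using that[of "fst w" "snd w" y z] wfL same_polynomials_trans[OF same_polynomials_sym[OF R3] R2]
  unfolding L_def by blast
qed

definition split_code :: "'l point list \<Rightarrow> 'l point list \<Rightarrow> bool" where
 "split_code A B \<longleftrightarrow> wf_code (A @ B) \<and> (\<forall>p \<in> set A. mate p \<in> set B) \<and> (\<forall>p \<in> set B. mate p \<in> set A)"

text \<open>The passage \<open>mate c\<close> is pushed past the passages of \<open>A3\<close> one
  at a time. The new passages \<open>y\<close> and \<open>z\<close> stay on the left while their
  mates land on the right, so no crossing with both passages on the left is created; the equality of
  the two sets records this.\<close>

lemma finger_steps: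
 fixes A3 :: "nat point list"
 assumes "wf_code (A1 @ [c] @ A2 @ [mate c] @ A3 @ B)"
  "\<And>p. p \<in> set B \<Longrightarrow> mate p \<notin> set B" "\<And>p. p \<in> set A3 \<Longrightarrow> mate p \<in> set B"
 shows "\<exists>A B'. wf_code (A @ [mate c] @ B') \<and> (\<forall>p \<in> set B'. mate p \<notin> set B') \<and>
  {p \<in> set (A @ [mate c]). mate p \<in> set (A @ [mate c])}
   = {p \<in> set (A1 @ [c] @ A2 @ [mate c] @ A3). mate p \<in> set (A1 @ [c] @ A2 @ [mate c] @ A3)} \<and>
  same_polynomials (A @ [mate c] @ B') (A1 @ [c] @ A2 @ [mate c] @ A3 @ B) \<and>
  code_euler (A @ [mate c] @ B') = code_euler (A1 @ [c] @ A2 @ [mate c] @ A3 @ B)"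
 using assms
proof (induction A3 arbitrary: A1 A2 B)
 case Nil
 then show ?case by (intro exI2[of _ "A1 @ [c] @ A2" B]) simp
next
 case (Cons x A3)
 have "mate x \<in> set B" using Cons.prems(3) by simp
 then obtain B1 B2 where B: "B = B1 @ mate x # B2" by (auto dest: split_list)
 let ?L0 = "A1 @ [c] @ A2 @ [mate c] @ (x # A3) @ B"
 have L0: "?L0 = A1 @ [c] @ A2 @ [mate c, x] @ (A3 @ B1) @ [mate x] @ B2" by (simp add: B)
 note d0 = wf_code_distinct[OF Cons.prems(1)]
 obtain y z w1 w2 where w: "{w1, w2} = {mate y, mate z}"
  and wfL: "wf_code (A1 @ [y, c, z] @ A2 @ [x, mate c] @ (A3 @ B1) @ [w1, mate x, w2] @ B2)"
  and sp: "same_polynomials (A1 @ [y, c, z] @ A2 @ [x, mate c] @ (A3 @ B1) @ [w1, mate x, w2] @ B2) ?L0"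
  and eu: "code_euler (A1 @ [y, c, z] @ A2 @ [x, mate c] @ (A3 @ B1) @ [w1, mate x, w2] @ B2) = code_euler ?L0"
  by (rule finger_step[OF Cons.prems(1) L0]) (rule that)
 let ?L = "A1 @ [y, c, z] @ A2 @ [x, mate c] @ (A3 @ B1) @ [w1, mate x, w2] @ B2"
 have dL: "distinct ?L" by (rule wf_code_distinct[OF wfL])
 let ?B = "B1 @ [w1, mate x, w2] @ B2"
 have eqL: "?L = (A1 @ [y]) @ [c] @ (z # A2 @ [x]) @ [mate c] @ A3 @ ?B" by simp
 have Bp: "mate p \<notin> set ?B" if "p \<in> set ?B" for p
 proof
  assume mp: "mate p \<in> set ?B"
  have no: "mate q \<notin> set ?B" if "q \<in> {mate x, mate y, mate z}" for q
  proof -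
   have "x \<notin> set ?B" "y \<notin> set ?B" "z \<notin> set ?B" using dL by simp_all
   then show ?thesis using that by (elim insertE emptyE) simp_all
  qed
  have "p \<notin> {mate x, w1, w2}" using no mp w by auto
  moreover have "mate p \<notin> {mate x, w1, w2}" using no[of "mate p"] that w by auto
  ultimately have "p \<in> set B" "mate p \<in> set B" using that mp by (auto simp: B)
  then show False using Cons.prems(2) by blast
 qed
 have A3p: "mate p \<in> set ?B" if "p \<in> set A3" for p using Cons.prems(3)[of p] that by (auto simp: B)
 from Cons.IH[of "A1 @ [y]" "z # A2 @ [x]" ?B, folded eqL, OF wfL Bp A3p] obtain A B' where
  AB: "wf_code (A @ [mate c] @ B')" "\<forall>p \<in> set B'. mate p \<notin> set B'"
   "{p \<in> set (A @ [mate c]). mate p \<in> set (A @ [mate c])}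
    = {p \<in> set ((A1 @ [y]) @ [c] @ (z # A2 @ [x]) @ [mate c] @ A3). mate p \<in> set ((A1 @ [y]) @ [c] @ (z # A2 @ [x]) @ [mate c] @ A3)}"
   "same_polynomials (A @ [mate c] @ B') ?L" "code_euler (A @ [mate c] @ B') = code_euler ?L" by blast
 let ?N = "set ((A1 @ [y]) @ [c] @ (z # A2 @ [x]) @ [mate c] @ A3)" and ?O = "set (A1 @ [c] @ A2 @ [mate c] @ x # A3)"
 have N: "?N = {y, z} \<union> ?O" by auto
 have "distinct (((A1 @ [y]) @ [c] @ (z # A2 @ [x]) @ [mate c] @ A3) @ ?B)" using dL by (simp only: append_assoc append_Cons append_Nil)
 then have "?N \<inter> set ?B = {}" by (simp only: distinct_append)
 moreover have "w1 \<in> set ?B" "w2 \<in> set ?B" by simp_all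
 ultimately have "w1 \<notin> ?N" "w2 \<notin> ?N" by blast+
 then have notN: "mate y \<notin> ?N" "mate z \<notin> ?N" using w by (metis insert_iff singletonD)+
 have "{p \<in> ?N. mate p \<in> ?N} = {p \<in> ?O. mate p \<in> ?O}"
 proof -
  have "p \<noteq> y \<and> p \<noteq> z \<and> mate p \<noteq> y \<and> mate p \<noteq> z" if "p \<in> ?N" "mate p \<in> ?N" for p
   using that notN by (metis mate_mate)
  then show ?thesis unfolding N by auto
 qed
 then show ?case using AB same_polynomials_trans[OF AB(4) sp] eu by (intro exI2[of _ A B']) simp
qed

text \<open>The measure counts the passages on the left whose mates are also on the left. Everything
  behind the last of them is paired with \<open>B\<close>, so this passage can be pushed to the
  border and handed over to the right half, which also frees its mate.\<close>

lemma split_code_exists_aux: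
 fixes A B :: "nat point list"
 assumes "wf_code (A @ B)" "\<And>p. p \<in> set B \<Longrightarrow> mate p \<notin> set B"
 shows "\<exists>(A' :: nat point list) B'. split_code A' B' \<and> same_polynomials (A' @ B') (A @ B) \<and> code_euler (A' @ B') = code_euler (A @ B)"
 using assms
proof (induction "card {p \<in> set A. mate p \<in> set A}" arbitrary: A B rule: less_induct)
 case less
 let ?P = "\<lambda>A. {p \<in> set A. mate p \<in> set A}"
 note mem = wf_code_mate[OF less.prems(1)]
 show ?case
 proof (cases "\<exists>p \<in> set A. mate p \<in> set A")
  case False
  then have "split_code A B" using less.prems mem unfolding split_code_def by (metis Un_iff set_append)
  then show ?thesis by (intro exI2[of _ A B]) simp
 next
  case True
  obtain A' c' A3 where A: "A = A' @ c' # A3" "mate c' \<in> set A" and A3: "\<forall>p \<in> set A3. mate p \<notin> set A"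
   using split_list_last_prop[OF True] by metis
  have "mate c' \<notin> set A3" using A3 A by (metis mate_mate in_set_conv_decomp)
  then have "mate c' \<in> set A'" using A by auto
  then obtain A1 A2 where A': "A' = A1 @ mate c' # A2" by (auto dest: split_list)
  define c where "c = mate c'"
  have c: "c' = mate c" by (simp add: c_def)
  have L: "A @ B = A1 @ [c] @ A2 @ [mate c] @ A3 @ B" and Ac: "A = A1 @ [c] @ A2 @ [mate c] @ A3"
   using A A' by (simp_all add: c_def)
  have wf: "wf_code (A1 @ [c] @ A2 @ [mate c] @ A3 @ B)" using less.prems(1) unfolding L .
  have "mate p \<in> set B" if "p \<in> set A3" for p using A3 that mem[of p] A(1) by auto
  from finger_steps[OF wf less.prems(2) this] obtain A'' B' where
   AB: "wf_code (A'' @ [mate c] @ B')" "\<forall>p \<in> set B'. mate p \<notin> set B'"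
    "?P (A'' @ [mate c]) = ?P A"
    "same_polynomials (A'' @ [mate c] @ B') (A @ B)" "code_euler (A'' @ [mate c] @ B') = code_euler (A @ B)"
   unfolding L[symmetric] Ac[symmetric] by blast
  have d: "distinct (A'' @ [mate c] @ B')" by (rule wf_code_distinct[OF AB(1)])
  have "c \<in> ?P A" using A A' by (auto simp: c_def)
  then have cA: "c \<in> set A''" using AB(3) by (metis (no_types, lifting) Un_iff empty_iff empty_set list.simps(15) mate_neq(1) mem_Collect_eq set_append singleton_iff)
  have "mate c \<in> ?P A" using A A' by (auto simp: c_def)
  moreover have "?P A'' \<subseteq> ?P A - {mate c}" using AB(3) d by auto
  ultimately have "?P A'' \<subset> ?P A" by blast
  then have "card (?P A'') < card (?P A)" by (intro psubset_card_mono) auto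
  moreover have "mate p \<notin> set ([mate c] @ B')" if "p \<in> set ([mate c] @ B')" for p
   using that AB(2) cA d by (auto simp: mate_eq_iff)
  ultimately obtain A1' B1' :: "nat point list" where "split_code A1' B1'" "same_polynomials (A1' @ B1') (A'' @ [mate c] @ B')"
   "code_euler (A1' @ B1') = code_euler (A'' @ [mate c] @ B')" using less.hyps[of A'' "[mate c] @ B'"] AB(1) by blast
  then show ?thesis using AB(4,5) same_polynomials_trans by metis
 qed
qed

lemma split_code_exists:
 fixes L :: "nat point list"
 assumes "wf_code L"
 obtains A B :: "nat point list" where "split_code A B" "same_polynomials (A @ B) L" "code_euler (A @ B) = code_euler L"
 using split_code_exists_aux[of L "[]"] assms by auto

section \<open>Kinks at the border of a split code\<close>

definition code_writhe :: "'l point list \<Rightarrow> nat \<Rightarrow> int" where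
 "code_writhe L a = (\<Sum>p\<in>firsts L a. psign p)"

text \<open>A kink at the border has one passage in either half, which keeps the code split; its
  sign \<open>e\<close> and, through \<open>o_k\<close>, its type can be chosen at will.\<close>

lemma kink_step:
 fixes A :: "nat point list"
 assumes s: "split_code A B" and e: "e = 1 \<or> e = - 1"
 obtains A' B' :: "nat point list" where "split_code A' B'" "same_polynomials (A' @ B') (A @ B)" "code_euler (A' @ B') = code_euler (A @ B)"
  "\<And>a. code_writhe (A' @ B') a = code_writhe (A @ B) a + (if o_k = (a = 0) then e else 0)"
proof -
 have wf: "wf_code (A @ B)" using s by (simp add: split_code_def)
 obtain l where l: "l \<notin> label ` set (A @ B)" using ex_new_if_finite[of "label ` set (A @ B)"] by auto
 define k where "k = Point l o_k e"
 have k: "label k = l" "psign k = e" "is_over k = o_k" by (simp_all add: k_def)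
 let ?L = "(A @ [k]) @ [mate k] @ B"
 have wfL: "wf_code ?L" using wf_code_add[OF wf, of k] wf_code_perm[of ?L "k # mate k # A @ B"] l e by (simp add: k)
 have d: "distinct ?L" by (rule wf_code_distinct[OF wfL])
 have f: "filter (\<lambda>p. label p \<noteq> label k) ?L = A @ B"
 proof -
  have "filter (\<lambda>p. label p \<noteq> l) A = A" "filter (\<lambda>p. label p \<noteq> l) B = B"
   by (rule filter_True, use l in auto)+
  then show ?thesis by (simp add: k)
 qed
 have "adjacent ?L k (mate k)" unfolding adjacent_def by (intro exI2[of _ A B]) simp
 from same_polynomials_R1[OF wfL this] have sp: "same_polynomials ?L (A @ B)" unfolding f .
 have eu: "code_euler ?L = code_euler (A @ B)" using code_euler_kink[of A k B] wfL wf by simp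
 have sc: "split_code (A @ [k]) ([mate k] @ B)" using s wfL by (auto simp: split_code_def)
 have fi: "firsts (A @ B) a = {p \<in> firsts ?L a. label p \<notin> {label k}}" for a
  using firsts_remove[OF wfL, where N = "{label k}" and c = a] f by simp
 have lk: "lv ?L k (mate k) = 2" "lv ?L (mate k) k = 0" using d by (auto simp: lv_def idx_append idx_Cons)
 have fs: "firsts ?L a = firsts (A @ B) a \<union> (if o_k = (a = 0) then {k} else {})" for a
 proof -
  have 1: "k \<in> firsts ?L a \<longleftrightarrow> o_k = (a = 0)" using lk by (simp add: firsts_def k)
  have "mate k \<notin> firsts ?L a" using lk by (simp add: firsts_def)
  moreover have "p = k \<or> p = mate k" if "p \<in> firsts ?L a" "label p = label k" for p
   using wf_code_label[OF wfL, of k p] that by (auto simp: firsts_def)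
  ultimately have "{p \<in> firsts ?L a. label p = label k} = (if o_k = (a = 0) then {k} else {})" using 1 by auto
  moreover have "firsts ?L a = {p \<in> firsts ?L a. label p \<notin> {label k}} \<union> {p \<in> firsts ?L a. label p = label k}"
   by blast
  ultimately show ?thesis unfolding fi by simp
 qed
 have "k \<notin> firsts (A @ B) a" for a using l by (auto simp: firsts_def simp flip: k(1))
 then have "code_writhe ?L a = code_writhe (A @ B) a + (if o_k = (a = 0) then e else 0)" for a
  unfolding code_writhe_def fs by (cases "a = 0"; cases o_k) (simp_all add: k)
 then show thesis using that[OF sc] sp eu by simp
qed

text \<open>A kink of the type of a nonzero writhe and of the opposite sign lowers the sum of the
  absolute values of both writhes.\<close>

lemma split_code_writhe_zero:
 fixes A B :: "nat point list"
 assumes "split_code A B"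
 shows "\<exists>(A' :: nat point list) B'. split_code A' B' \<and> same_polynomials (A' @ B') (A @ B) \<and> code_euler (A' @ B') = code_euler (A @ B)
  \<and> code_writhe (A' @ B') 0 = 0 \<and> code_writhe (A' @ B') 1 = 0"
 using assms
proof (induction "nat \<bar>code_writhe (A @ B) 0\<bar> + nat \<bar>code_writhe (A @ B) 1\<bar>" arbitrary: A B rule: less_induct)
 case less
 have step: ?case if a: "code_writhe (A @ B) a \<noteq> 0" "a = 0 \<or> a = 1" for a
 proof -
  obtain A' B' :: "nat point list" where AB: "split_code A' B'" "same_polynomials (A' @ B') (A @ B)" "code_euler (A' @ B') = code_euler (A @ B)"
   "\<And>b. code_writhe (A' @ B') b = code_writhe (A @ B) b + (if (a = 0) = (b = 0) then - sgn (code_writhe (A @ B) a) else 0)"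
   by (rule kink_step[OF less.prems, of "- sgn (code_writhe (A @ B) a)" "a = 0"]) (use a(1) in \<open>auto simp: sgn_if\<close>)
  have "nat \<bar>code_writhe (A' @ B') 0\<bar> + nat \<bar>code_writhe (A' @ B') 1\<bar> < nat \<bar>code_writhe (A @ B) 0\<bar> + nat \<bar>code_writhe (A @ B) 1\<bar>"
   using a AB(4)[of 0] AB(4)[of 1] by (auto simp: sgn_if split: if_splits)
  then obtain A1 B1 :: "nat point list" where "split_code A1 B1" "same_polynomials (A1 @ B1) (A' @ B')" "code_euler (A1 @ B1) = code_euler (A' @ B')"
   "code_writhe (A1 @ B1) 0 = 0" "code_writhe (A1 @ B1) 1 = 0" using less.hyps[OF _ AB(1)] by blast
  then show ?thesis using AB(2,3) same_polynomials_trans by metis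
 qed
 show ?case
 proof (cases "code_writhe (A @ B) 0 = 0 \<and> code_writhe (A @ B) 1 = 0")
  case True
  then show ?thesis using less.prems by (intro exI2[of _ A B]) simp
 qed (use step in blast)
qed

section \<open>Rotation of a split code\<close>

lemma split_code_rotate:
 assumes s: "split_code A B"
 shows "split_code B A" using assms wf_code_perm[of "A @ B" "B @ A"] by (auto simp: split_code_def)

lemma firsts_split:
 assumes s: "split_code A B"
 shows "firsts (A @ B) a = {p \<in> set A. is_over p = (a = 0)}"
proof -
 have d: "distinct (A @ B)" using s wf_code_distinct[of "A @ B"] by (simp add: split_code_def)
 have "lv (A @ B) p (mate p) = 2" if "p \<in> set A" for p
  using s that d by (auto simp: lv_def idx_append split_code_def less_imp_le_nat intro!: trans_less_add1)
 moreover have "lv (A @ B) p (mate p) = 0" if "p \<in> set B" for p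
 proof -
  have "p \<notin> set A" "mate p \<in> set A" using s that d by (auto simp: split_code_def)
  then have "idx (A @ B) (mate p) < idx (A @ B) p" using that by (simp add: idx_append trans_less_add1)
  then show ?thesis by (simp add: lv_def)
 qed
 ultimately show ?thesis using s by (auto simp: firsts_def split_code_def)
qed

lemma rotate_lv:
 assumes "distinct (A @ B)" "p \<in> set (A @ B)" "u \<in> set (A @ B)"
 shows "lv (B @ A) p u = lv (A @ B) p u + 2 * of_bool (p \<in> set B \<and> u \<in> set A) - 2 * of_bool (p \<in> set A \<and> u \<in> set B)"
proof -
 have "idx A q < length A + k" if "q \<in> set A" for q k using idx_less[OF that] by linarith
 moreover have "idx B q < length B + k" if "q \<in> set B" for q k using idx_less[OF that] by linarith
 moreover have "\<not> length A + k < idx A q" if "q \<in> set A" for q k using idx_less[OF that] by linarith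
 moreover have "\<not> length B + k < idx B q" if "q \<in> set B" for q k using idx_less[OF that] by linarith
 ultimately show ?thesis using assms by (auto simp: lv_def idx_append)
qed

text \<open>Sliding the basepoint past \<open>p\<close> but not past \<open>mate p\<close> makes
  \<open>mate p\<close> the first passage. The loop that avoids the basepoint is then the former
  \<beta>, with doubled indicator function 2 minus \<open>cyc\<close>.\<close>

lemma rotate_cyc:
 assumes s: "split_code A B" and p: "p \<in> set A" and u: "u \<in> set (A @ B)"
 shows "cyc (B @ A) (mate p) u = 2 - cyc (A @ B) p u"
proof -
 have d: "distinct (A @ B)" using s wf_code_distinct[of "A @ B"] by (simp add: split_code_def)
 have m: "mate p \<in> set B" "p \<notin> set B" "mate p \<notin> set A" using s p d by (auto simp: split_code_def)
 then show ?thesis using rotate_lv[OF d _ u, of p] rotate_lv[OF d _ u, of "mate p"] p u d by (auto simp: cyc_def)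
qed

lemma rotate_pairings:
 assumes s: "split_code A B" and p: "p \<in> set A" and q: "q \<in> set A"
 defines "L \<equiv> A @ B" and "M \<equiv> B @ A"
 shows "Om M (mate p) (mate q) = Om L p q + 2 * ind L q - 2 * ind L p"
  "ind M (mate p) = - ind L p"
proof -
 have wf: "wf_code L" and wfM: "wf_code M" using s split_code_rotate[OF s] by (simp_all add: split_code_def L_def M_def)
 have set: "set M = set L" by (auto simp: L_def M_def)
 have pM: "pairing M f g = pairing L f g" for f g by (simp add: pairing_def set)
 have one: "pairing L (\<lambda>_. 1) (\<lambda>_. 1) = 0" by (rule pairing_self[OF wf])
 have c2: "pairing L (\<lambda>_. 2) g = 2 * pairing L (\<lambda>_. 1) g" "pairing L f (\<lambda>_. 2) = 2 * pairing L f (\<lambda>_. 1)" for f g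
  using pairing_mult_left[of L 2 "\<lambda>_. 1" g] pairing_mult_right[of L f 2 "\<lambda>_. 1"] by simp_all
 have sw: "pairing L (\<lambda>_. 1) (cyc L q) = - ind L q" unfolding ind_def by (rule pairing_swap[OF wf])
 have c: "cyc M (mate r) u = 2 - cyc L r u" if "r \<in> set A" "u \<in> set L" for r u
  using rotate_cyc[OF s that(1), of u] that(2) by (simp add: L_def M_def)
 have "Om M (mate p) (mate q) = pairing L (\<lambda>u. 2 - cyc L p u) (\<lambda>u. 2 - cyc L q u)"
  unfolding Om_def pM by (rule pairing_cong[OF wf]) (simp_all add: c p q del: cyc_mate)
 also have "\<dots> = Om L p q + 2 * ind L q - 2 * ind L p"
  by (simp add: pairing_diff_left pairing_diff_right c2 one sw Om_def ind_def)
 finally show "Om M (mate p) (mate q) = Om L p q + 2 * ind L q - 2 * ind L p" .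
 have "ind M (mate p) = pairing L (\<lambda>u. 2 - cyc L p u) (\<lambda>_. 1)"
  unfolding ind_def pM by (rule pairing_cong[OF wf]) (simp_all add: c p del: cyc_mate)
 then show "ind M (mate p) = - ind L p" by (simp add: pairing_diff_left c2 one ind_def)
qed

text \<open>In a term that depends on one of the two crossings only, the sum over the other one
  factors out and equals a writhe.\<close>

lemma kernel_sum_separate:
 assumes "code_writhe L a = 0" "code_writhe L b = 0"
 shows "kernel_sum L (\<lambda>p q. k p q + f p + g q) a b = kernel_sum L k a b"
proof -
 have w: "(\<Sum>p\<in>firsts L c. of_int (psign p)) = (0 :: laurent)" if "code_writhe L c = 0" for c
  using that unfolding code_writhe_def by (metis of_int_0 of_int_sum)
 have "kernel_sum L (\<lambda>p q. k p q + f p + g q) a b = kernel_sum L k a b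
  + (\<Sum>p\<in>firsts L a. of_int (psign p) * f p * (\<Sum>q\<in>firsts L b. of_int (psign q)))
  + (\<Sum>p\<in>firsts L a. of_int (psign p) * (\<Sum>q\<in>firsts L b. of_int (psign q) * g q))"
  by (simp add: kernel_sum_def algebra_simps sum.distrib sum_distrib_left)
 also have "\<dots> = kernel_sum L k a b" by (simp add: w[OF assms(2)] sum_distrib_right[symmetric] w[OF assms(1)])
 finally show ?thesis .
qed

theorem rotate_exchanges_polynomials:
 assumes s: "split_code A B" and w: "code_writhe (A @ B) 0 = 0" "code_writhe (A @ B) 1 = 0"
  and ab: "a = 0 \<or> a = 1" "b = 0 \<or> b = 1"
 shows "F_code (B @ A) a b = H_code (A @ B) (1 - a) (1 - b)"
  "H_code (B @ A) a b = F_code (A @ B) (1 - a) (1 - b)"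
proof -
 let ?L = "A @ B" and ?M = "B @ A"
 have wa: "code_writhe ?L (1 - a) = 0" "code_writhe ?L (1 - b) = 0" using w ab by auto
 have fs: "firsts ?M c = mate ` firsts ?L (1 - c)" if "c = 0 \<or> c = 1" for c
 proof -
  have "mate ` {p \<in> set A. is_over p = (1 - c = 0)} = {p \<in> set B. is_over p = (c = 0)}" (is "?X = ?Y")
  proof
   show "?X \<subseteq> ?Y" using s that by (auto simp: split_code_def)
   show "?Y \<subseteq> ?X"
   proof
    fix p assume "p \<in> ?Y"
    then have "mate p \<in> {p \<in> set A. is_over p = (1 - c = 0)}" using s that by (auto simp: split_code_def)
    then show "p \<in> ?X" by (metis (no_types, lifting) image_eqI mate_mate)
   qed
  qed
  then show ?thesis using firsts_split[OF s] firsts_split[OF split_code_rotate[OF s]] by simp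
 qed
 have A: "p \<in> set A" if "p \<in> firsts ?L c" for p c using that firsts_split[OF s] by blast
 have ks: "kernel_sum ?M k a b = kernel_sum ?L (\<lambda>p q. k (mate p) (mate q)) (1 - a) (1 - b)" for k
  unfolding kernel_sum_def fs[OF ab(1)] fs[OF ab(2)] by (simp add: sum.reindex)
 have cg: "kernel_sum ?L k c d = kernel_sum ?L k' c d" if "\<And>p q. p \<in> set A \<Longrightarrow> q \<in> set A \<Longrightarrow> k p q = k' p q" for k k' c d
  unfolding kernel_sum_def by (intro sum.cong refl) (simp add: that[OF A A])
 \<comment> \<open>The rotated exponent is that of \<beta> . \<beta>. The difference to
   \<open>H_kernel\<close> splits into a function of \<open>p\<close>, which also takes the
   constant, and a function of \<open>q\<close>.\<close>
 have "F_code ?M a b = kernel_sum ?L (\<lambda>p q. H_kernel ?L p q + (t_power ((- 2 * ind ?L p) div 4) - 2) + t_power ((2 * ind ?L q) div 4)) (1 - a) (1 - b)"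
  unfolding F_code_def ks by (rule cg) (simp add: F_kernel_def H_kernel_def rotate_pairings[OF s] algebra_simps del: Om_mate ind_mate)
 then show "F_code ?M a b = H_code ?L (1 - a) (1 - b)" by (simp only: kernel_sum_separate[OF wa] H_code_def)
 \<comment> \<open>Since \<open>ind\<close> changes its sign under rotation, the index terms cancel
   in the first exponent, and only \<open>Om\<close> is left there.\<close>
 have "H_code ?M a b = kernel_sum ?L (\<lambda>p q. F_kernel ?L p q + (2 - t_power ((2 * ind ?L p) div 4)) + - t_power ((- 2 * ind ?L q) div 4)) (1 - a) (1 - b)"
  unfolding H_code_def ks by (rule cg) (simp add: F_kernel_def H_kernel_def rotate_pairings[OF s] algebra_simps del: Om_mate ind_mate)
 then show "H_code ?M a b = F_code ?L (1 - a) (1 - b)" by (simp only: kernel_sum_separate[OF wa] F_code_def)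
qed

section \<open>Euler characteristics\<close>

text \<open>The transpositions of disjoint pairs do not interfere, so attaching all the edges
  amounts to precomposing \<open>f\<close> with the involution that exchanges their ends.\<close>

lemma swaps_involution:
 assumes "\<And>x y. (x, y) \<in> set es \<Longrightarrow> p x = y \<and> p y = x" "distinct (map fst es @ map snd es)"
 shows "swaps f es z = f (if z \<in> fst ` set es \<union> snd ` set es then p z else z)" using assms
proof (induction es arbitrary: f)
 case (Cons e es)
 obtain x y where e: "e = (x, y)" by fastforce
 have xy: "p x = y" "p y = x" using Cons.prems(1)[of x y] by (auto simp: e)
 have d: "distinct (map fst es @ map snd es)" and ne: "x \<notin> fst ` set es \<union> snd ` set es" "y \<notin> fst ` set es \<union> snd ` set es" "x \<noteq> y"
  using Cons.prems(2) by (auto simp: e)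
 have "swaps (f \<circ> transpose x y) es z = (f \<circ> transpose x y) (if z \<in> fst ` set es \<union> snd ` set es then p z else z)"
  by (rule Cons.IH[OF _ d]) (use Cons.prems(1) in simp)
 then have "swaps f (e # es) z = (f \<circ> transpose x y) (if z \<in> fst ` set es \<union> snd ` set es then p z else z)"
  by (simp only: e swaps.simps)
 also have "\<dots> = f (if z \<in> fst ` set (e # es) \<union> snd ` set (e # es) then p z else z)"
 proof (cases "z \<in> fst ` set es \<union> snd ` set es")
  case True
  then have "p z \<in> fst ` set es \<union> snd ` set es" using Cons.prems(1) by force
  then have "p z \<noteq> x" "p z \<noteq> y" using ne by auto
  then show ?thesis using True by simp
 next
  case False
  then show ?thesis using xy by (auto simp: e transpose_def)
 qed
 finally show ?case .
qed simp

definition edges :: "(nat \<Rightarrow> nat) \<Rightarrow> nat set \<Rightarrow> (nat \<times> nat) list" where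
 "edges p D = map (\<lambda>d. (d, p d)) (filter (\<lambda>d. d < p d) (sorted_list_of_set D))"

context
 fixes p :: "nat \<Rightarrow> nat" and D :: "nat set"
 assumes fin: "finite D" and inv: "\<And>d. d \<in> D \<Longrightarrow> p d \<in> D \<and> p (p d) = d \<and> p d \<noteq> d"
begin

lemma edges_mem: "(x, y) \<in> set (edges p D) \<longleftrightarrow> x \<in> D \<and> y = p x \<and> x < p x"
 using fin by (auto simp: edges_def)

lemma edges_distinct: "distinct (map fst (edges p D) @ map snd (edges p D))"
proof -
 have 1: "map fst (edges p D) = filter (\<lambda>d. d < p d) (sorted_list_of_set D)"
  and 2: "map snd (edges p D) = map p (filter (\<lambda>d. d < p d) (sorted_list_of_set D))"
  by (simp_all add: edges_def comp_def)
 have "inj_on p D" using inv by (metis inj_onI)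
 then have "inj_on p {d \<in> D. d < p d}" by (rule inj_on_subset) blast
 moreover have "{d \<in> D. d < p d} \<inter> p ` {d \<in> D. d < p d} = {}" using inv by fastforce
 ultimately show ?thesis unfolding 1 2 using fin by (simp add: distinct_map)
qed

lemma edges_cover: "fst ` set (edges p D) \<union> snd ` set (edges p D) = D"
proof -
 have "d \<in> fst ` set (edges p D) \<union> snd ` set (edges p D)" if "d \<in> D" for d
 proof (cases "d < p d")
  case True
  then have "(d, p d) \<in> set (edges p D)" using that edges_mem by blast
  then show ?thesis by force
 next
  case False
  then have "(p d, d) \<in> set (edges p D)" using inv[OF that] edges_mem by auto
  then show ?thesis by force
 qed
 moreover have "fst ` set (edges p D) \<union> snd ` set (edges p D) \<subseteq> D" using edges_mem inv by auto
 ultimately show ?thesis by blast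
qed

lemma edges_length: "2 * length (edges p D) = card D" "card (orbit p ` D) = length (edges p D)"
proof -
 have "card (set (map fst (edges p D) @ map snd (edges p D))) = 2 * length (edges p D)"
  using distinct_card[OF edges_distinct] by simp
 then show "2 * length (edges p D) = card D" using edges_cover by simp
 have o: "orbit p d = {d, p d}" if "d \<in> D" for d
 proof -
  have "orbit p d \<subseteq> {d, p d}"
  proof
   fix x assume "x \<in> orbit p d"
   then show "x \<in> {d, p d}" by induction (use inv[OF that] in auto)
  qed
  moreover have "p d \<in> orbit p d" by (rule orbit.base)
  moreover from orbit.step[OF this] have "d \<in> orbit p d" using inv[OF that] by simp
  ultimately show ?thesis by blast
 qed
 let ?E = "{d \<in> D. d < p d}"
 have "orbit p ` D = orbit p ` ?E"
 proof -
  have "orbit p d \<in> orbit p ` ?E" if "d \<in> D" for d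
  proof (cases "d < p d")
   case False
   then have "p d \<in> ?E" using inv[OF that] by auto
   moreover have "orbit p (p d) = orbit p d" using o[of "p d"] o[of d] inv[OF that] that by (simp add: insert_commute)
   ultimately show ?thesis by (metis imageI)
  qed (use that in blast)
  then show ?thesis by blast
 qed
 moreover have "inj_on (orbit p) ?E" by (rule inj_onI) (use o inv in \<open>fastforce simp: doubleton_eq_iff\<close>)
 ultimately have "card (orbit p ` D) = card ?E" by (simp add: card_image)
 also have "\<dots> = length (edges p D)"
  using fin distinct_card[of "filter (\<lambda>d. d < p d) (sorted_list_of_set D)"] by (simp add: edges_def)
 finally show "card (orbit p ` D) = length (edges p D)" .
qed

end

text \<open>The orbits of \<open>h\<close> are closed under \<open>opp\<close> and
  \<open>rot\<close>, and steps of these two maps join any two darts of a connected surface.\<close>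

lemma connected_orbits:
 assumes S: "closed_surface S" and h: "h permutes darts S"
  and "\<And>d. d \<in> darts S \<Longrightarrow> opp S d \<in> orbit h d" "\<And>d. d \<in> darts S \<Longrightarrow> rot S d \<in> orbit h d"
 shows "card (orbit h ` darts S) = 1"
proof -
 have fin: "finite (darts S)" "darts S \<noteq> {}" using S by (auto simp: closed_surface_def)
 then obtain d where d: "d \<in> darts S" by blast
 note oe = permutes_orbit_eq_iff[OF fin(1) h]
 have "orbit h e = orbit h d" if e: "e \<in> darts S" for e
 proof -
  have "(d, e) \<in> (\<Union>c \<in> darts S. {(c, opp S c), (c, rot S c)})\<^sup>*"
   using S d e unfolding closed_surface_def by blast
  then have "e \<in> orbit h d"
  proof induction
   case base
   then show ?case by (rule permutes_self_orbit[OF fin(1) h])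
  next
   case (step x y)
   then obtain c where c: "c \<in> darts S" "x = c" "y = opp S c \<or> y = rot S c" by auto
   then have "y \<in> orbit h x" using assms(3,4) by auto
   then show ?case using step.IH by (metis orbit_trans)
  qed
  then show ?thesis using oe by blast
 qed
 then have "orbit h ` darts S = (\<lambda>_. orbit h d) ` darts S" by (rule image_cong[OF refl])
 also have "\<dots> = {orbit h d}" using d by auto
 finally show ?thesis by simp
qed

text \<open>The hypotheses fix the cyclic order \<open>u\<close>, \<open>v\<close>,
  \<open>u'\<close>, \<open>v'\<close> around the vertex, so that \<open>v\<close> follows upon
  \<open>u\<close> and \<open>v'\<close> upon \<open>u'\<close>.\<close>

lemma transversal_next:
 assumes self: "u \<in> orbit f u" and mem: "v \<in> orbit f u" "u' \<in> orbit f u" "v' \<in> orbit f u"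
  and ne: "u \<noteq> v" "u \<noteq> u'" "u \<noteq> v'" "v \<noteq> u'" "v \<noteq> v'" "u' \<noteq> v'"
  and tr: "v \<in> arc f u u'" "v' \<notin> arc f u u'"
 shows "arc f u v \<inter> {u, v, u', v'} = {}" "arc f u' v' \<inter> {u, v, u', v'} = {}"
proof -
 obtain a where a: "a < period f u" "u' = (f ^^ a) u" using orbit_position[OF self mem(2)] by blast
 obtain p where p: "p < period f u" "v = (f ^^ p) u" using orbit_position[OF self mem(1)] by blast
 obtain q where q: "q < period f u" "v' = (f ^^ q) u" using orbit_position[OF self mem(3)] by blast
 have 0: "0 < period f u" "u = (f ^^ 0) u" using period_pos[OF self] by auto
 note ap = arc_position[OF self]
 have d: "a \<noteq> 0" "p \<noteq> 0" "q \<noteq> 0" "a \<noteq> p" "a \<noteq> q" "p \<noteq> q"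
  using ne a(2) p(2) q(2) by (metis funpow_0)+
 have "p < a" "a < q"
  using ap[OF 0(1) a(1) p(1), folded a(2) p(2), simplified] ap[OF 0(1) a(1) q(1), folded a(2) q(2), simplified] d tr
  by auto
 then show "arc f u v \<inter> {u, v, u', v'} = {}" "arc f u' v' \<inter> {u, v, u', v'} = {}"
  using ap[OF 0(1) p(1) 0(1), folded p(2), simplified] ap[OF 0(1) p(1) p(1), folded p(2), simplified]
   ap[OF 0(1) p(1) a(1), folded p(2) a(2), simplified] ap[OF 0(1) p(1) q(1), folded p(2) q(2), simplified]
   ap[OF a(1) q(1) 0(1), folded a(2) q(2), simplified] ap[OF a(1) q(1) p(1), folded a(2) q(2) p(2)]
   ap[OF a(1) q(1) a(1), folded a(2) q(2)] ap[OF a(1) q(1) q(1), folded a(2) q(2)] d by auto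
qed

lemma first_return_arc:
 assumes "y \<in> orbit f x" "x \<noteq> y" "y \<in> A" "arc f x y \<inter> A = {}"
 shows "first_return f A x y"
proof -
 have "returns f A x (funpow_dist f x y) y" unfolding returns_def
 proof (intro conjI allI impI)
  show "(f ^^ funpow_dist f x y) x = y" by (rule funpow_dist_prop[OF assms(1)])
  then show "0 < funpow_dist f x y" using assms(2) by (cases "funpow_dist f x y") auto
  show "(f ^^ i) x \<notin> A" if "0 < i \<and> i < funpow_dist f x y" for i
   using that assms(4) unfolding arc_def by blast
 qed (rule assms(3))
 then show ?thesis by (auto simp: first_return_def)
qed

text \<open>After the initial step the two maps run through the same points, since they agree until
  \<open>A\<close> is reached.\<close>

lemma first_return_transfer:
 assumes "first_return f A x' y" "g x = f x'" "\<And>z. z \<notin> A \<Longrightarrow> g z = f z"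
 shows "first_return g A x y"
proof -
 obtain n where n: "returns f A x' n y" using assms(1) by (auto simp: first_return_def)
 have "(g ^^ i) x = (f ^^ i) x'" if "0 < i" "i \<le> n" for i using that
 proof (induction i)
  case (Suc i)
  show ?case
  proof (cases "i = 0")
   case False
   then have "(g ^^ i) x = (f ^^ i) x'" "(f ^^ i) x' \<notin> A" using Suc n by (auto simp: returns_def)
   then show ?thesis using assms(3) by simp
  qed (simp add: assms(2))
 qed simp
 then have "returns g A x n y" using n by (auto simp: returns_def)
 then show ?thesis by (auto simp: first_return_def)
qed

lemma first_return_exists:
 assumes "y \<in> orbit f x" "y \<in> A"
 shows "\<exists>z. first_return f A x z"
proof -
 obtain n where n: "0 < n" "y = (f ^^ n) x" using assms(1) by (auto simp: orbit_altdef)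
 define k where "k = (LEAST k. 0 < k \<and> (f ^^ k) x \<in> A)"
 have "0 < k \<and> (f ^^ k) x \<in> A" unfolding k_def by (rule LeastI[of _ n]) (use n assms(2) in simp)
 moreover have "(f ^^ i) x \<notin> A" if "0 < i" "i < k" for i
  using not_less_Least[of i "\<lambda>k. 0 < k \<and> (f ^^ k) x \<in> A"] that by (simp add: k_def)
 ultimately show ?thesis unfolding first_return_def returns_def by blast
qed

lemma faces_filter:
 assumes "wf_word mu eta (A @ R)" "A \<noteq> []" "\<And>u. u \<in> set R \<Longrightarrow> \<not> Q u \<Longrightarrow> mu u = u"
 shows "wf_word mu eta (A @ filter Q R) \<and> faces mu eta (A @ filter Q R) = faces mu eta (A @ R)" using assms
proof (induction R arbitrary: A)
 case (Cons x R)
 show ?case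
 proof (cases "Q x")
  case True
  then show ?thesis using Cons.IH[of "A @ [x]"] Cons.prems by simp
 next
  case False
  then have "mu x = x" using Cons.prems(3) by simp
  then have "wf_word mu eta (A @ R)" "faces mu eta (A @ x # R) = faces mu eta (A @ R)"
   using faces_marker[of mu eta A x R] Cons.prems by simp_all
  then show ?thesis using Cons.IH[of A] Cons.prems False by simp
 qed
qed simp

section \<open>The curve as a subgraph of its surface, and Euler characteristics\<close>

context surface_curve
begin

definition curve_darts :: "nat set" where
 "curve_darts = out ` {..<m} \<union> arr ` {..<m}"

text \<open>The face permutation when only the edges of the curve are attached: a dart off the curve
  is a loose end, which a walk around the vertex steps over.\<close>

definition curve_rot :: "nat \<Rightarrow> nat" where
 "curve_rot d = rot S (if d \<in> curve_darts then opp S d else d)"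

definition time_twist :: "nat \<Rightarrow> int" where
 "time_twist t = (if crossing_time t then eta t else - 1)"

abbreviation "dart \<equiv> \<lambda>(t, b). if b then out t else arr t"

lemma partner_noncrossing: "\<not> crossing_time t \<Longrightarrow> partner t = t" by (simp add: partner_def)

lemma wf_word_times: "wf_word partner time_twist [0..<m]" unfolding wf_word_def
proof (intro conjI ballI)
 fix t assume "t \<in> set [0..<m]"
 show "partner t \<in> set [0..<m]" "partner (partner t) = t" "time_twist t = 1 \<or> time_twist t = - 1"
  "if partner t = t then time_twist t = - 1 else time_twist (partner t) = - time_twist t"
  using \<open>t \<in> set [0..<m]\<close> crossing_partner[of t] eta_partner[of t] eta_cases partner_noncrossing[of t]
  by (cases "crossing_time t"; simp add: time_twist_def)+
qed simp

text \<open>Times without a crossing are points of degree two and may be dropped, except for time 0,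
  which stays as the basepoint \<open>None\<close>.\<close>

lemma faces_times: "faces partner time_twist [0..<m] = faces (map_option mate) word_twist (code_word (surface_code S))"
proof -
 have up: "[0..<m] = [0] @ [1..<m]" using m_pos by (simp add: upt_conv_Cons)
 let ?R = "filter crossing_time [1..<m]"
 have "\<not> crossing_time 0" using crossing_pos by blast
 then have R: "filter crossing_time [0..<m] = ?R" using up by simp
 have w: "wf_word partner time_twist ([0] @ [1..<m])" using wf_word_times up by simp
 note fi = faces_filter[OF w, of crossing_time]
 have wR: "wf_word partner time_twist ([0] @ ?R)" and fR: "faces partner time_twist ([0] @ ?R) = faces partner time_twist [0..<m]"
  using fi partner_noncrossing by (simp_all add: up)
 define h where "h t = (if t = 0 then None else Some (pt t))" for t
 have ct: "crossing_time t \<and> t \<noteq> 0" if "t \<in> set ?R" for t using that by auto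
 have "map h ([0] @ ?R) = code_word (surface_code S)" unfolding code_word_def surface_code_eq R by (simp add: h_def)
 moreover have "faces (map_option mate) word_twist (map h ([0] @ ?R)) = faces partner time_twist ([0] @ ?R)"
 proof (rule faces_map[OF wR])
  show "wf_word (map_option mate) word_twist (map h ([0] @ ?R))"
   using wf_word_code[OF wf_surface_code] calculation by simp
  show "inj_on h (set ([0] @ ?R))" using pt_inj by (auto simp: inj_on_def h_def)
  fix u assume u: "u \<in> set ([0] @ ?R)"
  show "map_option mate (h u) = h (partner u)"
   using u mate_pt crossing_pos crossing_partner(3) partner_noncrossing[of 0] \<open>\<not> crossing_time 0\<close> by (auto simp: h_def)
  show "word_twist (h u) = time_twist u"
   using u \<open>\<not> crossing_time 0\<close> by (auto simp: h_def word_twist_def time_twist_def twist_pt)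
 qed
 ultimately show ?thesis using fR by simp
qed

lemma curve_darts_vertex:
 assumes v: "v < m" and d: "d \<in> curve_darts" "d \<in> vertex S (out v)"
 shows "d \<in> {out v, arr v, out (partner v), arr (partner v)}"
proof -
 obtain t where t: "t < m" "d = out t \<or> d = arr t" using d(1) by (auto simp: curve_darts_def)
 have "vertex S (arr t) = vertex S (out t)" "vertex S d = vertex S (out v)"
  using d(2) arr_vertex[OF t(1)] unfolding vertex_eq_iff by blast+
 then have "vertex S (out t) = vertex S (out v)" using t(2) by auto
 then have "t = v \<or> t = partner v" using partner_eqI[of v t] v t(1) by (auto simp: same_vertex_def)
 then show ?thesis using t(2) by auto
qed

lemma partner_less: "t < m \<Longrightarrow> partner t < m"
 using crossing_partner(6) partner_noncrossing by (cases "crossing_time t") auto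

text \<open>Turning around a vertex and ignoring darts off the curve follows the rule built into
  \<open>face_map\<close>; at a vertex passed once it leads from one dart of the curve to the
  other.\<close>

lemma vertex_returns:
 assumes v: "v < m"
 shows "first_return (rot S) curve_darts (out v) (dart (partner v, time_twist v = 1))"
  "first_return (rot S) curve_darts (arr v) (dart (partner v, time_twist v \<noteq> 1))"
proof -
 let ?w = "partner v"
 let ?V = "{out v, arr v, out ?w, arr ?w}"
 have cd: "?V \<subseteq> curve_darts" using v partner_less by (auto simp: curve_darts_def)
 have vt: "vertex S (arr v) = vertex S (out v)" using arr_vertex[OF v] vertex_eq_iff by simp
 have frr: "first_return (rot S) curve_darts x y"
  if "x \<in> vertex S (out v)" "y \<in> vertex S (out v)" "x \<noteq> y" "y \<in> ?V" "arc (rot S) x y \<inter> ?V = {}" for x y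
 proof (rule first_return_arc)
  have "vertex S x = vertex S (out v)" using that(1) vertex_eq_iff by simp
  then show "y \<in> orbit (rot S) x" using that(2) by (simp add: vertex_def)
  have "d \<in> vertex S (out v)" if d: "d \<in> arc (rot S) x y" for d
  proof -
   have "d \<in> orbit (rot S) x" using d by (auto simp: orbit_altdef arc_def)
   then show ?thesis using \<open>vertex S x = vertex S (out v)\<close> by (simp add: vertex_def)
  qed
  then show "arc (rot S) x y \<inter> curve_darts = {}" using that(5) curve_darts_vertex[OF v] by blast
  show "y \<in> curve_darts" using that(4) cd by blast
 qed (rule that(3))
 have mem: "out v \<in> vertex S (out v)" "arr v \<in> vertex S (out v)" using arr_vertex[OF v] self_orbit by (auto simp: vertex_def)
 have "first_return (rot S) curve_darts (out v) (dart (partner v, time_twist v = 1)) \<and>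
  first_return (rot S) curve_darts (arr v) (dart (partner v, time_twist v \<noteq> 1))"
 proof (cases "crossing_time v")
  case False
  then have w: "?w = v" "time_twist v = - 1" by (simp_all add: partner_noncrossing time_twist_def)
  have ends: "x \<notin> arc (rot S) x y \<and> y \<notin> arc (rot S) x y" if "x \<noteq> y" "y \<in> orbit (rot S) x" for x y
   using arc_endpoints[OF self_orbit that(2,1)] by blast
  have "out v \<in> orbit (rot S) (arr v)" "arr v \<in> orbit (rot S) (out v)"
   using vt mem by (simp_all add: vertex_def)
  then show ?thesis
   using frr[OF mem] frr[OF mem(2,1)] ends[of "out v" "arr v"] ends[of "arr v" "out v"] v by (simp add: w)
 next
  case ct: True
  note cd = crossing_darts[OF ct]
  have wm: "out ?w \<in> vertex S (out v)" "arr ?w \<in> vertex S (out v)" using cd(1,3) by (auto simp: vertex_def)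
  note a = arcs(1,2)[OF ct]
  show ?thesis
  proof (cases "eta v = 1")
   case True
   note tn = transversal_next[OF self_orbit cd(1-9)]
   have "arc (rot S) (out v) (out ?w) \<inter> ?V = {}" "arc (rot S) (arr v) (arr ?w) \<inter> ?V = {}"
    using tn a True by auto
   then show ?thesis
    using frr[OF mem(1) wm(1)] frr[OF mem(2) wm(2)] ct True crossing_partner(2)[OF ct] v partner_less[OF v]
    by (simp add: time_twist_def eq_commute[of v])
  next
   case False
   note tn = transversal_next[OF self_orbit cd(3,2,1) cd(6,5,4) not_sym[OF cd(9)] not_sym[OF cd(8)] not_sym[OF cd(7)]]
   have "arc (rot S) (out v) (arr ?w) \<inter> ?V = {}" "arc (rot S) (arr v) (out ?w) \<inter> ?V = {}"
    using tn a False by auto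
   then show ?thesis
    using frr[OF mem(1) wm(2)] frr[OF mem(2) wm(1)] ct False crossing_partner(2)[OF ct] v partner_less[OF v]
    by (simp add: time_twist_def eq_commute[of v])
  qed
 qed
 then show "first_return (rot S) curve_darts (out v) (dart (partner v, time_twist v = 1))"
  "first_return (rot S) curve_darts (arr v) (dart (partner v, time_twist v \<noteq> 1))" by blast+
qed

lemma cyc_times:
 assumes "t < m"
 shows "cyc_prev [0..<m] t = prev t" "opp S (out t) = arr (cyc_next [0..<m] t)" "opp S (arr t) = out (cyc_prev [0..<m] t)"
proof -
 have p: "cyc_prev [0..<m] u = prev u" if "u < m" for u
  unfolding cyc_prev_def using prev_less[of u] idx_nth[of "[0..<m]" u] that by (simp add: prev_def)
 show "cyc_prev [0..<m] t = prev t" by (rule p[OF assms])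
 then show "opp S (arr t) = out (cyc_prev [0..<m] t)" by (simp add: arr_eq)
 have t: "t \<in> set [0..<m]" using assms by simp
 have "cyc_next [0..<m] t < m" using cyc_next_mem[OF t] by simp
 then have "prev (cyc_next [0..<m] t) = t" using cyc_prev_next[OF distinct_upt t] p by simp
 then show "opp S (out t) = arr (cyc_next [0..<m] t)" by (simp add: arr_eq)
qed

definition curve_edges :: "(nat \<times> nat) list" where
 "curve_edges = map (\<lambda>d. (d, opp S d)) (curve S)"

lemma curve_edges_facts:
 "(x, y) \<in> set curve_edges \<Longrightarrow> x \<in> curve_darts \<and> opp S x = y \<and> opp S y = x \<and> x \<in> darts S \<and> y \<in> darts S \<and> x \<noteq> y"
 "distinct (map fst curve_edges @ map snd curve_edges)" "length curve_edges = m"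
 "fst ` set curve_edges \<union> snd ` set curve_edges = curve_darts"
proof -
 have "map fst curve_edges = curve S" "map snd curve_edges = map (opp S) (curve S)"
  by (simp_all add: curve_edges_def comp_def)
 then show "distinct (map fst curve_edges @ map snd curve_edges)" using distinct_curve by simp
 show "length curve_edges = m" by (simp add: curve_edges_def)
 have cs: "set (curve S) = out ` {..<m}" by (auto simp: in_set_conv_nth)
 have "arr ` {..<m} = opp S ` out ` {..<m}"
 proof
  show "arr ` {..<m} \<subseteq> opp S ` out ` {..<m}" by (auto simp: arr_eq)
  show "opp S ` out ` {..<m} \<subseteq> arr ` {..<m}"
  proof (clarsimp)
   fix t assume "t < m"
   then obtain u where "u < m" "prev u = t" using prev_surj by blast
   then show "opp S (out t) \<in> arr ` {..<m}" by (intro image_eqI[of _ _ u]) (auto simp: arr_eq)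
  qed
 qed
 then show "fst ` set curve_edges \<union> snd ` set curve_edges = curve_darts"
  by (simp add: curve_edges_def curve_darts_def image_image cs)
 show "x \<in> curve_darts \<and> opp S x = y \<and> opp S y = x \<and> x \<in> darts S \<and> y \<in> darts S \<and> x \<noteq> y"
  if "(x, y) \<in> set curve_edges" using that opp_neq[of x] cs by (auto simp: curve_edges_def curve_darts_def)
qed

lemma swaps_curve_edges: "swaps (rot S) curve_edges = curve_rot"
proof
 fix z show "swaps (rot S) curve_edges z = curve_rot z"
  using swaps_involution[of curve_edges "opp S" "rot S" z] curve_edges_facts by (simp add: curve_rot_def)
qed

lemma curve_darts_sub: "curve_darts \<subseteq> darts S" by (auto simp: curve_darts_def)

text \<open>The edges of the curve are attached to bare vertices. At the beginning every vertex is a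
  face and a component of its own, so \<open>rot\<close> serves both as \<open>f\<close> and as
  \<open>h\<close> in \<open>swaps_orbits\<close>.\<close>

lemma curve_rot_facts:
 "curve_rot permutes darts S"
 "even (card (orbit curve_rot ` darts S) + card (orbit (rot S) ` darts S) + m)"
 "\<exists>h. h permutes darts S \<and> (\<forall>x \<in> darts S. curve_rot x \<in> orbit h x) \<and> (\<forall>(x, y) \<in> set curve_edges. y \<in> orbit h x)
  \<and> (\<forall>x \<in> darts S. orbit (rot S) x \<subseteq> orbit h x)
  \<and> card (orbit curve_rot ` darts S) + 2 * card (orbit (rot S) ` darts S) \<le> card (orbit (rot S) ` darts S) + m + 2 * card (orbit h ` darts S)
  \<and> (\<forall>z \<in> darts S. orbit (rot S) z \<inter> curve_darts = {} \<longrightarrow> orbit h z = orbit (rot S) z)" (is "\<exists>h. ?P h")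
proof -
 have e: "\<forall>(x, y) \<in> set curve_edges. x \<in> darts S \<and> y \<in> darts S \<and> x \<noteq> y"
  using curve_edges_facts(1) by blast
 have "\<forall>x \<in> darts S. rot S x \<in> orbit (rot S) x" by (blast intro: orbit.base)
 note so = swaps_orbits[OF finite_darts rot_perm rot_perm this e, unfolded swaps_curve_edges curve_edges_facts(3)]
 show "curve_rot permutes darts S" "even (card (orbit curve_rot ` darts S) + card (orbit (rot S) ` darts S) + m)"
  using so by blast+
 have sub: "x \<notin> orbit (rot S) z \<and> y \<notin> orbit (rot S) z" if "(x, y) \<in> set curve_edges" "orbit (rot S) z \<inter> curve_darts = {}" for x y z
 proof -
  have "x \<in> curve_darts" "y \<in> curve_darts" using that(1) curve_edges_facts(4) by force+
  then show ?thesis using that(2) by blast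
 qed
 from so obtain h where h: "h permutes darts S" "\<forall>x \<in> darts S. curve_rot x \<in> orbit h x"
  "\<forall>(x, y) \<in> set curve_edges. y \<in> orbit h x" "\<forall>x \<in> darts S. orbit (rot S) x \<subseteq> orbit h x"
  "card (orbit curve_rot ` darts S) + 2 * card (orbit (rot S) ` darts S) \<le> card (orbit (rot S) ` darts S) + m + 2 * card (orbit h ` darts S)"
  "\<forall>z \<in> darts S. (\<forall>(x, y) \<in> set curve_edges. x \<notin> orbit (rot S) z \<and> y \<notin> orbit (rot S) z) \<longrightarrow> orbit h z = orbit (rot S) z"
  by (elim conjE exE) (rule that)
 show "\<exists>h. ?P h" using h(1-5) h(6) sub by (intro exI[of _ h]) blast
qed

lemma opp_orbit:
 assumes "h permutes darts S" "\<And>x y. (x, y) \<in> set es \<Longrightarrow> y \<in> orbit h x \<and> opp S x = y \<and> opp S y = x"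
  and "d \<in> fst ` set es \<union> snd ` set es"
 shows "opp S d \<in> orbit h d"
proof -
 obtain e where "e \<in> set es" "d = fst e \<or> d = snd e" using assms(3) by blast
 then show ?thesis using assms(2)[of "fst e" "snd e"] permutes_orbit_eq_iff[OF finite_darts assms(1)]
   permutes_self_orbit[OF finite_darts assms(1)] by (metis prod.collapse)
qed

text \<open>The first return of \<open>curve_rot\<close> to the darts of the curve consists of an
  edge of the curve and a turn at its end, and this is \<open>face_map\<close> on the word of
  times.\<close>

lemma curve_faces:
 "card (orbit curve_rot ` curve_darts) = faces (map_option mate) word_twist (code_word (surface_code S))"
proof -
 let ?X = "set [0..<m] \<times> (UNIV :: bool set)" and ?f = "face_map partner time_twist [0..<m]"
 have img: "dart ` ?X = curve_darts"
 proof
  show "dart ` ?X \<subseteq> curve_darts" by (auto simp: curve_darts_def)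
  have "out t \<in> dart ` ?X" "arr t \<in> dart ` ?X" if "t < m" for t
   using that by (auto intro!: image_eqI[of "out t" dart "(t, True)"] image_eqI[of "arr t" dart "(t, False)"])
  then show "curve_darts \<subseteq> dart ` ?X" unfolding curve_darts_def by blast
 qed
 have "card (orbit ?f ` ?X) = card (orbit curve_rot ` dart ` ?X)"
 proof (rule first_return_count[OF wf_word_finite face_map_permutes[OF wf_word_times] finite_darts curve_rot_facts(1)])
  show "inj_on dart ?X" by (auto simp: inj_on_def split: if_splits)
  fix a assume a: "a \<in> ?X"
  obtain t b where tb: "a = (t, b)" "t < m" using a by auto
  have fa: "?f a \<in> ?X" using a permutes_in_image[OF face_map_permutes[OF wf_word_times]] by blast
  define v where "v = (if b then cyc_next [0..<m] t else cyc_prev [0..<m] t)"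
  have v: "v < m" using cyc_next_mem[of t "[0..<m]"] cyc_prev_mem[of t "[0..<m]"] tb by (simp add: v_def)
  have "dart a \<in> curve_darts" using tb by (auto simp: curve_darts_def)
  then have cr: "curve_rot (dart a) = rot S (if b then arr v else out v)"
   using cyc_times[OF tb(2)] tb by (simp add: curve_rot_def v_def)
  have fv: "?f a = (partner v, if b then time_twist v \<noteq> 1 else time_twist v = 1)"
   using tb by (cases b) (simp_all add: face_map_simps v_def)
  have "first_return (rot S) curve_darts (if b then arr v else out v) (dart (?f a))"
   using vertex_returns[OF v] unfolding fv by (cases b) simp_all
  then have "first_return curve_rot curve_darts (dart a) (dart (?f a))"
   by (rule first_return_transfer) (use cr in \<open>simp_all add: curve_rot_def\<close>)
  then show "\<exists>a'. a' \<in> ?X \<and> first_return ?f ?X a a' \<and> first_return curve_rot (dart ` ?X) (dart a) (dart a')"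
   unfolding img by (intro exI[of _ "?f a"] conjI fa first_return_now)
 qed
 then have "card (orbit curve_rot ` curve_darts) = faces partner time_twist [0..<m]"
  unfolding img faces_def by (rule sym)
 then show ?thesis using faces_times by (rule trans)
qed

lemma length_surface_code: "card {t. crossing_time t \<and> partner t < t} = length (surface_code S) div 2"
proof -
 let ?lo = "{t. crossing_time t \<and> t < partner t}" and ?hi = "{t. crossing_time t \<and> partner t < t}"
 have sub: "{t. crossing_time t} \<subseteq> {..<m}" using crossing_partner(5) by auto
 then have fin: "finite {t. crossing_time t}" by (rule finite_subset) simp
 have "{t. crossing_time t} = ?lo \<union> ?hi" using crossing_partner(2) nat_neq_iff by auto
 moreover have "?lo \<inter> ?hi = {}" by auto
 moreover have "finite ?lo" "finite ?hi" using fin by (auto intro: finite_subset)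
 ultimately have "card {t. crossing_time t} = card ?lo + card ?hi" using card_Un_disjoint by metis
 moreover have "bij_betw partner ?lo ?hi" by (rule bij_betw_byWitness[of _ partner]) (use crossing_partner(3,4) in auto)
 moreover have "length (surface_code S) = card {t. crossing_time t}"
  using distinct_card[of "filter crossing_time [0..<m]"] sub by (simp add: surface_code_eq Int_absorb1 Int_commute) (metis Collect_conj_eq Int_absorb1 Int_commute lessThan_def)
 ultimately show ?thesis using bij_betw_same_card by fastforce
qed

text \<open>The curve passes through \<open>m\<close> vertices counted with multiplicity, and every
  crossing is counted twice.\<close>

lemma curve_vertices: "card (orbit (rot S) ` curve_darts) + length (surface_code S) div 2 = m"
proof -
 let ?hi = "{t. crossing_time t \<and> partner t < t}" and ?v = "\<lambda>t. vertex S (out t)"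
 have hi: "?hi \<subseteq> {..<m}" using crossing_partner(5) by auto
 have "orbit (rot S) ` curve_darts = ?v ` {..<m}"
 proof -
  have "vertex S (arr t) = vertex S (out t)" if "t < m" for t using arr_vertex[OF that] vertex_eq_iff by blast
  then have "(\<lambda>t. vertex S (arr t)) ` {..<m} = ?v ` {..<m}" by (intro image_cong) auto
  then show ?thesis by (simp add: curve_darts_def image_Un image_image vertex_def[symmetric])
 qed
 also have "\<dots> = ?v ` ({..<m} - ?hi)"
 proof -
  have "?v t \<in> ?v ` ({..<m} - ?hi)" if "t < m" for t
  proof (cases "t \<in> ?hi")
   case True
   then have "?v (partner t) = ?v t" "partner t \<in> {..<m} - ?hi"
    using crossing_partner[of t] by (auto simp: same_vertex_def)
   then show ?thesis by (intro image_eqI[of _ _ "partner t"]) simp_all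
  qed (use that in blast)
  then show ?thesis by blast
 qed
 finally have "card (orbit (rot S) ` curve_darts) = card (?v ` ({..<m} - ?hi))" by simp
 also have "\<dots> = card ({..<m} - ?hi)"
 proof (rule card_image, rule inj_onI)
  fix s t assume st: "s \<in> {..<m} - ?hi" "t \<in> {..<m} - ?hi" "?v s = ?v t"
  show "s = t"
  proof (rule ccontr)
   assume ne: "s \<noteq> t"
   then have sv: "same_vertex s t" using st by (simp add: same_vertex_def)
   have ps: "partner s = t" using sv ne by (intro partner_eqI) auto
   have "crossing_time s" unfolding crossing_time_def using sv ne by (intro exI[of _ t]) simp
   then have "partner t = s" "crossing_time t" using crossing_partner(3,4)[of s] ps by auto
   then show False using st ne ps \<open>crossing_time s\<close> by auto
  qed
 qed
 also have "\<dots> = m - card ?hi" using hi by (simp add: card_Diff_subset finite_subset)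
 finally show ?thesis using length_surface_code card_mono[OF _ hi] by simp
qed

text \<open>
 Adding the edges of the surface one by one, beginning with those of the curve, bounds the number
 of faces by the number of faces of the curve in its regular neighbourhood.
\<close>

theorem euler_le_code_euler: "euler_characteristic S \<le> code_euler (surface_code S)"
proof -
 let ?D = "darts S" and ?n = "length (surface_code S) div 2"
 \<comment> \<open>The darts at vertices that the curve does not meet. As long as only the curve is
   attached, each of these vertices is a face and a component by itself.\<close>
 define U where "U = {d \<in> ?D. orbit (rot S) d \<inter> curve_darts = {}}"
 define es where "es = edges (opp S) (?D - curve_darts)"
 note r = finite_darts rot_perm and c = finite_darts curve_rot_facts(1)
 have cd: "opp S d \<in> curve_darts" if "d \<in> curve_darts" for d
 proof -
  have "d \<in> fst ` set curve_edges \<union> snd ` set curve_edges" using that by (simp add: curve_edges_facts(4))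
  then obtain e where e: "e \<in> set curve_edges" "d = fst e \<or> d = snd e" by blast
  then have "{fst e, snd e} \<subseteq> curve_darts" using curve_edges_facts(4) by blast
  then show ?thesis using curve_edges_facts(1)[of "fst e" "snd e"] e by auto
 qed
 have inv: "opp S d \<in> ?D - curve_darts \<and> opp S (opp S d) = d \<and> opp S d \<noteq> d" if "d \<in> ?D - curve_darts" for d
  using that cd[of "opp S d"] opp_neq by auto
 have fin: "finite (?D - curve_darts)" using finite_darts by simp
 have U: "orbit curve_rot d = orbit (rot S) d" if "d \<in> U" for d
 proof (rule orbit_cong[OF self_orbit])
  fix e assume "e \<in> orbit (rot S) d"
  then have "e \<notin> curve_darts" using that by (auto simp: U_def)
  then show "curve_rot e = rot S e" by (simp add: curve_rot_def)
 qed
 have "orbit curve_rot ` ?D = orbit curve_rot ` curve_darts \<union> orbit curve_rot ` (U \<inter> ?D)"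
 proof (rule orbits_meeting[OF c curve_darts_sub])
  fix x assume x: "x \<in> ?D - curve_darts - U"
  then obtain y where "y \<in> orbit (rot S) x" "y \<in> curve_darts" by (auto simp: U_def)
  then obtain z where "first_return (rot S) curve_darts x z" using first_return_exists by metis
  then have "first_return curve_rot curve_darts x z"
   by (rule first_return_transfer) (use x in \<open>simp_all add: curve_rot_def\<close>)
  then show "\<exists>z. first_return curve_rot curve_darts x z" by blast
 qed
 also have "orbit curve_rot ` (U \<inter> ?D) = orbit (rot S) ` U" using U by (auto simp: U_def)
 finally have f1: "card (orbit curve_rot ` ?D) \<le> card (orbit curve_rot ` curve_darts) + card (orbit (rot S) ` U)"
  using card_Un_le by metis
 have "orbit (rot S) ` ?D = orbit (rot S) ` curve_darts \<union> orbit (rot S) ` U"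
 proof -
  have "orbit (rot S) d \<in> orbit (rot S) ` curve_darts" if d: "d \<in> ?D - U" for d
  proof -
   obtain e where "e \<in> orbit (rot S) d" "e \<in> curve_darts" using d by (auto simp: U_def)
   then show ?thesis using permutes_orbit_eq_iff[OF r, of e d] by (metis imageI)
  qed
  then have "orbit (rot S) ` (?D - U) \<subseteq> orbit (rot S) ` curve_darts" by blast
  moreover have "?D = (?D - U) \<union> U" by (auto simp: U_def)
  ultimately have "orbit (rot S) ` ?D \<subseteq> orbit (rot S) ` curve_darts \<union> orbit (rot S) ` U" by blast
  then show ?thesis using curve_darts_sub by (auto simp: U_def)
 qed
 moreover have "orbit (rot S) ` curve_darts \<inter> orbit (rot S) ` U = {}" using self_orbit by (auto simp: U_def)
 moreover have "finite (orbit (rot S) ` curve_darts)" "finite (orbit (rot S) ` U)"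
  using finite_subset[OF curve_darts_sub finite_darts] finite_darts by (auto simp: U_def)
 ultimately have V: "card (orbit (rot S) ` ?D) = card (orbit (rot S) ` curve_darts) + card (orbit (rot S) ` U)"
  by (simp add: card_Un_disjoint)
 obtain h where h: "h permutes ?D" "\<forall>x \<in> ?D. curve_rot x \<in> orbit h x" "\<forall>(x, y) \<in> set curve_edges. y \<in> orbit h x"
  "\<forall>x \<in> ?D. orbit (rot S) x \<subseteq> orbit h x" "\<forall>z \<in> ?D. orbit (rot S) z \<inter> curve_darts = {} \<longrightarrow> orbit h z = orbit (rot S) z"
  using curve_rot_facts(3) by (elim conjE exE) (rule that)
 \<comment> \<open>The summand 1 is the component of the curve, represented by the basepoint dart
   \<open>out 0\<close>.\<close>
 have H: "card (orbit (rot S) ` U) + 1 \<le> card (orbit h ` ?D)"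
 proof -
  have o0: "out 0 \<in> ?D" "out 0 \<in> curve_darts" using m_pos by (auto simp: curve_darts_def)
  have "orbit h (out 0) \<notin> orbit (rot S) ` U"
   using o0 permutes_self_orbit[OF finite_darts h(1)] by (auto simp: U_def)
  moreover have "finite (orbit (rot S) ` U)" using finite_darts by (simp add: U_def)
  ultimately have "card (insert (orbit h (out 0)) (orbit (rot S) ` U)) = card (orbit (rot S) ` U) + 1" by simp
  moreover have "orbit (rot S) d \<in> orbit h ` ?D" if "d \<in> U" for d using that h(5) by (force simp: U_def)
  then have "insert (orbit h (out 0)) (orbit (rot S) ` U) \<subseteq> orbit h ` ?D" using o0 by blast
  ultimately show ?thesis using card_mono[of "orbit h ` ?D"] finite_darts by (metis finite_imageI)
 qed
 have e: "(x, y) \<in> set es \<Longrightarrow> x \<in> ?D \<and> y \<in> ?D \<and> x \<noteq> y" for x y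
  using edges_mem[OF fin inv] inv unfolding es_def by auto
 have sw: "swaps curve_rot es = rot S \<circ> opp S"
 proof
  fix z
  have "opp S z = z" if "z \<notin> ?D" using permutes_not_in[OF opp_perm that] .
  have "swaps curve_rot es z = curve_rot (if z \<in> fst ` set es \<union> snd ` set es then opp S z else z)"
   by (rule swaps_involution) (use edges_mem[OF fin inv] edges_distinct[OF fin inv] inv es_def in auto)
  also have "fst ` set es \<union> snd ` set es = ?D - curve_darts" unfolding es_def by (rule edges_cover[OF fin inv])
  also have "curve_rot (if z \<in> ?D - curve_darts then opp S z else z) = (rot S \<circ> opp S) z"
   using \<open>z \<notin> ?D \<Longrightarrow> opp S z = z\<close> inv curve_darts_sub
   by (cases "z \<in> curve_darts"; cases "z \<in> ?D") (auto simp: curve_rot_def)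
  finally show "swaps curve_rot es z = (rot S \<circ> opp S) z" .
 qed
 have e': "\<forall>(x, y) \<in> set es. x \<in> ?D \<and> y \<in> ?D \<and> x \<noteq> y" using e by blast
 from swaps_orbits[OF c h(1,2) e', unfolded sw]
 obtain k where k: "k permutes ?D" "\<forall>(x, y) \<in> set es. y \<in> orbit k x" "\<forall>x \<in> ?D. orbit h x \<subseteq> orbit k x"
  "card (orbit (rot S \<circ> opp S) ` ?D) + 2 * card (orbit h ` ?D)
   \<le> card (orbit curve_rot ` ?D) + length es + 2 * card (orbit k ` ?D)"
  by (elim conjE exE) (rule that)
 have "card (orbit k ` ?D) = 1"
 proof (rule connected_orbits[OF surface k(1)])
  fix d assume d: "d \<in> ?D"
  show "rot S d \<in> orbit k d" using h(4) k(3) d orbit.base[of "rot S" d] by blast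
  have "d \<in> fst ` set (curve_edges @ es) \<union> snd ` set (curve_edges @ es)"
   using d curve_edges_facts(4) edges_cover[OF fin inv] unfolding es_def image_Un set_append by blast
  moreover have "y \<in> orbit k x \<and> opp S x = y \<and> opp S y = x" if "(x, y) \<in> set (curve_edges @ es)" for x y
  proof (cases "(x, y) \<in> set curve_edges")
   case True
   then have "y \<in> orbit h x" using h(3) by blast
   then show ?thesis using k(3) curve_edges_facts(1)[OF True] by blast
  next
   case False
   then have es: "(x, y) \<in> set es" using that by simp
   then have "x \<in> ?D - curve_darts" "y = opp S x" using edges_mem[OF fin inv] unfolding es_def by auto
   then show ?thesis using inv k(2) es by blast
  qed
  ultimately show "opp S d \<in> orbit k d" using opp_orbit[OF k(1)] by blast
 qed
 moreover have "card (orbit (opp S) ` ?D) = m + length es"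
 proof -
  have i: "opp S d \<in> ?D \<and> opp S (opp S d) = d \<and> opp S d \<noteq> d" if "d \<in> ?D" for d
   using that opp_neq by simp
  have "card ?D = card curve_darts + card (?D - curve_darts)"
   using curve_darts_sub finite_darts by (metis card_Diff_subset card_mono finite_subset le_add_diff_inverse)
  moreover have "card curve_darts = 2 * m" using distinct_card[OF curve_edges_facts(2)] curve_edges_facts(3,4) by simp
  ultimately show ?thesis using edges_length[OF finite_darts i] edges_length(1)[OF fin inv] unfolding es_def by simp
 qed
 \<comment> \<open>The vertices off the curve count once as vertices by \<open>V\<close>, once as
   initial faces by \<open>f1\<close>, and twice negatively as components by \<open>H\<close>, so
   they cancel; the edges in \<open>es\<close> cancel likewise.\<close>
 ultimately show ?thesis
  using k(4) f1 V H curve_vertices by (simp add: euler_characteristic_def code_euler_def curve_faces)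
qed

text \<open>If all edges belong to the curve, \<open>curve_rot\<close> is the face permutation of
  the surface itself. Parity and the bound 2 come from attaching the edges of the curve to bare
  vertices and ending with one component.\<close>

theorem euler_filling:
 assumes "darts S = curve_darts"
 shows "euler_characteristic S = code_euler (surface_code S)" "euler_characteristic S \<le> 2" "even (euler_characteristic S)"
proof -
 have "opp S z = z" if "z \<notin> darts S" for z using permutes_not_in[OF opp_perm that] .
 then have cr: "curve_rot = rot S \<circ> opp S" using assms by (auto simp: curve_rot_def)
 have i: "opp S d \<in> darts S \<and> opp S (opp S d) = d \<and> opp S d \<noteq> d" if "d \<in> darts S" for d
  using that opp_neq by simp
 have "card curve_darts = 2 * m" using distinct_card[OF curve_edges_facts(2)] curve_edges_facts(3,4) by simp
 then have e: "card (orbit (opp S) ` darts S) = m" using edges_length[OF finite_darts i] assms by simp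
 then show "euler_characteristic S = code_euler (surface_code S)"
  using curve_vertices curve_faces by (simp add: euler_characteristic_def code_euler_def assms cr)
 show "even (euler_characteristic S)" using curve_rot_facts(2) by (auto simp: euler_characteristic_def e cr)
 obtain h where h: "h permutes darts S" "\<forall>(x, y) \<in> set curve_edges. y \<in> orbit h x" "\<forall>x \<in> darts S. orbit (rot S) x \<subseteq> orbit h x"
  "card (orbit curve_rot ` darts S) + 2 * card (orbit (rot S) ` darts S) \<le> card (orbit (rot S) ` darts S) + m + 2 * card (orbit h ` darts S)"
  using curve_rot_facts(3) by (elim conjE exE) (rule that)
 have "card (orbit h ` darts S) = 1"
 proof (rule connected_orbits[OF surface h(1)])
  fix d assume d: "d \<in> darts S"
  show "rot S d \<in> orbit h d" using h(3) d orbit.base[of "rot S" d] by blast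
  show "opp S d \<in> orbit h d"
   by (rule opp_orbit[OF h(1), of curve_edges]) (use h(2) curve_edges_facts d assms in auto)
 qed
 then show "euler_characteristic S \<le> 2" using h(4) by (simp add: euler_characteristic_def e cr)
qed

end

section \<open>The surface realization of a code with complementary disks\<close>

lemma code_euler_relabel:
 assumes wf: "wf_code L" and inj: "inj_on h (label ` set L)"
 shows "code_euler (map (relabel h) L) = code_euler L"
proof -
 let ?h = "map_option (relabel h)"
 have eq: "code_word (map (relabel h) L) = map ?h (code_word L)" by (simp add: code_word_def)
 have "faces (map_option mate) word_twist (map ?h (code_word L)) = faces (map_option mate) word_twist (code_word L)"
 proof (rule faces_map[OF wf_word_code[OF wf]])
  show "wf_word (map_option mate) word_twist (map ?h (code_word L))"
   using wf_word_code[OF wf_code_relabel[OF wf inj]] eq by simp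
  show "inj_on ?h (set (code_word L))" using inj_on_relabel[OF inj] by (auto simp: code_word_def inj_on_def)
  show "map_option mate (?h u) = ?h (map_option mate u)" "word_twist (?h u) = word_twist u" for u
   by (cases u; simp add: word_twist_def)+
 qed
 then show ?thesis by (simp add: code_euler_def eq)
qed

context
 fixes G :: "'l point list"
 assumes wf: "wf_code G"
begin

definition pn :: nat where "pn = Suc (length G)"

definition cmate :: "nat \<Rightarrow> nat" where
 "cmate t = (if t = 0 then 0 else Suc (idx G (mate (G ! (t - 1)))))"

definition ctwist :: "nat \<Rightarrow> int" where
 "ctwist t = (if t = 0 then - 1 else twist (G ! (t - 1)))"

text \<open>Around a crossing the darts of its two strands alternate, and the twist tells which dart
  of the other strand comes next, as in \<open>face_map\<close>. At the basepoint the values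
  \<open>cmate 0 = 0\<close> and -1 make the two darts swap.\<close>

definition crot :: "nat \<Rightarrow> nat" where
 "crot d = (if d < 2 * pn then 2 * cmate (d div 2) + of_bool (even d \<noteq> (ctwist (d div 2) = 1)) else d)"

definition copp :: "nat \<Rightarrow> nat" where
 "copp d = (if d < 2 * pn then
   if even d then 2 * (Suc (d div 2) mod pn) + 1 else 2 * ((d div 2 + pn - 1) mod pn) else d)"

text \<open>
 Time \<open>0\<close> is the basepoint, time \<open>t > 0\<close> the passage \<open>G ! (t - 1)\<close>; the dart \<open>2 * t\<close> leaves the
 vertex passed at time \<open>t\<close> forward, the dart \<open>2 * t + 1\<close> backward.
\<close>

definition code_surface :: surface_diagram where
 "code_surface = \<lparr>darts = {..<2 * pn}, opp = copp, rot = crot, curve = map (\<lambda>t. 2 * t) [0..<pn],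
   over = {t. 0 < t \<and> t < pn \<and> is_over (G ! (t - 1))}\<rparr>"

lemma cs [simp]: "darts code_surface = {..<2 * pn}" "opp code_surface = copp" "rot code_surface = crot"
 "curve code_surface = map (\<lambda>t. 2 * t) [0..<pn]" "t \<in> over code_surface \<longleftrightarrow> 0 < t \<and> t < pn \<and> is_over (G ! (t - 1))"
 by (simp_all add: code_surface_def)

lemma nth_pos: "0 < t \<Longrightarrow> t < pn \<Longrightarrow> G ! (t - 1) \<in> set G \<and> mate (G ! (t - 1)) \<in> set G"
 using wf_code_mate[OF wf] by (simp add: pn_def)

lemma cmate_facts:
 assumes "t < pn"
 shows "cmate t < pn" "cmate (cmate t) = t" "0 < t \<Longrightarrow> cmate t \<noteq> t \<and> 0 < cmate t"
  "0 < t \<Longrightarrow> G ! (cmate t - 1) = mate (G ! (t - 1)) \<and> ctwist (cmate t) = - ctwist t"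
  "0 < t \<Longrightarrow> ctwist t = 1 \<or> ctwist t = - 1"
proof -
 have *: "cmate t < pn \<and> cmate (cmate t) = t \<and> cmate t \<noteq> t \<and> 0 < cmate t \<and> G ! (cmate t - 1) = mate (G ! (t - 1))
  \<and> ctwist (cmate t) = - ctwist t \<and> (ctwist t = 1 \<or> ctwist t = - 1)" if "0 < t"
 proof -
  note n = nth_pos[OF that assms]
  have 1: "cmate t < pn" "G ! (cmate t - 1) = mate (G ! (t - 1))" "0 < cmate t"
   using n that by (simp_all add: cmate_def pn_def)
  have "cmate (cmate t) = t"
   using 1 that assms idx_nth[OF wf_code_distinct[OF wf], of "t - 1"] by (simp add: cmate_def pn_def)
  moreover have "cmate t \<noteq> t" using 1 by auto
  moreover have "twist (G ! (t - 1)) = 1 \<or> twist (G ! (t - 1)) = - 1"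
   using wf_code_psign[OF wf] n by (auto simp: twist_def)
  ultimately show ?thesis using 1 that by (simp add: ctwist_def)
 qed
 then show "cmate t < pn" "cmate (cmate t) = t" by (cases "t = 0"; simp add: cmate_def pn_def)+
 show "0 < t \<Longrightarrow> cmate t \<noteq> t \<and> 0 < cmate t" "0 < t \<Longrightarrow> ctwist t = 1 \<or> ctwist t = - 1"
  "0 < t \<Longrightarrow> G ! (cmate t - 1) = mate (G ! (t - 1)) \<and> ctwist (cmate t) = - ctwist t" using * by blast+
qed

lemma crot_dart: "t < pn \<Longrightarrow> crot (2 * t + of_bool b) = 2 * cmate t + of_bool (b = (ctwist t = 1))"
 by (auto simp: crot_def)

text \<open>Half a turn around a crossing leads to the opposite dart of the same strand.\<close>

lemma crot2:
 assumes "t < pn" "0 < t"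
 shows "crot (crot (2 * t + of_bool b)) = 2 * t + of_bool (\<not> b)"
 unfolding crot_dart[OF assms(1)] crot_dart[OF cmate_facts(1)[OF assms(1)]] cmate_facts(2)[OF assms(1)]
 using cmate_facts(4,5)[OF assms] by auto

lemma dart_cases:
 assumes "d < 2 * pn"
 obtains t b where "t < pn" "d = 2 * t + of_bool b" using that[of "d div 2" "odd d"] assms by auto

lemma crot4: "d < 2 * pn \<Longrightarrow> crot (crot (crot (crot d))) = d"
proof (erule dart_cases)
 fix t b assume t: "t < pn" "d = 2 * t + of_bool b"
 show ?thesis
 proof (cases "t = 0")
  case True
  then have r: "crot (2 * t + of_bool b) = 2 * t + of_bool (\<not> b)" for b
   using crot_dart[OF t(1), of b] by (simp add: cmate_def ctwist_def)
  show ?thesis unfolding t(2) r by simp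
 next
  case False
  then have "0 < t" by simp
  show ?thesis unfolding t(2) crot2[OF t(1) \<open>0 < t\<close>] by simp
 qed
qed

lemma crot_less: "d < 2 * pn \<Longrightarrow> crot d < 2 * pn"
proof (erule dart_cases)
 fix t b assume t: "t < pn" "d = 2 * t + of_bool b"
 then have "cmate t < pn" using cmate_facts(1) by blast
 then show "crot d < 2 * pn" using crot_dart[OF t(1), of b] t(2) by auto
qed

lemma permutes_lessI:
 assumes "\<And>d. d < k \<Longrightarrow> f d < k \<and> g (f d) = d" "\<And>d. \<not> d < k \<Longrightarrow> f d = d"
 shows "f permutes {..<k :: nat}"
proof (rule bij_imp_permutes)
 have i: "inj_on f {..<k}" by (rule inj_on_inverseI[of _ g]) (use assms(1) in auto)
 have "f ` {..<k} = {..<k}" by (rule endo_inj_surj) (use assms(1) i in auto)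
 with i show "bij_betw f {..<k} {..<k}" by (simp add: bij_betw_def)
qed (use assms(2) in auto)

lemma copp_facts: "d < 2 * pn \<Longrightarrow> copp d < 2 * pn \<and> copp (copp d) = d \<and> copp d \<noteq> d"
proof (erule dart_cases)
 fix t b assume t: "t < pn" "d = 2 * t + of_bool b"
 have n: "Suc t mod pn < pn" "(t + pn - 1) mod pn < pn" using t by (auto intro: mod_less_divisor)
 have "(Suc t mod pn + pn - 1) mod pn = t" using t by (cases "Suc t = pn") (auto simp: mod_Suc)
 moreover have "Suc ((t + pn - 1) mod pn) mod pn = t"
 proof (cases t)
  case (Suc t')
  then have "t + pn - 1 = t' + pn" by simp
  then show ?thesis using t Suc by simp
 qed (use t in simp)
 moreover have "even (copp d) \<longleftrightarrow> odd d" using t by (simp add: copp_def)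
 moreover have "Suc (2 * x) < 2 * y \<longleftrightarrow> x < y" for x y :: nat by linarith
 ultimately show ?thesis
  using t n by (cases b) (simp_all add: copp_def Suc_double_not_eq_double double_not_eq_Suc_double)
qed

lemma crot_perm: "crot permutes {..<2 * pn}" and copp_perm: "copp permutes {..<2 * pn}"
proof -
 show "crot permutes {..<2 * pn}"
  by (rule permutes_lessI[of _ _ "\<lambda>d. crot (crot (crot d))"]) (simp_all add: crot_less crot4, simp add: crot_def)
 show "copp permutes {..<2 * pn}" by (rule permutes_lessI[of _ _ copp]) (use copp_facts in simp, simp add: copp_def)
qed

lemma arrival_code: "t < pn \<Longrightarrow> arrival code_surface (curve code_surface) t = 2 * t + 1"
 using copp_facts[of "2 * t + 1"] mod_less_divisor[of pn "t + pn - 1"] by (simp add: arrival_def copp_def)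

lemma vertex_code:
 assumes t: "t < pn"
 shows "d \<in> vertex code_surface (2 * t + of_bool b) \<longleftrightarrow> d div 2 = t \<or> d div 2 = cmate t" "2 * cmate t < 2 * pn"
proof -
 have self: "2 * t + of_bool b \<in> orbit crot (2 * t + of_bool b)" for b
  by (rule permutes_self_orbit[OF finite_lessThan crot_perm])
 show "2 * cmate t < 2 * pn" using cmate_facts(1)[OF t] by simp
 have 1: "d div 2 = t \<or> d div 2 = cmate t" if "d \<in> orbit crot (2 * t + of_bool b)" using that
 proof induction
  case base
  then show ?case using crot_dart[OF t, of b] by simp
 next
  case (step d)
  have "crot d div 2 = cmate (d div 2)" using step.IH t cmate_facts(1)[OF t] by (auto simp: crot_def)
  then show ?case using step.IH cmate_facts(2)[OF t] by auto
 qed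
 have st: "crot x \<in> orbit crot (2 * t + of_bool b)" if "x \<in> orbit crot (2 * t + of_bool b)" for x
  using that by (rule orbit.step)
 have 2: "2 * t + of_bool c \<in> orbit crot (2 * t + of_bool b)" for c
 proof (cases "c = b")
  case False
  then have c: "of_bool c = (of_bool (\<not> b) :: nat)" by simp
  have "crot (crot (2 * t + of_bool b)) = 2 * t + of_bool (\<not> b) \<or> crot (2 * t + of_bool b) = 2 * t + of_bool (\<not> b)"
   using crot2[OF t, of b] crot_dart[OF t, of b] by (cases "t = 0") (auto simp: cmate_def ctwist_def)
  then show ?thesis using st[OF st[OF self]] st[OF self] c by metis
 qed (use self in simp)
 have 3: "2 * cmate t + of_bool c \<in> orbit crot (2 * t + of_bool b)" for c
  using st[OF 2[of "c = (ctwist t = 1)"]] crot_dart[OF t, of "c = (ctwist t = 1)"] by auto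
 have "d \<in> orbit crot (2 * t + of_bool b)" if "d div 2 = t \<or> d div 2 = cmate t"
 proof -
  have "2 * (d div 2) + of_bool (odd d) = d" by (cases "even d") auto
  then have "d = 2 * t + of_bool (odd d) \<or> d = 2 * cmate t + of_bool (odd d)" using that by metis
  then show ?thesis using 2 3 by metis
 qed
 then show "d \<in> vertex code_surface (2 * t + of_bool b) \<longleftrightarrow> d div 2 = t \<or> d div 2 = cmate t"
  using 1 by (auto simp: vertex_def)
qed

text \<open>By \<open>crot2\<close> the arriving dart is two rotation steps away from the departing
  one, so exactly one dart lies between them on the left.\<close>

lemma left_code:
 assumes t: "t < pn" "0 < t"
 shows "left_darts code_surface (curve code_surface) t = {2 * cmate t + of_bool (ctwist t \<noteq> 1)}"
proof -
 have r: "crot (2 * t) = 2 * cmate t + of_bool (ctwist t \<noteq> 1)" "crot (crot (2 * t)) = 2 * t + 1"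
  using crot_dart[OF t(1), of False] crot2[OF t, of False] by simp_all
 have "2 * cmate t + of_bool (ctwist t \<noteq> 1) \<noteq> 2 * t + 1" using cmate_facts(3)[OF t] by (auto elim: oddE)
 then have ne: "crot (2 * t) \<noteq> 2 * t + 1" using r(1) by simp
 have "funpow_dist crot (2 * t) (2 * t + 1) = 2" unfolding funpow_dist_def
 proof (rule Least_equality)
  show "(crot ^^ 2) (2 * t) = 2 * t + 1" using r(2) by (simp add: numeral_2_eq_2)
  fix y assume y: "(crot ^^ y) (2 * t) = 2 * t + 1"
  have "y \<noteq> 0" using y by (intro notI) simp
  moreover have "y \<noteq> 1" using y ne by (intro notI) simp
  ultimately show "2 \<le> y" by linarith
 qed
 then have "{(crot ^^ n) (2 * t) |n. 0 < n \<and> n < funpow_dist crot (2 * t) (2 * t + 1)} = {crot (2 * t)}"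
  by (auto simp: numeral_2_eq_2 less_Suc_eq intro!: exI[of _ 1])
 then show ?thesis using t arrival_code[OF t(1)] r(1) by (simp add: left_darts_def)
qed

lemma closed_code_surface: "closed_surface code_surface" unfolding closed_surface_def
proof (intro conjI ballI)
 show "opp code_surface permutes darts code_surface" using copp_perm by simp
 show "rot code_surface permutes darts code_surface" using crot_perm by simp
 show "darts code_surface \<noteq> {}" by (auto simp: pn_def)
 show "opp code_surface (opp code_surface d) = d" "opp code_surface d \<noteq> d" if "d \<in> darts code_surface" for d
  using that copp_facts by auto
 let ?R = "\<Union>c \<in> darts code_surface. {(c, opp code_surface c), (c, rot code_surface c)}"
 have o: "(d, copp d) \<in> ?R\<^sup>*" "(d, crot d) \<in> ?R\<^sup>*" if "d < 2 * pn" for d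
  using that by (auto intro!: r_into_rtrancl)
 have v: "(2 * t + of_bool b, 2 * t + of_bool c) \<in> ?R\<^sup>*" if "t < pn" for t b c
 proof -
  have "y \<in> orbit crot x \<Longrightarrow> x < 2 * pn \<Longrightarrow> (x, y) \<in> ?R\<^sup>* \<and> y < 2 * pn" for x y
  proof (induction rule: orbit.induct)
   case (step y)
   then show ?case using o(2)[of y] crot_less[of y] rtrancl_trans[of x y ?R "crot y"] by simp
  qed (use o(2)[of x] crot_less[of x] in simp)
  then show ?thesis using vertex_code(1)[OF that, of "2 * t + of_bool c" b] that by (auto simp: vertex_def)
 qed
 have u: "(2 * 0 + of_bool b, 2 * t + of_bool c) \<in> ?R\<^sup>* \<and> (2 * t + of_bool c, 2 * 0 + of_bool b) \<in> ?R\<^sup>*" if "t < pn" for t b c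
  using that
 proof (induction t arbitrary: c)
  case 0
  then show ?case using v by blast
 next
  case (Suc t)
  have "copp (2 * t + of_bool False) = 2 * Suc t + of_bool True" "copp (2 * Suc t + of_bool True) = 2 * t + of_bool False"
   using Suc.prems copp_facts[of "2 * t"] by (auto simp: copp_def)
  then have "(2 * t + of_bool False, 2 * Suc t + of_bool True) \<in> ?R\<^sup>*" "(2 * Suc t + of_bool True, 2 * t + of_bool False) \<in> ?R\<^sup>*"
   using o(1)[of "2 * t + of_bool False"] o(1)[of "2 * Suc t + of_bool True"] Suc.prems by simp_all
  then show ?case using Suc.IH[of False] v[OF Suc.prems] Suc.prems by (meson Suc_lessD rtrancl_trans)
 qed
 show "(d, e) \<in> ?R\<^sup>*" if "d \<in> darts code_surface" "e \<in> darts code_surface" for d e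
 proof -
  have de: "d < 2 * pn" "e < 2 * pn" using that by auto
  obtain t b where "t < pn" "d = 2 * t + of_bool b" by (rule dart_cases[OF de(1)]) (rule that)
  moreover obtain s c where "s < pn" "e = 2 * s + of_bool c" by (rule dart_cases[OF de(2)]) (rule that)
  ultimately have "(d, 2 * 0 + of_bool False) \<in> ?R\<^sup>*" "(2 * 0 + of_bool False, e) \<in> ?R\<^sup>*"
   using u[of t False b] u[of s False c] by blast+
  then show ?thesis by (rule rtrancl_trans)
 qed
qed simp

lemma same_vertex_code:
 assumes "s < pn" "t < pn"
 shows "vertex code_surface (2 * s) = vertex code_surface (2 * t) \<longleftrightarrow> s = t \<or> s = cmate t"
proof -
 have "vertex code_surface (2 * s) = {d. d div 2 = s \<or> d div 2 = cmate s}" if "s < pn" for s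
  using vertex_code(1)[OF that, of _ False] by auto
 moreover have "{d. d div 2 = s \<or> d div 2 = cmate s} = {d. d div 2 = t \<or> d div 2 = cmate t} \<longleftrightarrow> s = t \<or> s = cmate t"
 proof
  assume "{d. d div 2 = s \<or> d div 2 = cmate s} = {d. d div 2 = t \<or> d div 2 = cmate t}"
  moreover have "2 * s \<in> {d. d div 2 = s \<or> d div 2 = cmate s}" by simp
  ultimately show "s = t \<or> s = cmate t" by simp
 qed (use cmate_facts(2)[OF assms(2)] in auto)
 ultimately show ?thesis using assms by simp
qed

lemma curve_code_surface: "curve_diagram code_surface" unfolding curve_diagram_def
proof (intro conjI allI ballI impI)
 show "curve code_surface \<noteq> []" "set (curve code_surface) \<subseteq> darts code_surface" by (auto simp: pn_def)
 have "inj_on (copp \<circ> (\<lambda>t. 2 * t)) {0..<pn}"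
 proof (rule inj_onI)
  fix s t assume st: "s \<in> {0..<pn}" "t \<in> {0..<pn}" "(copp \<circ> (\<lambda>t. 2 * t)) s = (copp \<circ> (\<lambda>t. 2 * t)) t"
  have "2 * s = copp (copp (2 * s))" using copp_facts[of "2 * s"] st(1) by simp
  also have "\<dots> = copp (copp (2 * t))" using st(3) by simp
  also have "\<dots> = 2 * t" using copp_facts[of "2 * t"] st(2) by simp
  finally show "s = t" by simp
 qed
 then have "distinct (map copp (map (\<lambda>t. 2 * t) [0..<pn]))" unfolding map_map distinct_map by simp
 moreover have "set (map (\<lambda>t. 2 * t) [0..<pn]) \<inter> set (map copp (map (\<lambda>t. 2 * t) [0..<pn])) = {}"
 proof (rule equals0I)
  fix y assume "y \<in> set (map (\<lambda>t. 2 * t) [0..<pn]) \<inter> set (map copp (map (\<lambda>t. 2 * t) [0..<pn]))"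
  then obtain s t where st: "s < pn" "y = copp (2 * s)" "y = 2 * t" by auto
  show False using st(2) unfolding st(3) by (simp add: copp_def st(1) double_not_eq_Suc_double)
 qed
 ultimately show "distinct (curve code_surface @ map (opp code_surface) (curve code_surface))"
  unfolding cs distinct_append by (simp add: distinct_map inj_on_def)
 show "arrival code_surface (curve code_surface) t \<in> vertex code_surface (curve code_surface ! t)"
  if "t < length (curve code_surface)" for t using that vertex_code(1)[of t _ False] arrival_code[of t] by simp
 show "card {t. t < length (curve code_surface) \<and> curve code_surface ! t \<in> vertex code_surface d} \<le> 2"
  if "d \<in> darts code_surface" for d
 proof -
  have d': "d < 2 * pn" using that by simp
  obtain t b where d: "t < pn" "d = 2 * t + of_bool b" by (rule dart_cases[OF d']) (rule that)
  have "{t. t < length (curve code_surface) \<and> curve code_surface ! t \<in> vertex code_surface d} \<subseteq> {t, cmate t}"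
   using vertex_code(1)[OF d(1), of _ b] d(2) by auto
  then have "card {t. t < length (curve code_surface) \<and> curve code_surface ! t \<in> vertex code_surface d} \<le> card {t, cmate t}"
   by (rule card_mono[rotated]) simp
  also have "\<dots> \<le> 2" by (simp add: card_insert_if)
  finally show ?thesis .
 qed
 fix c assume "c \<in> crossings code_surface"
 then obtain s t where c': "c = (s, t)" "s < t" "t < pn" "vertex code_surface (2 * s) = vertex code_surface (2 * t)"
  by (auto simp: crossings_def)
 then have c: "c = (s, t)" "s < t" "t < pn" "s = cmate t" using same_vertex_code[of s t] by auto
 have s: "s < pn" "0 < s" "t = cmate s" using c cmate_facts(2,3)[of t] by auto
 show "case c of (s, t) \<Rightarrow> 0 < s \<and>
   (curve code_surface ! t \<in> left_darts code_surface (curve code_surface) s) \<noteq>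
    (arrival code_surface (curve code_surface) t \<in> left_darts code_surface (curve code_surface) s) \<and>
   (s \<in> over code_surface) \<noteq> (t \<in> over code_surface)"
  using c(1-3) s left_code[OF s(1,2)] arrival_code[OF c(3)] cmate_facts(4)[OF s(1,2)] by (auto split: if_splits)
qed

text \<open>Every dart of the constructed surface lies on the curve, so \<open>euler_filling\<close>
  applies. It makes the Euler characteristic even and at most 2, and this determines the genus;
  \<open>h\<close> accounts for the naming of crossings by pairs of times.\<close>

theorem surface_of_code:
 obtains S g h where "surface_diagram_of_genus g S" "2 - 2 * int g = code_euler G"
  "inj_on h (label ` set G)" "surface_code S = map (relabel h) G"
proof -
 interpret surface_curve code_surface by unfold_locales (rule closed_code_surface, rule curve_code_surface)
 have m: "m = pn" by simp
 have sv: "same_vertex s t \<longleftrightarrow> s < pn \<and> t < pn \<and> (s = t \<or> s = cmate t)" for s t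
  using same_vertex_code[of s t] by (cases "s < pn \<and> t < pn") (auto simp: same_vertex_def)
 have pr: "partner t = cmate t \<and> crossing_time t" if "0 < t" "t < pn" for t
  using partner_eqI[of t "cmate t"] sv[of t "cmate t"] cmate_facts[OF that(2)] that unfolding crossing_time_def by auto
 have "crossing_time t \<longleftrightarrow> 0 < t \<and> t < pn" for t
  using pr crossing_pos crossing_partner(5)[of t] m by auto
 then have "filter crossing_time [0..<m] = [1..<pn]"
 proof -
  have l: "[0..<m] = 0 # [1..<pn]" by (simp add: upt_conv_Cons pn_def del: upt_Suc)
  show ?thesis unfolding l using \<open>\<And>t. crossing_time t \<longleftrightarrow> 0 < t \<and> t < pn\<close> by (simp add: filter_id_conv)
 qed
 then have sc: "surface_code code_surface = map pt [1..<pn]" unfolding surface_code_eq by simp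
 define h where "h l = crossing_at (Suc (idx (map label G) l))" for l
 have ca: "crossing_at s = crossing_at t \<longleftrightarrow> label (G ! (s - 1)) = label (G ! (t - 1))"
  if st: "0 < s" "s < pn" "0 < t" "t < pn" for s t
 proof -
  have "crossing_at s = crossing_at t \<longleftrightarrow> t = s \<or> t = cmate s"
   using crossing_at_eq[of s t] crossing_at_partner[of s] pr st by auto
  moreover have "t = s \<or> t = cmate s" if "label (G ! (s - 1)) = label (G ! (t - 1))"
  proof -
   have "G ! (t - 1) = G ! (s - 1) \<or> G ! (t - 1) = G ! (cmate s - 1)"
    using wf_code_label[OF wf _ _ that] nth_pos st cmate_facts(4) by auto
   moreover have "G ! (a - 1) = G ! (b - 1) \<Longrightarrow> a = b" if "0 < a" "a < pn" "0 < b" "b < pn" for a b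
    using that nth_eq_iff_index_eq[OF wf_code_distinct[OF wf], of "a - 1" "b - 1"] by (simp add: pn_def) linarith
   ultimately show ?thesis using st cmate_facts(1,3)[of s] by metis
  qed
  ultimately show ?thesis using cmate_facts(4)[OF st(2,1)] by auto
 qed
 have fi: "Suc (idx (map label G) l) < pn" "label (G ! idx (map label G) l) = l" if "l \<in> label ` set G" for l
  using that idx_less[of l "map label G"] nth_idx[of l "map label G"] nth_map[of "idx (map label G) l" G label]
  by (simp_all add: pn_def)
 have inj: "inj_on h (label ` set G)"
 proof (rule inj_onI)
  fix l l' assume "l \<in> label ` set G" "l' \<in> label ` set G" "h l = h l'"
  then show "l = l'" using ca[of "Suc (idx (map label G) l)" "Suc (idx (map label G) l')"] fi by (simp add: h_def)
 qed
 have "pt t = relabel h (G ! (t - 1))" if t: "0 < t" "t < pn" for t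
 proof -
  let ?p = "G ! (t - 1)"
  have l: "label ?p \<in> label ` set G" using nth_pos[OF t] by auto
  have "label (pt t) = h (label ?p)"
   using ca[of t "Suc (idx (map label G) (label ?p))"] t fi[OF l] by (simp add: h_def pt_def)
  moreover have o: "is_over (pt t) = is_over ?p" using t by (simp add: is_over_pt)
  moreover have "eta t = ctwist t"
  proof -
   have "eta t = (if out (partner t) \<in> left_darts code_surface (curve code_surface) t then 1 else - 1)"
    unfolding eta_def left_darts_arc ..
   then show ?thesis using pr[OF t] left_code[OF t(2,1)] cmate_facts(1,5)[OF t(2)] t by auto
  qed
  then have "twist (pt t) = twist ?p" using twist_pt[of t] pr[OF t] t by (simp add: ctwist_def)
  then have "psign (pt t) = psign ?p" using o by (simp add: twist_def split: if_splits)
  ultimately show ?thesis by (simp add: point.expand)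
 qed
 then have "surface_code code_surface = map (\<lambda>t. relabel h (G ! (t - 1))) [1..<pn]" unfolding sc by (intro map_cong) auto
 also have "\<dots> = map (relabel h) G" by (rule nth_equalityI) (simp_all add: pn_def del: upt_Suc)
 finally have code: "surface_code code_surface = map (relabel h) G" .
 have cd: "darts code_surface = curve_darts"
 proof -
  have "d \<in> curve_darts" if d0: "d < 2 * pn" for d
  proof -
   obtain t b where d: "t < pn" "d = 2 * t + of_bool b" by (rule dart_cases[OF d0]) (rule that)
   then have "d = (if b then arr t else out t)" using arrival_code[OF d(1)] by simp
   then show ?thesis using d(1) by (cases b) (auto simp: curve_darts_def)
  qed
  then show ?thesis using curve_darts_sub by auto
 qed
 have eu: "euler_characteristic code_surface = code_euler G"
  using euler_filling(1)[OF cd] code_euler_relabel[OF wf inj] code by simp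
 obtain k where k: "2 - code_euler G = 2 * k"
 proof -
  have "even (2 - code_euler G)" using euler_filling(3)[OF cd] eu by simp
  then show thesis by (elim evenE) (rule that)
 qed
 moreover have "0 \<le> k" using euler_filling(2)[OF cd] eu k by linarith
 ultimately have g: "2 - 2 * int (nat k) = code_euler G" by simp
 then have "surface_diagram_of_genus (nat k) code_surface"
  using closed_code_surface curve_code_surface eu by (simp add: surface_diagram_of_genus_def)
 then show thesis using that g inj code by blast
qed

end

section \<open>Planar diagrams with a given code\<close>

lemma width_Suc: "k < length D \<Longrightarrow> width D (Suc k) = width D k - n_left (fst (D ! k)) + n_right (fst (D ! k))"
 by (simp add: width_def take_Suc_conv_app_nth case_prod_unfold)

text \<open>
 A traveller meeting a point on a vertical line also meets the points joined to it in the adjacent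
 slices, so only the points created by births have to be met explicitly.
\<close>

lemma long_diagramI:
 assumes height: "\<And>k. k < length D \<Longrightarrow> snd (D ! k) + n_left (fst (D ! k)) \<le> width D k"
  and w1: "width D (length D) = 1" and path: "path D n (0, 0, True) ps (length D, 0, True)"
  and births: "\<And>k i q. k < length D \<Longrightarrow> D ! k = (Birth, i) \<Longrightarrow> q = i \<or> q = Suc i \<Longrightarrow>
   \<exists>m qs r. path D m (0, 0, True) qs (Suc k, q, r)"
 shows "long_diagram D" "raw_list D = ps"
proof -
 note tt = path_travel_time[OF path]
 show "raw_list D = ps" by (rule tt(2))
 have live: "live D (state_at D t)" if "t < n" for t using path_state(3)[OF path that] by (simp add: state_at_def)
 have tr: "p' < (if r' then width D (Suc k) else width D k)"
  if "transit r (D ! k) p = (r', p')" "p < (if r then width D k else width D (Suc k))" "k < length D" for r k p r' p'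
  using that height[OF that(3)] width_Suc[OF that(3)]
  by (cases "D ! k"; cases "fst (D ! k)") (auto simp: Let_def n_left_def n_right_def turning_def split: if_splits)
 have pts: "(case state_at D t of (k, p, r) \<Rightarrow> k \<le> length D \<and> p < width D k)" if "t \<le> n" for t
  using that
 proof (induction t)
  case 0
  then show ?case by (simp add: state_at_def width_def)
 next
  case (Suc t)
  obtain k p r where s: "state_at D t = (k, p, r)" by (cases "state_at D t") blast
  have l: "live D (k, p, r)" using live[of t] Suc.prems s by simp
  have kp: "k \<le> length D" "p < width D k" using Suc s by auto
  let ?j = "next_event (k, p, r)"
  have j: "?j < length D" using live_next_event[OF l] .
  obtain r' p' where t: "transit r (D ! ?j) p = (r', p')" by fastforce
  have "k = (if r then ?j else Suc ?j)" using l by (auto simp: live_def)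
  then have "p' < (if r' then width D (Suc ?j) else width D ?j)" using tr[OF t _ j] kp by (auto split: if_splits)
  then show ?case using t j s by (auto simp: state_at_def)
 qed
 define V where "V = (\<lambda>(k, p, r). (k, p)) ` state_at D ` {..n}"
 have V: "(k, p) \<in> V \<longleftrightarrow> (\<exists>t\<le>n. \<exists>r. state_at D t = (k, p, r))" for k p
 proof -
  have "(case s of (k', p', r) \<Rightarrow> (k', p')) = (k, p) \<longleftrightarrow> (\<exists>r. s = (k, p, r))" for s :: state by (cases s) auto
  moreover have "(k, p) \<in> V \<longleftrightarrow> (\<exists>t\<le>n. (case state_at D t of (k', p', r) \<Rightarrow> (k', p')) = (k, p))"
   unfolding V_def image_image image_iff by (metis atMost_iff)
  ultimately show ?thesis by simp
 qed
 have "(k, p) \<in> V" if "k \<le> length D" "p < width D k" for k p using that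
 proof (induction k arbitrary: p)
  case 0
  then have "state_at D 0 = (0, p, True)" by (simp add: state_at_def width_def)
  then show ?case using V by blast
 next
  case (Suc k)
  obtain r q where q: "transit False (D ! k) p = (r, q)" by fastforce
  show ?case
  proof (cases r)
   case True
   obtain x i where e: "D ! k = (x, i)" by fastforce
   have "x = Birth \<and> (p = i \<or> p = Suc i)"
    using q e True by (cases x) (auto simp: Let_def n_left_def n_right_def turning_def split: if_splits)
   then obtain m qs r where m: "path D m (0, 0, True) qs (Suc k, p, r)" using births[of k i p] e Suc.prems by auto
   have "m \<le> n" using path_prefix[OF m path] by (auto simp: live_def)
   moreover have "state_at D m = (Suc k, p, r)" using path_state(1)[OF m] by (simp add: state_at_def)
   ultimately show ?thesis using V by blast
  next
   case False
   have "q < width D k" using tr[OF q] Suc.prems False by simp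
   then have "(k, q) \<in> V" using Suc.IH[of q] Suc.prems by simp
   then obtain t r where t: "t \<le> n" "state_at D t = (k, q, r)" using V by blast
   have st: "step D (k, q, True) = (Suc k, p, True)" using transit_reverse[OF q] False by simp
   show ?thesis
   proof (cases r)
    case True
    then have "t \<noteq> n" using t tt(3) Suc.prems by auto
    then have "state_at D (Suc t) = (Suc k, p, True)" "Suc t \<le> n" using t st True by (simp_all add: state_at_def)
    then show ?thesis using V by blast
   next
    case r: False
    obtain t' where t': "t = Suc t'" using t r by (cases t) (auto simp: state_at_def)
    obtain a b c where s: "state_at D t' = (a, b, c)" by (cases "state_at D t'") blast
    have "c \<or> 0 < a" using live[of t'] t t' s by (auto simp: live_def split: if_splits)
    from step_reverse[OF this, of D b] have "step D (reverse (k, q, False)) = reverse (a, b, c)"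
     using t t' r s by (simp add: state_at_def)
    then have "state_at D t' = (Suc k, p, False)" using st s by (auto simp del: step.simps)
    then show ?thesis using V t(1) t' by (metis Suc_leD)
   qed
  qed
 qed
 moreover have "k \<le> length D \<and> p < width D k" if "(k, p) \<in> V" for k p
  using that pts unfolding V by fastforce
 ultimately have "V = points D" by (auto simp: points_def)
 then show "long_diagram D" using height w1 tt by (auto simp: long_diagram_def V_def case_prod_unfold)
qed

lemma run_right:
 assumes "\<And>i. a \<le> i \<Longrightarrow> i < b \<Longrightarrow> i < length D \<and> raw D (i, f i, True) = [] \<and> step D (i, f i, True) = (Suc i, f (Suc i), True)"
  and "a \<le> b"
 shows "\<exists>n. path D n (a, f a, True) [] (b, f b, True)" using assms(2,1)
proof (induction b rule: dec_induct)
 case (step b)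
 then obtain n where "path D n (a, f a, True) [] (b, f b, True)" by auto
 from path_trans[OF this path_single] show ?case using step.prems[of b] step.hyps by (auto simp: live_def)
qed (auto intro: path_refl)

lemma run_left:
 assumes "\<And>i. a \<le> i \<Longrightarrow> i < b \<Longrightarrow> i < length D \<and> raw D (Suc i, f, False) = [] \<and> step D (Suc i, f, False) = (i, f, False)"
  and "a \<le> b"
 shows "\<exists>n. path D n (b, f, False) [] (a, f, False)" using assms(2,1)
proof (induction a rule: inc_induct)
 case (step a)
 then obtain n where "path D n (b, f, False) [] (Suc a, f, False)" by auto
 from path_trans[OF this path_single] show ?case using step.prems[of a] step.hyps by (auto simp: live_def)
qed (auto intro: path_refl)

section \<open>Braids, clasps and the zigzag diagram of a code\<close>

definition exchange :: "nat \<Rightarrow> nat \<Rightarrow> nat" where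
 "exchange i p = (if p = i then Suc i else if p = Suc i then i else p)"

fun exit_height :: "diagram \<Rightarrow> nat \<Rightarrow> nat" where
 "exit_height [] p = p"
| "exit_height ((x, i) # B) p = exit_height B (exchange i p)"

text \<open>The real crossings met by a strand running through \<open>B\<close> to the right.\<close>

fun hits :: "nat \<Rightarrow> diagram \<Rightarrow> nat \<Rightarrow> raw_point list" where
 "hits j [] p = []"
| "hits j ((x, i) # B) p = (case x of Real b \<Rightarrow> if p = i \<or> p = Suc i then [Raw j ((p = i) = b) True b] else [] | _ \<Rightarrow> [])
   @ hits (Suc j) B (exchange i p)"

lemma exit_height_append: "exit_height (A @ B) p = exit_height B (exit_height A p)"
 and hits_append: "hits j (A @ B) p = hits j A p @ hits (j + length A) B (exit_height A p)"
 by (induction A arbitrary: j p) auto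

lemma transit_exchange: "\<not> turning x \<Longrightarrow> transit r (x, i) p = (r, exchange i p)"
 by (cases x) (auto simp: Let_def n_left_def n_right_def turning_def exchange_def)

lemma exchange_exchange [simp]: "exchange i (exchange i p) = p" by (simp add: exchange_def)

text \<open>Without vertical tangents every strand runs straight through the block. Running back to
  the left is treated for strands without real crossings, which will be the returning strands of the
  zigzag.\<close>

lemma braid_paths:
 assumes "D = u @ B @ v" "\<And>x i. (x, i) \<in> set B \<Longrightarrow> \<not> turning x"
 shows "\<exists>n. path D n (length u, p, True) (hits (length u) B p) (length u + length B, exit_height B p, True)"
  "hits (length u) B p = [] \<Longrightarrow> \<exists>n. path D n (length u + length B, exit_height B p, False) [] (length u, p, False)"
proof -
 have "(\<exists>n. path D n (length u, p, True) (hits (length u) B p) (length u + length B, exit_height B p, True)) \<and>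
  (hits (length u) B p = [] \<longrightarrow> (\<exists>n. path D n (length u + length B, exit_height B p, False) [] (length u, p, False)))"
  using assms
 proof (induction B arbitrary: u p)
  case (Cons e B)
  obtain x i where e: "e = (x, i)" by fastforce
  have t: "transit r e p = (r, exchange i p)" for r p using transit_exchange Cons.prems(2)[of x i] by (simp add: e)
  have D: "D ! length u = e" "length u < length D" "D = (u @ [e]) @ B @ v" using Cons.prems(1) by simp_all
  note IH = Cons.IH[OF D(3), of "exchange i p", simplified]
  have "path D 1 (length u, p, True) (raw D (length u, p, True)) (Suc (length u), exchange i p, True)"
   using path_single[of D "(length u, p, True)"] D t by (simp add: live_def)
  moreover have "raw D (length u, p, True) @ hits (Suc (length u)) B (exchange i p) = hits (length u) (e # B) p"
   using D e by (auto simp: raw_def split: event.splits)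
  moreover obtain n where "path D n (Suc (length u), exchange i p, True) (hits (Suc (length u)) B (exchange i p))
   (Suc (length u + length B), exit_height B (exchange i p), True)" using IH Cons.prems(2) by auto
  ultimately have 1: "\<exists>n. path D n (length u, p, True) (hits (length u) (e # B) p) (length u + length (e # B), exit_height (e # B) p, True)"
   using path_trans[of D 1 "(length u, p, True)"] e by fastforce
  have "\<exists>n. path D n (length u + length (e # B), exit_height (e # B) p, False) [] (length u, p, False)"
   if h: "hits (length u) (e # B) p = []"
  proof -
   obtain n where n: "path D n (Suc (length u + length B), exit_height B (exchange i p), False) [] (Suc (length u), exchange i p, False)"
    using IH Cons.prems(2) h e by auto
   have "raw D (Suc (length u), exchange i p, False) = []"
    using D h e by (auto simp: raw_def exchange_def split: event.splits if_splits)
   then have "path D 1 (Suc (length u), exchange i p, False) [] (length u, p, False)"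
    using path_single[of D "(Suc (length u), exchange i p, False)"] D t[of False "exchange i p"] by (simp add: live_def)
   from path_trans[OF n this] show ?thesis using e by auto
  qed
  then show ?case using 1 by blast
 qed (auto intro: path_refl)
 then show "\<exists>n. path D n (length u, p, True) (hits (length u) B p) (length u + length B, exit_height B p, True)"
  "hits (length u) B p = [] \<Longrightarrow> \<exists>n. path D n (length u + length B, exit_height B p, False) [] (length u, p, False)"
  by blast+
qed

text \<open>
 The strands at heights \<open>P\<close> and \<open>P + k + 1\<close> meet in a real crossing, where the lower one rises iff \<open>up\<close>.
\<close>

fun clasp :: "bool \<Rightarrow> bool \<Rightarrow> nat \<Rightarrow> nat \<Rightarrow> diagram" where
 "clasp up b P 0 = (if up then [(Real b, P), (Virtual, P)] else [(Virtual, P), (Real b, P)])"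
| "clasp up b P (Suc k) = [(Virtual, P + Suc k)] @ clasp up b P k @ [(Virtual, P + Suc k)]"

lemma clasp_exit: "exit_height (clasp up b P k) p = p" by (induction k arbitrary: p) (auto simp: exit_height_append)

lemma clasp_mem: "(x, i) \<in> set (clasp up b P k) \<Longrightarrow> \<not> turning x \<and> i \<le> P + k"
 by (induction k) (auto simp: turning_def split: if_splits)

text \<open>The upper strand is brought down by \<open>k\<close> virtual crossings, so the real
  crossing is in slot \<open>k\<close>, or one later if a virtual crossing with the lower strand
  precedes it.\<close>

lemma clasp_hits: "hits j (clasp up b P k) p =
 (let l = j + k + of_bool (\<not> up) in if p = P then [Raw l (up = b) True b] else if p = P + k + 1 then [Raw l (up \<noteq> b) True b] else [])"
proof (induction k arbitrary: j p)
 case (Suc k)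
 have "hits j (clasp up b P (Suc k)) p = hits (Suc j) (clasp up b P k) (exchange (P + Suc k) p)"
  by (simp add: hits_append)
 then show ?case unfolding Suc.IH by (auto simp: exchange_def Let_def)
qed (auto simp: exchange_def)

lemma clasp_label: "of_bool (\<not> up) + k < length (clasp up b P k)" by (induction k) auto

context
 fixes G :: "'l point list"
 assumes wf: "wf_code G"
begin

definition gmate :: "nat \<Rightarrow> nat" where
 "gmate s = idx G (mate (G ! s))"

lemma gmate_facts:
 assumes "s < length G"
 shows "gmate s < length G" "G ! gmate s = mate (G ! s)" "gmate (gmate s) = s" "gmate s \<noteq> s"
proof -
 have m: "mate (G ! s) \<in> set G" using wf_code_mate[OF wf] assms by simp
 show 1: "gmate s < length G" "G ! gmate s = mate (G ! s)" using m by (simp_all add: gmate_def)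
 then show "gmate (gmate s) = s" using idx_nth[OF wf_code_distinct[OF wf] assms] by (simp add: gmate_def)
 show "gmate s \<noteq> s" using 1(2) by auto
qed

text \<open>The strands with real crossings all head right, so the sign is -1 iff the rising branch
  is over; this gives the flag \<open>b\<close>. The lower strand carries the first passage
  \<open>G ! s\<close> and has to rise iff this is over exactly when rising branches are. With the
  given last argument the upper strand has height \<open>2 * gmate s\<close>.\<close>

definition gclasp :: "nat \<Rightarrow> diagram" where
 "gclasp s = (let b = (psign (G ! s) = - 1) in clasp (b = is_over (G ! s)) b (2 * s) (2 * gmate s - 2 * s - 1))"

definition gpoint :: "(nat \<Rightarrow> nat) \<Rightarrow> nat \<Rightarrow> nat \<Rightarrow> raw_point" where
 "gpoint lab s a = Raw (lab s) (is_over (G ! a)) True (psign (G ! s) = - 1)"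

text \<open>Each clasp returns all strands to their heights, so successive clasps do not disturb one
  another; \<open>lab\<close> gives the position of the real crossing in each.\<close>

lemma middle:
 assumes "distinct xs" "\<And>s. s \<in> set xs \<Longrightarrow> s < gmate s \<and> s < length G"
 shows "\<exists>lab. inj_on lab (set xs) \<and> (\<forall>s \<in> set xs. j \<le> lab s) \<and> (\<forall>p. hits j (concat (map gclasp xs)) p =
  concat (map (\<lambda>s. if p = 2 * s then [gpoint lab s s] else if p = 2 * gmate s then [gpoint lab s (gmate s)] else []) xs))"
 using assms
proof (induction xs arbitrary: j)
 case (Cons s xs)
 obtain lab where lab: "inj_on lab (set xs)" "\<forall>s \<in> set xs. j + length (gclasp s) \<le> lab s \<or> True"
  "\<And>x. x \<in> set xs \<Longrightarrow> j + length (gclasp s) \<le> lab x"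
  "\<And>p. hits (j + length (gclasp s)) (concat (map gclasp xs)) p =
   concat (map (\<lambda>s. if p = 2 * s then [gpoint lab s s] else if p = 2 * gmate s then [gpoint lab s (gmate s)] else []) xs)"
  using Cons.IH[of "j + length (gclasp s)"] Cons.prems by auto
 define b where "b = (psign (G ! s) = - 1)"
 define up where "up = (b = is_over (G ! s))"
 define k where "k = 2 * gmate s - 2 * s - 1"
 define l where "l = j + k + of_bool (\<not> up)"
 define lab' where "lab' = lab(s := l)"
 have s: "s < gmate s" "s < length G" using Cons.prems(2) by auto
 have Q: "2 * s + k + 1 = 2 * gmate s" using s by (simp add: k_def)
 have c: "gclasp s = clasp up b (2 * s) k" by (simp add: gclasp_def Let_def b_def up_def k_def)
 have l: "j \<le> l" "l < j + length (gclasp s)" using clasp_label[of up k b "2 * s"] unfolding c l_def by simp_all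
 have new: "hits j (gclasp s) p = (if p = 2 * s then [gpoint lab' s s] else if p = 2 * gmate s then [gpoint lab' s (gmate s)] else [])" for p
  unfolding c clasp_hits Q Let_def l_def[symmetric] using gmate_facts(2)[OF s(2)]
  by (auto simp: gpoint_def lab'_def up_def b_def)
 have old: "gpoint lab' x a = gpoint lab x a" if "x \<in> set xs" for x a
  using that Cons.prems(1) by (auto simp: gpoint_def lab'_def)
 have "inj_on lab' (set (s # xs))" using lab(1,3) l(2) Cons.prems(1) by (force simp: lab'_def inj_on_def)
 moreover have "\<forall>x \<in> set (s # xs). j \<le> lab' x" using lab(3) l by (fastforce simp: lab'_def)
 moreover have "hits j (concat (map gclasp (s # xs))) p =
  concat (map (\<lambda>s. if p = 2 * s then [gpoint lab' s s] else if p = 2 * gmate s then [gpoint lab' s (gmate s)] else []) (s # xs))" for p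
 proof -
  have "exit_height (gclasp s) p = p" unfolding c by (rule clasp_exit)
  then have "hits j (concat (map gclasp (s # xs))) p = hits j (gclasp s) p @ hits (j + length (gclasp s)) (concat (map gclasp xs)) p"
   by (simp add: hits_append)
  also have "hits (j + length (gclasp s)) (concat (map gclasp xs)) p =
   concat (map (\<lambda>s. if p = 2 * s then [gpoint lab' s s] else if p = 2 * gmate s then [gpoint lab' s (gmate s)] else []) xs)"
   unfolding lab(4) by (intro arg_cong[of _ _ concat] map_cong) (auto simp: old)
  finally show ?thesis unfolding new by simp
 qed
 ultimately show ?case by blast
qed simp

definition gfirsts :: "nat list" where "gfirsts = filter (\<lambda>s. s < gmate s) [0..<length G]"

definition gfirst :: "nat \<Rightarrow> nat" where "gfirst a = min a (gmate a)"

lemma middle_hits: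
 obtains lab where "inj_on lab (set gfirsts)"
  "\<And>a. a < length G \<Longrightarrow> hits j (concat (map gclasp gfirsts)) (2 * a) = [gpoint lab (gfirst a) a]"
  "\<And>p. odd p \<Longrightarrow> hits j (concat (map gclasp gfirsts)) p = []"
proof -
 have d: "distinct gfirsts" and m: "\<And>s. s \<in> set gfirsts \<Longrightarrow> s < gmate s \<and> s < length G" by (auto simp: gfirsts_def)
 obtain lab where lab: "inj_on lab (set gfirsts)" "\<And>p. hits j (concat (map gclasp gfirsts)) p =
  concat (map (\<lambda>s. if p = 2 * s then [gpoint lab s s] else if p = 2 * gmate s then [gpoint lab s (gmate s)] else []) gfirsts)"
  using middle[OF d m, of j] by blast
 have "hits j (concat (map gclasp gfirsts)) (2 * a) = [gpoint lab (gfirst a) a]" if a: "a < length G" for a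
 proof -
  let ?f = "\<lambda>s. if 2 * a = 2 * s then [gpoint lab s s] else if 2 * a = 2 * gmate s then [gpoint lab s (gmate s)] else []"
  note g = gmate_facts[OF a]
  have "gfirst a \<in> set gfirsts" using g a by (auto simp: gfirsts_def gfirst_def min_def)
  then obtain A B where AB: "gfirsts = A @ gfirst a # B" by (auto dest: split_list)
  have "?f s = []" if "s \<in> set A \<union> set B" for s
  proof -
   have "s \<noteq> gfirst a" "s \<in> set gfirsts" using that d AB by auto
   then have "a \<noteq> s" "a \<noteq> gmate s" using m[of s] gmate_facts(3)[of s] by (auto simp: gfirst_def)
   then show ?thesis by simp
  qed
  then have "concat (map ?f A) = []" "concat (map ?f B) = []" by auto
  moreover have "?f (gfirst a) = [gpoint lab (gfirst a) a]" using g by (auto simp: gfirst_def min_def)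
  moreover have "hits j (concat (map gclasp gfirsts)) (2 * a) = concat (map ?f gfirsts)" by (rule lab(2))
  moreover have "concat (map ?f gfirsts) = concat (map ?f A) @ ?f (gfirst a) @ concat (map ?f B)" unfolding AB by simp
  ultimately show ?thesis by (simp only: append_Nil append_Nil2)
 qed
 moreover have "hits j (concat (map gclasp gfirsts)) p = []" if "odd p" for p unfolding lab(2) using that by auto
 ultimately show thesis using that lab(1) by blast
qed

lemma middle_events:
 "exit_height (concat (map gclasp xs)) p = p"
 "(x, i) \<in> set (concat (map gclasp gfirsts)) \<Longrightarrow> \<not> turning x \<and> i + 2 \<le> 2 * length G - 1"
proof -
 show "exit_height (concat (map gclasp xs)) p = p"
  by (induction xs arbitrary: p) (simp_all add: exit_height_append gclasp_def Let_def clasp_exit)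
 assume "(x, i) \<in> set (concat (map gclasp gfirsts))"
 then obtain s where s: "s < gmate s" "s < length G" "(x, i) \<in> set (gclasp s)" by (auto simp: gfirsts_def)
 have "\<not> turning x \<and> i \<le> 2 * s + (2 * gmate s - 2 * s - 1)"
  using clasp_mem s(3) unfolding gclasp_def Let_def by blast
 then show "\<not> turning x \<and> i + 2 \<le> 2 * length G - 1" using s gmate_facts(1)[OF s(2)] by linarith
qed

text \<open>
 A zigzag with the passage \<open>G ! a\<close> on its strand of height \<open>2 * a\<close>, which runs to the right.
\<close>

definition zigzag :: diagram where
 "zigzag = map (\<lambda>i. (Birth, 2 * i + 1)) [0..<length G - 1] @ concat (map gclasp gfirsts)
   @ map (\<lambda>i. (Death, 2 * (length G - 2 - i))) [0..<length G - 1]"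

text \<open>Strands of even height run right and strands of odd height run back left. The latter
  meet virtual crossings only, and the strand of height \<open>2 * a\<close> meets precisely one
  real crossing, so the traversal spells out the code.\<close>

lemma zigzag_long:
 assumes ne: "G \<noteq> []"
 obtains lab where "inj_on lab (set gfirsts)" "long_diagram zigzag"
  "raw_list zigzag = map (\<lambda>a. gpoint lab (gfirst a) a) [0..<length G]"
proof -
 \<comment> \<open>The number of times the traveller is sent back: one less than the number of
   strands running right.\<close>
 define J where "J = length G - 1"
 define M where "M = concat (map gclasp gfirsts)"
 define K where "K = length M"
 define D where "D = zigzag"
 have G: "length G = Suc J" using ne by (simp add: J_def)
 have D: "D = map (\<lambda>i. (Birth, 2 * i + 1)) [0..<J] @ M @ map (\<lambda>i. (Death, 2 * (J - 1 - i))) [0..<J]"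
  by (simp add: D_def zigzag_def M_def G)
 have len: "length D = J + K + J" by (simp add: D K_def)
 have B: "D ! i = (Birth, 2 * i + 1)" if "i < J" for i using that by (simp add: D nth_append)
 have Mi: "D ! (J + i) = M ! i" if "i < K" for i using that by (simp add: D nth_append K_def)
 have Di: "D ! (J + K + i) = (Death, 2 * (J - 1 - i))" if "i < J" for i using that by (simp add: D nth_append K_def)
 have Mm: "\<not> turning x \<and> i + 2 \<le> 2 * J + 1" if "(x, i) \<in> set M" for x i
  using middle_events(2)[of x i] that G unfolding M_def by simp
 obtain lab where lab: "inj_on lab (set gfirsts)"
  "\<And>a. a < length G \<Longrightarrow> hits J M (2 * a) = [gpoint lab (gfirst a) a]" "\<And>p. odd p \<Longrightarrow> hits J M p = []"
  by (rule middle_hits[of J, folded M_def]) (rule that; assumption)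
 have ex: "exit_height M p = p" for p unfolding M_def by (rule middle_events(1))
 have nt: "(x, i) \<in> set M \<Longrightarrow> \<not> turning x" for x i using Mm by blast
 have reg: thesis if "k < J + K + J" "k < J \<Longrightarrow> thesis" "\<And>i. k = J + i \<Longrightarrow> i < K \<Longrightarrow> thesis"
  "\<And>i. k = J + K + i \<Longrightarrow> i < J \<Longrightarrow> thesis" for k thesis
  using that(1) that(2) that(3)[of "k - J"] that(4)[of "k - J - K"] by linarith
 have width: "width D k = (if k \<le> J then 2 * k + 1 else if k \<le> J + K then 2 * J + 1 else 2 * (J + K + J - k) + 1)"
  if "k \<le> J + K + J" for k using that
 proof (induction k)
  case (Suc k)
  consider "k < J" | i where "k = J + i" "i < K" | i where "k = J + K + i" "i < J"
   by (rule reg[of k]) (use Suc.prems in auto)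
  then show ?case
  proof cases
   case 1
   then show ?thesis using Suc B[of k] width_Suc[of k D] len by (simp add: n_left_def n_right_def)
  next
   case 2
   have "\<not> turning (fst (M ! i)) \<and> snd (M ! i) + 2 \<le> 2 * J + 1" using Mm[of "fst (M ! i)" "snd (M ! i)"] 2 by (simp add: K_def)
   then show ?thesis using Suc Mi[OF 2(2)] width_Suc[of k D] len 2 by (auto simp: n_left_def n_right_def turning_def)
  next
   case 3
   then show ?thesis using Suc Di[OF 3(2)] width_Suc[of k D] len by (auto simp: n_left_def n_right_def)
  qed
 qed (simp add: width_def)
 have height: "snd (D ! k) + n_left (fst (D ! k)) \<le> width D k" if kk: "k < length D" for k
 proof -
  consider "k < J" | i where "k = J + i" "i < K" | i where "k = J + K + i" "i < J"
   by (rule reg[of k]) (use kk len in auto)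
  then show ?thesis
  proof cases
   case 1
   then show ?thesis using B[of k] width[of k] by (simp add: n_left_def)
  next
   case 2
   have "snd (M ! i) + 2 \<le> 2 * J + 1" using Mm[of "fst (M ! i)" "snd (M ! i)"] 2 by (simp add: K_def)
   then show ?thesis using Mi[OF 2(2)] width[of k] 2 by (auto simp: n_left_def)
  next
   case 3
   then show ?thesis using Di[OF 3(2)] width[of k] by (auto simp: n_left_def)
  qed
 qed
 have birth_raw: "raw D (k, p, r) = []" if "next_event (k, p, r) < J" for k p r using B[OF that] by (simp add: raw_def)
 have death_raw: "raw D (k, p, r) = []" if "next_event (k, p, r) = J + K + i" "i < J" for k p r i
  using Di[OF that(2)] that(1) by (simp add: raw_def)
 have r1: "\<exists>n. path D n (k, 2 * k, True) [] (J, 2 * k, True)" if "k \<le> J" for k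
  by (rule run_right[of k J D "\<lambda>_. 2 * k"]) (use that B birth_raw len in \<open>auto simp: Let_def n_left_def n_right_def\<close>)
 have l1: "\<exists>n. path D n (J, 2 * k + 1, False) [] (Suc k, 2 * k + 1, False)" if "k < J" for k
  by (rule run_left) (use that B birth_raw len in \<open>auto simp: Let_def n_left_def n_right_def\<close>)
 have t1: "path D 1 (Suc k, 2 * k + 1, False) [] (Suc k, 2 * k + 2, True)" if "k < J" for k
  using path_single[of D "(Suc k, 2 * k + 1, False)"] B[OF that] birth_raw[of "Suc k" "2 * k + 1" False] that len
  by (simp add: live_def Let_def n_left_def n_right_def turning_def)
 have m1: "\<exists>n. path D n (J, p, True) (hits J M p) (J + K, p, True)" "odd p \<Longrightarrow> \<exists>n. path D n (J + K, p, False) [] (J, p, False)" for p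
  using braid_paths[OF D nt, where p = p] ex lab(3)[of p] by (simp_all add: K_def)
 have above: "\<exists>i'. i = J + K + i' \<and> i' < J \<and> 2 * k + 1 < 2 * (J - 1 - i')" if "J + K \<le> i" "i < J + K + (J - 1 - k)" for i k
  using that by (intro exI[of _ "i - (J + K)"]) linarith
 have r2: "\<exists>n. path D n (J + K, 2 * k, True) [] (J + K + (J - 1 - k), 2 * k, True)" if "k < J" for k
 proof (rule run_right[of "J + K" "J + K + (J - 1 - k)" D "\<lambda>_. 2 * k"])
  fix i assume i: "J + K \<le> i" "i < J + K + (J - 1 - k)"
  from above[OF i] obtain i' where "i = J + K + i'" "i' < J" "2 * k + 1 < 2 * (J - 1 - i')" by blast
  then show "i < length D \<and> raw D (i, 2 * k, True) = [] \<and> step D (i, 2 * k, True) = (Suc i, 2 * k, True)"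
   using Di[of i'] death_raw[of i "2 * k" True i'] len by (simp add: Let_def)
 qed simp
 have l2: "\<exists>n. path D n (J + K + (J - 1 - k), 2 * k + 1, False) [] (J + K, 2 * k + 1, False)" if "k < J" for k
 proof (rule run_left)
  fix i assume i: "J + K \<le> i" "i < J + K + (J - 1 - k)"
  from above[OF i] obtain i' where "i = J + K + i'" "i' < J" "2 * k + 1 < 2 * (J - 1 - i')" by blast
  then show "i < length D \<and> raw D (Suc i, 2 * k + 1, False) = [] \<and> step D (Suc i, 2 * k + 1, False) = (i, 2 * k + 1, False)"
   using Di[of i'] death_raw[of "Suc i" "2 * k + 1" False i'] len by (simp add: Let_def)
 qed simp
 have t2: "path D 1 (J + K + (J - 1 - k), 2 * k, True) [] (J + K + (J - 1 - k), 2 * k + 1, False)" if "k < J" for k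
 proof -
  have i: "J - 1 - k < J" "J - 1 - (J - 1 - k) = k" using that by auto
  show ?thesis using path_single[of D "(J + K + (J - 1 - k), 2 * k, True)"] Di[OF i(1)] i(2) that len
    death_raw[of "J + K + (J - 1 - k)" "2 * k" True, OF _ i(1)]
   by (simp add: live_def Let_def n_left_def n_right_def turning_def)
 qed
 have fin: "\<exists>n. path D n (J + K, 2 * J, True) [] (J + K + J, 0, True)"
 proof -
  have "\<exists>n. path D n (J + K, 2 * (J + K + J - (J + K)), True) [] (J + K + J, 2 * (J + K + J - (J + K + J)), True)"
  proof (rule run_right[of "J + K" "J + K + J" D "\<lambda>i. 2 * (J + K + J - i)"])
   fix i assume i: "J + K \<le> i" "i < J + K + J"
   obtain i' where i': "i = J + K + i'" "i' < J" using i by (metis add_less_cancel_left le_Suc_ex)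
   have "2 * (J + K + J - i) = 2 * (J - 1 - i') + 2" "2 * (J + K + J - Suc i) = 2 * (J - 1 - i')" using i' by auto
   then show "i < length D \<and> raw D (i, 2 * (J + K + J - i), True) = [] \<and>
    step D (i, 2 * (J + K + J - i), True) = (Suc i, 2 * (J + K + J - Suc i), True)"
    using Di[OF i'(2)] death_raw[of i _ True i'] i' len by (simp add: Let_def n_left_def n_right_def)
  qed simp
  then show ?thesis by simp
 qed
 define R where "R a = gpoint lab (gfirst a) a" for a
 have leg: "\<exists>n. path D n (J, 2 * k, True) [R k] (Suc k, 2 * k + 1, False)" if k: "k < J" for k
 proof -
  obtain n1 where 1: "path D n1 (J, 2 * k, True) [R k] (J + K, 2 * k, True)"
   using m1(1)[of "2 * k"] lab(2)[of k] k G by (auto simp: R_def)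
  obtain n2 where 2: "path D n2 (J + K, 2 * k, True) [] (J + K + (J - 1 - k), 2 * k, True)" using r2[OF k] by blast
  obtain n3 where 3: "path D n3 (J + K + (J - 1 - k), 2 * k + 1, False) [] (J + K, 2 * k + 1, False)" using l2[OF k] by blast
  obtain n4 where 4: "path D n4 (J + K, 2 * k + 1, False) [] (J, 2 * k + 1, False)" using m1(2)[of "2 * k + 1"] by auto
  obtain n5 where 5: "path D n5 (J, 2 * k + 1, False) [] (Suc k, 2 * k + 1, False)" using l1[OF k] by blast
  show ?thesis
   using path_trans[OF path_trans[OF path_trans[OF path_trans[OF path_trans[OF 1 2] t2[OF k]] 3] 4] 5] by auto
 qed
 have start: "\<exists>n. path D n (0, 0, True) (map R [0..<k]) (J, 2 * k, True)" if "k \<le> J" for k using that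
 proof (induction k)
  case 0
  then show ?case using r1[of 0] by simp
 next
  case (Suc k)
  obtain n1 where 1: "path D n1 (0, 0, True) (map R [0..<k]) (J, 2 * k, True)" using Suc by auto
  obtain n2 where 2: "path D n2 (J, 2 * k, True) [R k] (Suc k, 2 * k + 1, False)" using leg[of k] Suc.prems by auto
  obtain n3 where 3: "path D n3 (Suc k, 2 * k + 2, True) [] (J, 2 * k + 2, True)" using r1[of "Suc k"] Suc.prems by auto
  show ?case using path_trans[OF path_trans[OF path_trans[OF 1 2] t1] 3] Suc.prems by auto
 qed
 obtain n1 where 1: "path D n1 (0, 0, True) (map R [0..<J]) (J, 2 * J, True)" using start[of J] by blast
 obtain n2 where 2: "path D n2 (J, 2 * J, True) [R J] (J + K, 2 * J, True)"
  using m1(1)[of "2 * J"] lab(2)[of J] G by (auto simp: R_def)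
 obtain n3 where 3: "path D n3 (J + K, 2 * J, True) [] (length D, 0, True)" using fin len by auto
 have path: "path D (n1 + n2 + n3) (0, 0, True) (map R [0..<length G]) (length D, 0, True)"
  using path_trans[OF path_trans[OF 1 2] 3] by (simp add: G)
 have "width D (length D) = 1" using width[of "length D"] len by (auto simp: split: if_splits)
 \<comment> \<open>The two points born in slice \<open>k\<close> are the end of the leg
   \<open>k\<close>, met heading left, and the point reached from it by the turn \<open>t1\<close>,
   met heading right.\<close>
 moreover have "\<exists>m qs r. path D m (0, 0, True) qs (Suc k, q, r)"
  if k: "k < length D" "D ! k = (Birth, i)" "q = i \<or> q = Suc i" for k i q
 proof -
  have "k < J"
  proof (rule ccontr)
   assume "\<not> k < J"
   consider i where "k = J + i" "i < K" | i where "k = J + K + i" "i < J"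
    by (rule reg[of k]) (use k(1) len \<open>\<not> k < J\<close> in auto)
   then show False using k(2) Mi Di Mm[of Birth i] by cases (auto simp: turning_def K_def in_set_conv_nth)
  qed
  then have i: "i = 2 * k + 1" using B k(2) by simp
  obtain n1 where 1: "path D n1 (0, 0, True) (map R [0..<k]) (J, 2 * k, True)" using start[of k] \<open>k < J\<close> by auto
  obtain n2 where 2: "path D n2 (J, 2 * k, True) [R k] (Suc k, 2 * k + 1, False)" using leg[of k] \<open>k < J\<close> by auto
  show ?thesis using path_trans[OF 1 2] path_trans[OF path_trans[OF 1 2] t1[OF \<open>k < J\<close>]] i k(3) by auto
 qed
 ultimately have "long_diagram D" "raw_list D = map R [0..<length G]" using long_diagramI[OF height _ path] by blast+
 then show thesis using that[OF lab(1)] by (simp add: D_def R_def)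
qed

text \<open>As all real passages of the zigzag head right, their flags alone reproduce the signs.
  The empty code is treated separately, by the diagram without events.\<close>

theorem diagram_of_code:
 obtains D h where "long_diagram D" "inj_on h (label ` set G)" "diagram_code D = map (relabel h) G"
proof (cases "G = []")
 case True
 have "path [] 0 (0, 0, True) [] (0, 0, True)" by (rule path_refl)
 then have "long_diagram []" "raw_list [] = []" using long_diagramI[of "[]" 0 "[]"] by (auto simp: width_def)
 then show thesis using that[of "[]" "\<lambda>_. 0"] True by (simp add: diagram_code_raw code_of_raw_def)
next
 case False
 obtain lab where lab: "inj_on lab (set gfirsts)" "long_diagram zigzag"
  "raw_list zigzag = map (\<lambda>a. gpoint lab (gfirst a) a) [0..<length G]"
  by (rule zigzag_long[OF False]) (rule that)
 define h where "h l = lab (gfirst (idx (map label G) l))" for l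
 have gf: "gfirst a \<in> set gfirsts" "label (G ! gfirst a) = label (G ! a)" "psign (G ! gfirst a) = psign (G ! a)" "gfirst (gmate a) = gfirst a"
  if "a < length G" for a using gmate_facts[OF that] that by (auto simp: gfirsts_def gfirst_def min_def)
 have same: "gfirst a = gfirst b" if "a < length G" "b < length G" "label (G ! a) = label (G ! b)" for a b
 proof -
  have "G ! b = G ! a \<or> G ! b = G ! gmate a" using wf_code_label[OF wf _ _ that(3)] gmate_facts(2) that by auto
  then have "b = a \<or> b = gmate a" using nth_eq_iff_index_eq[OF wf_code_distinct[OF wf]] gmate_facts(1) that by metis
  then show ?thesis using gf(4)[OF that(1)] by auto
 qed
 have ix: "idx (map label G) l < length G" "label (G ! idx (map label G) l) = l" if "l \<in> label ` set G" for l
  using that idx_less[of l "map label G"] nth_idx[of l "map label G"] nth_map[of "idx (map label G) l" G label] by simp_all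
 have ha: "h (label (G ! a)) = lab (gfirst a)" if "a < length G" for a
  using same[of a "idx (map label G) (label (G ! a))"] ix[of "label (G ! a)"] that by (simp add: h_def)
 have "inj_on h (label ` set G)"
 proof (rule inj_onI)
  fix l l' assume l: "l \<in> label ` set G" "l' \<in> label ` set G" "h l = h l'"
  then have "gfirst (idx (map label G) l) = gfirst (idx (map label G) l')"
   using inj_onD[OF lab(1)] gf(1) ix(1) by (simp add: h_def)
  moreover have "label (G ! gfirst (idx (map label G) l)) = l" "label (G ! gfirst (idx (map label G) l')) = l'"
   using gf(2) ix l(1,2) by simp_all
  ultimately show "l = l'" by metis
 qed
 moreover have "diagram_code zigzag = map (relabel h) G"
 proof -
  let ?R = "raw_list zigzag"
  have "raw_to_point ?R (gpoint lab (gfirst a) a) = relabel h (G ! a)" if a: "a < length G" for a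
  proof -
   note g = gmate_facts[OF a]
   have "gpoint lab (gfirst (gmate a)) (gmate a) \<in> set ?R" using g(1) lab(3) by auto
   then have "Raw (lab (gfirst a)) (\<not> is_over (G ! a)) True (psign (G ! a) = - 1) \<in> set ?R"
    using g gf(3,4)[OF a] by (simp add: gpoint_def)
   moreover have "psign (G ! a) = 1 \<or> psign (G ! a) = - 1" using wf_code_psign[OF wf] a by simp
   ultimately show ?thesis using ha[OF a] gf(3)[OF a] by (auto simp: raw_to_point_def gpoint_def relabel_def)
  qed
  then have "diagram_code zigzag = map (\<lambda>a. relabel h (G ! a)) [0..<length G]"
   unfolding diagram_code_raw[OF lab(2)] code_of_raw_def by (subst (2) lab(3)) simp
  also have "\<dots> = map (relabel h) G" by (rule nth_equalityI) simp_all
  finally show ?thesis .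
 qed
 ultimately show thesis using that lab(2) by blast
qed

end

section \<open>Interchanging the two families of polynomials\<close>

lemma realizes_iff:
 "realizes S D \<longleftrightarrow> (\<exists>h. inj_on h (label ` set (diagram_code D)) \<and> surface_code S = map (relabel h) (diagram_code D))"
proof -
 have l: "label ` set (diagram_code D) = fst ` set (diagram_passages D)" by (force simp: diagram_code_def)
 let ?p = "\<lambda>(c, o_c, \<epsilon>). Point c o_c \<epsilon>"
 have "surface_code S = map (relabel h) (diagram_code D) \<longleftrightarrow>
  surface_passages S = map (\<lambda>(c, o_c, \<epsilon>). (h c, o_c, \<epsilon>)) (diagram_passages D)" for h
 proof -
  have "map (relabel h) (diagram_code D) = map ?p (map (\<lambda>(c, o_c, \<epsilon>). (h c, o_c, \<epsilon>)) (diagram_passages D))"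
   by (simp add: diagram_code_def relabel_def case_prod_unfold)
  moreover have "inj ?p" by (auto simp: inj_on_def)
  ultimately show ?thesis unfolding surface_code_def by (metis inj_map_eq_map)
 qed
 then show ?thesis by (simp add: realizes_def l)
qed

lemma realizes_same_polynomials:
 assumes "long_diagram D" "realizes S D"
 shows "same_polynomials (surface_code S) (diagram_code D)"
 using assms same_polynomials_relabel[OF wf_diagram_code] same_polynomials_sym unfolding realizes_iff by metis

lemma realizes_code_euler:
 assumes "long_diagram D" "realizes S D"
 shows "code_euler (surface_code S) = code_euler (diagram_code D)"
 using assms code_euler_relabel[OF wf_diagram_code] unfolding realizes_iff by metis

lemma diagram_realization:
 assumes "long_diagram D"
 obtains S g where "surface_diagram_of_genus g S" "realizes S D" "2 - 2 * int g = code_euler (diagram_code D)"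
 by (rule surface_of_code[OF wf_diagram_code[OF assms]]) (use that realizes_iff in blast)

lemma class_self: "long_diagram D \<Longrightarrow> D \<in> diagram_equiv `` {D}" by (simp add: diagram_equiv_def)

lemma class_facts:
 assumes "K \<in> long_virtual_knots" "D \<in> K"
 shows "long_diagram D" "E \<in> K \<Longrightarrow> same_polynomials (diagram_code D) (diagram_code E)"
proof -
 obtain D0 where K: "K = diagram_equiv `` {D0}" using assms(1) by (auto simp: long_virtual_knots_def quotient_def)
 show "long_diagram D" using assms(2) K by (simp add: diagram_equiv_def)
 have *: "same_polynomials (diagram_code D0) (diagram_code E)" if "E \<in> K" for E
  using that K same_polynomials_diagram_equiv by blast
 show "same_polynomials (diagram_code D) (diagram_code E)" if "E \<in> K"
  using *[OF assms(2)] *[OF that] same_polynomials_sym same_polynomials_trans by metis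
qed

text \<open>A realization exists by \<open>diagram_realization\<close>, so the chosen surface
  realizes some diagram of \<open>K\<close>; its code has the same polynomials as that of any other
  diagram of \<open>K\<close>.\<close>

lemma polynomials_diagram_code:
 assumes K: "K \<in> long_virtual_knots" "D \<in> K" and ab: "a \<in> {0, 1}" "b \<in> {0, 1}"
 shows "F_polynomial K a b = F_code (diagram_code D) a b" "H_polynomial K a b = H_code (diagram_code D) a b"
proof -
 have "\<exists>S g. surface_realization K g S"
  using diagram_realization[OF class_facts(1)[OF K]] K(2) unfolding surface_realization_def by metis
 then have "\<exists>g. surface_realization K g (some_realization K)" unfolding some_realization_def by (rule someI_ex)
 then obtain g E where S: "surface_diagram_of_genus g (some_realization K)" and E: "E \<in> K" "realizes (some_realization K) E"
  by (auto simp: surface_realization_def)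
 interpret surface_curve "some_realization K" using S by unfold_locales (simp_all add: surface_diagram_of_genus_def)
 have "same_polynomials (surface_code (some_realization K)) (diagram_code D)"
  using realizes_same_polynomials[OF class_facts(1)[OF K(1) E(1)] E(2)] class_facts(2)[OF K(1) E(1) K(2)]
   same_polynomials_trans by blast
 then show "F_polynomial K a b = F_code (diagram_code D) a b" "H_polynomial K a b = H_code (diagram_code D) a b"
  using F_surface_code[OF ab] H_surface_code[OF ab]
  by (simp_all add: F_polynomial_def H_polynomial_def same_polynomials_def)
qed

theorem proposition5p4:
 assumes "K \<in> long_virtual_knots"
 shows "\<exists>K' \<in> long_virtual_knots.
  (\<forall>a \<in> {0, 1}. \<forall>b \<in> {0, 1}.
    F_polynomial K' a b = H_polynomial K (1 - a) (1 - b) \<and>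
    H_polynomial K' a b = F_polynomial K (1 - a) (1 - b)) \<and>
  sg\<^sub>1 K' \<le> sg\<^sub>1 K"
proof -
 obtain D1 where "D1 \<in> K" using assms class_self by (auto simp: long_virtual_knots_def quotient_def)
 then have "\<exists>g S. surface_realization K g S"
  using diagram_realization[OF class_facts(1)[OF assms]] unfolding surface_realization_def by metis
 then have "\<exists>S. surface_realization K (sg\<^sub>1 K) S" unfolding supporting_genus_def by (rule LeastI_ex)
 then obtain S D where S: "surface_diagram_of_genus (sg\<^sub>1 K) S" and D: "D \<in> K" "realizes S D"
  by (auto simp: surface_realization_def)
 have long: "long_diagram D" by (rule class_facts(1)[OF assms D(1)])
 interpret surface_curve S using S by unfold_locales (simp_all add: surface_diagram_of_genus_def)
 \<comment> \<open>Complementary disks give the greatest Euler characteristic among the surfaces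
   carrying the code, so the ribbon surface of the code of \<open>D\<close> has genus at most
   \<open>sg\<^sub>1 K\<close>.\<close>
 have genus: "2 - 2 * int (sg\<^sub>1 K) \<le> code_euler (diagram_code D)"
  using S euler_le_code_euler realizes_code_euler[OF long D(2)] by (simp add: surface_diagram_of_genus_def)
 obtain A0 B0 :: "nat point list" where 0: "split_code A0 B0" "same_polynomials (A0 @ B0) (diagram_code D)"
  "code_euler (A0 @ B0) = code_euler (diagram_code D)"
  by (rule split_code_exists[OF wf_diagram_code[OF long]]) (rule that)
 obtain A B :: "nat point list" where AB: "split_code A B" "same_polynomials (A @ B) (A0 @ B0)" "code_euler (A @ B) = code_euler (A0 @ B0)"
  "code_writhe (A @ B) 0 = 0" "code_writhe (A @ B) 1 = 0" using split_code_writhe_zero[OF 0(1)] by blast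
 have wf: "wf_code (A @ B)" "wf_code (B @ A)" using AB(1) split_code_rotate[OF AB(1)] by (simp_all add: split_code_def)
 have sp: "same_polynomials (A @ B) (diagram_code D)" using AB(2) 0(2) by (rule same_polynomials_trans)
 \<comment> \<open>Only the rotated code is turned into a diagram; the code \<open>A @ B\<close>
   takes part through its polynomials, which are those of \<open>K\<close> by
   \<open>sp\<close>.\<close>
 obtain D' h where D': "long_diagram D'" "inj_on h (label ` set (B @ A))" "diagram_code D' = map (relabel h) (B @ A)"
  by (rule diagram_of_code[OF wf(2)]) (rule that)
 define K' where "K' = diagram_equiv `` {D'}"
 have K': "K' \<in> long_virtual_knots" "D' \<in> K'"
  using D'(1) class_self by (auto simp: K'_def long_virtual_knots_def quotient_def)
 have sp': "same_polynomials (diagram_code D') (B @ A)"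
  unfolding D'(3) by (rule same_polynomials_sym[OF same_polynomials_relabel[OF wf(2) D'(2)]])
 have "F_polynomial K' a b = H_polynomial K (1 - a) (1 - b) \<and> H_polynomial K' a b = F_polynomial K (1 - a) (1 - b)"
  if ab: "a \<in> {0, 1}" "b \<in> {0, 1}" for a b
 proof -
  have ab': "1 - a \<in> {0, 1}" "1 - b \<in> {0, 1}" and ab01: "a = 0 \<or> a = 1" "b = 0 \<or> b = 1" using ab by auto
  show ?thesis using polynomials_diagram_code[OF K' ab] polynomials_diagram_code[OF assms D(1) ab'] sp sp'
    rotate_exchanges_polynomials[OF AB(1,4,5) ab01] by (simp add: same_polynomials_def)
 qed
 moreover have "sg\<^sub>1 K' \<le> sg\<^sub>1 K"
 proof -
  obtain S' g where S': "surface_diagram_of_genus g S'" "realizes S' D'" "2 - 2 * int g = code_euler (diagram_code D')"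
   by (rule diagram_realization[OF D'(1)]) (rule that)
  \<comment> \<open>Fingers, kinks, rotation and renaming have all preserved the Euler
    characteristic of the code.\<close>
  have "code_euler (diagram_code D') = code_euler (diagram_code D)"
   using code_euler_relabel[OF wf(2) D'(2)] code_euler_rotate[OF wf(1)] AB(3) 0(3) by (simp add: D'(3))
  then have "g \<le> sg\<^sub>1 K" using genus S'(3) by linarith
  moreover have "\<exists>S. surface_realization K' g S" using S' K'(2) unfolding surface_realization_def by blast
  then have "sg\<^sub>1 K' \<le> g" unfolding supporting_genus_def by (rule Least_le)
  ultimately show ?thesis by linarith
 qed
 ultimately show ?thesis using K'(1) by blast
qed

end
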